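(* Let $n\ge 2$. The unital completely positive surjection $\phi:\mathcal M_n\to\mathcal W_n$ defined on matrix units by $\phi(E_{ij})=\frac1n w_iw_j^*$, $1\le i,j\le n$, is a complete quotient map, and the C$^*$-envelope of the quotient operator system $\mathcal M_n/\mathcal J_n$ is $C^*(\mathbb F_{n-1})$.
   Context: $C^*(\mathbb F_{n-1})$ is the full group C$^*$-algebra of the free group on $n-1$ generators, $w_2,\dots,w_n$ are its universal generating unitaries, and $w_1=1$. $\mathcal W_n=\mathrm{Span}\{w_iw_j^*:1\le i,j\le n\}\subseteq C^*(\mathbb F_{n-1})$, an operator system. $\mathcal J_n\subset\mathcal M_n$ is the space of diagonal matrices of trace zero; it equals $\ker\phi$. Quotients: if $\mathcal J$ is the kernel of a (nonzero) completely positive (cp) map on an operator system $\mathcal S$, the quotient operator system $\mathcal S/\mathcal J$ has order unit $q(1)$, where $q$ is the quotient map, and positive cone in $\mathcal M_p(\mathcal S/\mathcal J)$ consisting of all $q^{(p)}(H)$, $H=H^*\in\mathcal M_p(\mathcal S)$, such that for every $\varepsilon>0$ there is $K_\varepsilon=K_\varepsilon^*\in\mathcal M_p(\mathcal J)$ with $\varepsilon1+H+K_\varepsilon\in\mathcal M_p(\mathcal S)_+$. A cp map $\phi:\mathcal S\to\mathcal T$ induces a unique cp map $\dot\phi:\mathcal S/\ker\phi\to\mathcal T$ with $\phi=\dot\phi\circ q$. The map $\phi$ is a complete quotient map if $\dot\phi$ is a complete order isomorphism (a linear isomorphism with $\dot\phi$ and $\dot\phi^{-1}$ cp). The C$^*$-envelope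 of an operator system is the smallest C$^*$-algebra generated by a unital completely order isomorphic copy of it, i.e. the one that is canonically a quotient of every C$^*$-algebra generated by such a copy. *)

theory Defs
  imports "HOL-Analysis.Analysis" "HOL-Library.Poly_Mapping"
begin

section \<open>Unital C*-algebras\<close>

class cstar_algebra = banach + real_normed_algebra_1 +
  fixes scaleC :: "complex \<Rightarrow> 'a \<Rightarrow> 'a"  (infixr \<open>*\<^sub>C\<close> 75)
    and adj :: "'a \<Rightarrow> 'a"
  assumes scaleC_add_right: "c *\<^sub>C (x + y) = c *\<^sub>C x + c *\<^sub>C y"
    and scaleC_add_left: "(c + d) *\<^sub>C x = c *\<^sub>C x + d *\<^sub>C x"
    and scaleC_scaleC: "c *\<^sub>C d *\<^sub>C x = (c * d) *\<^sub>C x"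
    and scaleR_scaleC: "scaleR r x = complex_of_real r *\<^sub>C x"
    and scaleC_mult_left: "(c *\<^sub>C x) * y = c *\<^sub>C (x * y)"
    and scaleC_mult_right: "x * (c *\<^sub>C y) = c *\<^sub>C (x * y)"
    and norm_scaleC: "norm (c *\<^sub>C x) = cmod c * norm x"
    and adj_adj: "adj (adj x) = x"
    and adj_add: "adj (x + y) = adj x + adj y"
    and adj_scaleC: "adj (c *\<^sub>C x) = cnj c *\<^sub>C adj x"
    and adj_mult: "adj (x * y) = adj y * adj x"
    and cstar_identity: "norm (adj x * x) = (norm x)\<^sup>2"

lemma scaleC_one: "1 *\<^sub>C x = x" for x :: "'a::cstar_algebra"
  using scaleR_scaleC[of 1 x] by simp

global_interpretation complex_vector:
  vector_space "scaleC :: complex \<Rightarrow> 'a \<Rightarrow> 'a::cstar_algebra"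
  by unfold_locales
    (simp_all add: scaleC_add_right scaleC_add_left scaleC_scaleC scaleC_one)

definition cstar_subalgebra :: "'a::cstar_algebra set \<Rightarrow> bool" where
  "cstar_subalgebra B \<longleftrightarrow>
     1 \<in> B \<and> (\<forall>x\<in>B. \<forall>y\<in>B. x + y \<in> B \<and> x * y \<in> B) \<and>
     (\<forall>c. \<forall>x\<in>B. c *\<^sub>C x \<in> B) \<and> (\<forall>x\<in>B. adj x \<in> B) \<and> closed B"

definition star_hom_on :: "'b::cstar_algebra set \<Rightarrow> ('b \<Rightarrow> 'a::cstar_algebra) \<Rightarrow> bool" where
  "star_hom_on B f \<longleftrightarrow>
     (\<forall>x\<in>B. \<forall>y\<in>B. f (x + y) = f x + f y \<and> f (x * y) = f x * f y) \<and>
     (\<forall>c. \<forall>x\<in>B. f (c *\<^sub>C x) = c *\<^sub>C f x) \<and> (\<forall>x\<in>B. f (adj x) = adj (f x)) \<and> f 1 = 1"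

section \<open>Free groups\<close>

text \<open>
  Words in the letters \<open>(a, True)\<close> (the generator \<open>a\<close>) and \<open>(a, False)\<close> (its inverse), modulo
  cancellation. The group is written additively, as the library has no class of noncommutative
  multiplicative groups; \<open>group_add\<close> does not assume commutativity.
\<close>

definition word_inverse :: "('a \<times> bool) list \<Rightarrow> ('a \<times> bool) list" where
  "word_inverse w = rev (map (\<lambda>(a, b). (a, \<not> b)) w)"

inductive word_eq :: "('a \<times> bool) list \<Rightarrow> ('a \<times> bool) list \<Rightarrow> bool" where
  word_eq_refl: "word_eq u u"
| word_eq_sym: "word_eq u v \<Longrightarrow> word_eq v u"
| word_eq_trans: "word_eq u v \<Longrightarrow> word_eq v w \<Longrightarrow> word_eq u w"
| word_eq_cancel: "word_eq (u @ [(a, b), (a, \<not> b)] @ v) (u @ v)"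

lemma word_eq_append_left: "word_eq u v \<Longrightarrow> word_eq (w @ u) (w @ v)"
proof (induction rule: word_eq.induct)
  case (word_eq_cancel u a b v)
  then show ?case using word_eq.word_eq_cancel[of "w @ u" a b v] by simp
qed (auto intro: word_eq.intros)

lemma word_eq_append_right: "word_eq u v \<Longrightarrow> word_eq (u @ w) (v @ w)"
proof (induction rule: word_eq.induct)
  case (word_eq_cancel u a b v)
  then show ?case using word_eq.word_eq_cancel[of u a b "v @ w"] by simp
qed (auto intro: word_eq.intros)

lemma word_eq_word_inverse: "word_eq u v \<Longrightarrow> word_eq (word_inverse u) (word_inverse v)"
proof (induction rule: word_eq.induct)
  case (word_eq_cancel u a b v)
  then show ?case
    using word_eq.word_eq_cancel[of "word_inverse v" a b "word_inverse u"]
    by (simp add: word_inverse_def)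
qed (auto intro: word_eq.intros)

lemma word_eq_inverse_append: "word_eq (word_inverse u @ u) []"
proof (induction u)
  case Nil
  show ?case by (simp add: word_inverse_def word_eq_refl)
next
  case (Cons x u)
  obtain a b where x: "x = (a, b)" by (cases x)
  have "word_eq (word_inverse u @ [(a, \<not> b), (a, \<not> \<not> b)] @ u) (word_inverse u @ u)"
    by (rule word_eq_cancel)
  then show ?case using Cons x by (auto simp: word_inverse_def intro: word_eq_trans)
qed

quotient_type 'a free_group = "('a \<times> bool) list" / word_eq
  by (rule equivpI) (auto intro!: reflpI sympI transpI intro: word_eq.intros)

lift_definition free_gen :: "'a \<Rightarrow> 'a free_group" is "\<lambda>a. [(a, True)]" .

instantiation free_group :: (type) group_add
begin

lift_definition zero_free_group :: "'a free_group" is "[]" .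

lift_definition plus_free_group :: "'a free_group \<Rightarrow> 'a free_group \<Rightarrow> 'a free_group" is "(@)"
  by (blast intro: word_eq_append_left word_eq_append_right word_eq_trans)

lift_definition uminus_free_group :: "'a free_group \<Rightarrow> 'a free_group" is word_inverse
  by (rule word_eq_word_inverse)

definition minus_free_group :: "'a free_group \<Rightarrow> 'a free_group \<Rightarrow> 'a free_group" where
  "minus_free_group x y = x + - y"

instance
proof
  fix a b c :: "'a free_group"
  show "a + b + c = a + (b + c)" by transfer (simp add: word_eq_refl)
  show "0 + a = a" by transfer (simp add: word_eq_refl)
  show "a + 0 = a" by transfer (simp add: word_eq_refl)
  show "- a + a = 0" by transfer (rule word_eq_inverse_append)
  show "a + - b = a - b" by (simp add: minus_free_group_def)
qed

end

section \<open>The full group C*-algebra of a discrete group\<close>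

text \<open>
  The complex group algebra of \<open>'g\<close> is \<^typ>\<open>'g \<Rightarrow>\<^sub>0 complex\<close> with the convolution product of
  \<^theory>\<open>HOL-Library.Poly_Mapping\<close>; the group element \<open>g\<close> is \<^term>\<open>Poly_Mapping.single g (1::complex)\<close>
  and the scalar \<open>c\<close> is \<^term>\<open>Poly_Mapping.single 0 (c::complex)\<close>.
\<close>

lift_definition ga_star :: "('g::group_add \<Rightarrow>\<^sub>0 complex) \<Rightarrow> ('g \<Rightarrow>\<^sub>0 complex)"
  is "\<lambda>f g. cnj (f (- g))"
proof -
  fix f :: "'g \<Rightarrow> complex" assume "finite {g. f g \<noteq> 0}"
  then have "finite (uminus ` {g. f g \<noteq> 0})" by simp
  then show "finite {g. cnj (f (- g)) \<noteq> 0}"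
    by (rule finite_subset[rotated]) (auto intro: image_eqI[of _ _ "- _"])
qed

definition cstar_seminorm :: "(('g::group_add \<Rightarrow>\<^sub>0 complex) \<Rightarrow> real) \<Rightarrow> bool" where
  "cstar_seminorm p \<longleftrightarrow>
     (\<forall>x y. p (x + y) \<le> p x + p y) \<and>
     (\<forall>c x. p (Poly_Mapping.single 0 c * x) = cmod c * p x) \<and>
     (\<forall>x y. p (x * y) \<le> p x * p y) \<and>
     (\<forall>x. p (ga_star x * x) = (p x)\<^sup>2)"

text \<open>
  The largest C*-seminorm. Equivalently the supremum of the operator norms over all unitary
  representations of the group, since every C*-seminorm on the group algebra is the norm of a
  *-homomorphism into a C*-algebra.
\<close>

definition full_norm :: "('g::group_add \<Rightarrow>\<^sub>0 complex) \<Rightarrow> real" where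
  "full_norm x = (SUP p\<in>Collect cstar_seminorm. p x)"


lemma ga_induct [case_names zero single add]:
  assumes "P 0" and "\<And>g c. P (Poly_Mapping.single g c)" and "\<And>x y. P x \<Longrightarrow> P y \<Longrightarrow> P (x + y)"
  shows "P (x :: 'g::group_add \<Rightarrow>\<^sub>0 complex)"
proof -
  have "P (\<Sum>k\<in>A. Poly_Mapping.single k (Poly_Mapping.lookup x k))" if "finite A" for A
    using that by induction (auto intro: assms)
  moreover have "x = (\<Sum>k\<in>Poly_Mapping.keys x. Poly_Mapping.single k (Poly_Mapping.lookup x k))"
    by (rule poly_mapping_eqI)
      (auto simp: lookup_sum lookup_single when_def  Poly_Mapping.in_keys_iff)
  ultimately show ?thesis by (metis finite_keys)
qed

lemma ga_star_zero: "ga_star 0 = 0"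
  by transfer simp

lemma ga_star_add: "ga_star (x + y) = ga_star x + ga_star y"
  by transfer (simp add: fun_eq_iff)

lemma ga_star_star: "ga_star (ga_star x) = x"
  by transfer simp

lemma ga_star_single: "ga_star (Poly_Mapping.single g c) = Poly_Mapping.single (- g) (cnj c)"
  by transfer (auto simp: fun_eq_iff when_def minus_equation_iff)

lemma ga_star_one: "ga_star 1 = 1"
  using ga_star_single[of 0 1] by simp

lemma ga_star_mult: "ga_star (x * y) = ga_star y * ga_star x"
proof (induction x rule: ga_induct)
  case (single g c)
  show ?case
    by (induction y rule: ga_induct)
      (simp_all add: ga_star_zero ga_star_add ga_star_single mult_single minus_add distrib_left
        distrib_right mult.commute)
qed (simp_all add: ga_star_zero ga_star_add distrib_left distrib_right)

lemma ga_scalar_commute: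
  "x * Poly_Mapping.single 0 c = Poly_Mapping.single 0 c * (x :: 'g::group_add \<Rightarrow>\<^sub>0 complex)"
  by (induction x rule: ga_induct)
    (simp_all add: mult_single distrib_left distrib_right mult.commute)

context
  fixes p :: "('g::group_add \<Rightarrow>\<^sub>0 complex) \<Rightarrow> real"
  assumes p: "cstar_seminorm p"
begin

lemma cs_add: "p (x + y) \<le> p x + p y"
  and cs_scale: "p (Poly_Mapping.single 0 c * x) = cmod c * p x"
  and cs_mult: "p (x * y) \<le> p x * p y"
  and cs_star: "p (ga_star x * x) = (p x)\<^sup>2"
  using p by (auto simp: cstar_seminorm_def)

lemma cs_zero: "p 0 = 0"
  using cs_scale[of 0 0] by simp

lemma cs_minus: "p (- x) = p x"
  using cs_scale[of "-1" x] by (simp add: single_uminus)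

lemma cs_nonneg: "0 \<le> p x"
  using cs_add[of x "- x"] by (simp add: cs_zero cs_minus)

lemma cs_adj: "p (ga_star x) = p x"
proof -
  have le: "p y \<le> p (ga_star y)" for y
  proof (cases "p y = 0")
    case False
    then have "0 < p y" using cs_nonneg[of y] by simp
    moreover have "p y * p y \<le> p (ga_star y) * p y"
      using cs_mult[of "ga_star y" y] by (simp add: cs_star power2_eq_square)
    ultimately show ?thesis by simp
  qed (simp add: cs_nonneg)
  show ?thesis using le[of x] le[of "ga_star x"] by (simp add: ga_star_star)
qed

lemma cs_single: "p (Poly_Mapping.single g c) \<le> cmod c"
proof -
  have one: "p 1 = (p 1)\<^sup>2"
    using cs_star[of 1] by (simp add: ga_star_one)
  have one': "p 1 \<le> 1"
  proof (rule ccontr)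
    assume "\<not> p 1 \<le> 1"
    then have "p 1 * 1 < p 1 * p 1" by (intro mult_strict_left_mono) auto
    with one show False by (auto simp: power2_eq_square)
  qed
  have "(p (Poly_Mapping.single g 1))\<^sup>2 = p 1"
    using cs_star[of "Poly_Mapping.single g 1"] by (simp add: ga_star_single mult_single)
  with one' have "(p (Poly_Mapping.single g 1))\<^sup>2 \<le> 1\<^sup>2" by simp
  then have "p (Poly_Mapping.single g 1) \<le> 1" by (rule power2_le_imp_le) simp
  then have "cmod c * p (Poly_Mapping.single g 1) \<le> cmod c * 1"
    by (intro mult_left_mono) auto
  then show ?thesis
    using cs_scale[of c "Poly_Mapping.single g 1"] by (simp add: mult_single)
qed

end

lemma cstar_seminorm_bounded:
  "\<exists>b. \<forall>p. cstar_seminorm p \<longrightarrow> p (x :: 'g::group_add \<Rightarrow>\<^sub>0 complex) \<le> b"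
proof (induction x rule: ga_induct)
  case zero
  show ?case using cs_zero by (metis order_refl)
next
  case (single g c)
  show ?case using cs_single by blast
next
  case (add x y)
  then obtain b c where "\<And>p. cstar_seminorm p \<Longrightarrow> p x \<le> b" "\<And>p. cstar_seminorm p \<Longrightarrow> p y \<le> c"
    by blast
  then have "p (x + y) \<le> b + c" if "cstar_seminorm p" for p
    using cs_add[OF that, of x y] that by (meson add_mono order_trans)
  then show ?case by blast
qed

definition ga_augmentation :: "('g::group_add \<Rightarrow>\<^sub>0 complex) \<Rightarrow> complex" where
  "ga_augmentation x = (\<Sum>k\<in>Poly_Mapping.keys x. Poly_Mapping.lookup x k)"

lemma ga_augmentation_add: "ga_augmentation (x + y) = ga_augmentation x + ga_augmentation y"
  unfolding ga_augmentation_def by (rule setsum_keys_plus_distrib) simp_all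

lemma ga_augmentation_zero: "ga_augmentation 0 = 0"
  by (simp add: ga_augmentation_def)

lemma ga_augmentation_single: "ga_augmentation (Poly_Mapping.single g c) = c"
  by (simp add: ga_augmentation_def)

lemma ga_augmentation_mult: "ga_augmentation (x * y) = ga_augmentation x * ga_augmentation y"
proof (induction x rule: ga_induct)
  case (single g c)
  show ?case
    by (induction y rule: ga_induct)
      (simp_all add: ga_augmentation_zero ga_augmentation_single ga_augmentation_add mult_single
        distrib_left)
qed (simp_all add: ga_augmentation_zero ga_augmentation_add distrib_right)

lemma ga_augmentation_star: "ga_augmentation (ga_star x) = cnj (ga_augmentation x)"
  by (induction x rule: ga_induct)
    (simp_all add: ga_star_zero ga_star_single ga_star_add ga_augmentation_zero
      ga_augmentation_single ga_augmentation_add)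

lemma cstar_seminorm_augmentation: "cstar_seminorm (\<lambda>x. cmod (ga_augmentation x))"
  by (simp add: cstar_seminorm_def ga_augmentation_add ga_augmentation_mult ga_augmentation_single
      ga_augmentation_star norm_mult norm_triangle_ineq power2_eq_square)

lemma full_norm_upper: "cstar_seminorm p \<Longrightarrow> p x \<le> full_norm x"
  unfolding full_norm_def using cstar_seminorm_bounded[of x]
  by (auto intro!: cSUP_upper simp: bdd_above_def)

lemma full_norm_least: "(\<And>p. cstar_seminorm p \<Longrightarrow> p x \<le> b) \<Longrightarrow> full_norm x \<le> b"
  unfolding full_norm_def using cstar_seminorm_augmentation by (intro cSUP_least) auto

lemma full_norm_nonneg: "0 \<le> full_norm x"
  using full_norm_upper[OF cstar_seminorm_augmentation, of x] norm_ge_zero order_trans by blast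

lemma cstar_seminorm_full_norm: "cstar_seminorm (full_norm :: ('g::group_add \<Rightarrow>\<^sub>0 complex) \<Rightarrow> real)"
  unfolding cstar_seminorm_def
proof (intro conjI allI)
  fix x y :: "'g \<Rightarrow>\<^sub>0 complex" and c :: complex
  show "full_norm (x + y) \<le> full_norm x + full_norm y"
    by (rule full_norm_least) (meson add_mono cs_add full_norm_upper order_trans)
  show "full_norm (x * y) \<le> full_norm x * full_norm y"
    by (rule full_norm_least)
      (meson mult_mono cs_mult cs_nonneg full_norm_nonneg full_norm_upper order_trans)
  show "full_norm (Poly_Mapping.single 0 c * x) = cmod c * full_norm x"
  proof (rule antisym)
    show "full_norm (Poly_Mapping.single 0 c * x) \<le> cmod c * full_norm x"
      by (rule full_norm_least) (simp add: cs_scale full_norm_upper mult_left_mono)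
    show "cmod c * full_norm x \<le> full_norm (Poly_Mapping.single 0 c * x)"
    proof (cases "c = 0")
      case False
      then have c: "0 < cmod c" by simp
      have "full_norm x \<le> full_norm (Poly_Mapping.single 0 c * x) / cmod c"
      proof (rule full_norm_least)
        fix p :: "('g \<Rightarrow>\<^sub>0 complex) \<Rightarrow> real" assume "cstar_seminorm p"
        then have "cmod c * p x \<le> full_norm (Poly_Mapping.single 0 c * x)"
          by (metis cs_scale full_norm_upper)
        with c show "p x \<le> full_norm (Poly_Mapping.single 0 c * x) / cmod c"
          by (simp add: pos_le_divide_eq mult.commute)
      qed
      with c show ?thesis by (simp add: pos_le_divide_eq mult.commute)
    qed (simp add: full_norm_nonneg)
  qed
  show "full_norm (ga_star x * x) = (full_norm x)\<^sup>2"
  proof (rule antisym)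
    show "full_norm (ga_star x * x) \<le> (full_norm x)\<^sup>2"
      by (rule full_norm_least) (simp add: cs_star cs_nonneg full_norm_upper power_mono)
    have "full_norm x \<le> sqrt (full_norm (ga_star x * x))"
    proof (rule full_norm_least)
      fix p :: "('g \<Rightarrow>\<^sub>0 complex) \<Rightarrow> real" assume "cstar_seminorm p"
      then have "(p x)\<^sup>2 \<le> full_norm (ga_star x * x)"
        by (metis cs_star full_norm_upper)
      then show "p x \<le> sqrt (full_norm (ga_star x * x))" by (rule real_le_rsqrt)
    qed
    then have "(full_norm x)\<^sup>2 \<le> (sqrt (full_norm (ga_star x * x)))\<^sup>2"
      by (rule power_mono) (rule full_norm_nonneg)
    then show "(full_norm x)\<^sup>2 \<le> full_norm (ga_star x * x)"
      by (simp add: full_norm_nonneg)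
  qed
qed

lemmas full_norm_add = cs_add[OF cstar_seminorm_full_norm]
  and full_norm_scale = cs_scale[OF cstar_seminorm_full_norm]
  and full_norm_mult = cs_mult[OF cstar_seminorm_full_norm]
  and full_norm_star = cs_star[OF cstar_seminorm_full_norm]
  and full_norm_zero = cs_zero[OF cstar_seminorm_full_norm]
  and full_norm_minus = cs_minus[OF cstar_seminorm_full_norm]
  and full_norm_adj = cs_adj[OF cstar_seminorm_full_norm]
  and full_norm_single = cs_single[OF cstar_seminorm_full_norm]

lemma full_norm_one: "full_norm (1 :: 'g::group_add \<Rightarrow>\<^sub>0 complex) = 1"
proof (rule antisym)
  show "full_norm (1 :: 'g \<Rightarrow>\<^sub>0 complex) \<le> 1" using full_norm_single[of "0 :: 'g" 1] by simp
  show "1 \<le> full_norm (1 :: 'g \<Rightarrow>\<^sub>0 complex)"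
    using full_norm_upper[OF cstar_seminorm_augmentation, of "1 :: 'g \<Rightarrow>\<^sub>0 complex"]
      ga_augmentation_single[of "0 :: 'g" 1] by simp
qed

lemma full_norm_diff_commute: "full_norm (x - y) = full_norm (y - x)"
  using full_norm_minus[of "x - y"] by simp

lemma full_norm_diff_triangle: "full_norm (x - z) \<le> full_norm (x - y) + full_norm (y - z)"
  using full_norm_add[of "x - y" "y - z"] by simp

lemma full_norm_diff_abs: "\<bar>full_norm x - full_norm y\<bar> \<le> full_norm (x - y)"
  using full_norm_add[of "x - y" y] full_norm_add[of "y - x" x] full_norm_diff_commute[of x y]
  by auto

text \<open>The completion of the group algebra, as Cauchy sequences modulo null sequences.\<close>

definition ga_Cauchy :: "(nat \<Rightarrow> ('g::group_add \<Rightarrow>\<^sub>0 complex)) \<Rightarrow> bool" where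
  "ga_Cauchy X \<longleftrightarrow> (\<forall>e>0. \<exists>M. \<forall>m\<ge>M. \<forall>n\<ge>M. full_norm (X m - X n) < e)"

definition ga_rel ::
    "(nat \<Rightarrow> ('g::group_add \<Rightarrow>\<^sub>0 complex)) \<Rightarrow> (nat \<Rightarrow> ('g \<Rightarrow>\<^sub>0 complex)) \<Rightarrow> bool" where
  "ga_rel X Y \<longleftrightarrow> ga_Cauchy X \<and> ga_Cauchy Y \<and> (\<lambda>n. full_norm (X n - Y n)) \<longlonglongrightarrow> 0"

lemma ga_Cauchy_const: "ga_Cauchy (\<lambda>n. x)"
  by (simp add: ga_Cauchy_def full_norm_zero)

lemma ga_Cauchy_norm: "ga_Cauchy X \<Longrightarrow> Cauchy (\<lambda>n. full_norm (X n))"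
  unfolding ga_Cauchy_def Cauchy_def dist_real_def
  by (meson full_norm_diff_abs le_less_trans)

lemma ga_Cauchy_norm_convergent: "ga_Cauchy X \<Longrightarrow> convergent (\<lambda>n. full_norm (X n))"
  by (rule real_Cauchy_convergent) (rule ga_Cauchy_norm)

lemma ga_Cauchy_bounded:
  assumes "ga_Cauchy X" obtains b where "0 < b" "\<And>n. full_norm (X n) \<le> b"
proof -
  have "Bseq (\<lambda>n. full_norm (X n))"
    using ga_Cauchy_norm[OF assms] by (rule Cauchy_Bseq)
  then show ?thesis using that by (auto simp: Bseq_def abs_le_iff)
qed

lemma ga_Cauchy_contraction:
  assumes "ga_Cauchy X" and "\<And>m n. full_norm (Y m - Y n) \<le> b * full_norm (X m - X n)" and "0 < b"
  shows "ga_Cauchy Y"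
  unfolding ga_Cauchy_def
proof (intro allI impI)
  fix e :: real assume "0 < e"
  with assms obtain M where "\<forall>m\<ge>M. \<forall>n\<ge>M. full_norm (X m - X n) < e / b"
    unfolding ga_Cauchy_def by (meson divide_pos_pos)
  then have "\<forall>m\<ge>M. \<forall>n\<ge>M. b * full_norm (X m - X n) < e"
    using \<open>0 < b\<close> by (simp add: pos_less_divide_eq mult.commute)
  then show "\<exists>M. \<forall>m\<ge>M. \<forall>n\<ge>M. full_norm (Y m - Y n) < e"
    using assms(2) le_less_trans by blast
qed

lemma ga_Cauchy_sum_bound:
  assumes X: "ga_Cauchy X" and Y: "ga_Cauchy Y" and "0 < b" "0 < c"
    and le: "\<And>m n. full_norm (Z m - Z n) \<le> b * full_norm (X m - X n) + c * full_norm (Y m - Y n)"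
  shows "ga_Cauchy Z"
  unfolding ga_Cauchy_def
proof (intro allI impI)
  fix e :: real assume "0 < e"
  then have "0 < e / (2 * b)" "0 < e / (2 * c)" using \<open>0 < b\<close> \<open>0 < c\<close> by simp_all
  with X Y obtain M1 M2 where M: "\<forall>m\<ge>M1. \<forall>n\<ge>M1. full_norm (X m - X n) < e / (2 * b)"
    "\<forall>m\<ge>M2. \<forall>n\<ge>M2. full_norm (Y m - Y n) < e / (2 * c)"
    unfolding ga_Cauchy_def by meson
  show "\<exists>M. \<forall>m\<ge>M. \<forall>n\<ge>M. full_norm (Z m - Z n) < e"
  proof (intro exI allI impI)
    fix m n assume "max M1 M2 \<le> m" "max M1 M2 \<le> n"
    with M have "full_norm (X m - X n) < e / (2 * b)" "full_norm (Y m - Y n) < e / (2 * c)"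
      by auto
    then have "b * full_norm (X m - X n) < e / 2" "c * full_norm (Y m - Y n) < e / 2"
      using \<open>0 < b\<close> \<open>0 < c\<close> by (simp_all add: pos_less_divide_eq field_simps)
    with le[of m n] show "full_norm (Z m - Z n) < e" by linarith
  qed
qed

lemma ga_Cauchy_add:
  assumes "ga_Cauchy X" "ga_Cauchy Y" shows "ga_Cauchy (\<lambda>n. X n + Y n)"
proof (rule ga_Cauchy_sum_bound[OF assms, of 1 1])
  fix m n
  show "full_norm (X m + Y m - (X n + Y n)) \<le> 1 * full_norm (X m - X n) + 1 * full_norm (Y m - Y n)"
    using full_norm_add[of "X m - X n" "Y m - Y n"] by (simp add: algebra_simps)
qed simp_all

lemma full_norm_mult_diff:
  "full_norm (x * y - x' * y') \<le> full_norm x * full_norm (y - y') + full_norm y' * full_norm (x - x')"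
proof -
  have "x * y - x' * y' = x * (y - y') + (x - x') * y'"
    by (simp add: algebra_simps)
  then have "full_norm (x * y - x' * y') \<le> full_norm (x * (y - y')) + full_norm ((x - x') * y')"
    by (simp only: full_norm_add)
  also have "\<dots> \<le> full_norm x * full_norm (y - y') + full_norm (x - x') * full_norm y'"
    by (intro add_mono full_norm_mult)
  finally show ?thesis by (simp add: mult.commute)
qed

lemma ga_Cauchy_mult:
  assumes X: "ga_Cauchy X" and Y: "ga_Cauchy Y" shows "ga_Cauchy (\<lambda>n. X n * Y n)"
proof -
  obtain b where b: "0 < b" "\<And>n. full_norm (X n) \<le> b" using ga_Cauchy_bounded[OF X] by blast
  obtain c where c: "0 < c" "\<And>n. full_norm (Y n) \<le> c" using ga_Cauchy_bounded[OF Y] by blast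
  show ?thesis
  proof (rule ga_Cauchy_sum_bound[OF X Y c(1) b(1)])
    fix m n
    have "full_norm (X m * Y m - X n * Y n)
      \<le> full_norm (X m) * full_norm (Y m - Y n) + full_norm (Y n) * full_norm (X m - X n)"
      by (rule full_norm_mult_diff)
    also have "\<dots> \<le> b * full_norm (Y m - Y n) + c * full_norm (X m - X n)"
      by (intro add_mono mult_right_mono b c full_norm_nonneg)
    finally show "full_norm (X m * Y m - X n * Y n)
      \<le> c * full_norm (X m - X n) + b * full_norm (Y m - Y n)" by simp
  qed
qed

lemma ga_Cauchy_uminus: "ga_Cauchy X \<Longrightarrow> ga_Cauchy (\<lambda>n. - X n)"
  by (erule ga_Cauchy_contraction[where b = 1])
    (simp_all add: full_norm_diff_commute add.commute[of "- _"])

lemma ga_Cauchy_star: "ga_Cauchy X \<Longrightarrow> ga_Cauchy (\<lambda>n. ga_star (X n))"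
proof (erule ga_Cauchy_contraction[where b = 1])
  fix m n
  have "ga_star (X m) - ga_star (X n) = ga_star (X m - X n)"
    using ga_star_add[of "X m - X n" "X n"] by simp
  then show "full_norm (ga_star (X m) - ga_star (X n)) \<le> 1 * full_norm (X m - X n)"
    by (simp add: full_norm_adj)
qed simp

lemma ga_rel_part_equivp: "part_equivp (ga_rel :: (nat \<Rightarrow> 'g::group_add \<Rightarrow>\<^sub>0 complex) \<Rightarrow> _)"
proof (rule part_equivpI)
  show "\<exists>X :: nat \<Rightarrow> 'g \<Rightarrow>\<^sub>0 complex. ga_rel X X"
    by (rule exI[of _ "\<lambda>_. 0"]) (simp add: ga_rel_def ga_Cauchy_const full_norm_zero)
  show "symp (ga_rel :: (nat \<Rightarrow> 'g \<Rightarrow>\<^sub>0 complex) \<Rightarrow> _)"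
    by (auto intro!: sympI simp: ga_rel_def full_norm_diff_commute)
  show "transp (ga_rel :: (nat \<Rightarrow> 'g \<Rightarrow>\<^sub>0 complex) \<Rightarrow> _)"
  proof (rule transpI)
    fix X Y Z :: "nat \<Rightarrow> 'g \<Rightarrow>\<^sub>0 complex"
    assume XY: "ga_rel X Y" and YZ: "ga_rel Y Z"
    have "(\<lambda>n. full_norm (X n - Z n)) \<longlonglongrightarrow> 0"
    proof (rule tendsto_sandwich[of "\<lambda>_. 0"])
      show "(\<lambda>n. full_norm (X n - Y n) + full_norm (Y n - Z n)) \<longlonglongrightarrow> 0"
        using XY YZ tendsto_add[of _ 0 _ _ 0] by (fastforce simp: ga_rel_def)
    qed (simp_all add: full_norm_nonneg full_norm_diff_triangle)
    with XY YZ show "ga_rel X Z" by (simp add: ga_rel_def)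
  qed
qed

lifting_forget poly_mapping.lifting

quotient_type (overloaded) 'g group_cstar = "nat \<Rightarrow> ('g::group_add \<Rightarrow>\<^sub>0 complex)" / partial: ga_rel
  by (rule ga_rel_part_equivp)


lemma ga_relI:
  assumes "ga_Cauchy X" "ga_Cauchy Y" "\<And>n. full_norm (X n - Y n) \<le> f n" "f \<longlonglongrightarrow> 0"
  shows "ga_rel X Y"
  unfolding ga_rel_def
proof (intro conjI assms(1,2))
  show "(\<lambda>n. full_norm (X n - Y n)) \<longlonglongrightarrow> 0"
    by (rule tendsto_sandwich[OF _ _ tendsto_const assms(4)])
      (simp_all add: full_norm_nonneg assms(3))
qed

lemma ga_rel_refl: "ga_Cauchy X \<Longrightarrow> ga_rel X X"
  by (simp add: ga_rel_def full_norm_zero)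

lemma ga_rel_Cauchy: "ga_rel X X \<Longrightarrow> ga_Cauchy X"
  by (simp add: ga_rel_def)

lemma ga_rel_add:
  assumes "ga_rel X X'" "ga_rel Y Y'" shows "ga_rel (\<lambda>n. X n + Y n) (\<lambda>n. X' n + Y' n)"
proof (rule ga_relI)
  show "full_norm (X n + Y n - (X' n + Y' n)) \<le> full_norm (X n - X' n) + full_norm (Y n - Y' n)" for n
    using full_norm_add[of "X n - X' n" "Y n - Y' n"] by (simp add: algebra_simps)
  show "(\<lambda>n. full_norm (X n - X' n) + full_norm (Y n - Y' n)) \<longlonglongrightarrow> 0"
    using assms tendsto_add[of _ 0 _ _ 0] by (fastforce simp: ga_rel_def)
qed (use assms in \<open>simp_all add: ga_rel_def ga_Cauchy_add\<close>)

lemma ga_rel_mult: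
  assumes "ga_rel X X'" "ga_rel Y Y'" shows "ga_rel (\<lambda>n. X n * Y n) (\<lambda>n. X' n * Y' n)"
proof -
  have C: "ga_Cauchy X" "ga_Cauchy X'" "ga_Cauchy Y" "ga_Cauchy Y'"
    and lim: "(\<lambda>n. full_norm (X n - X' n)) \<longlonglongrightarrow> 0" "(\<lambda>n. full_norm (Y n - Y' n)) \<longlonglongrightarrow> 0"
    using assms by (simp_all add: ga_rel_def)
  obtain b where b: "0 < b" "\<And>n. full_norm (X n) \<le> b" using ga_Cauchy_bounded[OF C(1)] by blast
  obtain c where c: "0 < c" "\<And>n. full_norm (Y' n) \<le> c" using ga_Cauchy_bounded[OF C(4)] by blast
  show ?thesis
  proof (rule ga_relI)
    fix n
    have "full_norm (X n * Y n - X' n * Y' n)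
      \<le> full_norm (X n) * full_norm (Y n - Y' n) + full_norm (Y' n) * full_norm (X n - X' n)"
      by (rule full_norm_mult_diff)
    also have "\<dots> \<le> b * full_norm (Y n - Y' n) + c * full_norm (X n - X' n)"
      by (intro add_mono mult_right_mono b c full_norm_nonneg)
    finally show "full_norm (X n * Y n - X' n * Y' n)
      \<le> b * full_norm (Y n - Y' n) + c * full_norm (X n - X' n)" .
  next
    show "(\<lambda>n. b * full_norm (Y n - Y' n) + c * full_norm (X n - X' n)) \<longlonglongrightarrow> 0"
      using tendsto_add[OF tendsto_mult_left[OF lim(2), of b] tendsto_mult_left[OF lim(1), of c]]
      by simp
  qed (simp_all add: C ga_Cauchy_mult)
qed

lemma ga_rel_uminus: "ga_rel X Y \<Longrightarrow> ga_rel (\<lambda>n. - X n) (\<lambda>n. - Y n)"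
  by (simp add: ga_rel_def ga_Cauchy_uminus full_norm_diff_commute add.commute[of "- _"])

lemma ga_rel_star: "ga_rel X Y \<Longrightarrow> ga_rel (\<lambda>n. ga_star (X n)) (\<lambda>n. ga_star (Y n))"
proof -
  assume rel: "ga_rel X Y"
  have "ga_star (X n) - ga_star (Y n) = ga_star (X n - Y n)" for n
    using ga_star_add[of "X n - Y n" "Y n"] by simp
  with rel show ?thesis by (simp add: ga_rel_def ga_Cauchy_star full_norm_adj)
qed

lemma ga_rel_lim_norm:
  assumes "ga_rel X Y" shows "lim (\<lambda>n. full_norm (X n)) = lim (\<lambda>n. full_norm (Y n))"
proof -
  have CX: "ga_Cauchy X" and CY: "ga_Cauchy Y" and null: "(\<lambda>n. full_norm (X n - Y n)) \<longlonglongrightarrow> 0"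
    using assms by (simp_all add: ga_rel_def)
  have "(\<lambda>n. full_norm (X n) - full_norm (Y n)) \<longlonglongrightarrow> 0"
    by (rule tendsto_rabs_zero_cancel, rule tendsto_sandwich[OF _ _ tendsto_const null])
      (simp_all add: full_norm_diff_abs)
  moreover have "(\<lambda>n. full_norm (X n) - full_norm (Y n))
      \<longlonglongrightarrow> lim (\<lambda>n. full_norm (X n)) - lim (\<lambda>n. full_norm (Y n))"
    using ga_Cauchy_norm_convergent[OF CX] ga_Cauchy_norm_convergent[OF CY]
    by (intro tendsto_diff) (simp_all add: convergent_LIMSEQ_iff)
  ultimately show ?thesis using LIMSEQ_unique by fastforce
qed

lift_definition group_cstar_of :: "('g::group_add \<Rightarrow>\<^sub>0 complex) \<Rightarrow> 'g group_cstar" is "\<lambda>x n. x"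
  by (simp add: ga_rel_refl ga_Cauchy_const)

instantiation group_cstar :: (group_add) ring_1
begin

lift_definition zero_group_cstar :: "'a group_cstar" is "\<lambda>n. 0"
  by (simp add: ga_rel_refl ga_Cauchy_const)

lift_definition one_group_cstar :: "'a group_cstar" is "\<lambda>n. 1"
  by (simp add: ga_rel_refl ga_Cauchy_const)

lift_definition plus_group_cstar :: "'a group_cstar \<Rightarrow> 'a group_cstar \<Rightarrow> 'a group_cstar"
  is "\<lambda>X Y n. X n + Y n"
  by (rule ga_rel_add)

lift_definition uminus_group_cstar :: "'a group_cstar \<Rightarrow> 'a group_cstar"
  is "\<lambda>X n. - X n"
  by (rule ga_rel_uminus)

lift_definition times_group_cstar :: "'a group_cstar \<Rightarrow> 'a group_cstar \<Rightarrow> 'a group_cstar"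
  is "\<lambda>X Y n. X n * Y n"
  by (rule ga_rel_mult)

definition minus_group_cstar :: "'a group_cstar \<Rightarrow> 'a group_cstar \<Rightarrow> 'a group_cstar" where
  "minus_group_cstar x y = x + - y"

instance
proof
  fix a b c :: "'a group_cstar"
  note C = ga_rel_refl ga_rel_Cauchy ga_Cauchy_add ga_Cauchy_mult ga_Cauchy_uminus ga_Cauchy_const
  show "a + b + c = a + (b + c)" by transfer (simp add: C add.assoc)
  show "a + b = b + a" by transfer (simp add: C add.commute)
  show "0 + a = a" by transfer (simp add: C)
  show "- a + a = 0" by transfer (simp add: C)
  show "a - b = a + - b" by (simp add: minus_group_cstar_def)
  show "a * b * c = a * (b * c)" by transfer (simp add: C mult.assoc)
  show "1 * a = a" "a * 1 = a" by (transfer, simp add: C)+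
  show "(a + b) * c = a * c + b * c" by transfer (simp add: C distrib_right)
  show "a * (b + c) = a * b + a * c" by transfer (simp add: C distrib_left)
  have "\<not> ga_rel (\<lambda>_. 0) (\<lambda>_. 1 :: 'a \<Rightarrow>\<^sub>0 complex)"
    by (simp add: ga_rel_def full_norm_minus full_norm_one LIMSEQ_const_iff)
  then show "(0 :: 'a group_cstar) \<noteq> 1" by transfer
qed

end

lemma ga_Cauchy_scale: "ga_Cauchy X \<Longrightarrow> ga_Cauchy (\<lambda>n. Poly_Mapping.single 0 c * X n)"
  by (rule ga_Cauchy_mult[OF ga_Cauchy_const])

lemma ga_rel_scale:
  "ga_rel X Y \<Longrightarrow> ga_rel (\<lambda>n. Poly_Mapping.single 0 c * X n) (\<lambda>n. Poly_Mapping.single 0 c * Y n)"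
  by (rule ga_rel_mult[OF ga_rel_refl[OF ga_Cauchy_const]])

instantiation group_cstar :: (group_add) real_normed_algebra_1
begin

lift_definition scaleR_group_cstar :: "real \<Rightarrow> 'a group_cstar \<Rightarrow> 'a group_cstar"
  is "\<lambda>r X n. Poly_Mapping.single 0 (complex_of_real r) * X n"
  by (rule ga_rel_scale)

lift_definition norm_group_cstar :: "'a group_cstar \<Rightarrow> real" is "\<lambda>X. lim (\<lambda>n. full_norm (X n))"
  by (rule ga_rel_lim_norm)

definition sgn_group_cstar :: "'a group_cstar \<Rightarrow> 'a group_cstar" where
  "sgn_group_cstar x = scaleR (inverse (norm x)) x"

definition dist_group_cstar :: "'a group_cstar \<Rightarrow> 'a group_cstar \<Rightarrow> real" where
  "dist_group_cstar x y = norm (x - y)"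

definition uniformity_group_cstar :: "('a group_cstar \<times> 'a group_cstar) filter" where
  "uniformity_group_cstar = (INF e\<in>{0 <..}. principal {(x, y). dist x y < e})"

definition open_group_cstar :: "'a group_cstar set \<Rightarrow> bool" where
  "open_group_cstar U \<longleftrightarrow> (\<forall>x\<in>U. eventually (\<lambda>(x', y). x' = x \<longrightarrow> y \<in> U) uniformity)"

lemma norm_group_cstar_tendsto:
  "ga_Cauchy X \<Longrightarrow> (\<lambda>n. full_norm (X n)) \<longlonglongrightarrow> lim (\<lambda>n. full_norm (X n))"
  using ga_Cauchy_norm_convergent convergent_LIMSEQ_iff by blast

instance
proof
  fix a b :: real and x y :: "'a group_cstar"
  note C = ga_rel_refl ga_rel_Cauchy ga_Cauchy_add ga_Cauchy_mult ga_Cauchy_scale ga_Cauchy_const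
  note T = norm_group_cstar_tendsto[OF ga_rel_Cauchy]
  show "a *\<^sub>R (x + y) = a *\<^sub>R x + a *\<^sub>R y" by transfer (simp add: C distrib_left)
  show "(a + b) *\<^sub>R x = a *\<^sub>R x + b *\<^sub>R x"
    by transfer (simp add: C distrib_right single_add)
  show "a *\<^sub>R b *\<^sub>R x = (a * b) *\<^sub>R x"
    by transfer (simp add: C mult_single flip: mult.assoc)
  show "1 *\<^sub>R x = x" by transfer (simp add: C)
  show "a *\<^sub>R x * y = a *\<^sub>R (x * y)" by transfer (simp add: C mult.assoc)
  show "x * a *\<^sub>R y = a *\<^sub>R (x * y)"
    by transfer (simp add: C ga_scalar_commute flip: mult.assoc)
  show "dist x y = norm (x - y)" by (simp add: dist_group_cstar_def)
  show "sgn x = inverse (norm x) *\<^sub>R x" by (simp add: sgn_group_cstar_def)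
  show "uniformity = (INF e\<in>{0 <..}. principal {(x, y :: 'a group_cstar). dist x y < e})"
    by (simp add: uniformity_group_cstar_def)
  show "open U \<longleftrightarrow> (\<forall>x\<in>U. eventually (\<lambda>(x', y). x' = x \<longrightarrow> y \<in> U) uniformity)"
    for U :: "'a group_cstar set"
    by (simp add: open_group_cstar_def)
  show "norm x = 0 \<longleftrightarrow> x = 0"
  proof transfer
    fix X :: "nat \<Rightarrow> 'a \<Rightarrow>\<^sub>0 complex" assume X: "ga_rel X X"
    show "lim (\<lambda>n. full_norm (X n)) = 0 \<longleftrightarrow> ga_rel X (\<lambda>n. 0)"
      using T[OF X] ga_rel_Cauchy[OF X]
      by (auto simp: ga_rel_def ga_Cauchy_const dest: limI)
  qed
  show "norm (x + y) \<le> norm x + norm y"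
  proof transfer
    fix X Y :: "nat \<Rightarrow> 'a \<Rightarrow>\<^sub>0 complex" assume X: "ga_rel X X" and Y: "ga_rel Y Y"
    show "lim (\<lambda>n. full_norm (X n + Y n)) \<le> lim (\<lambda>n. full_norm (X n)) + lim (\<lambda>n. full_norm (Y n))"
      by (rule LIMSEQ_le[OF T[OF ga_rel_add[OF X Y]] tendsto_add[OF T[OF X] T[OF Y]]])
        (simp add: full_norm_add)
  qed
  show "norm (x * y) \<le> norm x * norm y"
  proof transfer
    fix X Y :: "nat \<Rightarrow> 'a \<Rightarrow>\<^sub>0 complex" assume X: "ga_rel X X" and Y: "ga_rel Y Y"
    show "lim (\<lambda>n. full_norm (X n * Y n)) \<le> lim (\<lambda>n. full_norm (X n)) * lim (\<lambda>n. full_norm (Y n))"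
      by (rule LIMSEQ_le[OF T[OF ga_rel_mult[OF X Y]] tendsto_mult[OF T[OF X] T[OF Y]]])
        (simp add: full_norm_mult)
  qed
  show "norm (a *\<^sub>R x) = \<bar>a\<bar> * norm x"
  proof transfer
    fix a and X :: "nat \<Rightarrow> 'a \<Rightarrow>\<^sub>0 complex" assume X: "ga_rel X X"
    show "lim (\<lambda>n. full_norm (Poly_Mapping.single 0 (complex_of_real a) * X n))
        = \<bar>a\<bar> * lim (\<lambda>n. full_norm (X n))"
      using tendsto_mult_left[OF T[OF X], of "\<bar>a\<bar>"] by (simp add: full_norm_scale limI)
  qed
  show "norm (1 :: 'a group_cstar) = 1"
    by transfer (simp add: full_norm_one)
qed

end

lemma norm_group_cstar_of: "norm (group_cstar_of x) = full_norm x"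
  by transfer simp

lemma group_cstar_of_diff: "group_cstar_of (x - y) = group_cstar_of x - group_cstar_of y"
proof -
  have "group_cstar_of x = group_cstar_of (x - y) + group_cstar_of y"
    by transfer (simp add: ga_rel_refl ga_Cauchy_const)
  then show ?thesis by (simp add: algebra_simps)
qed

lemma group_cstar_of_dense:
  assumes "0 < e" shows "\<exists>a. norm (x - group_cstar_of a) < e"
proof -
  obtain X where X: "ga_rel X X" and x: "x = abs_group_cstar X"
    by (induction x rule: group_cstar.abs_induct) blast
  have C: "ga_Cauchy X" using X by (rule ga_rel_Cauchy)
  obtain M where M: "\<forall>m\<ge>M. \<forall>n\<ge>M. full_norm (X m - X n) < e / 2"
    using C \<open>0 < e\<close> unfolding ga_Cauchy_def by (meson half_gt_zero)
  have D: "ga_rel (\<lambda>n. X n + - X M) (\<lambda>n. X n + - X M)"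
    by (intro ga_rel_add X ga_rel_refl ga_Cauchy_const)
  have "x - group_cstar_of (X M) = abs_group_cstar (\<lambda>n. X n + - X M)"
    unfolding x minus_group_cstar_def
    using X by (simp add: group_cstar_of.abs_eq uminus_group_cstar.abs_eq plus_group_cstar.abs_eq
        ga_rel_refl ga_Cauchy_const eq_onp_same_args)
  then have "norm (x - group_cstar_of (X M)) = lim (\<lambda>n. full_norm (X n - X M))"
    using D by (simp add: norm_group_cstar.abs_eq eq_onp_same_args)
  moreover have "(\<lambda>n. full_norm (X n - X M)) \<longlonglongrightarrow> lim (\<lambda>n. full_norm (X n - X M))"
    using norm_group_cstar_tendsto[OF ga_rel_Cauchy[OF D]] by simp
  then have "lim (\<lambda>n. full_norm (X n - X M)) \<le> e / 2"
    by (rule LIMSEQ_le_const2) (use M in \<open>auto intro!: exI[of _ M] less_imp_le\<close>)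
  ultimately show ?thesis using \<open>0 < e\<close> by (intro exI[of _ "X M"]) simp
qed

lemma group_cstar_of_tendsto:
  assumes "ga_Cauchy X" shows "(\<lambda>n. group_cstar_of (X n)) \<longlonglongrightarrow> abs_group_cstar X"
proof (rule LIMSEQ_I)
  fix e :: real assume "0 < e"
  have X: "ga_rel X X" using assms by (rule ga_rel_refl)
  obtain M where M: "\<forall>m\<ge>M. \<forall>n\<ge>M. full_norm (X m - X n) < e / 2"
    using assms \<open>0 < e\<close> unfolding ga_Cauchy_def by (meson half_gt_zero)
  show "\<exists>M. \<forall>m\<ge>M. norm (group_cstar_of (X m) - abs_group_cstar X) < e"
  proof (intro exI[of _ M] allI impI)
    fix m assume "M \<le> m"
    have D: "ga_rel (\<lambda>n. X m + - X n) (\<lambda>n. X m + - X n)"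
      by (intro ga_rel_add ga_rel_uminus X ga_rel_refl ga_Cauchy_const)
    have "group_cstar_of (X m) - abs_group_cstar X = abs_group_cstar (\<lambda>n. X m + - X n)"
      unfolding minus_group_cstar_def
      using X by (simp add: group_cstar_of.abs_eq uminus_group_cstar.abs_eq plus_group_cstar.abs_eq
          ga_rel_refl ga_Cauchy_const ga_rel_uminus eq_onp_same_args)
    then have "norm (group_cstar_of (X m) - abs_group_cstar X) = lim (\<lambda>n. full_norm (X m - X n))"
      using D by (simp add: norm_group_cstar.abs_eq eq_onp_same_args)
    moreover have "(\<lambda>n. full_norm (X m - X n)) \<longlonglongrightarrow> lim (\<lambda>n. full_norm (X m - X n))"
      using norm_group_cstar_tendsto[OF ga_rel_Cauchy[OF D]] by simp
    then have "lim (\<lambda>n. full_norm (X m - X n)) \<le> e / 2"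
      by (rule LIMSEQ_le_const2) (use M \<open>M \<le> m\<close> in \<open>auto intro!: exI[of _ M] less_imp_le\<close>)
    ultimately show "norm (group_cstar_of (X m) - abs_group_cstar X) < e" using \<open>0 < e\<close> by simp
  qed
qed

instantiation group_cstar :: (group_add) cstar_algebra
begin

lift_definition scaleC_group_cstar :: "complex \<Rightarrow> 'a group_cstar \<Rightarrow> 'a group_cstar"
  is "\<lambda>c X n. Poly_Mapping.single 0 c * X n"
  by (rule ga_rel_scale)

lift_definition adj_group_cstar :: "'a group_cstar \<Rightarrow> 'a group_cstar"
  is "\<lambda>X n. ga_star (X n)"
  by (rule ga_rel_star)

instance
proof
  fix c d :: complex and r :: real and x y :: "'a group_cstar"
  note C = ga_rel_refl ga_rel_Cauchy ga_Cauchy_add ga_Cauchy_mult ga_Cauchy_scale ga_Cauchy_const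
    ga_Cauchy_star
  note T = norm_group_cstar_tendsto[OF ga_rel_Cauchy]
  show "c *\<^sub>C (x + y) = c *\<^sub>C x + c *\<^sub>C y" by transfer (simp add: C distrib_left)
  show "(c + d) *\<^sub>C x = c *\<^sub>C x + d *\<^sub>C x"
    by transfer (simp add: C distrib_right single_add)
  show "c *\<^sub>C d *\<^sub>C x = (c * d) *\<^sub>C x"
    by transfer (simp add: C mult_single flip: mult.assoc)
  show "r *\<^sub>R x = complex_of_real r *\<^sub>C x" by transfer (simp add: C)
  show "c *\<^sub>C x * y = c *\<^sub>C (x * y)" by transfer (simp add: C mult.assoc)
  show "x * c *\<^sub>C y = c *\<^sub>C (x * y)"
    by transfer (simp add: C ga_scalar_commute flip: mult.assoc)
  show "norm (c *\<^sub>C x) = cmod c * norm x"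
  proof transfer
    fix c and X :: "nat \<Rightarrow> 'a \<Rightarrow>\<^sub>0 complex" assume X: "ga_rel X X"
    show "lim (\<lambda>n. full_norm (Poly_Mapping.single 0 c * X n)) = cmod c * lim (\<lambda>n. full_norm (X n))"
      using tendsto_mult_left[OF T[OF X], of "cmod c"] by (simp add: full_norm_scale limI)
  qed
  show "adj (adj x) = x" by transfer (simp add: C ga_star_star)
  show "adj (x + y) = adj x + adj y" by transfer (simp add: C ga_star_add)
  show "adj (c *\<^sub>C x) = cnj c *\<^sub>C adj x"
    by transfer (simp add: C ga_star_mult ga_star_single ga_scalar_commute)
  show "adj (x * y) = adj y * adj x" by transfer (simp add: C ga_star_mult)
  show "norm (adj x * x) = (norm x)\<^sup>2"
  proof transfer
    fix X :: "nat \<Rightarrow> 'a \<Rightarrow>\<^sub>0 complex" assume X: "ga_rel X X"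
    show "lim (\<lambda>n. full_norm (ga_star (X n) * X n)) = (lim (\<lambda>n. full_norm (X n)))\<^sup>2"
      using tendsto_power[OF T[OF X], of 2] by (simp add: full_norm_star limI)
  qed
  fix X :: "nat \<Rightarrow> 'a group_cstar" assume X: "Cauchy X"
  have "\<exists>a. norm (X n - group_cstar_of a) < inverse (real (Suc n))" for n
    by (rule group_cstar_of_dense) simp
  then obtain A where A: "\<And>n. norm (X n - group_cstar_of (A n)) < inverse (real (Suc n))"
    by metis
  have null: "(\<lambda>n. X n - group_cstar_of (A n)) \<longlonglongrightarrow> 0"
    by (rule Lim_null_comparison[OF _ LIMSEQ_inverse_real_of_nat])
      (intro always_eventually allI less_imp_le A)
  have "ga_Cauchy A"
    unfolding ga_Cauchy_def
  proof (intro allI impI)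
    fix e :: real assume e: "0 < e"
    obtain M1 where M1: "\<And>m n. M1 \<le> m \<Longrightarrow> M1 \<le> n \<Longrightarrow> norm (X m - X n) < e / 3"
      using X e unfolding Cauchy_def dist_norm by (meson divide_pos_pos zero_less_numeral)
    obtain M2 where M2: "\<And>n. M2 \<le> n \<Longrightarrow> norm (X n - group_cstar_of (A n)) < e / 3"
      using LIMSEQ_D[OF null, of "e / 3"] e by auto
    show "\<exists>M. \<forall>m\<ge>M. \<forall>n\<ge>M. full_norm (A m - A n) < e"
    proof (intro exI allI impI)
      fix m n assume "max M1 M2 \<le> m" "max M1 M2 \<le> n"
      then have "norm (X m - X n) + norm (X m - group_cstar_of (A m))
          + norm (X n - group_cstar_of (A n)) < e"
        using M1[of m n] M2[of m] M2[of n] by simp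
      moreover have "group_cstar_of (A m) - group_cstar_of (A n)
          = (X m - X n) - (X m - group_cstar_of (A m)) + (X n - group_cstar_of (A n))"
        by simp
      then have "norm (group_cstar_of (A m) - group_cstar_of (A n)) \<le>
          norm (X m - X n) + norm (X m - group_cstar_of (A m)) + norm (X n - group_cstar_of (A n))"
        by (simp only:) (intro order_trans[OF norm_triangle_ineq] add_right_mono norm_triangle_ineq4)
      ultimately show "full_norm (A m - A n) < e"
        by (simp add: norm_group_cstar_of flip: group_cstar_of_diff)
    qed
  qed
  then have "(\<lambda>n. group_cstar_of (A n)) \<longlonglongrightarrow> abs_group_cstar A"
    by (rule group_cstar_of_tendsto)
  from tendsto_add[OF null this] show "convergent X" by (auto simp: convergent_def)
qed

end


section \<open>Operator systems\<close>

text \<open>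
  The data of an operator system: a complex *-vector space on the set \<open>os_space\<close>, an order unit and
  matrix cones. A \<open>p \<times> p\<close> matrix is a function \<^typ>\<open>nat \<Rightarrow> nat \<Rightarrow> 'a\<close>, of which only the entries
  with both indices below \<open>p\<close> are relevant; \<open>os_pos S p X\<close> says that \<open>X\<close> lies in the positive cone
  of the \<open>p \<times> p\<close> matrices over \<open>S\<close>.
\<close>

record 'a operator_system =
  os_space :: "'a set"
  os_zero :: 'a
  os_add :: "'a \<Rightarrow> 'a \<Rightarrow> 'a"
  os_scale :: "complex \<Rightarrow> 'a \<Rightarrow> 'a"
  os_adj :: "'a \<Rightarrow> 'a"
  os_unit :: 'a
  os_pos :: "nat \<Rightarrow> (nat \<Rightarrow> nat \<Rightarrow> 'a) \<Rightarrow> bool"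

text \<open>
  The operator system on a unital self-adjoint subspace \<open>V\<close> of a C*-algebra \<open>A\<close>. The positive
  elements of the C*-algebra of \<open>p \<times> p\<close> matrices over \<open>A\<close> are the products \<open>Y\<^sup>* Y\<close>.
\<close>

definition cstar_system :: "'a::cstar_algebra set \<Rightarrow> 'a operator_system" where
  "cstar_system V =
    \<lparr>os_space = V, os_zero = 0, os_add = (+), os_scale = scaleC, os_adj = adj, os_unit = 1,
     os_pos = (\<lambda>p X. (\<forall>i<p. \<forall>j<p. X i j \<in> V) \<and>
       (\<exists>Y. \<forall>i<p. \<forall>j<p. X i j = (\<Sum>k<p. adj (Y k i) * Y k j)))\<rparr>"

text \<open>
  The complex matrices indexed by a finite type. A \<open>p \<times> p\<close> matrix over them is positive iff it is
  positive semidefinite as a block matrix.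
\<close>

definition matrix_system :: "(complex^'n^'n) operator_system" where
  "matrix_system =
    \<lparr>os_space = UNIV, os_zero = 0, os_add = (+), os_scale = (\<lambda>c A. \<chi> a b. c * A $ a $ b),
     os_adj = (\<lambda>A. \<chi> a b. cnj (A $ b $ a)), os_unit = mat 1,
     os_pos = (\<lambda>p X. \<forall>v :: nat \<Rightarrow> complex^'n.
       (\<Sum>i<p. \<Sum>j<p. \<Sum>a\<in>UNIV. \<Sum>b\<in>UNIV. cnj (v i $ a) * X i j $ a $ b * v j $ b) \<in> \<real>\<^sub>\<ge>\<^sub>0)\<rparr>"

definition cp_map ::
    "'a operator_system \<Rightarrow> 'b operator_system \<Rightarrow> ('a \<Rightarrow> 'b) \<Rightarrow> bool" where
  "cp_map S T f \<longleftrightarrow>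
     (\<forall>x\<in>os_space S. f x \<in> os_space T) \<and>
     (\<forall>x\<in>os_space S. \<forall>y\<in>os_space S. f (os_add S x y) = os_add T (f x) (f y)) \<and>
     (\<forall>c. \<forall>x\<in>os_space S. f (os_scale S c x) = os_scale T c (f x)) \<and>
     (\<forall>p X. os_pos S p X \<longrightarrow> os_pos T p (\<lambda>i j. f (X i j)))"

definition ucp_map ::
    "'a operator_system \<Rightarrow> 'b operator_system \<Rightarrow> ('a \<Rightarrow> 'b) \<Rightarrow> bool" where
  "ucp_map S T f \<longleftrightarrow> cp_map S T f \<and> f (os_unit S) = os_unit T"

definition complete_order_iso ::
    "'a operator_system \<Rightarrow> 'b operator_system \<Rightarrow> ('a \<Rightarrow> 'b) \<Rightarrow> bool" where
  "complete_order_iso S T f \<longleftrightarrow>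
     bij_betw f (os_space S) (os_space T) \<and> cp_map S T f \<and> cp_map T S (inv_into (os_space S) f)"

definition os_kernel ::
    "'a operator_system \<Rightarrow> 'b operator_system \<Rightarrow> ('a \<Rightarrow> 'b) \<Rightarrow> 'a set" where
  "os_kernel S T f = {x \<in> os_space S. f x = os_zero T}"

subsection \<open>Quotients\<close>

definition os_coset :: "'a operator_system \<Rightarrow> 'a set \<Rightarrow> 'a \<Rightarrow> 'a set" where
  "os_coset S J x = os_add S x ` J"

definition hermitian_matrix ::
    "'a operator_system \<Rightarrow> 'a set \<Rightarrow> nat \<Rightarrow> (nat \<Rightarrow> nat \<Rightarrow> 'a) \<Rightarrow> bool" where
  "hermitian_matrix S V p H \<longleftrightarrow> (\<forall>i<p. \<forall>j<p. H i j \<in> V \<and> H i j = os_adj S (H j i))"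

text \<open>
  \<open>S / J\<close> on the set of cosets. Adding \<open>J\<close> in \<open>os_scale\<close> only matters for the scalar \<open>0\<close>.
\<close>

definition quotient_system :: "'a operator_system \<Rightarrow> 'a set \<Rightarrow> 'a set operator_system" where
  "quotient_system S J =
    \<lparr>os_space = os_coset S J ` os_space S,
     os_zero = J,
     os_add = (\<lambda>C D. {os_add S x y | x y. x \<in> C \<and> y \<in> D}),
     os_scale = (\<lambda>c C. {os_add S (os_scale S c x) k | x k. x \<in> C \<and> k \<in> J}),
     os_adj = (\<lambda>C. os_adj S ` C),
     os_unit = os_coset S J (os_unit S),
     os_pos = (\<lambda>p X. \<exists>H. hermitian_matrix S (os_space S) p H \<and>
       (\<forall>i<p. \<forall>j<p. X i j = os_coset S J (H i j)) \<and>
       (\<forall>\<epsilon>>0. \<exists>K. hermitian_matrix S J p K \<and>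
         os_pos S p (\<lambda>i j.
           os_add S (os_add S
             (if i = j then os_scale S (complex_of_real \<epsilon>) (os_unit S) else os_zero S)
             (H i j)) (K i j))))\<rparr>"

text \<open>
  The map induced on cosets; meaningful if \<open>f\<close> is constant on each coset.
\<close>

definition induced_map :: "('a \<Rightarrow> 'b) \<Rightarrow> 'a set \<Rightarrow> 'b" where
  "induced_map f C = the_elem (f ` C)"

definition complete_quotient_map ::
    "'a operator_system \<Rightarrow> 'b operator_system \<Rightarrow> ('a \<Rightarrow> 'b) \<Rightarrow> bool" where
  "complete_quotient_map S T f \<longleftrightarrow>
     cp_map S T f \<and>
     complete_order_iso (quotient_system S (os_kernel S T f)) T (induced_map f)"

subsection \<open>C*-envelopes\<close>

definition complete_order_embedding ::
    "'s operator_system \<Rightarrow> ('s \<Rightarrow> 'a::cstar_algebra) \<Rightarrow> bool" where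
  "complete_order_embedding S \<kappa> \<longleftrightarrow>
     \<kappa> (os_unit S) = 1 \<and> complete_order_iso S (cstar_system (\<kappa> ` os_space S)) \<kappa>"

definition generated_cstar :: "'a::cstar_algebra set \<Rightarrow> 'a set" where
  "generated_cstar V = cstar_subalgebra hull V"

text \<open>
  The C*-algebra \<open>'a\<close> with the embedding \<open>\<iota>\<close> is the C*-envelope of \<open>S\<close>: it is generated by the copy
  \<open>\<iota>(S)\<close> of \<open>S\<close>, and every C*-algebra generated by a copy \<open>\<kappa>(S)\<close> maps onto it by a *-homomorphism
  that sends \<open>\<kappa>(x)\<close> to \<open>\<iota>(x)\<close>. HOL cannot quantify over types within a formula, so the type \<open>'b\<close>
  of the competing C*-algebras is a parameter; a theorem with \<open>'b\<close> free covers all of them.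
\<close>

definition is_cstar_envelope ::
    "'b::cstar_algebra itself \<Rightarrow> 's operator_system \<Rightarrow> ('s \<Rightarrow> 'a::cstar_algebra) \<Rightarrow> bool" where
  "is_cstar_envelope TYPE('b) S \<iota> \<longleftrightarrow>
     complete_order_embedding S \<iota> \<and>
     generated_cstar (\<iota> ` os_space S) = UNIV \<and>
     (\<forall>\<kappa> :: 's \<Rightarrow> 'b. complete_order_embedding S \<kappa> \<longrightarrow>
       (\<exists>\<pi> :: 'b \<Rightarrow> 'a. star_hom_on (generated_cstar (\<kappa> ` os_space S)) \<pi> \<and>
         \<pi> ` generated_cstar (\<kappa> ` os_space S) = UNIV \<and>
         (\<forall>x\<in>os_space S. \<pi> (\<kappa> x) = \<iota> x)))"

section \<open>The map from the matrices to the span of the products of universal unitaries\<close>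

text \<open>
  The \<open>n\<close> indices are the elements of \<^typ>\<open>'g option\<close> for a finite type \<open>'g\<close> of \<open>n - 1\<close> generators,
  with \<^term>\<open>None\<close> as the index of the unitary \<open>1\<close>. As types are nonempty, \<open>n \<ge> 2\<close>.
\<close>

lemma two_le_card_option: "2 \<le> CARD('g::finite option)"
  by (simp add: card_UNIV_option Suc_le_eq)

definition univ_unitary :: "'g option \<Rightarrow> 'g free_group group_cstar" where
  "univ_unitary i =
     (case i of None \<Rightarrow> 1 | Some g \<Rightarrow> group_cstar_of (Poly_Mapping.single (free_gen g) 1))"

definition W_space :: "'g free_group group_cstar set" where
  "W_space = complex_vector.span {univ_unitary i * adj (univ_unitary j) | i j. True}"

definition W_system :: "'g free_group group_cstar operator_system" where
  "W_system = cstar_system W_space"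

definition phi_map :: "complex^('g::finite option)^('g option) \<Rightarrow> 'g free_group group_cstar" where
  "phi_map A = (\<Sum>i\<in>UNIV. \<Sum>j\<in>UNIV.
     A $ i $ j *\<^sub>C (1 / of_nat CARD('g option)) *\<^sub>C (univ_unitary i * adj (univ_unitary j)))"

definition matrix_unit :: "'n \<Rightarrow> 'n \<Rightarrow> complex^'n^'n" where
  "matrix_unit i j = (\<chi> a b. if a = i \<and> b = j then 1 else 0)"

lemma phi_map_matrix_unit:
  "phi_map (matrix_unit i j) =
     (1 / of_nat CARD('g::finite option)) *\<^sub>C
       (univ_unitary i * adj (univ_unitary (j :: 'g option)))"
proof -
  let ?f = "\<lambda>a b. (1 / of_nat CARD('g option)) *\<^sub>C (univ_unitary a * adj (univ_unitary (b :: 'g option)))"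
  have "phi_map (matrix_unit i j) =
      (\<Sum>a\<in>UNIV. \<Sum>b\<in>UNIV. if b = j then if a = i then ?f a b else 0 else 0)"
    unfolding phi_map_def matrix_unit_def
    by (intro sum.cong refl) (simp add: complex_vector.scale_one)
  then show ?thesis by simp
qed

definition diag_trace_zero :: "(complex^'n^'n) set" where
  "diag_trace_zero = {A. (\<forall>i j. i \<noteq> j \<longrightarrow> A $ i $ j = 0) \<and> trace A = 0}"

end

(*
  Suppose phi(H) is positive but H + eps 1 + K is positive for no K over the trace zero diagonal
  matrices. Separation gives a functional F, positive on matrices and zero over J_n, with F(H) < 0.
  Since F kills J_n, the families of basis vectors with a fixed second index all have the same Gram
  matrix in the semi-inner product of F. Hence unitaries move one family into another; they
  represent the free group, and F(H) becomes a vector functional of n phi(H), which is a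
  contradiction. Applied to the Hermitian matrices in ker phi, the same lifting gives ker phi = J_n.

  For the envelope, let B contain a copy of M_n / J_n. The copy u of the class of n E_ij is a
  contraction, and the completely positive map from the copy to C*(F_{n-1}) sends it to the unitary
  w = w_i w_j*. Extend this map, composed with a state, to B. A contraction sent to a unitary acts
  in the dilation as w does (multiplicative domain), so norm P(w) <= norm P(u) for every
  *-polynomial P. The closure of the graph of P(u) |-> P(w) is then the desired *-homomorphism,
  surjective by an open mapping argument.

  Positivity is treated without spectral theory: square roots come from the binomial series, and
  positivity of a matrix over a C*-algebra is tested on states.
*)
theory Submission
  imports Defs "HOL-Library.Function_Algebras"
begin

section \<open>Positive elements of a C*-algebra\<close>

text \<open>No Hilbert space is completed or divided by its null vectors. Every GNS or Stinespring
  space is a semi-inner product on concrete tuples, and equality of vectors becomes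
  \<open>nrm (x - y) = 0\<close>. This dictates two choices. Inverses of unitaries must be exact as
  functions, or the free group would not act; reflections provide that. And the extended completely
  positive map is built for finitely many vectors at a time, so a statement about it must list
  beforehand the vectors that it meets.

  Separation is algebraic as well: a cone maximal among those avoiding one point, without any
  topology. The element \<epsilon> + H that should become positive is put into the cone with the
  opposite sign.

  Freeness enters at one place: arbitrary unitaries for the generators give a representation, and
  \<open>full_norm\<close> dominates every C*-seminorm, in particular the one of that
  representation. Surjectivity of the homomorphism takes work because the norm estimate runs from u
  to w only: the preimage of an approximation may have a large norm until a rational function cuts
  it off.\<close>

lemma adj_zero [simp]: "adj 0 = (0 :: 'a::cstar_algebra)"
  using adj_scaleC[of 0 "0 :: 'a"] by simp

lemma adj_one [simp]: "adj 1 = (1 :: 'a::cstar_algebra)"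
  using adj_mult[of "adj 1" "1 :: 'a"] by (simp add: adj_adj)

lemma adj_minus: "adj (- x) = - adj (x :: 'a::cstar_algebra)"
  using adj_scaleC[of "-1" x] by simp

lemma adj_diff: "adj (x - y) = adj x - adj (y :: 'a::cstar_algebra)"
  using adj_add[of x "- y"] by (simp add: adj_minus)

lemma adj_scaleR: "adj (r *\<^sub>R x) = r *\<^sub>R adj (x :: 'a::cstar_algebra)"
  by (simp add: scaleR_scaleC adj_scaleC)

lemma adj_sum: "adj (sum f A) = (\<Sum>i\<in>A. adj (f i :: 'a::cstar_algebra))"
  by (induction A rule: infinite_finite_induct) (simp_all add: adj_add)

lemma adj_power: "adj (x ^ n) = adj (x :: 'a::cstar_algebra) ^ n"
  by (induction n) (simp_all add: adj_mult power_commutes)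

lemma norm_adj [simp]: "norm (adj x) = norm (x :: 'a::cstar_algebra)"
proof -
  have le: "norm y \<le> norm (adj y)" for y :: 'a
  proof (cases "y = 0")
    case False
    have "norm y * norm y \<le> norm (adj y) * norm y"
      using norm_mult_ineq[of "adj y" y] by (simp add: cstar_identity power2_eq_square)
    with False show ?thesis by simp
  qed simp
  show ?thesis using le[of x] le[of "adj x"] by (simp add: adj_adj)
qed

lemma bounded_linear_adj: "bounded_linear (adj :: 'a::cstar_algebra \<Rightarrow> 'a)"
  by (rule bounded_linear_intro[of _ 1]) (simp_all add: adj_add adj_scaleR)

lemma of_real_scaleC: "of_real r = complex_of_real r *\<^sub>C (1 :: 'a::cstar_algebra)"
  by (simp add: of_real_def scaleR_scaleC)

lemma adj_of_real [simp]: "adj (of_real r) = (of_real r :: 'a::cstar_algebra)"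
  by (simp add: of_real_def adj_scaleR)

lemma norm_selfadj_square: "adj x = x \<Longrightarrow> norm (x * x) = (norm (x :: 'a::cstar_algebra))\<^sup>2"
  using cstar_identity[of x] by simp

subsection \<open>Square roots by the binomial series\<close>

text \<open>The Taylor coefficients of sqrt(1 - x) at 0.\<close>

definition sqrt_coeff :: "nat \<Rightarrow> real" where
  "sqrt_coeff k = (1 / 2 gchoose k) * (- 1) ^ k"

lemma sqrt_coeff_0 [simp]: "sqrt_coeff 0 = 1"
  by (simp add: sqrt_coeff_def)

text \<open>Vandermonde's identity for 1/2 + 1/2 = 1: the Cauchy square of the series of sqrt(1 - x)
  is 1 - x.\<close>

lemma sqrt_coeff_convolution:
  "(\<Sum>i\<le>m. sqrt_coeff i * sqrt_coeff (m - i)) = (if m = 0 then 1 else if m = 1 then -1 else 0)"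
proof -
  have "(\<Sum>i\<le>m. sqrt_coeff i * sqrt_coeff (m - i))
      = (\<Sum>i\<le>m. (-1) ^ m * ((1 / 2 gchoose i) * (1 / 2 gchoose (m - i))))"
    by (intro sum.cong refl) (simp add: sqrt_coeff_def flip: power_add)
  also have "\<dots> = (-1) ^ m * (1 gchoose m)"
    using gbinomial_Vandermonde[of "1/2 :: real" "1/2" m]
    by (simp add: sum_distrib_left[symmetric] atLeast0AtMost)
  also have "(1 gchoose m :: real) = of_nat (1 choose m)"
    using binomial_gbinomial[of 1 m, where ?'a = real] by simp
  finally show ?thesis by (cases m) (auto simp: binomial_eq_0)
qed

text \<open>The ratio of consecutive terms. It is nonnegative for \<open>a = 1/2\<close> from k = 1
  on and for \<open>a = -1/2\<close> always, which settles the two signs below.\<close>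

lemma gbinomial_alternating_Suc:
  "(a gchoose Suc k) * (- 1) ^ Suc k = (of_nat k - a) / (of_nat k + 1) * ((a gchoose k) * (- 1) ^ k)"
  for a :: real
proof -
  have "(of_nat k + 1) * (a gchoose Suc k) = (a - of_nat k) * (a gchoose k)"
    using gbinomial_mult_1[of a k] by (simp add: algebra_simps)
  then have *: "(a gchoose Suc k) = (a - of_nat k) / (of_nat k + 1) * (a gchoose k)"
    by (simp add: field_simps)
  show ?thesis unfolding * by (simp add: field_simps)
qed

lemma sqrt_coeff_Suc_le_0: "sqrt_coeff (Suc k) \<le> 0"
proof (induction k)
  case 0 show ?case by (simp add: sqrt_coeff_def)
next
  case (Suc k)
  have "sqrt_coeff (Suc (Suc k)) = (real (Suc k) - 1 / 2) / (real (Suc k) + 1) * sqrt_coeff (Suc k)"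
    unfolding sqrt_coeff_def by (rule gbinomial_alternating_Suc)
  moreover have "0 \<le> (real (Suc k) - 1 / 2) / (real (Suc k) + 1)" by simp
  ultimately show ?case using Suc mult_nonneg_nonpos by metis
qed

text \<open>Partial sums of the coefficients of (1 - x)^(1/2) are the coefficients of (1 - x)^(1/2)
  / (1 - x) = (1 - x)^(-1/2), and these are nonnegative.\<close>

lemma sqrt_coeff_sum_nonneg: "0 \<le> (\<Sum>k\<le>m. sqrt_coeff k)"
proof -
  have "0 \<le> ((- 1 / 2 :: real) gchoose m) * (- 1) ^ m"
  proof (induction m)
    case (Suc m)
    moreover have "0 \<le> (real m - - 1 / 2) / (real m + 1)" by simp
    ultimately show ?case unfolding gbinomial_alternating_Suc by (rule mult_nonneg_nonneg[rotated])
  qed simp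
  then show ?thesis using gbinomial_sum_lower_neg[of "1/2 :: real" m]
    by (simp add: sqrt_coeff_def mult.commute)
qed

text \<open>The leading coefficient is 1, the later ones are nonpositive and the partial sums stay
  nonnegative. The exact bound 1 matters: it gives \<open>norm (1 - c) \<le> 1\<close> for the root
  c in \<open>sqrt_one_minus\<close>, which is the positivity of c.\<close>

lemma sqrt_coeff_tail:
  shows "summable (\<lambda>k. \<bar>sqrt_coeff (Suc k)\<bar>)" and "suminf (\<lambda>k. \<bar>sqrt_coeff (Suc k)\<bar>) \<le> 1"
proof -
  have le: "(\<Sum>k<m. \<bar>sqrt_coeff (Suc k)\<bar>) \<le> 1" for m
  proof -
    have "(\<Sum>k<m. \<bar>sqrt_coeff (Suc k)\<bar>) = 1 - (\<Sum>k\<le>m. sqrt_coeff k)"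
      using sqrt_coeff_Suc_le_0
      by (simp add: sum.atMost_shift abs_of_nonpos sum_negf)
    then show ?thesis using sqrt_coeff_sum_nonneg[of m] by simp
  qed
  show "summable (\<lambda>k. \<bar>sqrt_coeff (Suc k)\<bar>)"
    by (rule summableI_nonneg_bounded[of _ 1]) (simp_all add: le)
  then show "suminf (\<lambda>k. \<bar>sqrt_coeff (Suc k)\<bar>) \<le> 1"
    using le by (rule suminf_le_const)
qed

lemma summable_sqrt_series:
  fixes x :: "nat \<Rightarrow> 'a::banach"
  assumes "\<And>m. norm (x m) \<le> 1"
  shows "summable (\<lambda>m. norm (sqrt_coeff m *\<^sub>R x m))"
proof -
  have "summable (\<lambda>k. norm (sqrt_coeff (Suc k) *\<^sub>R x (Suc k)))"
    by (rule summable_comparison_test'[OF sqrt_coeff_tail(1), of 0])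
      (simp add: assms mult_left_le)
  then show ?thesis by (simp only: summable_Suc_iff[of "\<lambda>k. norm (sqrt_coeff k *\<^sub>R x k)"])
qed

text \<open>
  Here \<open>t m\<close> is the \<open>m\<close>-th power of a \<open>p \<times> p\<close> matrix \<open>T\<close>, so \<open>Y\<close> is a square root of \<open>1 - T\<close>.
  Boundedness of the entries of the powers is enough since the coefficients are absolutely summable.
\<close>

lemma matrix_sqrt_series:
  fixes t :: "nat \<Rightarrow> nat \<Rightarrow> nat \<Rightarrow> 'a::cstar_algebra"
  assumes bound: "\<And>m i j. i < p \<Longrightarrow> j < p \<Longrightarrow> norm (t m i j) \<le> 1"
    and t0: "\<And>i j. i < p \<Longrightarrow> j < p \<Longrightarrow> t 0 i j = (if i = j then 1 else 0)"
    and t_add: "\<And>m n i j. i < p \<Longrightarrow> j < p \<Longrightarrow> t (m + n) i j = (\<Sum>k<p. t m i k * t n k j)"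
    and "i < p" "j < p"
  defines "Y \<equiv> \<lambda>i j. suminf (\<lambda>m. sqrt_coeff m *\<^sub>R t m i j)"
  shows "(\<Sum>k<p. Y i k * Y k j) = (if i = j then 1 else 0) - t 1 i j"
proof -
  let ?c = "\<lambda>i j m. sqrt_coeff m *\<^sub>R t m i j"
  have sums: "(\<lambda>m. \<Sum>l\<le>m. ?c i k l * ?c k j (m - l)) sums (Y i k * Y k j)" if "k < p" for k
    unfolding Y_def using that \<open>i < p\<close> \<open>j < p\<close> bound
    by (intro Cauchy_product_sums summable_sqrt_series) auto
  have "(\<lambda>m. \<Sum>k<p. \<Sum>l\<le>m. ?c i k l * ?c k j (m - l)) sums (\<Sum>k<p. Y i k * Y k j)"
    by (rule sums_sum) (use sums in auto)
  moreover have "(\<Sum>k<p. \<Sum>l\<le>m. ?c i k l * ?c k j (m - l))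
      = (if m = 0 then t 0 i j else 0) + (if m = 1 then - t 1 i j else 0)" for m
  proof -
    have "(\<Sum>k<p. \<Sum>l\<le>m. ?c i k l * ?c k j (m - l))
      = (\<Sum>l\<le>m. (sqrt_coeff l * sqrt_coeff (m - l)) *\<^sub>R (\<Sum>k<p. t l i k * t (m - l) k j))"
      by (subst sum.swap) (simp add: scaleR_sum_right mult.commute)
    also have "\<dots> = (\<Sum>l\<le>m. (sqrt_coeff l * sqrt_coeff (m - l)) *\<^sub>R t m i j)"
      using t_add[OF \<open>i < p\<close> \<open>j < p\<close>]
      by (intro sum.cong refl) (metis atMost_iff le_add_diff_inverse)
    also have "\<dots> = (\<Sum>l\<le>m. sqrt_coeff l * sqrt_coeff (m - l)) *\<^sub>R t m i j"
      by (simp add: scaleR_sum_left)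
    finally show ?thesis by (simp add: sqrt_coeff_convolution)
  qed
  moreover have "(\<lambda>m. (if m = 0 then t 0 i j else 0) + (if m = 1 then - t 1 i j else 0))
      sums (t 0 i j + - t 1 i j)"
    by (intro sums_add) (simp_all only: sums_single[of 0 "\<lambda>_. t 0 i j"] sums_single[of 1 "\<lambda>_. - t 1 i j"])
  ultimately show ?thesis
    using t0[OF \<open>i < p\<close> \<open>j < p\<close>] sums_unique2 by fastforce
qed

lemma adj_sqrt_series:
  fixes x :: "nat \<Rightarrow> 'a::cstar_algebra"
  assumes "\<And>m. norm (x m) \<le> 1"
  shows "adj (suminf (\<lambda>m. sqrt_coeff m *\<^sub>R x m)) = suminf (\<lambda>m. sqrt_coeff m *\<^sub>R adj (x m))"
  using bounded_linear.suminf[OF bounded_linear_adj summable_norm_cancel[OF summable_sqrt_series[OF assms]]]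
  by (simp add: adj_scaleR)

text \<open>The commutation clause stands in for functional calculus: c is a limit of polynomials in
  \<open>T\<close>.\<close>

lemma sqrt_one_minus:
  fixes T :: "'a::cstar_algebra"
  assumes T: "norm T \<le> 1" "adj T = T"
  obtains c where "adj c = c" "c * c = 1 - T" "norm (1 - c) \<le> 1"
    "\<And>z. z * T = T * z \<Longrightarrow> z * c = c * z"
proof -
  have bound: "norm (T ^ m) \<le> 1" for m
    using norm_power_ineq[of T m] power_le_one[OF norm_ge_zero T(1), of m] by linarith
  have summable: "summable (\<lambda>m. sqrt_coeff m *\<^sub>R T ^ m)"
    by (rule summable_norm_cancel[OF summable_sqrt_series[OF bound]])
  define c where "c = suminf (\<lambda>m. sqrt_coeff m *\<^sub>R T ^ m)"
  show ?thesis
  proof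
    show "adj c = c" using adj_sqrt_series[OF bound] by (simp add: c_def adj_power T)
    show "c * c = 1 - T"
      using matrix_sqrt_series[where t = "\<lambda>m _ _. T ^ m" and p = 1 and i = 0 and j = 0] bound
      by (simp add: c_def power_add)
    have "1 - c = - suminf (\<lambda>m. sqrt_coeff (Suc m) *\<^sub>R T ^ Suc m)"
      unfolding c_def using suminf_split_head[OF summable] by simp
    also have "norm \<dots> \<le> suminf (\<lambda>m. \<bar>sqrt_coeff (Suc m)\<bar>)"
      unfolding norm_minus_cancel
      by (rule norm_suminf_le) (use bound sqrt_coeff_tail(1) in
        \<open>auto simp del: power_Suc simp: mult_left_le\<close>)
    also have "\<dots> \<le> 1" by (rule sqrt_coeff_tail(2))
    finally show "norm (1 - c) \<le> 1" .
    fix z assume z: "z * T = T * z"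
    have "z * T ^ m = T ^ m * z" for m
    proof (induction m)
      case (Suc m)
      have "z * T ^ Suc m = T * (z * T ^ m)" using z by (simp add: mult.assoc[symmetric])
      with Suc show ?case by (simp add: mult.assoc)
    qed simp
    then show "z * c = c * z"
      unfolding c_def
      by (simp add: suminf_mult[OF summable, symmetric] suminf_mult2[OF summable])
  qed
qed

subsection \<open>The positive cone\<close>

text \<open>
  The self-adjoint elements with spectrum in the nonnegative reals, characterised by the norm.
\<close>

definition pos_elem :: "'a::cstar_algebra \<Rightarrow> bool" where
  "pos_elem h \<longleftrightarrow> adj h = h \<and> (\<exists>t. norm (of_real t - h) \<le> t)"

lemma pos_elem_adj: "pos_elem h \<Longrightarrow> adj h = h"
  by (simp add: pos_elem_def)

lemma pos_elem_of_real_diff: "adj h = h \<Longrightarrow> norm h \<le> t \<Longrightarrow> pos_elem (of_real t - h)"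
  by (auto simp: pos_elem_def adj_diff intro!: exI[of _ t])

lemma pos_elem_of_real: "0 \<le> t \<Longrightarrow> pos_elem (of_real t)"
  using pos_elem_of_real_diff[of 0 t] by simp

lemma pos_elem_add: "pos_elem h \<Longrightarrow> pos_elem k \<Longrightarrow> pos_elem (h + k)"
proof -
  assume h: "pos_elem h" and k: "pos_elem k"
  then obtain t r where "norm (of_real t - h) \<le> t" "norm (of_real r - k) \<le> r"
    by (auto simp: pos_elem_def)
  then have "norm (of_real (t + r) - (h + k)) \<le> t + r"
    using norm_triangle_ineq[of "of_real t - h" "of_real r - k"] by (simp add: algebra_simps)
  with h k show ?thesis unfolding pos_elem_def adj_add by metis
qed

lemma pos_elem_scaleR: "pos_elem h \<Longrightarrow> 0 \<le> r \<Longrightarrow> pos_elem (r *\<^sub>R h)"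
proof -
  assume h: "pos_elem h" and r: "0 \<le> r"
  then obtain t where t: "norm (of_real t - h) \<le> t" by (auto simp: pos_elem_def)
  have "of_real (r * t) - r *\<^sub>R h = r *\<^sub>R (of_real t - h)"
    by (simp add: scaleR_diff_right of_real_def)
  then have "norm (of_real (r * t) - r *\<^sub>R h) \<le> r * t"
    using t r by (simp add: mult_left_mono)
  with h show ?thesis unfolding pos_elem_def adj_scaleR by metis
qed

lemma pos_elem_sqrt:
  assumes "pos_elem h"
  obtains y where "adj y = y" "y * y = h" "pos_elem y" "\<And>z. z * h = h * z \<Longrightarrow> z * y = y * z"
proof -
  from assms obtain t where t: "norm (of_real t - h) \<le> t" and h: "adj h = h"
    by (auto simp: pos_elem_def)
  have t0: "0 \<le> t" using t norm_ge_zero order_trans by blast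
  show ?thesis
  proof (cases "t = 0")
    case True
    with t have "h = 0" by simp
    then show ?thesis using that[of 0] pos_elem_of_real[of 0] by simp
  next
    case False
    with t0 have t0: "0 < t" by simp
    \<comment> \<open>Normalised so that h = t (1 - T) with a contraction \<open>T\<close>.\<close>
    define T where "T = 1 - inverse t *\<^sub>R h"
    have "inverse t *\<^sub>R (of_real t - h) = T"
      using t0 by (simp add: T_def scaleR_diff_right of_real_def)
    then have "norm T = inverse t * norm (of_real t - h)"
      using t0 norm_scaleR[of "inverse t" "of_real t - h"] by simp
    also have "\<dots> \<le> inverse t * t" using t t0 by (intro mult_left_mono) auto
    finally have "norm T \<le> 1" using t0 by simp
    moreover have "adj T = T" by (simp add: T_def adj_diff adj_scaleR h)
    ultimately obtain c where c: "adj c = c" "c * c = 1 - T" "norm (1 - c) \<le> 1"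
      and comm: "\<And>z. z * T = T * z \<Longrightarrow> z * c = c * z"
      using sqrt_one_minus by blast
    show ?thesis
    proof (rule that)
      let ?y = "sqrt t *\<^sub>R c"
      show "adj ?y = ?y" by (simp add: adj_scaleR c)
      show "?y * ?y = h" using t0 by (simp add: c T_def flip: mult.assoc)
      show "pos_elem ?y"
        using t0 c by (intro pos_elem_scaleR) (auto simp: pos_elem_def intro!: exI[of _ 1])
      show "z * ?y = ?y * z" if "z * h = h * z" for z
      proof -
        have "z * T = T * z" by (simp add: T_def algebra_simps that)
        then show ?thesis by (simp add: comm)
      qed
    qed
  qed
qed

text \<open>Since c and y commute, c + i y is r times an isometry, and c is the mean of it and its
  adjoint. This replaces spectral estimates for self-adjoint elements.\<close>

lemma norm_Re_unitary:
  fixes c y :: "'a::cstar_algebra"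
  assumes "adj c = c" "adj y = y" "c * y = y * c" "c * c + y * y = of_real (r\<^sup>2)" "0 \<le> r"
  shows "norm c \<le> r"
proof -
  let ?u = "c + \<i> *\<^sub>C y"
  have u: "adj ?u = c - \<i> *\<^sub>C y" by (simp add: adj_add adj_scaleC assms)
  have "adj ?u * ?u = c * c + y * y + \<i> *\<^sub>C (c * y - y * c)"
    unfolding u by (simp add: algebra_simps scaleC_mult_left scaleC_mult_right scaleC_scaleC
        complex_vector.scale_right_diff_distrib)
  then have "(norm ?u)\<^sup>2 = r\<^sup>2"
    using cstar_identity[of ?u] assms by (simp del: of_real_power)
  then have n: "norm ?u = r" using assms by (simp add: power2_eq_iff_nonneg)
  have "2 *\<^sub>R c = ?u + adj ?u" unfolding u by (simp add: scaleR_2)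
  then have "2 * norm c \<le> norm ?u + norm (adj ?u)"
    using norm_triangle_ineq[of ?u "adj ?u"] by (metis norm_scaleR abs_numeral)
  then show ?thesis using n by simp
qed

text \<open>With r = norm y, the element y^2 / r^2 is a self-adjoint contraction, so c = sqrt(r^2 -
  y^2) exists before anything is known about the sign of y^2. By \<open>norm_Re_unitary\<close> it
  has norm at most r; hence r^2 - y^2 = c^2 has norm at most r^2, which is \<open>pos_elem\<close>
  with witness r^2.\<close>

lemma pos_elem_square: "pos_elem (y * y)" if y: "adj y = (y :: 'a::cstar_algebra)"
proof (cases "y = 0")
  case True then show ?thesis using pos_elem_of_real[of 0] by simp
next
  case False
  define r where "r = norm y"
  have r: "0 < r" using False by (simp add: r_def)
  define T where "T = inverse (r\<^sup>2) *\<^sub>R (y * y)"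
  have T: "norm T \<le> 1" "adj T = T"
    using r by (simp_all add: T_def adj_scaleR adj_mult y norm_selfadj_square[OF y] r_def)
  obtain c where c: "adj c = c" "c * c = 1 - T" and comm: "\<And>z. z * T = T * z \<Longrightarrow> z * c = c * z"
    using sqrt_one_minus[OF T] by blast
  let ?c = "r *\<^sub>R c"
  have sq: "?c * ?c = of_real (r\<^sup>2) - y * y"
    using r by (simp add: c T_def scaleR_diff_right power2_eq_square of_real_def field_simps)
  have "y * c = c * y" by (rule comm) (simp add: T_def mult.assoc)
  then have "norm ?c \<le> r"
    using r sq by (intro norm_Re_unitary[of _ y]) (auto simp: adj_scaleR c y)
  then have "(norm ?c)\<^sup>2 \<le> r\<^sup>2" by (rule power_mono) simp
  moreover have "norm (of_real (r\<^sup>2) - y * y) = (norm ?c)\<^sup>2"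
    unfolding sq[symmetric] by (rule norm_selfadj_square) (simp add: adj_scaleR c)
  ultimately show ?thesis by (auto simp: pos_elem_def adj_mult y intro!: exI[of _ "r\<^sup>2"] simp del: of_real_power)
qed

lemma pos_elem_mult:
  assumes "pos_elem h" "pos_elem k" "h * k = k * h"
  shows "pos_elem (h * k)"
proof -
  obtain y where y: "adj y = y" "y * y = h" "\<And>z. z * h = h * z \<Longrightarrow> z * y = y * z"
    using pos_elem_sqrt[OF assms(1)] by blast
  obtain z where z: "adj z = z" "z * z = k" "\<And>x. x * k = k * x \<Longrightarrow> x * z = z * x"
    using pos_elem_sqrt[OF assms(2)] by blast
  have "k * y = y * k" by (rule y) (simp add: assms)
  then have yz: "y * z = z * y" by (intro z) simp
  have "h * k = (y * z) * (y * z)"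
    unfolding y(2)[symmetric] z(2)[symmetric] by (metis mult.assoc yz)
  then show ?thesis using pos_elem_square[of "y * z"] by (simp add: adj_mult y(1) z(1) yz)
qed

text \<open>(r - h)(r + h) = r^2 - h^2 is positive, being a product of commuting positive elements.
  With its root c, the element h + i c is r times an isometry with real part h.\<close>

lemma norm_le_of_real:
  assumes "pos_elem h" "pos_elem (of_real r - h)" "0 \<le> r"
  shows "norm h \<le> r"
proof -
  have "pos_elem ((of_real r - h) * (of_real r + h))"
    by (intro pos_elem_mult assms pos_elem_add pos_elem_of_real)
      (simp_all add: algebra_simps of_real_def)
  then obtain c where c: "adj c = c" "c * c = (of_real r - h) * (of_real r + h)"
    "\<And>z. z * ((of_real r - h) * (of_real r + h)) = (of_real r - h) * (of_real r + h) * z \<Longrightarrow> z * c = c * z"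
    using pos_elem_sqrt by blast
  have hr: "h * of_real r = of_real r * h" by (simp add: of_real_def)
  have sq: "(of_real r - h) * (of_real r + h) = of_real (r\<^sup>2) - h * h"
    by (simp add: algebra_simps hr power2_eq_square)
  have "h * of_real (r\<^sup>2) = of_real (r\<^sup>2) * h" by (simp add: of_real_def)
  then have "h * c = c * h"
    by (intro c(3)) (simp only: sq, simp add: algebra_simps)
  then show ?thesis
    using assms c(1,2) sq by (intro norm_Re_unitary[of _ c]) (auto simp: pos_elem_adj)
qed

lemma pos_elem_antisym: "pos_elem h \<Longrightarrow> pos_elem (- h) \<Longrightarrow> h = 0"
  using norm_le_of_real[of h 0] by simp

text \<open>
  Kaplansky's theorem without spectral theory: with \<open>h = y\<^sup>* y\<close> and \<open>k = \<bar>h\<bar> - h\<close>, the element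
  \<open>z = y k\<close> has \<open>z\<^sup>* z = - m\<^sup>2\<close> for a self-adjoint \<open>m\<close>; passing to \<open>g = z m\<close> makes both \<open>g\<^sup>* g\<close>
  and \<open>g g\<^sup>*\<close> negative, whereas their sum is a sum of two squares of self-adjoint elements.
\<close>

lemma pos_elem_adj_mult_self_sum:
  "pos_elem (adj g * g + g * adj (g :: 'a::cstar_algebra))"
proof -
  let ?a = "g + adj g" and ?b = "\<i> *\<^sub>C (g - adj g)"
  have "pos_elem (?a * ?a)" "pos_elem (?b * ?b)"
    by (intro pos_elem_square; simp add: adj_add adj_scaleC adj_diff adj_adj
        complex_vector.scale_right_diff_distrib)+
  then have "pos_elem ((1 / 2) *\<^sub>R (?a * ?a + ?b * ?b))"
    by (intro pos_elem_scaleR pos_elem_add) simp_all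
  moreover have "?a * ?a + ?b * ?b = 2 *\<^sub>R (adj g * g + g * adj g)"
    by (simp add: scaleC_mult_left scaleC_mult_right scaleC_scaleC scaleR_2 algebra_simps)
  ultimately show ?thesis by simp
qed

lemma neg_adj_mult_self:
  assumes m: "adj m = m" and z: "adj z * z = - (m * m)"
  shows "z = (0 :: 'a::cstar_algebra)"
proof -
  let ?k = "m * m" and ?q = "z * adj z" and ?g = "z * m"
  have "adj ?g * ?g = m * (adj z * z) * m" by (simp add: adj_mult m mult.assoc)
  then have g1: "adj ?g * ?g = - (?k * ?k)" by (simp add: z mult.assoc)
  have "?q * ?q = z * (adj z * z) * adj z" by (simp add: mult.assoc)
  then have g2: "?g * adj ?g = - (?q * ?q)" by (simp add: z adj_mult m mult.assoc)
  have k: "pos_elem (?k * ?k)" and q: "pos_elem (?q * ?q)"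
    by (intro pos_elem_square; simp add: adj_mult m adj_adj)+
  have "pos_elem (- (?k * ?k + ?q * ?q))"
    using pos_elem_adj_mult_self_sum[of ?g] by (simp only: g1 g2) simp
  then have "?k * ?k + ?q * ?q = 0" using k q by (intro pos_elem_antisym pos_elem_add)
  then have "- (?k * ?k) = ?q * ?q" by (simp add: minus_unique)
  with q k have "?k * ?k = 0" by (intro pos_elem_antisym) simp_all
  then have "?k = 0" using norm_selfadj_square[of ?k] by (simp add: adj_mult m)
  then have "adj z * z = 0" using z by simp
  then show ?thesis using cstar_identity[of z] by simp
qed

theorem pos_elem_adj_mult_self: "pos_elem (adj y * (y :: 'a::cstar_algebra))"
proof -
  let ?h = "adj y * y"
  have h: "adj ?h = ?h" by (simp add: adj_mult adj_adj)
  obtain a where a: "adj a = a" "a * a = ?h * ?h" "pos_elem a"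
    and comm: "\<And>z. z * (?h * ?h) = ?h * ?h * z \<Longrightarrow> z * a = a * z"
    using pos_elem_sqrt[OF pos_elem_square[OF h]] by blast
  obtain b where b: "adj b = b" "b * b = a" and commb: "\<And>z. z * a = a * z \<Longrightarrow> z * b = b * z"
    using pos_elem_sqrt[OF a(3)] by blast
  have ha: "?h * a = a * ?h" by (rule comm) (simp add: mult.assoc)
  have hb: "?h * b = b * ?h" by (rule commb) (rule ha)
  \<comment> \<open>\<open>a\<close> is the absolute value of h and \<open>?k\<close> twice its
    negative part, so h acts on \<open>?k\<close> as -a. Hence z = y k satisfies
    \<open>adj z * z = - (m * m)\<close> with m = b k and b the root of a. Once z = 0 is known, h k
    = 0 forces k = 0, so that h = a.\<close>
  let ?k = "a - ?h" and ?m = "b * (a - ?h)"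
  have ab: "a * b = b * a" by (rule commb) simp
  have kb: "?k * b = b * ?k" using ab hb by (simp add: algebra_simps)
  have hk: "?h * ?k = - (a * ?k)" using ha a(2) by (simp add: algebra_simps)
  have k: "adj ?k = ?k" by (simp add: adj_diff a h)
  let ?z = "y * ?k"
  have "adj ?z * ?z = ?k * (?h * ?k)"
    unfolding adj_mult[of y ?k] k by (simp only: mult.assoc)
  also have "\<dots> = - (?k * a * ?k)" unfolding hk by (simp add: mult.assoc)
  also have "?k * a * ?k = (?k * b) * (b * ?k)" by (simp only: b(2) mult.assoc flip: mult.assoc[of b b])
  also have "\<dots> = ?m * ?m" by (simp only: kb)
  finally have "?z = 0"
    by (intro neg_adj_mult_self[of ?m]) (simp_all only: adj_mult k b kb)
  then have "?h * ?k = 0" by (simp add: mult.assoc)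
  moreover have "?k * ?k = a * a - ?h * ?h - 2 *\<^sub>R (?h * ?k)"
    using ha a(2) by (simp add: algebra_simps scaleR_2)
  ultimately have "?k * ?k = 0" using a(2) by simp
  then have "?k = 0" using norm_selfadj_square[OF k] by simp
  then show ?thesis using a(3) by simp
qed

lemma pos_elem_iff: "pos_elem h \<longleftrightarrow> (\<exists>y. h = adj y * y)"
  using pos_elem_adj_mult_self by (metis pos_elem_sqrt)

section \<open>Separation of a point from a convex cone\<close>

text \<open>The scalar multiplication is an argument because the cones lie in complex spaces with
  scalars restricted to the reals, and in function spaces with pointwise operations.\<close>

definition vcone :: "(real \<Rightarrow> 'v::ab_group_add \<Rightarrow> 'v) \<Rightarrow> 'v set \<Rightarrow> bool" where
  "vcone smul C \<longleftrightarrow> 0 \<in> C \<and> (\<forall>x\<in>C. \<forall>y\<in>C. x + y \<in> C) \<and> (\<forall>r\<ge>0. \<forall>x\<in>C. smul r x \<in> C)"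

lemma vconeD:
  assumes "vcone smul C"
  shows "0 \<in> C" "\<And>x y. x \<in> C \<Longrightarrow> y \<in> C \<Longrightarrow> x + y \<in> C"
    "\<And>r x. 0 \<le> r \<Longrightarrow> x \<in> C \<Longrightarrow> smul r x \<in> C"
  using assms by (auto simp: vcone_def)

text \<open>Zorn's lemma: any two elements of the union of a chain of cones lie in one of its
  members.\<close>

lemma vcone_maximal:
  assumes C: "vcone smul C" and e: "e \<notin> C"
  obtains M where "vcone smul M" "C \<subseteq> M" "e \<notin> M"
    "\<And>N. vcone smul N \<Longrightarrow> M \<subseteq> N \<Longrightarrow> e \<notin> N \<Longrightarrow> N = M"
proof -
  let ?A = "{M. vcone smul M \<and> C \<subseteq> M \<and> e \<notin> M}"
  have "\<exists>M\<in>?A. \<forall>X\<in>?A. M \<subseteq> X \<longrightarrow> X = M"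
  proof (rule subset_Zorn_nonempty)
    show "?A \<noteq> {}" using C e by blast
    fix K assume K: "K \<noteq> {}" "subset.chain ?A K"
    then have sub: "\<And>M. M \<in> K \<Longrightarrow> M \<in> ?A" and lin: "\<And>M N. M \<in> K \<Longrightarrow> N \<in> K \<Longrightarrow> M \<subseteq> N \<or> N \<subseteq> M"
      by (auto simp: subset.chain_def)
    have "x + y \<in> \<Union>K" if xy: "x \<in> \<Union>K" "y \<in> \<Union>K" for x y
    proof -
      obtain M N where MN: "M \<in> K" "N \<in> K" "x \<in> M" "y \<in> N" using xy by blast
      with lin obtain L where L: "L \<in> K" "x \<in> L" "y \<in> L" by blast
      then have "x + y \<in> L" using sub vconeD(2)[of smul L] by blast
      with L show ?thesis by blast
    qed
    moreover have "smul r x \<in> \<Union>K" if "x \<in> \<Union>K" "0 \<le> r" for x r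
      using that sub vconeD(3)[of smul] by blast
    moreover obtain L where L: "L \<in> K" using K(1) by blast
    moreover have "0 \<in> \<Union>K"
      using sub[OF L] L vconeD(1)[of smul L] by blast
    moreover have "C \<subseteq> \<Union>K" "e \<notin> \<Union>K"
      using sub L by blast+
    ultimately show "\<Union>K \<in> ?A" unfolding vcone_def by blast
  qed
  then obtain M where M: "M \<in> ?A" and max: "\<forall>X\<in>?A. M \<subseteq> X \<longrightarrow> X = M" by (rule bexE)
  show ?thesis
  proof (rule that)
    show "N = M" if "vcone smul N" "M \<subseteq> N" "e \<notin> N" for N
      using that M by (intro max[rule_format]) auto
  qed (use M in auto)
qed

text \<open>
  A cone that is maximal among those not containing \<open>- e\<close> is a half-space; the functional is the
  height above its boundary in the direction of the order unit \<open>e\<close>.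
\<close>

theorem cone_functional:
  fixes scale :: "real \<Rightarrow> 'v::ab_group_add \<Rightarrow> 'v"
  assumes "vector_space scale" and C: "vcone scale C" and "- e \<notin> C"
    and unit: "\<And>v. \<exists>t. scale t e + v \<in> C"
  obtains f where "\<And>x y. f (x + y) = f x + f y" "\<And>r x. f (scale r x) = r * f x" "f e = 1"
    "\<And>x. x \<in> C \<Longrightarrow> 0 \<le> f x"
proof -
  interpret vector_space scale by fact
  obtain M where M: "vcone scale M" and CM: "C \<subseteq> M" and eM: "- e \<notin> M"
    and max: "\<And>N. vcone scale N \<Longrightarrow> M \<subseteq> N \<Longrightarrow> - e \<notin> N \<Longrightarrow> N = M"
    using vcone_maximal[OF C \<open>- e \<notin> C\<close>] by blast
  note M0 = vconeD(1)[OF M] and Madd = vconeD(2)[OF M] and Mscale = vconeD(3)[OF M]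
  have neg: "t \<le> 0" if "- scale t e \<in> M" for t
  proof (rule ccontr)
    assume "\<not> t \<le> 0"
    then have "scale (inverse t) (- scale t e) \<in> M" by (intro Mscale that) simp
    with \<open>\<not> t \<le> 0\<close> eM show False by simp
  qed
  \<comment> \<open>By maximality the cone generated by \<open>M\<close> and v contains -e. The
    coefficient of v is nonzero there since -e is not in \<open>M\<close>.\<close>
  have ext: "\<exists>m\<in>M. \<exists>r>0. - e = m + scale r v" if v: "v \<notin> M" for v
  proof -
    let ?N = "{m + scale r v | m r. m \<in> M \<and> 0 \<le> r}"
    have "vcone scale ?N" unfolding vcone_def
    proof (intro conjI ballI allI impI)
      show "0 \<in> ?N" using M0 scale_zero_left[of v] by force
      fix x assume "x \<in> ?N"
      then obtain m r where x: "x = m + scale r v" "m \<in> M" "0 \<le> r" by blast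
      { fix y assume "y \<in> ?N"
        then obtain n q where y: "y = n + scale q v" "n \<in> M" "0 \<le> q" by blast
        have "x + y = (m + n) + scale (r + q) v" by (simp add: x y scale_left_distrib)
        with x y Madd show "x + y \<in> ?N" by (metis (mono_tags, lifting) add_nonneg_nonneg mem_Collect_eq) }
      fix q :: real assume "0 \<le> q"
      moreover have "scale q x = scale q m + scale (q * r) v" by (simp add: x scale_right_distrib)
      ultimately show "scale q x \<in> ?N" using x Mscale
        by (metis (mono_tags, lifting) mem_Collect_eq mult_nonneg_nonneg)
    qed
    moreover have "M \<subseteq> ?N" using scale_zero_left[of v] by force
    moreover have "v \<in> ?N"
    proof -
      have "v = 0 + scale 1 v" by simp
      then show ?thesis using M0 zero_le_one by blast
    qed
    ultimately have "- e \<in> ?N" using max v by blast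
    then obtain m r where m: "- e = m + scale r v" "m \<in> M" "0 \<le> r" by blast
    have "r \<noteq> 0"
    proof
      assume "r = 0"
      with m eM show False by simp
    qed
    with m show ?thesis by (intro bexI[of _ m] exI[of _ r]) simp_all
  qed
  \<comment> \<open>If v and -v were both outside, a weighted sum of the two representations of -e
    would cancel v and put a negative multiple of e into \<open>M\<close>.\<close>
  have total: "v \<in> M \<or> - v \<in> M" for v
  proof (rule ccontr)
    assume "\<not> ?thesis"
    then obtain m r m' r' where m: "m \<in> M" "0 < r" "- e = m + scale r v"
        "m' \<in> M" "0 < r'" "- e = m' + scale r' (- v)"
      using ext[of v] ext[of "- v"] by auto
    have mm: "m = - e - scale r v" "m' = - e + scale r' v"
      using m(3,6) by (simp_all add: algebra_simps)
    have "scale r' m + scale r m' = - scale (r' + r) e"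
      unfolding mm by (simp add: scale_right_distrib scale_right_diff_distrib scale_left_distrib mult.commute)
    moreover have "scale r' m + scale r m' \<in> M" using m by (intro Madd Mscale) simp_all
    ultimately show False using neg[of "r' + r"] m by simp
  qed
  \<comment> \<open>\<sigma> is the height at which the line v - t e leaves \<open>M\<close>. The
    inequalities are strict because nothing is claimed at the boundary point itself.\<close>
  define L where "L v \<sigma> \<longleftrightarrow> (\<forall>t<\<sigma>. v - scale t e \<in> M) \<and> (\<forall>t>\<sigma>. scale t e - v \<in> M)" for v \<sigma>
  have uniq: "\<sigma> \<le> \<tau>" if "L v \<sigma>" "L v \<tau>" for v \<sigma> \<tau>
  proof (rule ccontr)
    assume "\<not> \<sigma> \<le> \<tau>"
    then obtain a b where ab: "\<tau> < a" "a < b" "b < \<sigma>" by (meson dense not_le)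
    with that have "(scale a e - v) + (v - scale b e) \<in> M" by (intro Madd[of "(scale a e - v)"]) (auto simp: L_def)
    moreover have "(scale a e - v) + (v - scale b e) = - scale (b - a) e"
      by (simp add: scale_left_diff_distrib)
    ultimately show False using neg[of "b - a"] ab by simp
  qed
  have ex: "\<exists>\<sigma>. L v \<sigma>" for v
  proof -
    let ?T = "{t. v - scale t e \<in> M}"
    obtain t where "scale t e + v \<in> M" using unit CM by blast
    then have ne: "- t \<in> ?T" by (simp add: add.commute)
    obtain t' where t': "scale t' e + - v \<in> M" using unit CM by blast
    have up: "s \<le> t'" if "s \<in> ?T" for s
    proof -
      have "(scale t' e + - v) + (v - scale s e) \<in> M" using that t' by (intro Madd[of "(scale t' e + - v)"]) simp_all
      then have "- scale (s - t') e \<in> M" by (simp add: scale_left_diff_distrib)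
      then show ?thesis using neg by fastforce
    qed
    have bdd: "bdd_above ?T" using up by (auto simp: bdd_above_def)
    have e: "e \<in> M" using total[of e] eM by simp
    have "L v (Sup ?T)" unfolding L_def
    proof (intro conjI allI impI)
      fix s assume "s < Sup ?T"
      then obtain u where u: "u \<in> ?T" "s < u" using ne less_cSupD[of ?T s] by blast
      have "(v - scale u e) + scale (u - s) e \<in> M" using u e by (intro Madd Mscale) simp_all
      then show "v - scale s e \<in> M" by (simp add: scale_left_diff_distrib)
    next
      fix s assume "Sup ?T < s"
      then have "s \<notin> ?T" using cSup_upper[OF _ bdd] by (meson not_le)
      then show "scale s e - v \<in> M" using total[of "v - scale s e"] by simp
    qed
    then show ?thesis by blast
  qed
  define f where "f v = (SOME \<sigma>. L v \<sigma>)" for v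
  have fL: "L v (f v)" for v unfolding f_def using ex by (rule someI_ex)
  have fI: "f v = \<sigma>" if "L v \<sigma>" for v \<sigma> using uniq fL that by (meson antisym)
  have add: "f (x + y) = f x + f y" for x y
  proof (rule fI, unfold L_def, intro conjI allI impI)
    fix t assume "t < f x + f y"
    \<comment> \<open>The slack f x + f y - t is shared equally between x and y.\<close>
    then have "t / 2 + (f x - f y) / 2 < f x" "t / 2 + (f y - f x) / 2 < f y" by (simp_all add: field_simps)
    then have "(x - scale (t / 2 + (f x - f y) / 2) e) + (y - scale (t / 2 + (f y - f x) / 2) e) \<in> M"
      using fL[of x] fL[of y] by (intro Madd[of "(x - scale (t / 2 + (f x - f y) / 2) e)"]) (simp_all add: L_def)
    moreover have "(x - scale a e) + (y - scale b e) = x + y - scale (a + b) e" for a b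
      by (simp add: scale_left_distrib)
    moreover have "t / 2 + (f x - f y) / 2 + (t / 2 + (f y - f x) / 2) = t" by (simp add: field_simps)
    ultimately show "x + y - scale t e \<in> M" by metis
  next
    fix t assume "f x + f y < t"
    then have "f x < t / 2 + (f x - f y) / 2" "f y < t / 2 + (f y - f x) / 2" by (simp_all add: field_simps)
    then have "(scale (t / 2 + (f x - f y) / 2) e - x) + (scale (t / 2 + (f y - f x) / 2) e - y) \<in> M"
      using fL[of x] fL[of y] by (intro Madd[of "(scale (t / 2 + (f x - f y) / 2) e - x)"]) (simp_all add: L_def)
    moreover have "(scale a e - x) + (scale b e - y) = scale (a + b) e - (x + y)" for a b
      by (simp add: scale_left_distrib)
    moreover have "t / 2 + (f x - f y) / 2 + (t / 2 + (f y - f x) / 2) = t" by (simp add: field_simps)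
    ultimately show "scale t e - (x + y) \<in> M" by metis
  qed
  have pos: "0 \<le> f x" if x: "x \<in> M" for x
  proof (rule ccontr)
    assume neg0: "\<not> 0 \<le> f x"
    then have "scale (f x / 2) e - x \<in> M" using fL[of x] by (simp add: L_def)
    with x have "(scale (f x / 2) e - x) + x \<in> M" by (rule Madd[rotated])
    then show False using neg[of "- (f x / 2)"] neg0 by simp
  qed
  have fe: "f e = 1"
  proof (rule fI, unfold L_def, intro conjI allI impI)
    have e: "e \<in> M" using total[of e] eM by simp
    fix t :: real
    { assume "t < 1"
      then have "scale (1 - t) e \<in> M" using e by (intro Mscale) simp_all
      then show "e - scale t e \<in> M" by (simp add: scale_left_diff_distrib) }
    assume "1 < t"
    then have "scale (t - 1) e \<in> M" using e by (intro Mscale) simp_all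
    then show "scale t e - e \<in> M" by (simp add: scale_left_diff_distrib)
  qed
  have f0: "f 0 = 0" using add[of 0 0] by simp
  have minus: "f (- x) = - f x" for x using add[of x "- x"] f0 by simp
  have scale_pos: "f (scale r x) = r * f x" if r: "0 < r" for r x
  proof (rule fI, unfold L_def, intro conjI allI impI)
    fix t assume "t < r * f x"
    then have "t / r < f x" using r by (simp add: field_simps)
    then have "scale r (x - scale (t / r) e) \<in> M" using fL[of x] r by (intro Mscale) (simp_all add: L_def)
    then show "scale r x - scale t e \<in> M" using r by (simp add: scale_right_diff_distrib)
  next
    fix t assume "r * f x < t"
    then have "f x < t / r" using r by (simp add: field_simps)
    then have "scale r (scale (t / r) e - x) \<in> M" using fL[of x] r by (intro Mscale) (simp_all add: L_def)
    then show "scale t e - scale r x \<in> M" using r by (simp add: scale_right_diff_distrib)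
  qed
  have "f (scale r x) = r * f x" for r x
  proof (cases r "0 :: real" rule: linorder_cases)
    case less
    then show ?thesis using scale_pos[of "- r" x] minus[of "scale r x"] by simp
  qed (simp_all add: f0 scale_pos)
  then show ?thesis using add fe pos CM that by blast
qed

theorem star_cone_functional:
  fixes scale :: "complex \<Rightarrow> 'v::ab_group_add \<Rightarrow> 'v" and star :: "'v \<Rightarrow> 'v"
  assumes "vector_space scale"
    and star_add: "\<And>x y. star (x + y) = star x + star y"
    and star_scale: "\<And>c x. star (scale c x) = scale (cnj c) (star x)"
    and star_star: "\<And>x. star (star x) = x"
    and C: "vcone (\<lambda>r. scale (of_real r)) C" and herm: "\<And>x. x \<in> C \<Longrightarrow> star x = x"
    and e: "- e \<notin> C" "star e = e"
    and unit: "\<And>h. star h = h \<Longrightarrow> \<exists>t. scale (of_real t) e + h \<in> C"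
  obtains F where "\<And>x y. F (x + y) = F x + F y" "\<And>c x. F (scale c x) = c * F x" "F e = 1"
    "\<And>x. F (star x) = cnj (F x)" "\<And>x. x \<in> C \<Longrightarrow> F x \<in> \<real>\<^sub>\<ge>\<^sub>0"
proof -
  interpret vector_space scale by fact
  note C0 = vconeD(1)[OF C] and Cadd = vconeD(2)[OF C] and Cscale = vconeD(3)[OF C]
  have star0: "star 0 = 0" using star_add[of 0 0] by simp
  have star_minus: "star (- x) = - star x" for x using star_add[of x "- x"] star0
    by (simp add: add_eq_0_iff)
  \<comment> \<open>\<open>C\<close> has self-adjoint members only, so it has no order unit for the
    whole space. \<open>?D\<close> has one and contains every skew element together with its
    negative. A functional positive on \<open>?D\<close> thus vanishes on skew elements, which makes
    its complexification hermitian, and real on \<open>C\<close>.\<close>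
  let ?D = "{x. x + star x \<in> C}"
  have half: "scale (of_real (1 / 2)) (x + x) = x" for x
    by (simp add: scale_right_distrib flip: scale_left_distrib)
  have dbl: "x \<in> C" if "x + x \<in> C" for x
    using Cscale[of "1/2" "x + x"] that half[of x] by (simp del: of_real_divide)
  have D: "vcone (\<lambda>r. scale (of_real r)) ?D" unfolding vcone_def
  proof (intro conjI ballI allI impI)
    show "0 \<in> ?D" by (simp add: star0 C0)
    fix x assume x: "x \<in> ?D"
    { fix y assume "y \<in> ?D"
      then have "(x + star x) + (y + star y) \<in> C" using x by (intro Cadd[of "x + star x"]) simp_all
      then show "x + y \<in> ?D" by (simp add: star_add algebra_simps) }
    fix r :: real assume "0 \<le> r"
    then have "scale (of_real r) (x + star x) \<in> C" using x by (intro Cscale) simp_all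
    then show "scale (of_real r) x \<in> ?D" by (simp add: star_scale scale_right_distrib)
  qed
  obtain f where f: "\<And>x y. f (x + y) = f x + f y" "\<And>r x. f (scale (of_real r) x) = r * f x" "f e = 1"
    "\<And>x. x \<in> ?D \<Longrightarrow> 0 \<le> f x"
  proof (rule cone_functional[OF _ D, of e])
    show "vector_space (\<lambda>r. scale (complex_of_real r))"
      by unfold_locales (simp_all add: scale_right_distrib scale_left_distrib)
    show "- e \<notin> ?D" using e dbl[of "- e"] by (auto simp: star_minus)
    fix v
    obtain t where t: "scale (of_real t) e + (v + star v) \<in> C"
      using unit[of "v + star v"] by (auto simp: star_add star_star add.commute)
    have "scale (of_real t) e = scale (of_real (t / 2)) e + scale (of_real (t / 2)) e"
      by (simp flip: scale_left_distrib)
    with t have "scale (of_real (t / 2)) e + v \<in> ?D"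
      by (simp add: star_add star_scale e algebra_simps)
    then show "\<exists>t. scale (of_real t) e + v \<in> ?D" by blast
  qed blast
  have f0: "f 0 = 0" using f(1)[of 0 0] by simp
  have fm: "f (- x) = - f x" for x using f(1)[of x "- x"] f0 by simp
  have skew: "f z = 0" if "star z = - z" for z
    using f(4)[of z] f(4)[of "- z"] that by (simp add: C0 star_minus fm)
  \<comment> \<open>The complex linear functional with real part f.\<close>
  define F where "F x = Complex (f x) (- f (scale \<i> x))" for x
  have Fi: "F (scale \<i> x) = \<i> * F x" for x
    by (simp add: F_def complex_eq_iff fm)
  have Fadd: "F (x + y) = F x + F y" for x y
    by (simp add: F_def complex_eq_iff f scale_right_distrib)
  have Fr: "F (scale (of_real r) x) = of_real r * F x" for r x
    using f(2)[of r "scale \<i> x"] by (simp add: F_def complex_eq_iff f(2) mult.commute)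
  have "F (scale c x) = c * F x" for c x
  proof -
    have "scale c x = scale (of_real (Re c)) x + scale \<i> (scale (of_real (Im c)) x)"
      by (simp flip: scale_left_distrib complex_eq)
    then have "F (scale c x) = of_real (Re c) * F x + \<i> * (of_real (Im c) * F x)"
      by (simp only: Fadd Fi Fr)
    also have "\<dots> = (of_real (Re c) + \<i> * of_real (Im c)) * F x" by (simp only: distrib_right mult.assoc)
    finally show ?thesis by (simp only: complex_eq[symmetric])
  qed
  moreover have "F e = 1"
    using skew[of "scale \<i> e"] by (simp add: F_def f star_scale e complex_eq_iff)
  moreover have "F (star x) = cnj (F x)" for x
  proof -
    have *: "f (star y) = f y" for y
      using skew[of "star y + - y"] by (simp only: star_add star_star star_minus f fm) simp
    have "scale \<i> (star x) = - star (scale \<i> x)" by (simp add: star_scale)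
    then show ?thesis by (simp add: F_def complex_eq_iff * fm)
  qed
  moreover have "F x \<in> \<real>\<^sub>\<ge>\<^sub>0" if x: "x \<in> C" for x
  proof -
    have "f (scale \<i> x) = 0" using herm[OF x] by (intro skew) (simp add: star_scale)
    moreover have "0 \<le> f x" using x herm[OF x] Cadd by (intro f(4)) simp
    ultimately show ?thesis by (simp add: F_def complex_nonneg_Reals_iff)
  qed
  ultimately show ?thesis using Fadd that by blast
qed

section \<open>Semi-inner products\<close>

locale semi_inner = vector_space scale
  for scale :: "complex \<Rightarrow> 'v::ab_group_add \<Rightarrow> 'v" +
  fixes ip :: "'v \<Rightarrow> 'v \<Rightarrow> complex"
  assumes ip_add_left: "ip (x + y) z = ip x z + ip y z"
    and ip_scale_left: "ip (scale c x) z = c * ip x z"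
    and ip_cnj: "cnj (ip x y) = ip y x"
    and ip_nonneg: "0 \<le> Re (ip x x)"
begin

lemma ip_add_right: "ip z (x + y) = ip z x + ip z y"
  by (metis complex_cnj_add ip_add_left ip_cnj)

lemma ip_scale_right: "ip z (scale c x) = cnj c * ip z x"
  by (metis complex_cnj_mult ip_scale_left ip_cnj)

lemma ip_zero_left [simp]: "ip 0 z = 0"
  using ip_add_left[of 0 0 z] by simp

lemma ip_minus_left: "ip (- x) z = - ip x z"
  using ip_add_left[of x "- x" z] by (simp add: add_eq_0_iff)

lemma ip_diff_left: "ip (x - y) z = ip x z - ip y z"
  using ip_add_left[of x "- y" z] by (simp add: ip_minus_left)

lemma ip_zero_right [simp]: "ip z 0 = 0"
  using ip_add_right[of z 0 0] by simp

lemma ip_minus_right: "ip z (- x) = - ip z x"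
  using ip_add_right[of z x "- x"] by (simp add: add_eq_0_iff)

lemma ip_diff_right: "ip z (x - y) = ip z x - ip z y"
  using ip_add_right[of z x "- y"] by (simp add: ip_minus_right)

lemma ip_sum_left: "ip (\<Sum>i\<in>A. f i) z = (\<Sum>i\<in>A. ip (f i) z)"
  by (induction A rule: infinite_finite_induct) (simp_all add: ip_add_left)

lemma ip_sum_right: "ip z (\<Sum>i\<in>A. f i) = (\<Sum>i\<in>A. ip z (f i))"
  by (induction A rule: infinite_finite_induct) (simp_all add: ip_add_right)

lemma Im_ip_self [simp]: "Im (ip x x) = 0"
  using ip_cnj[of x x] by (metis complex_cnj_cancel_iff Reals_cnj_iff complex_is_Real_iff)

lemma ip_self: "ip x x = of_real (Re (ip x x))"
  by (simp add: complex_eq_iff)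

definition nrm :: "'v \<Rightarrow> real" where
  "nrm x = sqrt (Re (ip x x))"

lemma nrm_nonneg [simp]: "0 \<le> nrm x"
  by (simp add: nrm_def ip_nonneg)

lemma nrm_square: "(nrm x)\<^sup>2 = Re (ip x x)"
  by (simp add: nrm_def ip_nonneg)

lemma ip_nrm: "ip x x = of_real ((nrm x)\<^sup>2)"
  unfolding nrm_square by (rule ip_self)

lemma Cauchy_Schwarz: "cmod (ip x y) \<le> nrm x * nrm y"
proof -
  let ?a = "Re (ip x x)" and ?b = "Re (ip y y)" and ?c = "cmod (ip x y)"
  \<comment> \<open>The square of the norm of x - t (ip x y) y, a quadratic in the real number t.
    For b > 0 its minimiser 1/b is inserted; for b = 0 it is linear in t, and t = (a + 1) / c^2
    makes it negative if c is nonzero.\<close>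
  have q: "0 \<le> ?a - 2 * t * ?c\<^sup>2 + t\<^sup>2 * ?c\<^sup>2 * ?b" for t :: real
  proof -
    let ?s = "of_real t * ip x y"
    let ?w = "x - scale ?s y"
    have "ip ?w ?w = ip x x - cnj ?s * ip x y - ?s * ip y x + ?s * cnj ?s * ip y y"
      by (simp add: ip_diff_left ip_diff_right ip_scale_left ip_scale_right algebra_simps)
    moreover have "ip x y * cnj (ip x y) = of_real (?c\<^sup>2)" by (simp add: complex_norm_square[symmetric])
    ultimately have "ip ?w ?w = ip x x - of_real (2 * t * ?c\<^sup>2) + of_real (t\<^sup>2 * ?c\<^sup>2) * ip y y"
      unfolding ip_cnj[of x y, symmetric] by (simp add: algebra_simps power2_eq_square)
    then have "Re (ip ?w ?w) = ?a - 2 * t * ?c\<^sup>2 + t\<^sup>2 * ?c\<^sup>2 * ?b"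
      by (simp only: minus_complex.sel plus_complex.sel Re_complex_of_real times_complex.sel
          Im_complex_of_real Im_ip_self)
    then show ?thesis using ip_nonneg[of ?w] by simp
  qed
  have "?c\<^sup>2 \<le> ?a * ?b"
  proof (cases "?b = 0")
    case True
    have "?c = 0"
    proof (rule ccontr)
      assume "?c \<noteq> 0"
      then have "0 < ?c\<^sup>2" by simp
      then have "2 * ((?a + 1) / ?c\<^sup>2) * ?c\<^sup>2 = 2 * (?a + 1)" by (simp add: field_simps)
      with q[of "(?a + 1) / ?c\<^sup>2"] True ip_nonneg[of x] show False by simp
    qed
    then show ?thesis using ip_nonneg[of x] ip_nonneg[of y] by simp
  next
    case False
    then have b: "0 < ?b" using ip_nonneg[of y] by simp
    have "0 \<le> ?a - 2 * (1 / ?b) * ?c\<^sup>2 + (1 / ?b)\<^sup>2 * ?c\<^sup>2 * ?b" by (rule q)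
    also have "\<dots> = ?a - ?c\<^sup>2 / ?b" using b by (simp add: power2_eq_square)
    finally show ?thesis using b by (simp add: field_simps)
  qed
  then have "?c\<^sup>2 \<le> (nrm x * nrm y)\<^sup>2" by (simp add: power_mult_distrib nrm_square)
  then show ?thesis by (rule power2_le_imp_le) simp
qed

lemma nrm_triangle: "nrm (x + y) \<le> nrm x + nrm y"
proof (rule power2_le_imp_le)
  have "(nrm (x + y))\<^sup>2 = (nrm x)\<^sup>2 + (nrm y)\<^sup>2 + Re (ip x y + ip y x)"
    by (simp add: nrm_square ip_add_left ip_add_right)
  also have "ip y x = cnj (ip x y)" by (simp add: ip_cnj)
  also have "Re (ip x y + cnj (ip x y)) \<le> 2 * (nrm x * nrm y)"
    using Cauchy_Schwarz[of x y] complex_Re_le_cmod[of "ip x y"] by simp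
  finally show "(nrm (x + y))\<^sup>2 \<le> (nrm x + nrm y)\<^sup>2" by (simp add: power2_sum)
qed simp

lemma nrm_scale: "nrm (scale c x) = cmod c * nrm x"
proof -
  have "ip (scale c x) (scale c x) = (c * cnj c) * ip x x"
    by (simp add: ip_scale_left ip_scale_right)
  also have "\<dots> = of_real ((cmod c)\<^sup>2 * (nrm x)\<^sup>2)"
    by (simp add: ip_nrm flip: complex_norm_square)
  finally have "(nrm (scale c x))\<^sup>2 = (cmod c * nrm x)\<^sup>2"
    unfolding nrm_square by (simp add: power_mult_distrib nrm_square)
  then show ?thesis by (simp add: power2_eq_iff_nonneg)
qed

lemma ip_null: "nrm x = 0 \<Longrightarrow> ip x y = 0"
  using Cauchy_Schwarz[of x y] by simp

text \<open>For \<open>0 \<le> h \<le> 1\<close> one has \<open>h\<^sup>2 \<le> h\<close>, by the Cauchy-Schwarz inequality for the form of \<open>h\<close>.\<close>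

lemma nrm_diff_positive_contraction:
  assumes add: "\<And>x y. h (x + y) = h x + h y" and scale: "\<And>c x. h (scale c x) = scale c (h x)"
    and sym: "\<And>x y. ip (h x) y = ip x (h y)"
    and ge: "\<And>x. 0 \<le> Re (ip (h x) x)" and le: "\<And>x. Re (ip (h x) x) \<le> Re (ip x x)"
  shows "nrm (x - h x) \<le> nrm x"
proof -
  interpret h: semi_inner scale "\<lambda>x y. ip (h x) y"
    by unfold_locales (simp_all add: add scale ip_add_left ip_scale_left ip_cnj ge sym[symmetric])
  let ?q = "Re (ip (h x) (h x))" and ?r = "Re (ip (h x) x)"
  have "?q \<le> cmod (ip (h x) (h x))" by (rule complex_Re_le_cmod)
  also have "\<dots> \<le> h.nrm x * h.nrm (h x)" by (rule h.Cauchy_Schwarz)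
  finally have "?q \<le> h.nrm x * h.nrm (h x)" .
  then have "?q\<^sup>2 \<le> (h.nrm x * h.nrm (h x))\<^sup>2" by (intro power_mono ip_nonneg)
  also have "\<dots> = ?r * Re (ip (h (h x)) (h x))" by (simp add: power_mult_distrib h.nrm_square)
  also have "\<dots> \<le> ?r * ?q" by (intro mult_left_mono le ge)
  finally have "?q * ?q \<le> ?r * ?q" by (simp add: power2_eq_square)
  then have qr: "?q \<le> ?r" using ip_nonneg[of "h x"] ge[of x] by (cases "?q = 0") auto
  have "(nrm (x - h x))\<^sup>2 = Re (ip x x) - 2 * ?r + ?q"
    by (simp add: nrm_square ip_diff_left ip_diff_right sym)
  also have "\<dots> \<le> (nrm x)\<^sup>2" using qr ge[of x] by (simp add: nrm_square)
  finally show ?thesis by (rule power2_le_imp_le) simp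
qed

end

section \<open>States\<close>

definition state :: "('a::cstar_algebra \<Rightarrow> complex) \<Rightarrow> bool" where
  "state s \<longleftrightarrow> (\<forall>x y. s (x + y) = s x + s y) \<and> (\<forall>c x. s (c *\<^sub>C x) = c * s x) \<and> s 1 = 1 \<and>
     (\<forall>x. s (adj x) = cnj (s x)) \<and> (\<forall>x. pos_elem x \<longrightarrow> s x \<in> \<real>\<^sub>\<ge>\<^sub>0)"

lemma stateD:
  assumes "state s"
  shows "s (x + y) = s x + s y" "s (c *\<^sub>C x) = c * s x" "s 1 = 1" "s (adj x) = cnj (s x)"
    "pos_elem x \<Longrightarrow> s x \<in> \<real>\<^sub>\<ge>\<^sub>0"
  using assms by (auto simp: state_def)

text \<open>Separation of -1 from the cone generated by the positive elements and by both signs of h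
  - norm h, where h = \<open>adj a * a\<close>. The resulting functional is a state that vanishes at
  h - norm h.\<close>

lemma state_attaining_norm:
  fixes a :: "'a::cstar_algebra"
  obtains s where "state s" "s (adj a * a) = of_real ((norm a)\<^sup>2)"
proof -
  let ?h = "adj a * a" and ?n = "(norm a)\<^sup>2"
  have h: "adj ?h = ?h" and n: "norm ?h = ?n" and pos: "pos_elem ?h"
    by (simp_all add: adj_mult adj_adj cstar_identity pos_elem_adj_mult_self)
  let ?C = "{p + \<beta> *\<^sub>R (?h - of_real ?n) | p \<beta>. pos_elem p}"
  have C: "vcone (\<lambda>r. (*\<^sub>C) (complex_of_real r)) ?C"
    unfolding vcone_def scaleR_scaleC[symmetric]
  proof (intro conjI ballI allI impI)
    have "(0 :: 'a) = of_real 0 + 0 *\<^sub>R (?h - of_real ?n)" by simp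
    then show "0 \<in> ?C" using pos_elem_of_real[of 0] by blast
    fix x assume "x \<in> ?C"
    then obtain p \<beta> where x: "x = p + \<beta> *\<^sub>R (?h - of_real ?n)" "pos_elem p" by blast
    { fix y assume "y \<in> ?C"
      then obtain q \<gamma> where y: "y = q + \<gamma> *\<^sub>R (?h - of_real ?n)" "pos_elem q" by blast
      have "x + y = (p + q) + (\<beta> + \<gamma>) *\<^sub>R (?h - of_real ?n)"
        unfolding x y by (simp add: scaleR_left_distrib del: scaleR_diff_right)
      then show "x + y \<in> ?C" using pos_elem_add[OF x(2) y(2)] by blast }
    fix r :: real assume "0 \<le> r"
    moreover have "r *\<^sub>R x = r *\<^sub>R p + (r * \<beta>) *\<^sub>R (?h - of_real ?n)"
      unfolding x by (simp add: scaleR_right_distrib)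
    ultimately show "r *\<^sub>R x \<in> ?C" using pos_elem_scaleR[OF x(2)] by blast
  qed
  \<comment> \<open>Membership makes p = (\<beta> n - 1) - \<beta> h positive. If \<beta> \<ge> 0
    and \<beta> n \<ge> 1, this bounds \<beta> n = norm (\<beta> h) by \<beta> n - 1. Otherwise -p
    is positive too, so p = 0 and \<beta> h is the scalar \<beta> n - 1, whose sign (for \<beta>
    \<ge> 0) or norm (for \<beta> < 0) does not fit.\<close>
  have notin: "- 1 \<notin> ?C"
  proof
    assume "- 1 \<in> ?C"
    then obtain p \<beta> where p: "- 1 = p + \<beta> *\<^sub>R (?h - of_real ?n)" "pos_elem p" by blast
    have "p = - 1 - \<beta> *\<^sub>R (?h - of_real ?n)" by (simp add: p(1))
    also have "\<dots> = of_real (\<beta> * ?n - 1) - \<beta> *\<^sub>R ?h"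
      by (simp add: scaleR_diff_right of_real_def scaleR_left_diff_distrib)
    finally have p_eq: "p = of_real (\<beta> * ?n - 1) - \<beta> *\<^sub>R ?h" .
    have nb: "norm (\<beta> *\<^sub>R ?h) = \<bar>\<beta>\<bar> * ?n" by (simp add: n)
    show False
    proof (cases "0 \<le> \<beta> \<and> 0 \<le> \<beta> * ?n - 1")
      case True
      then have "norm (\<beta> *\<^sub>R ?h) \<le> \<beta> * ?n - 1"
        using p(2) pos by (intro norm_le_of_real pos_elem_scaleR) (simp_all only: p_eq)
      then show False using True by (simp add: n)
    next
      case False
      have "pos_elem (- p)"
      proof (cases "0 \<le> \<beta>")
        case True
        have "- p = of_real (1 - \<beta> * ?n) + \<beta> *\<^sub>R ?h" unfolding p_eq by simp
        then show ?thesis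
          using False True pos by (simp only:) (intro pos_elem_add pos_elem_of_real pos_elem_scaleR, auto)
      next
        case False
        have "- p = of_real (1 - \<beta> * ?n) - (- \<beta> *\<^sub>R ?h)" unfolding p_eq by simp
        moreover have "norm (- \<beta> *\<^sub>R ?h) \<le> 1 - \<beta> * ?n" using nb False by simp
        ultimately show ?thesis by (simp only:) (intro pos_elem_of_real_diff, simp_all add: adj_minus adj_scaleR h)
      qed
      with p(2) have "p = 0" by (rule pos_elem_antisym)
      then have bh: "\<beta> *\<^sub>R ?h = of_real (\<beta> * ?n - 1)" using p_eq by simp
      then have abs: "\<bar>\<beta>\<bar> * ?n = \<bar>\<beta> * ?n - 1\<bar>" using nb by (metis norm_of_real)
      show False
      proof (cases "0 \<le> \<beta>")
        case True
        then have "pos_elem (\<beta> *\<^sub>R ?h)" using pos by (rule pos_elem_scaleR[rotated])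
        moreover have "- (\<beta> *\<^sub>R ?h) = of_real (1 - \<beta> * ?n)" unfolding bh by simp
        then have "pos_elem (- (\<beta> *\<^sub>R ?h))" using False True by (simp only:) (intro pos_elem_of_real, simp)
        ultimately have "\<beta> *\<^sub>R ?h = 0" by (rule pos_elem_antisym)
        then have "\<beta> * ?n = 1" unfolding bh by (simp only: of_real_eq_0_iff)
        then show False using False True by simp
      next
        case False
        then show False using abs mult_nonneg_nonneg[of "- \<beta>" ?n] by simp
      qed
    qed
  qed
  have herm: "adj x = x" if "x \<in> ?C" for x
    using that h by (auto simp: adj_add adj_scaleR adj_diff dest: pos_elem_adj simp del: of_real_power)
  have unit: "\<exists>t. complex_of_real t *\<^sub>C 1 + x \<in> ?C" if "adj x = x" for x
  proof -
    have "pos_elem (of_real (norm x) - (- x))"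
      using that by (intro pos_elem_of_real_diff) (simp_all add: adj_minus)
    moreover have "complex_of_real (norm x) *\<^sub>C 1 + x = (of_real (norm x) - (- x)) + 0 *\<^sub>R (?h - of_real ?n)"
      by (simp add: of_real_scaleC)
    ultimately show ?thesis by blast
  qed
  obtain s where s: "\<And>x y. s (x + y) = s x + s y" "\<And>c x. s (c *\<^sub>C x) = c * s x" "s 1 = 1"
    "\<And>x. s (adj x) = cnj (s x)" "\<And>x. x \<in> ?C \<Longrightarrow> s x \<in> \<real>\<^sub>\<ge>\<^sub>0"
    by (rule star_cone_functional[OF complex_vector.vector_space_axioms adj_add adj_scaleC adj_adj C
          herm notin adj_one unit], assumption+) (rule that)
  have CI: "p + \<beta> *\<^sub>R (?h - of_real ?n) \<in> ?C" if "pos_elem p" for p \<beta> using that by blast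
  have "s p \<in> \<real>\<^sub>\<ge>\<^sub>0" if "pos_elem p" for p
    using s(5)[OF CI[OF that, of 0]] by simp
  then have "state s" using s by (simp add: state_def)
  have m: "s (- x) = - s x" for x using s(2)[of "-1" x] by simp
  have pos0: "pos_elem (0 :: 'a)" using pos_elem_of_real[of 0] by simp
  have "s (?h - of_real ?n) \<in> \<real>\<^sub>\<ge>\<^sub>0" "- s (?h - of_real ?n) \<in> \<real>\<^sub>\<ge>\<^sub>0"
    using s(5)[OF CI[OF pos0, of 1]] s(5)[OF CI[OF pos0, of "-1"]]
    by (simp_all only: add_0 scaleR_minus_left scaleR_one m)
  then have "s (?h - of_real ?n) = 0"
    by (auto simp only: complex_nonneg_Reals_iff complex_eq_iff uminus_complex.sel zero_complex.sel)
  moreover have "s (?h - of_real ?n) = s ?h - of_real ?n"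
    using s(1)[of ?h "- of_real ?n"] s(2,3) by (simp add: m of_real_scaleC del: of_real_power)
  ultimately show ?thesis using that \<open>state s\<close> by simp
qed

context
  fixes s :: "'a::cstar_algebra \<Rightarrow> complex"
  assumes s: "state s"
begin

lemma state_zero: "s 0 = 0"
  using stateD(1)[OF s, of 0 0] by simp

lemma state_minus: "s (- x) = - s x"
  using stateD(2)[OF s, of "-1" x] by simp

lemma state_diff: "s (x - y) = s x - s y"
  using stateD(1)[OF s, of x "- y"] by (simp add: state_minus)

lemma state_scaleR: "s (r *\<^sub>R x) = of_real r * s x"
  by (simp add: scaleR_scaleC stateD(2)[OF s])

lemma state_sum: "s (\<Sum>i\<in>A. f i) = (\<Sum>i\<in>A. s (f i))"
  by (induction A rule: infinite_finite_induct) (simp_all add: state_zero stateD(1)[OF s])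

lemma state_adj_mult: "s (adj x * y) = cnj (s (adj y * x))"
  using stateD(4)[OF s, of "adj y * x"] by (simp add: adj_mult adj_adj)

lemma state_square: "s (adj x * x) \<in> \<real>\<^sub>\<ge>\<^sub>0"
  by (intro stateD(5)[OF s] pos_elem_adj_mult_self)

text \<open>Left multiplication by z is bounded by norm z in the GNS form of s: the difference of
  the squared norm and \<open>adj z * z\<close> has the form \<open>adj y * y\<close>, and
  conjugation by v preserves that form.\<close>

lemma state_conj_bound: "Re (s (adj v * (adj z * z) * v)) \<le> (norm z)\<^sup>2 * Re (s (adj v * v))"
proof -
  have "pos_elem (of_real ((norm z)\<^sup>2) - adj z * z)"
    by (intro pos_elem_of_real_diff) (simp_all add: adj_mult adj_adj cstar_identity)
  then obtain y where y: "of_real ((norm z)\<^sup>2) - adj z * z = adj y * y"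
    using pos_elem_iff by blast
  have "adj v * (of_real ((norm z)\<^sup>2) - adj z * z) * v = adj (y * v) * (y * v)"
    unfolding y by (simp add: adj_mult mult.assoc)
  then have "(norm z)\<^sup>2 *\<^sub>R (adj v * v) - adj v * (adj z * z) * v = adj (y * v) * (y * v)"
    by (simp add: algebra_simps of_real_def)
  then have "0 \<le> Re (s ((norm z)\<^sup>2 *\<^sub>R (adj v * v) - adj v * (adj z * z) * v))"
    using state_square[of "y * v"] by (simp add: complex_nonneg_Reals_iff)
  then show ?thesis by (simp add: state_diff state_scaleR)
qed

lemma semi_inner_state: "semi_inner (*\<^sub>C) (\<lambda>x y. s (adj y * x))"
proof unfold_locales
  fix c and x y z :: 'a
  show "s (adj z * (x + y)) = s (adj z * x) + s (adj z * y)" by (simp add: distrib_left stateD[OF s])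
  show "s (adj z * c *\<^sub>C x) = c * s (adj z * x)" by (simp add: scaleC_mult_right stateD[OF s])
  show "cnj (s (adj y * x)) = s (adj x * y)" by (rule state_adj_mult[symmetric])
  show "0 \<le> Re (s (adj x * x))" using state_square[of x] by (simp add: complex_nonneg_Reals_iff)
qed

lemma vector_space_pointwise: "vector_space (\<lambda>c (v :: 'i \<Rightarrow> 'a) i. c *\<^sub>C v i)"
  by unfold_locales (simp_all add: fun_eq_iff scaleC_add_right scaleC_add_left scaleC_scaleC scaleC_one)

lemma semi_inner_state_tuple:
  "semi_inner (\<lambda>c (v :: nat \<Rightarrow> 'a) i. c *\<^sub>C v i) (\<lambda>v w. \<Sum>i<p. s (adj (w i) * v i))"
proof -
  interpret vector_space "\<lambda>c (v :: nat \<Rightarrow> 'a) i. c *\<^sub>C v i" by (rule vector_space_pointwise)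
  interpret t: semi_inner "(*\<^sub>C)" "\<lambda>x y. s (adj y * x)" by (rule semi_inner_state)
  show ?thesis
    by unfold_locales
      (simp_all add: t.ip_add_left t.ip_scale_left sum.distrib sum_distrib_left state_adj_mult[symmetric]
        t.ip_nonneg sum_nonneg)
qed

end

section \<open>Positive matrices over a C*-algebra\<close>

text \<open>With T = 1 - h/C the series of sqrt(1 - T) is summed entrywise, for which the entries of
  all powers of T must have norm at most 1. Given one entry, take a state that attains its norm. In
  the GNS form on p-tuples 0 \<le> h/C \<le> 1, so T is a contraction there, and the entry is a
  component of a power of T applied to a unit vector.\<close>

theorem matrix_sqrt:
  fixes h :: "nat \<Rightarrow> nat \<Rightarrow> 'a::cstar_algebra"
  assumes herm: "\<And>i j. i < p \<Longrightarrow> j < p \<Longrightarrow> adj (h i j) = h j i"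
    and pos: "\<And>s v. state s \<Longrightarrow> 0 \<le> Re (s (\<Sum>i<p. \<Sum>j<p. adj (v i) * h i j * v j))"
  obtains Y where "\<And>i j. i < p \<Longrightarrow> j < p \<Longrightarrow> h i j = (\<Sum>k<p. adj (Y k i) * Y k j)"
proof -
  \<comment> \<open>The sum of the norms dominates h in every state; 1 is added so that division by
    \<open>C\<close> is possible.\<close>
  define C where "C = (\<Sum>i<p. \<Sum>j<p. norm (h i j)) + 1"
  have C: "0 < C" by (simp add: C_def add_nonneg_pos sum_nonneg)
  define T where "T i j = (if i = j then 1 else 0) - (1 / C) *\<^sub>R h i j" for i j
  \<comment> \<open>The powers of \<open>T\<close>. The new factor stands on the left, so each
    column of \<open>t (Suc m)\<close> is the image under \<open>T\<close> of the same column of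
    \<open>t m\<close>.\<close>
  define t where "t = rec_nat (\<lambda>i j. if i = j then 1 else 0) (\<lambda>_ t i j. \<Sum>k<p. T i k * t k j)"
  have t0: "t 0 i j = (if i = j then 1 else 0)" and tS: "t (Suc m) i j = (\<Sum>k<p. T i k * t m k j)"
    for i j m by (simp_all add: t_def)
  have T_adj: "adj (T i j) = T j i" if "i < p" "j < p" for i j
    using herm[OF that] by (simp add: T_def adj_diff adj_scaleR)
  have t_add: "t (m + n) i j = (\<Sum>k<p. t m i k * t n k j)" if "i < p" "j < p" for m n i j
    using that
  proof (induction m arbitrary: i)
    case 0
    then show ?case by (simp add: t0 if_distrib[of "\<lambda>x. x * _"] cong: if_cong)
  next
    case (Suc m)
    have "t (Suc m + n) i j = (\<Sum>k<p. T i k * (\<Sum>l<p. t m k l * t n l j))"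
      using Suc by (simp add: tS)
    also have "\<dots> = (\<Sum>l<p. \<Sum>k<p. T i k * t m k l * t n l j)"
      by (subst sum.swap) (simp add: sum_distrib_left mult.assoc)
    finally show ?case by (simp add: tS sum_distrib_right)
  qed
  have t1: "t 1 i j = T i j" if "i < p" "j < p" for i j
    using that by (simp add: tS t0 if_distrib[of "\<lambda>x. _ * x"] cong: if_cong)
  have t_adj: "adj (t m i j) = t m j i" if "i < p" "j < p" for m i j
    using that
  proof (induction m arbitrary: i j)
    case (Suc m)
    have "adj (t (Suc m) i j) = (\<Sum>k<p. t m j k * t 1 k i)"
      unfolding tS adj_sum adj_mult using Suc by (intro sum.cong refl) (simp add: T_adj t1[simplified])
    also have "\<dots> = t (m + 1) j i" using Suc.prems by (intro t_add[symmetric])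
    finally show ?case by simp
  qed (simp add: t0)
  have bound: "norm (t m i j) \<le> 1" if i: "i < p" and j: "j < p" for m i j
  proof -
    obtain s where s: "state s" "s (adj (t m i j) * t m i j) = of_real ((norm (t m i j))\<^sup>2)"
      using state_attaining_norm by blast
    interpret t: semi_inner "(*\<^sub>C)" "\<lambda>x y. s (adj y * x)" by (rule semi_inner_state[OF s(1)])
    interpret V: semi_inner "\<lambda>c (v :: nat \<Rightarrow> 'a) i. c *\<^sub>C v i" "\<lambda>v w. \<Sum>i<p. s (adj (w i) * v i)"
      by (rule semi_inner_state_tuple[OF s(1)])
    define H where "H v = (\<lambda>i. (1 / C) *\<^sub>R (\<Sum>j<p. h i j * v j))" for v :: "nat \<Rightarrow> 'a"
    note st = state_sum[OF s(1)] state_scaleR[OF s(1)] stateD(1,2)[OF s(1)]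
    have HV: "(\<Sum>i<p. s (adj (w i) * H v i)) = of_real (1 / C) * (\<Sum>i<p. \<Sum>j<p. s (adj (w i) * h i j * v j))"
      for v w
      by (simp add: H_def st sum_distrib_left mult.assoc)
    have nrm_H: "V.nrm (v - H v) \<le> V.nrm v" for v
    proof (rule V.nrm_diff_positive_contraction)
      fix x y and c
      show "H (x + y) = H x + H y"
        by (simp add: H_def fun_eq_iff distrib_left sum.distrib scaleR_right_distrib)
      show "H (\<lambda>i. c *\<^sub>C x i) = (\<lambda>i. c *\<^sub>C H x i)"
        by (simp add: H_def fun_eq_iff scaleC_mult_right scaleR_scaleC scaleC_scaleC mult.commute
            flip: complex_vector.scale_sum_right)
      have "(\<Sum>i<p. s (adj (y i) * H x i)) = of_real (1 / C) * (\<Sum>i<p. \<Sum>j<p. s (adj (y i) * h i j * x j))"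
        by (rule HV)
      also have "(\<Sum>i<p. \<Sum>j<p. s (adj (y i) * h i j * x j))
          = cnj (\<Sum>i<p. \<Sum>j<p. s (adj (x i) * h i j * y j))"
        unfolding cnj_sum
      proof (subst sum.swap, intro sum.cong refl)
        fix i j assume "i \<in> {..<p}" "j \<in> {..<p}"
        then have "adj (adj (x i) * h i j * y j) = adj (y j) * h j i * x i"
          by (simp add: adj_mult adj_adj herm mult.assoc)
        then show "s (adj (y j) * h j i * x i) = cnj (s (adj (x i) * h i j * y j))"
          by (simp flip: stateD(4)[OF s(1)])
      qed
      also have "of_real (1 / C) * \<dots> = cnj (\<Sum>i<p. s (adj (x i) * H y i))"
        unfolding HV by simp
      finally show "(\<Sum>i<p. s (adj (y i) * H x i)) = (\<Sum>i<p. s (adj (H y i) * x i))"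
        by (simp add: state_adj_mult[OF s(1), symmetric])
      have "0 \<le> Re (\<Sum>i<p. \<Sum>j<p. s (adj (x i) * h i j * x j))"
        using pos[OF s(1), of x] by (simp add: st)
      then show "0 \<le> Re (\<Sum>i<p. s (adj (x i) * H x i))"
        unfolding HV using C by (simp add: mult_nonneg_nonneg)
      have "Re (\<Sum>i<p. \<Sum>j<p. s (adj (x i) * h i j * x j))
          \<le> (\<Sum>i<p. \<Sum>j<p. norm (h i j) * (V.nrm x)\<^sup>2)"
        unfolding Re_sum
      proof (intro sum_mono)
        fix i j assume ij: "i \<in> {..<p}" "j \<in> {..<p}"
        have le: "t.nrm (x k) \<le> V.nrm x" if "k < p" for k
          unfolding t.nrm_def V.nrm_def Re_sum
          using that t.ip_nonneg by (intro real_sqrt_le_mono member_le_sum) auto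
        have "(t.nrm (h i j * x j))\<^sup>2 \<le> (norm (h i j) * t.nrm (x j))\<^sup>2"
          using state_conj_bound[OF s(1), of "x j" "h i j"]
          by (simp add: t.nrm_square power_mult_distrib adj_mult mult.assoc)
        then have n: "t.nrm (h i j * x j) \<le> norm (h i j) * t.nrm (x j)"
          by (rule power2_le_imp_le) simp
        have "Re (s (adj (x i) * h i j * x j)) \<le> cmod (s (adj (x i) * (h i j * x j)))"
          by (simp add: mult.assoc complex_Re_le_cmod)
        also have "\<dots> \<le> t.nrm (h i j * x j) * t.nrm (x i)" by (rule t.Cauchy_Schwarz)
        also have "\<dots> \<le> (norm (h i j) * V.nrm x) * V.nrm x"
          using ij le by (intro mult_mono order_trans[OF n] mult_left_mono) auto
        finally show "Re (s (adj (x i) * h i j * x j)) \<le> norm (h i j) * (V.nrm x)\<^sup>2"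
          by (simp add: power2_eq_square mult.assoc)
      qed
      also have "\<dots> = (C - 1) * (V.nrm x)\<^sup>2" by (simp add: C_def sum_distrib_right)
      also have "\<dots> \<le> C * (V.nrm x)\<^sup>2" by (simp add: mult_right_mono)
      finally show "Re (\<Sum>i<p. s (adj (x i) * H x i)) \<le> Re (\<Sum>i<p. s (adj (x i) * x i))"
        unfolding HV using C by (simp add: V.nrm_square field_simps)
    qed
    have cong: "V.nrm v = V.nrm w" if "\<And>i. i < p \<Longrightarrow> v i = w i" for v w
      using that unfolding V.nrm_def by simp
    have nrm_t: "V.nrm (\<lambda>i. t m i j) \<le> 1" for m
    proof (induction m)
      case 0
      have "(V.nrm (\<lambda>i. t 0 i j))\<^sup>2 = (\<Sum>i<p. if i = j then 1 else 0)"
        unfolding V.nrm_square Re_sum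
        by (intro sum.cong refl) (simp add: t0 stateD(3)[OF s(1)] state_zero[OF s(1)])
      also have "\<dots> = 1" using j by simp
      finally show ?case using power2_le_imp_le[of "V.nrm (\<lambda>i. t 0 i j)" 1] by simp
    next
      case (Suc m)
      have "V.nrm (\<lambda>i. t (Suc m) i j) = V.nrm ((\<lambda>i. t m i j) - H (\<lambda>i. t m i j))"
      proof (rule cong)
        fix i assume "i < p"
        then have *: "(\<Sum>k<p. (if i = k then 1 else 0) * t m k j) = t m i j"
          by (simp add: if_distrib[of "\<lambda>x. x * _"] cong: if_cong)
        have "t (Suc m) i j = (\<Sum>k<p. (if i = k then 1 else 0) * t m k j - (1 / C) *\<^sub>R (h i k * t m k j))"
          unfolding tS T_def by (intro sum.cong refl) (simp only: left_diff_distrib mult_scaleR_left)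
        then show "t (Suc m) i j = ((\<lambda>i. t m i j) - H (\<lambda>i. t m i j)) i"
          unfolding sum_subtractf * by (simp only: H_def minus_apply scaleR_sum_right)
      qed
      also have "\<dots> \<le> V.nrm (\<lambda>i. t m i j)" by (rule nrm_H)
      finally show ?case using Suc by (rule order_trans)
    qed
    have "(norm (t m i j))\<^sup>2 = Re (s (adj (t m i j) * t m i j))" by (simp add: s)
    also have "\<dots> \<le> (V.nrm (\<lambda>i. t m i j))\<^sup>2"
      unfolding V.nrm_square Re_sum using i t.ip_nonneg
      by (intro member_le_sum[of i _ "\<lambda>i. Re (s (adj (t m i j) * t m i j))"]) auto
    also have "\<dots> \<le> 1" by (intro power_le_one V.nrm_nonneg nrm_t)
    finally show ?thesis by (simp add: power2_le_iff_abs_le abs_square_le_1)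
  qed
  define Y where "Y i j = sqrt C *\<^sub>R suminf (\<lambda>m. sqrt_coeff m *\<^sub>R t m i j)" for i j
  show ?thesis
  proof (rule that)
    fix i j assume ij: "i < p" "j < p"
    have "adj (Y k i) = Y i k" if "k < p" for k
      using adj_sqrt_series[of "\<lambda>m. t m k i"] bound that ij by (simp add: Y_def adj_scaleR t_adj)
    then have "(\<Sum>k<p. adj (Y k i) * Y k j) = (\<Sum>k<p. Y i k * Y k j)" by simp
    also have "\<dots> = C *\<^sub>R (\<Sum>k<p. suminf (\<lambda>m. sqrt_coeff m *\<^sub>R t m i k) * suminf (\<lambda>m. sqrt_coeff m *\<^sub>R t m k j))"
      using C by (simp add: Y_def scaleR_sum_right)
    also have "\<dots> = C *\<^sub>R ((if i = j then 1 else 0) - t 1 i j)"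
      using matrix_sqrt_series[of p t i j] bound t0 t_add ij by simp
    also have "\<dots> = h i j" using C by (simp add: t1[OF ij, simplified] T_def)
    finally show "h i j = (\<Sum>k<p. adj (Y k i) * Y k j)" by simp
  qed
qed

section \<open>Unitary operators and representations of groups\<close>

context semi_inner
begin

text \<open>Surjectivity is not part of it; invertibility is supplied by a second operator that
  inverts the first one exactly, not merely modulo null vectors.\<close>

definition unitary_op :: "('v \<Rightarrow> 'v) \<Rightarrow> bool" where
  "unitary_op U \<longleftrightarrow> (\<forall>x y. U (x + y) = U x + U y) \<and> (\<forall>c x. U (scale c x) = scale c (U x)) \<and>
     (\<forall>x y. ip (U x) (U y) = ip x y)"

lemma unitary_opD:
  assumes "unitary_op U"
  shows "U (x + y) = U x + U y" "U (scale c x) = scale c (U x)" "ip (U x) (U y) = ip x y"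
  using assms by (auto simp: unitary_op_def)

lemma unitary_op_diff: "unitary_op U \<Longrightarrow> U (x - y) = U x - U y"
  using unitary_opD(1)[of U "x - y" y] by simp

lemma unitary_op_zero: "unitary_op U \<Longrightarrow> U 0 = 0"
  using unitary_opD(1)[of U 0 0] by simp

lemma unitary_op_nrm: "unitary_op U \<Longrightarrow> nrm (U x) = nrm x"
  by (simp add: nrm_def unitary_opD)

lemma unitary_op_id: "unitary_op (\<lambda>x. x)"
  by (simp add: unitary_op_def)

lemma unitary_op_compose: "unitary_op U \<Longrightarrow> unitary_op V \<Longrightarrow> unitary_op (\<lambda>x. U (V x))"
  by (simp add: unitary_op_def)

text \<open>For \<open>d = x - y\<close> and \<open>a = ip x d\<close>, where \<open>x\<close> and \<open>y\<close> have the same norm, it maps \<open>x\<close> to \<open>y\<close>.\<close>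

definition reflection :: "'v \<Rightarrow> complex \<Rightarrow> 'v \<Rightarrow> 'v" where
  "reflection d a v = v - scale (ip v d / a) d"

text \<open>Expanding \<open>ip\<close> of the two images, the cross terms contribute -(1/a + 1/cnj
  a) times \<open>ip v d * cnj (ip w d)\<close>, and the last term contributes
  \<open>ip d d / (a * cnj a)\<close> times the same product. The condition on \<open>ip d d\<close>
  says that these cancel.\<close>

lemma unitary_op_reflection:
  assumes "a \<noteq> 0" "ip d d = a + cnj a"
  shows "unitary_op (reflection d a)"
  unfolding unitary_op_def
proof (intro conjI allI)
  fix v w c
  show "reflection d a (v + w) = reflection d a v + reflection d a w"
    by (simp add: reflection_def ip_add_left add_divide_distrib scale_left_distrib)
  show "reflection d a (scale c v) = scale c (reflection d a v)"
    by (simp add: reflection_def ip_scale_left scale_right_diff_distrib)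
  have "ip (reflection d a v) (reflection d a w) = ip v w
      - cnj (ip w d / a) * ip v d - ip v d / a * cnj (ip w d) + ip v d / a * (cnj (ip w d / a) * (a + cnj a))"
  proof -
    have "ip (v - scale \<alpha> d) (w - scale \<beta> d)
        = ip v w - cnj \<beta> * ip v d - \<alpha> * cnj (ip w d) + \<alpha> * (cnj \<beta> * ip d d)" for \<alpha> \<beta>
      by (simp add: ip_diff_left ip_diff_right ip_scale_left ip_scale_right ip_cnj algebra_simps)
    then show ?thesis unfolding reflection_def assms(2) .
  qed
  also have "\<dots> = ip v w"
  proof -
    have "r - q / b * p - p / a * q + p / a * (q / b * (a + b)) = r"
      if "b \<noteq> 0" for p q r b :: complex
      using that assms(1) by (simp add: field_simps)
    note * = this
    show ?thesis unfolding complex_cnj_divide by (rule *) (use assms(1) in simp)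
  qed
  finally show "ip (reflection d a v) (reflection d a w) = ip v w" .
qed

lemma reflection_reflection:
  assumes "a \<noteq> 0" "ip d d = a + cnj a"
  shows "reflection d a (reflection d (cnj a) v) = v"
proof -
  have "ip (reflection d (cnj a) v) d = - (a * ip v d / cnj a)"
    using assms(1) by (simp add: reflection_def ip_diff_left ip_scale_left assms(2) field_simps)
  then show ?thesis using assms(1) by (simp add: reflection_def[of d a] reflection_def[of d "cnj a"])
qed

text \<open>The reflection along x - y, or the identity if x - y is null. Because vectors orthogonal
  to x - y stay fixed, the induction in \<open>unitary_extension\<close> can leave its earlier
  vectors in place.\<close>

lemma unitary_moving:
  assumes xy: "nrm x = nrm y"
  obtains U V where "unitary_op U" "unitary_op V" "\<And>v. U (V v) = v" "\<And>v. V (U v) = v"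
    "nrm (U x - y) = 0" "\<And>z. ip z (x - y) = 0 \<Longrightarrow> U z = z"
proof (cases "nrm (x - y) = 0")
  case True
  then show ?thesis using that[of "\<lambda>x. x" "\<lambda>x. x"] unitary_op_id by simp
next
  case False
  let ?d = "x - y" and ?a = "ip x (x - y)"
  have xx: "ip x x = ip y y" using xy by (simp add: ip_nrm)
  have d: "ip ?d ?d = ?a + cnj ?a"
    by (simp add: ip_diff_left ip_diff_right ip_cnj xx)
  \<comment> \<open>Its real part is half of \<open>ip d d\<close>, which is nonzero in this
    case.\<close>
  have a: "?a \<noteq> 0"
  proof
    assume "?a = 0"
    with d have "ip ?d ?d = 0" by simp
    with False show False by (simp add: ip_nrm)
  qed
  have a': "cnj ?a \<noteq> 0" "ip ?d ?d = cnj ?a + cnj (cnj ?a)" using a d by (simp_all add: add.commute)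
  show ?thesis
  proof (rule that)
    show "unitary_op (reflection ?d ?a)" by (rule unitary_op_reflection[OF a d])
    show "unitary_op (reflection ?d (cnj ?a))" by (rule unitary_op_reflection[OF a'])
    show "reflection ?d ?a (reflection ?d (cnj ?a) v) = v" for v
      by (rule reflection_reflection[OF a d])
    show "reflection ?d (cnj ?a) (reflection ?d ?a v) = v" for v
      using reflection_reflection[OF a'] by simp
    show "nrm (reflection ?d ?a x - y) = 0" using a by (simp add: reflection_def nrm_def)
    show "reflection ?d ?a z = z" if "ip z ?d = 0" for z using that by (simp add: reflection_def)
  qed
qed

text \<open>The images are corrected one at a time: the unitary for the first p vectors is followed
  by a reflection that moves \<open>U (x p)\<close> to \<open>y p\<close>. Equality of the Gram
  matrices makes each earlier \<open>y k\<close> orthogonal to \<open>U (x p) - y p\<close>, so the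
  reflection fixes it.\<close>

theorem unitary_extension:
  fixes p :: nat
  assumes "\<And>k l. k < p \<Longrightarrow> l < p \<Longrightarrow> ip (x k) (x l) = ip (y k) (y l)"
  shows "\<exists>U V. unitary_op U \<and> unitary_op V \<and> (\<forall>v. U (V v) = v) \<and> (\<forall>v. V (U v) = v) \<and>
    (\<forall>k<p. nrm (U (x k) - y k) = 0)"
  using assms
proof (induction p)
  case 0
  then show ?case using unitary_op_id by (intro exI[of _ "\<lambda>x. x"]) simp
next
  case (Suc p)
  then obtain U V where U: "unitary_op U" "unitary_op V" "\<And>v. U (V v) = v" "\<And>v. V (U v) = v"
    and Uxy: "\<And>k. k < p \<Longrightarrow> nrm (U (x k) - y k) = 0"
    by (metis less_Suc_eq)
  have "nrm (U (x p)) = nrm (y p)"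
    using Suc.prems[of p p] by (simp add: unitary_op_nrm[OF U(1)]) (simp add: nrm_def)
  then obtain R S where R: "unitary_op R" "unitary_op S" "\<And>v. R (S v) = v" "\<And>v. S (R v) = v"
    "nrm (R (U (x p)) - y p) = 0" and Rz: "\<And>z. ip z (U (x p) - y p) = 0 \<Longrightarrow> R z = z"
    using unitary_moving by metis
  have "nrm (R (U (x k)) - y k) = 0" if k: "k < p" for k
  proof -
    have "ip (y k) (U (x p)) = ip (U (x k)) (U (x p))"
      using ip_null[OF Uxy[OF k], of "U (x p)"] by (simp add: ip_diff_left)
    also have "\<dots> = ip (y k) (y p)" using Suc.prems[of k p] k by (simp add: unitary_opD[OF U(1)])
    finally have "R (y k) = y k" by (intro Rz) (simp add: ip_diff_right)
    then have "R (U (x k)) - y k = R (U (x k) - y k)" by (simp add: unitary_op_diff[OF R(1)])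
    then show ?thesis by (simp add: unitary_op_nrm[OF R(1)] Uxy[OF k])
  qed
  then have "\<forall>k<Suc p. nrm (R (U (x k)) - y k) = 0" using R(5) by (auto simp: less_Suc_eq)
  then show ?case
    using unitary_op_compose[OF R(1) U(1)] unitary_op_compose[OF U(2) R(2)] U(3,4) R(3,4)
    by (intro exI[of _ "\<lambda>v. R (U v)"] exI[of _ "\<lambda>v. V (S v)"]) simp
qed

end

locale unitary_representation = semi_inner scale ip
  for scale :: "complex \<Rightarrow> 'v::ab_group_add \<Rightarrow> 'v" and ip +
  fixes \<rho> :: "'g::group_add \<Rightarrow> 'v \<Rightarrow> 'v"
  assumes rep_unitary: "unitary_op (\<rho> g)"
    and rep_zero: "\<rho> 0 v = v"
    and rep_add: "\<rho> (g + h) v = \<rho> g (\<rho> h v)"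
begin

definition act :: "('g \<Rightarrow>\<^sub>0 complex) \<Rightarrow> 'v \<Rightarrow> 'v" where
  "act x v = (\<Sum>k\<in>Poly_Mapping.keys x. scale (Poly_Mapping.lookup x k) (\<rho> k v))"

lemma act_zero [simp]: "act 0 v = 0"
  by (simp add: act_def)

lemma act_add: "act (x + y) v = act x v + act y v"
  unfolding act_def by (rule setsum_keys_plus_distrib) (simp_all add: scale_left_distrib)

lemma act_single: "act (Poly_Mapping.single g c) v = scale c (\<rho> g v)"
  by (cases "c = 0") (simp_all add: act_def)

lemma act_vec_add: "act x (v + w) = act x v + act x w"
  by (simp add: act_def unitary_opD(1)[OF rep_unitary] scale_right_distrib sum.distrib)

lemma act_vec_scale: "act x (scale c v) = scale c (act x v)"
  by (simp add: act_def unitary_opD(2)[OF rep_unitary] scale_sum_right mult.commute)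

lemma act_vec_zero [simp]: "act x 0 = 0"
  by (simp add: act_def unitary_op_zero[OF rep_unitary])

lemma act_mult: "act (x * y) v = act x (act y v)"
proof (induction x rule: ga_induct)
  case (single g c)
  show ?case
    by (induction y rule: ga_induct)
      (simp_all add: act_add act_single act_vec_add mult_single rep_add distrib_left
        unitary_opD[OF rep_unitary] scale_right_distrib unitary_op_zero[OF rep_unitary])
qed (simp_all add: act_add distrib_right)

lemma rep_adjoint: "ip (\<rho> g v) w = ip v (\<rho> (- g) w)"
  using unitary_opD(3)[OF rep_unitary, of "- g" "\<rho> g v" w] rep_add[of "- g" g v]
  by (simp add: rep_zero)

lemma act_star: "ip (act x v) w = ip v (act (ga_star x) w)"
  by (induction x rule: ga_induct)
    (simp_all add: ga_star_zero ga_star_single ga_star_add act_add act_single ip_add_left ip_add_right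
      ip_scale_left ip_scale_right rep_adjoint)

text \<open>Makes the supremum in \<open>op_norm\<close> one over a bounded set.\<close>

lemma act_bounded: "\<exists>b. \<forall>v. nrm (act x v) \<le> b * nrm v"
proof (induction x rule: ga_induct)
  case zero
  show ?case by (rule exI[of _ 0]) (simp add: nrm_def)
next
  case (single g c)
  show ?case by (rule exI[of _ "cmod c"]) (simp add: act_single nrm_scale unitary_op_nrm[OF rep_unitary])
next
  case (add x y)
  then obtain b c where b: "\<And>v. nrm (act x v) \<le> b * nrm v" and c: "\<And>v. nrm (act y v) \<le> c * nrm v"
    by blast
  have "nrm (act (x + y) v) \<le> (b + c) * nrm v" for v
    using nrm_triangle[of "act x v" "act y v"] b[of v] c[of v] by (simp add: act_add distrib_right)
  then show ?case by blast
qed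

definition op_norm :: "('g \<Rightarrow>\<^sub>0 complex) \<Rightarrow> real" where
  "op_norm x = (SUP v\<in>{v. nrm v \<le> 1}. nrm (act x v))"

lemma nrm_zero [simp]: "nrm 0 = 0"
  by (simp add: nrm_def)

lemma op_norm_least: "(\<And>v. nrm v \<le> 1 \<Longrightarrow> nrm (act x v) \<le> b) \<Longrightarrow> op_norm x \<le> b"
  unfolding op_norm_def by (rule cSUP_least) (auto intro: exI[of _ 0])

lemma op_norm_upper_unit: "nrm v \<le> 1 \<Longrightarrow> nrm (act x v) \<le> op_norm x"
proof -
  assume v: "nrm v \<le> 1"
  obtain b where b: "\<And>v. nrm (act x v) \<le> b * nrm v" using act_bounded by blast
  have "nrm (act x w) \<le> \<bar>b\<bar>" if "nrm w \<le> 1" for w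
  proof -
    have "b * nrm w \<le> \<bar>b\<bar> * 1" using that by (intro mult_mono) auto
    then show ?thesis using b[of w] by simp
  qed
  then have "bdd_above ((\<lambda>v. nrm (act x v)) ` {v. nrm v \<le> 1})" by (auto simp: bdd_above_def)
  then show ?thesis unfolding op_norm_def using v by (intro cSUP_upper) auto
qed

lemma op_norm_nonneg: "0 \<le> op_norm x"
  using op_norm_upper_unit[of 0 x] by simp

lemma op_norm_upper: "nrm (act x v) \<le> op_norm x * nrm v"
proof (cases "nrm v = 0")
  case True
  obtain b where "\<And>v. nrm (act x v) \<le> b * nrm v" using act_bounded by blast
  then have "nrm (act x v) \<le> b * nrm v" .
  then show ?thesis using True by simp
next
  case False
  then have v: "0 < nrm v" by (simp add: less_le)
  let ?w = "scale (of_real (inverse (nrm v))) v"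
  have "nrm ?w = 1" using v by (simp add: nrm_scale norm_inverse)
  then have "nrm (act x ?w) \<le> op_norm x" by (intro op_norm_upper_unit) simp
  then show ?thesis using v by (simp add: act_vec_scale nrm_scale norm_inverse norm_divide field_simps)
qed

text \<open>As \<open>full_norm\<close> is the supremum of all C*-seminorms, this makes every
  unitary representation contractive for it, the conclusion drawn in
  \<open>ip_act_le_full_norm\<close>.\<close>

lemma cstar_seminorm_op_norm: "cstar_seminorm op_norm"
  unfolding cstar_seminorm_def
proof (intro conjI allI)
  fix x y :: "'g \<Rightarrow>\<^sub>0 complex" and c
  have act_scalar: "act (Poly_Mapping.single 0 c * x) v = scale c (act x v)" for c x v
    by (simp add: act_mult act_single rep_zero)
  show "op_norm (x + y) \<le> op_norm x + op_norm y"
    unfolding op_norm_def[of "x + y"]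
  proof (rule cSUP_least)
    fix v assume "v \<in> {v. nrm v \<le> 1}"
    then show "nrm (act (x + y) v) \<le> op_norm x + op_norm y"
      unfolding act_add by (intro order_trans[OF nrm_triangle] add_mono op_norm_upper_unit) auto
  qed (auto intro: exI[of _ 0])
  show mult: "op_norm (x * y) \<le> op_norm x * op_norm y" for x y
  proof (rule op_norm_least)
    fix v assume v: "nrm v \<le> 1"
    have "nrm (act (x * y) v) \<le> op_norm x * nrm (act y v)" unfolding act_mult by (rule op_norm_upper)
    also have "\<dots> \<le> op_norm x * op_norm y"
      by (intro mult_left_mono op_norm_upper_unit v op_norm_nonneg)
    finally show "nrm (act (x * y) v) \<le> op_norm x * op_norm y" .
  qed
  have le: "op_norm (Poly_Mapping.single 0 c * x) \<le> cmod c * op_norm x" for c x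
    by (rule op_norm_least) (simp add: act_scalar nrm_scale mult_left_mono op_norm_upper_unit)
  show "op_norm (Poly_Mapping.single 0 c * x) = cmod c * op_norm x"
  proof (rule antisym[OF le], cases "c = 0")
    case True
    then show "cmod c * op_norm x \<le> op_norm (Poly_Mapping.single 0 c * x)"
      by (simp add: op_norm_nonneg)
  next
    case False
    have "x = Poly_Mapping.single 0 (inverse c) * (Poly_Mapping.single 0 c * x)"
      using False by (simp add: mult_single flip: mult.assoc)
    then have "op_norm x \<le> inverse (cmod c) * op_norm (Poly_Mapping.single 0 c * x)"
      using le[of "inverse c" "Poly_Mapping.single 0 c * x"] by (simp add: norm_inverse)
    then show "cmod c * op_norm x \<le> op_norm (Poly_Mapping.single 0 c * x)"
      using False by (simp add: field_simps)
  qed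
  have sq: "(op_norm x)\<^sup>2 \<le> op_norm (ga_star x * x)" for x
  proof -
    have "op_norm x \<le> sqrt (op_norm (ga_star x * x))"
    proof (rule op_norm_least, rule real_le_rsqrt)
      fix v assume v: "nrm v \<le> 1"
      have "(nrm (act x v))\<^sup>2 = Re (ip v (act (ga_star x * x) v))"
        by (simp add: nrm_square act_star act_mult)
      also have "\<dots> \<le> cmod (ip v (act (ga_star x * x) v))" by (rule complex_Re_le_cmod)
      also have "\<dots> \<le> nrm v * nrm (act (ga_star x * x) v)" by (rule Cauchy_Schwarz)
      also have "\<dots> \<le> 1 * op_norm (ga_star x * x)"
        using v by (intro mult_mono op_norm_upper_unit) auto
      finally show "(nrm (act x v))\<^sup>2 \<le> op_norm (ga_star x * x)" by simp
    qed
    then have "(op_norm x)\<^sup>2 \<le> (sqrt (op_norm (ga_star x * x)))\<^sup>2"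
      by (intro power_mono op_norm_nonneg)
    then show ?thesis by (simp add: op_norm_nonneg)
  qed
  have adj_le: "op_norm x \<le> op_norm (ga_star x)" for x
  proof (cases "op_norm x = 0")
    case False
    have "op_norm x * op_norm x \<le> op_norm (ga_star x) * op_norm x"
      using sq[of x] mult[of "ga_star x" x] by (simp add: power2_eq_square)
    moreover have "0 < op_norm x" using False op_norm_nonneg[of x] by simp
    ultimately show ?thesis by (rule mult_right_le_imp_le)
  qed (simp add: op_norm_nonneg)
  have "op_norm (ga_star x) = op_norm x"
    using adj_le[of x] adj_le[of "ga_star x"] by (simp add: ga_star_star)
  then show "op_norm (ga_star x * x) = (op_norm x)\<^sup>2"
    using sq[of x] mult[of "ga_star x" x] by (simp add: power2_eq_square)
qed

theorem ip_act_le_full_norm: "cmod (ip (act x v) w) \<le> full_norm x * nrm v * nrm w"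
proof -
  have "cmod (ip (act x v) w) \<le> nrm (act x v) * nrm w" by (rule Cauchy_Schwarz)
  also have "\<dots> \<le> (full_norm x * nrm v) * nrm w"
    using full_norm_upper[OF cstar_seminorm_op_norm, of x]
    by (intro mult_right_mono order_trans[OF op_norm_upper] nrm_nonneg)
  finally show ?thesis .
qed

end

subsection \<open>Representations of free groups\<close>

definition word_act :: "('a \<Rightarrow> 'v \<Rightarrow> 'v) \<Rightarrow> ('a \<Rightarrow> 'v \<Rightarrow> 'v) \<Rightarrow> ('a \<times> bool) list \<Rightarrow> 'v \<Rightarrow> 'v" where
  "word_act U V w = foldr (\<lambda>(a, b). if b then U a else V a) w"

text \<open>U gives the action of the generators and V that of their inverses. Independence of the
  chosen representative is \<open>free_act_abs\<close>, for U and V inverse to each other.\<close>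

definition free_act :: "('a \<Rightarrow> 'v \<Rightarrow> 'v) \<Rightarrow> ('a \<Rightarrow> 'v \<Rightarrow> 'v) \<Rightarrow> 'a free_group \<Rightarrow> 'v \<Rightarrow> 'v" where
  "free_act U V g = word_act U V (rep_free_group g)"

lemma word_act_word_eq:
  assumes "word_eq u v" "\<And>a x. U a (V a x) = x" "\<And>a x. V a (U a x) = x"
  shows "word_act U V u x = word_act U V v x"
  using assms(1) by (induction arbitrary: x) (simp_all add: word_act_def assms(2,3))

lemma word_eq_rep: "word_eq (rep_free_group (abs_free_group w)) w"
  using Quotient3_rep_abs[OF Quotient3_free_group] word_eq_refl by blast

context
  fixes U V :: "'a \<Rightarrow> 'v \<Rightarrow> 'v"
  assumes UV: "\<And>a x. U a (V a x) = x" "\<And>a x. V a (U a x) = x"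
begin

lemma free_act_abs: "free_act U V (abs_free_group w) x = word_act U V w x"
  unfolding free_act_def by (rule word_act_word_eq[OF word_eq_rep UV])

lemma free_act_zero: "free_act U V 0 x = x"
  by (simp add: zero_free_group.abs_eq free_act_abs word_act_def)

lemma free_act_add: "free_act U V (g + h) x = free_act U V g (free_act U V h x)"
proof -
  obtain u v where "g = abs_free_group u" "h = abs_free_group v"
    by (metis Quotient3_abs_rep[OF Quotient3_free_group])
  then show ?thesis by (simp add: plus_free_group.abs_eq free_act_abs word_act_def)
qed

lemma free_act_uminus_gen: "free_act U V (- free_gen a) x = V a x"
  by (simp add: free_gen.abs_eq uminus_free_group.abs_eq free_act_abs word_act_def word_inverse_def)

end

lemma (in semi_inner) unitary_representation_free_act:
  assumes "\<And>a x. U a (V a x) = x" "\<And>a x. V a (U a x) = x"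
    and "\<And>a. unitary_op (U a)" "\<And>a. unitary_op (V a)"
  shows "unitary_representation scale ip (free_act U V)"
proof unfold_locales
  have "unitary_op (word_act U V w)" for w
  proof (induction w)
    case Nil
    show ?case using unitary_op_id by (simp add: word_act_def id_def)
  next
    case (Cons l w)
    then show ?case
      using unitary_op_compose[of "if snd l then U (fst l) else V (fst l)" "word_act U V w"] assms(3,4)
      by (simp add: word_act_def case_prod_beta comp_def)
  qed
  then show "unitary_op (free_act U V g)" for g by (simp add: free_act_def)
qed (simp_all add: free_act_zero[OF assms(1,2)] free_act_add[OF assms(1,2)])

section \<open>The group algebra inside the group C*-algebra\<close>

lemma group_cstar_of_add: "group_cstar_of (x + y) = group_cstar_of x + group_cstar_of y"
  by transfer (simp add: ga_rel_refl ga_Cauchy_const)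

lemma group_cstar_of_mult: "group_cstar_of (x * y) = group_cstar_of x * group_cstar_of y"
  by transfer (simp add: ga_rel_refl ga_Cauchy_const)

lemma group_cstar_of_zero [simp]: "group_cstar_of 0 = 0"
  by transfer (simp add: ga_rel_refl ga_Cauchy_const)

lemma group_cstar_of_one: "group_cstar_of 1 = 1"
  by transfer (simp add: ga_rel_refl ga_Cauchy_const)

lemma group_cstar_of_star: "group_cstar_of (ga_star x) = adj (group_cstar_of x)"
  by transfer (simp add: ga_rel_refl ga_Cauchy_const)

lemma group_cstar_of_scale: "group_cstar_of (Poly_Mapping.single 0 c * x) = c *\<^sub>C group_cstar_of x"
  by transfer (simp add: ga_rel_refl ga_Cauchy_const)

lemma group_cstar_of_sum: "group_cstar_of (sum f A) = (\<Sum>i\<in>A. group_cstar_of (f i))"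
  by (induction A rule: infinite_finite_induct) (simp_all add: group_cstar_of_add)

lemma group_cstar_of_approx: "\<exists>X. (\<lambda>n. group_cstar_of (X n)) \<longlonglongrightarrow> y"
proof -
  have "\<exists>a. norm (y - group_cstar_of a) < inverse (real (Suc n))" for n
    by (rule group_cstar_of_dense) simp
  then obtain X where X: "\<And>n. norm (y - group_cstar_of (X n)) < inverse (real (Suc n))" by metis
  have "(\<lambda>n. y - group_cstar_of (X n)) \<longlonglongrightarrow> 0"
    by (rule Lim_null_comparison[OF _ LIMSEQ_inverse_real_of_nat])
      (intro always_eventually allI less_imp_le X)
  from tendsto_diff[OF tendsto_const[of y] this] show ?thesis by (intro exI[of _ X]) simp
qed

lemma tendsto_adj: "(f \<longlongrightarrow> a) F \<Longrightarrow> ((\<lambda>x. adj (f x)) \<longlongrightarrow> adj (a :: 'a::cstar_algebra)) F"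
  by (rule bounded_linear.tendsto[OF bounded_linear_adj])

text \<open>The representation acts through the group algebra and is never extended to its
  completion. The Gram factor Y is approximated by group algebra elements instead: their Gram matrix
  \<open>z n\<close> gives a sum of squares, and its distance to x in \<open>full_norm\<close>
  controls the error.\<close>

lemma (in unitary_representation) gram_nonneg:
  fixes p :: nat
  assumes x: "\<And>k l. k < p \<Longrightarrow> l < p \<Longrightarrow> group_cstar_of (x k l) = (\<Sum>m<p. adj (Y m k) * Y m l)"
  shows "0 \<le> Re (\<Sum>k<p. \<Sum>l<p. ip (act (x k l) (\<xi> l)) (\<xi> k))"
proof -
  define y where "y m k = (SOME X. (\<lambda>n. group_cstar_of (X n)) \<longlonglongrightarrow> Y m k)" for m k
  have y: "(\<lambda>n. group_cstar_of (y m k n)) \<longlonglongrightarrow> Y m k" for m k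
    unfolding y_def by (rule someI_ex[OF group_cstar_of_approx])
  define z where "z n k l = (\<Sum>m<p. ga_star (y m k n) * y m l n)" for n k l
  have act_sum: "act (sum f A) v = (\<Sum>i\<in>A. act (f i) v)" for f :: "nat \<Rightarrow> _" and A v
    by (induction A rule: infinite_finite_induct) (simp_all add: act_add)
  have adjoint: "ip (act (ga_star u) v) w = ip v (act u w)" for u v w
    using act_star[of "ga_star u" v w] by (simp add: ga_star_star)
  have z_nonneg: "0 \<le> Re (\<Sum>k<p. \<Sum>l<p. ip (act (z n k l) (\<xi> l)) (\<xi> k))" for n
  proof -
    have "(\<Sum>k<p. \<Sum>l<p. ip (act (z n k l) (\<xi> l)) (\<xi> k))
        = (\<Sum>k<p. \<Sum>l<p. \<Sum>m<p. ip (act (y m l n) (\<xi> l)) (act (y m k n) (\<xi> k)))"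
      by (simp add: z_def act_sum act_mult ip_sum_left adjoint)
    also have "\<dots> = (\<Sum>k<p. \<Sum>m<p. \<Sum>l<p. ip (act (y m l n) (\<xi> l)) (act (y m k n) (\<xi> k)))"
      by (rule sum.cong[OF refl]) (rule sum.swap)
    also have "\<dots> = (\<Sum>m<p. \<Sum>k<p. \<Sum>l<p. ip (act (y m l n) (\<xi> l)) (act (y m k n) (\<xi> k)))"
      by (rule sum.swap)
    also have "\<dots> = (\<Sum>m<p. ip (\<Sum>l<p. act (y m l n) (\<xi> l)) (\<Sum>k<p. act (y m k n) (\<xi> k)))"
      by (simp add: ip_sum_left ip_sum_right)
    finally show ?thesis by (simp add: sum_nonneg ip_nonneg)
  qed
  have "(\<lambda>n. full_norm (z n k l - x k l)) \<longlonglongrightarrow> 0" if "k < p" "l < p" for k l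
  proof -
    have "(\<lambda>n. group_cstar_of (z n k l)) \<longlonglongrightarrow> group_cstar_of (x k l)"
      unfolding x[OF that] z_def group_cstar_of_sum group_cstar_of_mult group_cstar_of_star
      by (intro tendsto_sum tendsto_mult tendsto_adj y)
    from tendsto_norm_zero[OF LIM_zero[OF this]] show ?thesis
      unfolding group_cstar_of_diff[symmetric] norm_group_cstar_of .
  qed
  then have lim: "(\<lambda>n. \<Sum>k<p. \<Sum>l<p. full_norm (z n k l - x k l) * nrm (\<xi> l) * nrm (\<xi> k)) \<longlonglongrightarrow> 0"
    by (intro tendsto_null_sum tendsto_mult_left_zero) auto
  have "- (\<Sum>k<p. \<Sum>l<p. full_norm (z n k l - x k l) * nrm (\<xi> l) * nrm (\<xi> k))
      \<le> Re (\<Sum>k<p. \<Sum>l<p. ip (act (x k l) (\<xi> l)) (\<xi> k))" for n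
  proof -
    let ?w = "\<lambda>k l. ip (act (z n k l - x k l) (\<xi> l)) (\<xi> k)"
    have "(\<Sum>k<p. \<Sum>l<p. ip (act (z n k l) (\<xi> l)) (\<xi> k))
        = (\<Sum>k<p. \<Sum>l<p. ?w k l + ip (act (x k l) (\<xi> l)) (\<xi> k))"
      by (intro sum.cong refl) (simp flip: ip_add_left act_add)
    then have "Re (\<Sum>k<p. \<Sum>l<p. ip (act (z n k l) (\<xi> l)) (\<xi> k))
        = Re (\<Sum>k<p. \<Sum>l<p. ?w k l) + Re (\<Sum>k<p. \<Sum>l<p. ip (act (x k l) (\<xi> l)) (\<xi> k))"
      by (simp only: sum.distrib plus_complex.sel)
    moreover have "Re (\<Sum>k<p. \<Sum>l<p. ?w k l)
        \<le> (\<Sum>k<p. \<Sum>l<p. full_norm (z n k l - x k l) * nrm (\<xi> l) * nrm (\<xi> k))"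
      unfolding Re_sum by (intro sum_mono order_trans[OF complex_Re_le_cmod] ip_act_le_full_norm)
    ultimately show ?thesis using z_nonneg[of n] by linarith
  qed
  then have "- 0 \<le> Re (\<Sum>k<p. \<Sum>l<p. ip (act (x k l) (\<xi> l)) (\<xi> k))"
    by (intro LIMSEQ_le_const2[OF tendsto_minus[OF lim]]) blast
  then show ?thesis by simp
qed

section \<open>Positive semidefinite matrices\<close>

definition psd_form :: "'i set \<Rightarrow> ('i \<Rightarrow> 'i \<Rightarrow> complex) \<Rightarrow> ('i \<Rightarrow> complex) \<Rightarrow> complex" where
  "psd_form I X v = (\<Sum>i\<in>I. \<Sum>j\<in>I. cnj (v i) * X i j * v j)"

text \<open>Polarisation: the form is real at e_i + c e_j, and c = 1 and c = i give the two halves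
  of the equation.\<close>

lemma psd_hermitian:
  assumes "finite I" and psd: "\<And>v. psd_form I X v \<in> \<real>\<^sub>\<ge>\<^sub>0" and ij: "i \<in> I" "j \<in> I"
  shows "X j i = cnj (X i j)"
proof -
  let ?e = "\<lambda>c k. (if k = i then 1 else 0) + (if k = j then c else 0)"
  have form: "psd_form I X (?e c) = X i i + c * X i j + cnj c * X j i + cnj c * c * X j j" for c
  proof -
    define S where "S k = (\<Sum>l\<in>I. X k l * ?e c l)" for k
    have "psd_form I X (?e c) = (\<Sum>k\<in>I. cnj (?e c k) * S k)"
      unfolding psd_form_def S_def sum_distrib_left mult.assoc ..
    also have "\<dots> = (\<Sum>k\<in>I. (if k = i then S k else 0) + (if k = j then cnj c * S k else 0))"
      by (intro sum.cong refl) (simp add: distrib_right)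
    also have "\<dots> = S i + cnj c * S j"
      using assms(1) ij by (simp add: sum.distrib)
    finally have "psd_form I X (?e c) = S i + cnj c * S j" .
    moreover have "S k = X k i + c * X k j" for k
      unfolding S_def distrib_left sum.distrib using assms(1) ij
      by (simp add: if_distrib[of "\<lambda>x. _ * x"] mult.commute cong: if_cong)
    ultimately show ?thesis by (simp add: distrib_left)
  qed
  have diag: "Im (X k k) = 0" if k: "k \<in> I" for k
  proof -
    have "psd_form I X (\<lambda>l. if l = k then 1 else 0) = (\<Sum>i\<in>I. cnj (if i = k then 1 else 0) * X i k)"
      unfolding psd_form_def using assms(1) k
      by (intro sum.cong refl) (simp add: if_distrib[of "\<lambda>x. _ * x"] cong: if_cong)
    also have "\<dots> = X k k"
      using assms(1) k by (simp add: if_distrib[of cnj] if_distrib[of "\<lambda>x. x * _"] cong: if_cong)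
    finally have "psd_form I X (\<lambda>l. if l = k then 1 else 0) = X k k" .
    then show ?thesis using psd[of "\<lambda>l. if l = k then 1 else 0"] by (simp add: complex_nonneg_Reals_iff)
  qed
  have "Im (X i i + c * X i j + cnj c * X j i + cnj c * c * X j j) = 0" for c
    using psd[of "?e c"] unfolding form by (simp add: complex_nonneg_Reals_iff)
  from this[of 1] this[of \<i>] show ?thesis
    using diag ij by (simp add: complex_eq_iff)
qed

text \<open>Cholesky factorisation. The new index q contributes one row of the factor, and the Schur
  complement \<open>X'\<close> is left to the induction hypothesis.\<close>

lemma psd_gram:
  assumes "finite I" and "\<And>v. psd_form I X v \<in> \<real>\<^sub>\<ge>\<^sub>0"
  shows "\<exists>V. \<forall>i\<in>I. \<forall>j\<in>I. X i j = (\<Sum>r\<in>I. cnj (V r i) * V r j)"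
  using assms
proof (induction I arbitrary: X rule: finite_induct)
  case empty
  then show ?case by simp
next
  case (insert q I)
  let ?I = "insert q I"
  have fin: "finite ?I" using insert by simp
  note herm = psd_hermitian[OF fin insert.prems]
  define d where "d = Re (X q q)"
  have Xqq: "X q q = of_real d" using herm[of q q] by (simp add: d_def complex_eq_iff)
  define r where "r w = (\<Sum>j\<in>I. X q j * w j)" for w
  have form: "psd_form ?I X (w(q := t)) = cnj t * d * t + cnj t * r w + t * cnj (r w) + psd_form I X w" for w t
  proof -
    have upd: "(w(q := t)) i = w i" if "i \<in> I" for i using that insert by auto
    have "psd_form ?I X (w(q := t)) = cnj t * X q q * t + (\<Sum>j\<in>I. cnj t * X q j * w j)
        + (\<Sum>i\<in>I. cnj (w i) * X i q * t + (\<Sum>j\<in>I. cnj (w i) * X i j * w j))"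
      unfolding psd_form_def using insert upd by (simp cong: sum.cong)
    moreover have "(\<Sum>i\<in>I. cnj (w i) * X i q * t) = t * cnj (r w)"
      unfolding r_def cnj_sum sum_distrib_left
      by (intro sum.cong refl) (simp add: herm[of q])
    ultimately show ?thesis
      by (simp add: sum.distrib r_def sum_distrib_left mult.assoc Xqq psd_form_def)
  qed
  have nonneg: "0 \<le> Re (cnj t * d * t + cnj t * r w + t * cnj (r w) + psd_form I X w)" for w t
    using insert.prems[of "w(q := t)"] unfolding form by (simp add: complex_nonneg_Reals_iff)
  have d: "0 \<le> d" using nonneg[of 1 "\<lambda>_. 0"] by (simp add: r_def psd_form_def)
  \<comment> \<open>A zero on the diagonal kills its row: otherwise the form is negative at e_j + t
    e_q for t = -s X_qj with s large.\<close>
  have r0: "X q j = 0" if d0: "d = 0" and j: "j \<in> ?I" for j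
  proof (cases "j = q")
    case False
    with j have j: "j \<in> I" by simp
    let ?w = "\<lambda>i. if i = j then 1 else 0"
    have r: "r ?w = X q j" using insert j by (simp add: r_def if_distrib[of "\<lambda>x. _ * x"] cong: if_cong)
    let ?m = "(cmod (X q j))\<^sup>2" and ?f = "Re (psd_form I X ?w)"
    have "0 \<le> ?f - 2 * s * ?m" for s :: real
    proof -
      have "cnj (- of_real s * X q j) * X q j + (- of_real s * X q j) * cnj (X q j) = of_real (- 2 * s * ?m)"
        by (simp add: complex_norm_square algebra_simps del: of_real_power)
      then have "Re (cnj (- of_real s * X q j) * X q j + (- of_real s * X q j) * cnj (X q j)) = - 2 * s * ?m"
        by (simp only: Re_complex_of_real)
      then show ?thesis
        using nonneg[of "- of_real s * X q j" ?w] unfolding r d0 plus_complex.sel by simp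
    qed
    note * = this
    show ?thesis
    proof (rule ccontr)
      assume "X q j \<noteq> 0"
      then have eq: "2 * ((?f + 1) / ?m) * ?m = 2 * (?f + 1)" by simp
      have "0 \<le> ?f - 2 * (?f + 1)" using *[of "(?f + 1) / ?m"] unfolding eq .
      then show False using *[of 0] by simp
    qed
  qed (use d0 Xqq in simp)
  \<comment> \<open>For \<open>d = 0\<close> the division yields 0, as it should, since row q
    vanishes in that case.\<close>
  define X' where "X' i j = X i j - X i q * X q j / of_real d" for i j
  have "psd_form I X' w \<in> \<real>\<^sub>\<ge>\<^sub>0" for w
  proof -
    have "psd_form I X' w = psd_form I X w - (\<Sum>i\<in>I. \<Sum>j\<in>I. (cnj (w i) * X i q) * (X q j * w j) / of_real d)"
      by (simp add: psd_form_def X'_def algebra_simps sum_subtractf)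
    also have "(\<Sum>i\<in>I. \<Sum>j\<in>I. (cnj (w i) * X i q) * (X q j * w j) / of_real d)
        = (\<Sum>i\<in>I. cnj (w i) * X i q) * r w / of_real d"
      by (simp add: r_def sum_product sum_divide_distrib)
    also have "(\<Sum>i\<in>I. cnj (w i) * X i q) = cnj (r w)"
      unfolding r_def cnj_sum by (intro sum.cong refl) (simp add: herm[of q])
    finally have "psd_form I X' w = psd_form I X w - cnj (r w) * r w / of_real d" .
    \<comment> \<open>The value inserted at q is the minimiser of the form for the given w when d >
      0.\<close>
    also have "\<dots> = psd_form ?I X (w(q := - r w / of_real d))"
      unfolding form by (cases "d = 0") (simp_all add: field_simps)
    finally show ?thesis using insert.prems by simp
  qed
  then obtain V where V: "\<And>i j. i \<in> I \<Longrightarrow> j \<in> I \<Longrightarrow> X' i j = (\<Sum>r\<in>I. cnj (V r i) * V r j)"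
    using insert.IH by blast
  define V' where "V' r i = (if r = q then X q i / of_real (sqrt d) else if i = q then 0 else V r i)" for r i
  have sq: "of_real (sqrt d) * of_real (sqrt d) = (of_real d :: complex)"
    using d by (simp flip: of_real_mult)
  have "X i j = (\<Sum>r\<in>?I. cnj (V' r i) * V' r j)" if ij: "i \<in> ?I" "j \<in> ?I" for i j
  proof -
    have "(\<Sum>r\<in>?I. cnj (V' r i) * V' r j)
        = cnj (V' q i) * V' q j + (\<Sum>r\<in>I. cnj (V' r i) * V' r j)"
      using insert by simp
    also have "(\<Sum>r\<in>I. cnj (V' r i) * V' r j) = (if i = q \<or> j = q then 0 else X' i j)"
    proof (cases "i = q \<or> j = q")
      case True
      then have "cnj (V' r i) * V' r j = 0" if "r \<in> I" for r
        using that insert by (auto simp: V'_def)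
      then show ?thesis using True by (simp only: sum.neutral_const cong: sum.cong) simp
    next
      case False
      then have "(\<Sum>r\<in>I. cnj (V' r i) * V' r j) = (\<Sum>r\<in>I. cnj (V r i) * V r j)"
        using insert by (intro sum.cong refl) (auto simp: V'_def)
      then show ?thesis using False V ij by auto
    qed
    also have "cnj (V' q i) * V' q j = X i q * X q j / of_real d"
      using herm[of q i] ij by (simp add: V'_def flip: sq)
    finally show ?thesis
      using ij r0 herm[of q i] Xqq by (cases "d = 0") (auto simp: X'_def)
  qed
  then show ?case by blast
qed

section \<open>The map from the matrices\<close>

definition mat_scale :: "complex \<Rightarrow> complex^'n^'n \<Rightarrow> complex^'n^'n" where
  "mat_scale c A = (\<chi> a b. c * A $ a $ b)"

definition mat_adj :: "complex^'n^'n \<Rightarrow> complex^'n^'n" where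
  "mat_adj A = (\<chi> a b. cnj (A $ b $ a))"

lemma mat_nth [simp]: "mat_scale c A $ a $ b = c * A $ a $ b" "mat_adj A $ a $ b = cnj (A $ b $ a)"
  by (simp_all add: mat_scale_def mat_adj_def)

lemma matrix_eqI: "(\<And>a b. A $ a $ b = B $ a $ b) \<Longrightarrow> A = (B :: 'a^'n^'m)"
  by (simp add: vec_eq_iff)

lemma mat_adj_simps: "mat_adj (A + B) = mat_adj A + mat_adj B" "mat_adj (mat_adj A) = A"
  "mat_adj (mat_scale c A) = mat_scale (cnj c) (mat_adj A)" "mat_adj 0 = 0" "mat_adj (mat 1) = mat 1"
  "mat_adj (- A) = - mat_adj A" "mat_adj (A - B) = mat_adj A - mat_adj B"
  by (auto intro!: matrix_eqI simp: mat_def)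

lemma mat_scale_simps: "mat_scale c (A + B) = mat_scale c A + mat_scale c B"
  "mat_scale (c + d) A = mat_scale c A + mat_scale d A" "mat_scale c (mat_scale d A) = mat_scale (c * d) A"
  "mat_scale 1 A = A" "mat_scale c 0 = 0"
  by (auto intro!: matrix_eqI simp: algebra_simps)

lemma matrix_system_simps [simp]:
  "os_space (matrix_system :: (complex^'n^'n) operator_system) = UNIV"
  "os_zero (matrix_system :: (complex^'n^'n) operator_system) = 0"
  "os_add (matrix_system :: (complex^'n^'n) operator_system) = (+)"
  "os_scale (matrix_system :: (complex^'n^'n) operator_system) = mat_scale"
  "os_adj (matrix_system :: (complex^'n^'n) operator_system) = mat_adj"
  "os_unit (matrix_system :: (complex^'n^'n) operator_system) = mat 1"
  by (simp_all add: matrix_system_def mat_scale_def mat_adj_def fun_eq_iff)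

definition mform :: "nat \<Rightarrow> (nat \<Rightarrow> nat \<Rightarrow> complex^'n^'n) \<Rightarrow> (nat \<Rightarrow> 'n \<Rightarrow> complex) \<Rightarrow> complex" where
  "mform p X v = (\<Sum>i<p. \<Sum>j<p. \<Sum>a\<in>UNIV. \<Sum>b\<in>UNIV. cnj (v i a) * X i j $ a $ b * v j b)"

lemma os_pos_matrix_iff: "os_pos matrix_system p X \<longleftrightarrow> (\<forall>v. mform p X v \<in> \<real>\<^sub>\<ge>\<^sub>0)"
proof
  assume *: "os_pos matrix_system p X"
  show "\<forall>v. mform p X v \<in> \<real>\<^sub>\<ge>\<^sub>0"
  proof
    fix v :: "nat \<Rightarrow> 'a \<Rightarrow> complex"
    show "mform p X v \<in> \<real>\<^sub>\<ge>\<^sub>0"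
      using *[unfolded matrix_system_def, simplified, rule_format, of "\<lambda>i. \<chi> a. v i a"] by (simp add: mform_def)
  qed
next
  assume "\<forall>v. mform p X v \<in> \<real>\<^sub>\<ge>\<^sub>0"
  then show "os_pos matrix_system p X" by (simp add: matrix_system_def mform_def)
qed

lemma mform_add: "mform p (\<lambda>i j. X i j + Y i j) v = mform p X v + mform p Y v"
  by (simp add: mform_def algebra_simps sum.distrib)

lemma mform_scale: "mform p (\<lambda>i j. mat_scale c (X i j)) v = c * mform p X v"
  by (simp add: mform_def sum_distrib_left mult_ac)

lemma mform_cong: "(\<And>i j. i < p \<Longrightarrow> j < p \<Longrightarrow> X i j = Y i j) \<Longrightarrow> mform p X v = mform p Y v"
  by (simp add: mform_def)

lemma os_pos_matrix_add:
  "os_pos matrix_system p X \<Longrightarrow> os_pos matrix_system p Y \<Longrightarrow> os_pos matrix_system p (\<lambda>i j. X i j + Y i j)"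
  by (auto simp: os_pos_matrix_iff mform_add complex_nonneg_Reals_iff)

lemma os_pos_matrix_scale:
  "os_pos matrix_system p X \<Longrightarrow> 0 \<le> r \<Longrightarrow> os_pos matrix_system p (\<lambda>i j. mat_scale (of_real r) (X i j))"
  by (auto simp: os_pos_matrix_iff mform_scale complex_nonneg_Reals_iff)

lemma os_pos_matrix_cong:
  "(\<And>i j. i < p \<Longrightarrow> j < p \<Longrightarrow> X i j = Y i j) \<Longrightarrow> os_pos matrix_system p X \<Longrightarrow> os_pos matrix_system p Y"
  using mform_cong[of p X Y] by (simp add: os_pos_matrix_iff)

definition unit_mat :: "nat \<Rightarrow> nat \<Rightarrow> complex^'n^'n" where
  "unit_mat i j = (if i = j then mat 1 else 0)"

lemma mform_unit: "mform p unit_mat v = (\<Sum>i<p. \<Sum>a\<in>UNIV. of_real ((cmod (v i a))\<^sup>2))"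
proof -
  have "mform p unit_mat v = (\<Sum>i<p. \<Sum>j<p. if i = j then \<Sum>a\<in>UNIV. cnj (v i a) * v i a else 0)"
    unfolding mform_def
  proof (intro sum.cong refl)
    fix i j
    have "(\<Sum>b\<in>UNIV. cnj (v i a) * unit_mat i j $ a $ b * v j b)
        = (\<Sum>b\<in>UNIV. if a = b then (if i = j then cnj (v i a) * v i a else 0) else 0)" for a
      by (intro sum.cong refl) (auto simp: unit_mat_def mat_def)
    then show "(\<Sum>a\<in>UNIV. \<Sum>b\<in>UNIV. cnj (v i a) * unit_mat i j $ a $ b * v j b)
        = (if i = j then \<Sum>a\<in>UNIV. cnj (v i a) * v i a else 0)" by simp
  qed
  also have "\<dots> = (\<Sum>i<p. \<Sum>a\<in>UNIV. cnj (v i a) * v i a)" by simp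
  also have "\<dots> = (\<Sum>i<p. \<Sum>a\<in>UNIV. of_real ((cmod (v i a))\<^sup>2))"
    unfolding complex_norm_square by (simp add: mult.commute)
  finally show ?thesis .
qed

lemma sum_Times: "(\<Sum>x\<in>A \<times> B. f x) = (\<Sum>i\<in>A. \<Sum>a\<in>B. f (i, a))"
  by (simp add: sum.cartesian_product)

lemma mform_gram:
  fixes X :: "nat \<Rightarrow> nat \<Rightarrow> complex^'n^'n"
  shows "mform p X v = psd_form ({..<p} \<times> UNIV) (\<lambda>x y. X (fst x) (fst y) $ snd x $ snd y) (\<lambda>x. v (fst x) (snd x))"
proof -
  have "mform p X v = (\<Sum>i<p. \<Sum>a\<in>UNIV. \<Sum>j<p. \<Sum>b\<in>UNIV. cnj (v i a) * X i j $ a $ b * v j b)"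
    unfolding mform_def by (rule sum.cong[OF refl]) (rule sum.swap)
  then show ?thesis by (simp add: psd_form_def sum_Times)
qed

lemma os_pos_matrix_gram:
  fixes X :: "nat \<Rightarrow> nat \<Rightarrow> complex^'n^'n"
  assumes "os_pos matrix_system p X"
  shows "\<exists>V. \<forall>x\<in>{..<p} \<times> UNIV. \<forall>y\<in>{..<p} \<times> UNIV.
    X (fst x) (fst y) $ snd x $ snd y = (\<Sum>r\<in>{..<p} \<times> (UNIV :: 'n set). cnj (V r x) * V r y)"
proof -
  have "psd_form ({..<p} \<times> UNIV) (\<lambda>x y. X (fst x) (fst y) $ snd x $ snd y) v \<in> \<real>\<^sub>\<ge>\<^sub>0" for v
    using assms mform_gram[of p X "\<lambda>i a. v (i, a)"] by (simp add: os_pos_matrix_iff) metis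
  from psd_gram[OF _ this] show ?thesis by simp
qed

lemma os_pos_matrix_hermitian:
  fixes X :: "nat \<Rightarrow> nat \<Rightarrow> complex^'n^'n"
  assumes "os_pos matrix_system p X" "i < p" "j < p"
  shows "mat_adj (X i j) = X j i"
proof -
  obtain V where V: "\<forall>x\<in>{..<p} \<times> UNIV. \<forall>y\<in>{..<p} \<times> UNIV.
    X (fst x) (fst y) $ snd x $ snd y = (\<Sum>r\<in>{..<p} \<times> (UNIV :: 'n set). cnj (V r x) * V r y)"
    using os_pos_matrix_gram[OF assms(1)] by blast
  show ?thesis
  proof (rule matrix_eqI)
    fix a b
    have "X i j $ b $ a = (\<Sum>r\<in>{..<p} \<times> (UNIV :: 'n set). cnj (V r (i, b)) * V r (j, a))"
      "X j i $ a $ b = (\<Sum>r\<in>{..<p} \<times> (UNIV :: 'n set). cnj (V r (j, a)) * V r (i, b))"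
      using V[rule_format, of "(i, b)" "(j, a)"] V[rule_format, of "(j, a)" "(i, b)"] assms(2,3) by auto
    then show "mat_adj (X i j) $ a $ b = X j i $ a $ b" by (simp add: cnj_sum mult.commute)
  qed
qed

section \<open>The universal unitaries and the positivity of \<open>phi_map\<close>\<close>

definition gen_word :: "'g option \<Rightarrow> 'g free_group" where
  "gen_word a = (case a of None \<Rightarrow> 0 | Some g \<Rightarrow> free_gen g)"

lemma univ_unitary_eq: "univ_unitary a = group_cstar_of (Poly_Mapping.single (gen_word a) 1)"
  by (cases a) (simp_all add: univ_unitary_def gen_word_def group_cstar_of_one)

lemma univ_unitary_mult_adj:
  "univ_unitary a * adj (univ_unitary b) = group_cstar_of (Poly_Mapping.single (gen_word a - gen_word b) 1)"
  by (simp add: univ_unitary_eq ga_star_single mult_single flip: group_cstar_of_star group_cstar_of_mult)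

lemma univ_unitary_inverse [simp]:
  "univ_unitary a * adj (univ_unitary a) = 1" "adj (univ_unitary a) * univ_unitary a = 1"
  by (simp_all add: univ_unitary_eq ga_star_single mult_single group_cstar_of_one
      flip: group_cstar_of_star group_cstar_of_mult)

lemma one_plus_of_nat_neq_0 [simp]: "1 + complex_of_nat n \<noteq> 0"
  by (metis of_nat_Suc of_nat_neq_0)

lemma phi_map_add: "phi_map (A + B) = phi_map A + phi_map (B :: complex^('g::finite option)^('g option))"
  by (simp add: phi_map_def scaleC_add_left sum.distrib add_divide_distrib)

lemma phi_map_scale: "phi_map (mat_scale c A) = c *\<^sub>C phi_map (A :: complex^('g::finite option)^('g option))"
  by (simp add: phi_map_def complex_vector.scale_sum_right scaleC_scaleC mult.assoc)

lemma phi_map_zero [simp]: "phi_map (0 :: complex^('g::finite option)^('g option)) = 0"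
  by (simp add: phi_map_def)

lemma phi_map_adj: "phi_map (mat_adj A) = adj (phi_map (A :: complex^('g::finite option)^('g option)))"
  unfolding phi_map_def adj_sum by (subst sum.swap) (simp add: adj_scaleC adj_mult adj_adj)

lemma phi_map_diag:
  fixes A :: "complex^('g::finite option)^('g option)"
  assumes "\<And>i j. i \<noteq> j \<Longrightarrow> A $ i $ j = 0"
  shows "phi_map A = (trace A / of_nat CARD('g option)) *\<^sub>C 1"
proof -
  have "(\<Sum>j\<in>UNIV. A $ i $ j *\<^sub>C (1 / of_nat CARD('g option)) *\<^sub>C (univ_unitary i * adj (univ_unitary j)))
      = (\<Sum>j\<in>UNIV. if i = j then (A $ i $ i / of_nat CARD('g option)) *\<^sub>C 1 else 0)" for i :: "'g option"
    using assms by (intro sum.cong refl) (auto simp: scaleC_scaleC)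
  then show ?thesis
    by (simp add: phi_map_def trace_def sum_divide_distrib flip: complex_vector.scale_sum_left)
qed

lemma phi_map_one: "phi_map (mat 1 :: complex^('g::finite option)^('g option)) = 1"
  by (subst phi_map_diag) (simp_all add: mat_def trace_def scaleC_one)

lemma phi_map_diag_trace_zero:
  "A \<in> diag_trace_zero \<Longrightarrow> phi_map (A :: complex^('g::finite option)^('g option)) = 0"
  by (simp add: diag_trace_zero_def phi_map_diag)

lemma W_space_eq: "(W_space :: 'g::finite free_group group_cstar set) = range phi_map"
proof
  let ?S = "{univ_unitary i * adj (univ_unitary j) | i (j :: 'g option). True}"
  have "phi_map A \<in> W_space" for A :: "complex^('g option)^('g option)"
    unfolding phi_map_def W_space_def
    by (intro complex_vector.span_sum complex_vector.span_scale complex_vector.span_base) blast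
  then show "range phi_map \<subseteq> (W_space :: 'g free_group group_cstar set)" by blast
  have "complex_vector.subspace (range (phi_map :: complex^('g option)^('g option) \<Rightarrow> _))"
    unfolding complex_vector.subspace_def
    by (auto simp flip: phi_map_add phi_map_scale intro: rangeI[of phi_map 0, simplified])
  moreover have "?S \<subseteq> range phi_map"
  proof
    fix x assume "x \<in> ?S"
    then obtain i j where "x = univ_unitary i * adj (univ_unitary (j :: 'g option))" by blast
    then have "x = phi_map (mat_scale (of_nat CARD('g option)) (matrix_unit i j))"
      unfolding phi_map_scale phi_map_matrix_unit by (simp add: scaleC_scaleC scaleC_one)
    then show "x \<in> range phi_map" by blast
  qed
  ultimately show "W_space \<subseteq> range (phi_map :: complex^('g option)^('g option) \<Rightarrow> _)"
    unfolding W_space_def by (intro complex_vector.span_minimal)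
qed

text \<open>The coefficients w_a w_b^* of \<open>phi_map\<close> form a Gram matrix themselves. With
  V a Gram factor of X and \<open>y (i, a)\<close> the product of the adjoint of w_a with v_i, the
  whole sum is 1/n times the sum of \<open>adj (z r) * z r\<close>.\<close>

lemma phi_map_state_nonneg:
  fixes X :: "nat \<Rightarrow> nat \<Rightarrow> complex^('g::finite option)^('g option)"
  assumes X: "os_pos matrix_system p X" and s: "state s"
  shows "0 \<le> Re (s (\<Sum>i<p. \<Sum>j<p. adj (v i) * phi_map (X i j) * v j))"
proof -
  let ?I = "{..<p} \<times> (UNIV :: 'g option set)" and ?N = "of_nat CARD('g option) :: complex"
  obtain V where V: "\<forall>x\<in>?I. \<forall>y\<in>?I.
    X (fst x) (fst y) $ snd x $ snd y = (\<Sum>r\<in>?I. cnj (V r x) * V r y)"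
    using os_pos_matrix_gram[OF X] by blast
  define y where "y x = adj (univ_unitary (snd x)) * v (fst x)" for x
  define z where "z r = (\<Sum>x\<in>?I. V r x *\<^sub>C y x)" for r
  have "(\<Sum>i<p. \<Sum>j<p. adj (v i) * phi_map (X i j) * v j)
      = (\<Sum>i<p. \<Sum>j<p. \<Sum>a\<in>UNIV. \<Sum>b\<in>UNIV. X i j $ a $ b *\<^sub>C (1 / ?N) *\<^sub>C (adj (y (i, a)) * y (j, b)))"
    by (simp add: phi_map_def y_def sum_distrib_left sum_distrib_right scaleC_mult_left scaleC_mult_right
        adj_mult adj_adj mult.assoc)
  also have "\<dots> = (\<Sum>i<p. \<Sum>a\<in>UNIV. \<Sum>j<p. \<Sum>b\<in>UNIV. X i j $ a $ b *\<^sub>C (1 / ?N) *\<^sub>C (adj (y (i, a)) * y (j, b)))"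
    by (rule sum.cong[OF refl]) (rule sum.swap)
  also have "\<dots> = (\<Sum>x\<in>?I. \<Sum>x'\<in>?I. X (fst x) (fst x') $ snd x $ snd x' *\<^sub>C (1 / ?N) *\<^sub>C (adj (y x) * y x'))"
    by (simp add: sum_Times)
  also have "\<dots> = (\<Sum>x\<in>?I. \<Sum>x'\<in>?I. \<Sum>r\<in>?I. (1 / ?N) *\<^sub>C (adj (V r x *\<^sub>C y x) * (V r x' *\<^sub>C y x')))"
  proof (intro sum.cong refl)
    fix x x' assume "x \<in> ?I" "x' \<in> ?I"
    then have eq: "X (fst x) (fst x') $ snd x $ snd x' = (\<Sum>r\<in>?I. cnj (V r x) * V r x')" using V by blast
    show "X (fst x) (fst x') $ snd x $ snd x' *\<^sub>C (1 / ?N) *\<^sub>C (adj (y x) * y x')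
        = (\<Sum>r\<in>?I. (1 / ?N) *\<^sub>C (adj (V r x *\<^sub>C y x) * (V r x' *\<^sub>C y x')))"
      unfolding eq complex_vector.scale_sum_left
      by (simp add: adj_scaleC scaleC_mult_left scaleC_mult_right scaleC_scaleC mult_ac)
  qed
  also have "\<dots> = (\<Sum>x\<in>?I. \<Sum>r\<in>?I. \<Sum>x'\<in>?I. (1 / ?N) *\<^sub>C (adj (V r x *\<^sub>C y x) * (V r x' *\<^sub>C y x')))"
    by (rule sum.cong[OF refl]) (rule sum.swap)
  also have "\<dots> = (\<Sum>r\<in>?I. \<Sum>x\<in>?I. \<Sum>x'\<in>?I. (1 / ?N) *\<^sub>C (adj (V r x *\<^sub>C y x) * (V r x' *\<^sub>C y x')))"
    by (rule sum.swap)
  also have "\<dots> = (\<Sum>r\<in>?I. (1 / ?N) *\<^sub>C (adj (z r) * z r))"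
    by (simp add: z_def adj_sum sum_product complex_vector.scale_sum_right)
  finally have "s (\<Sum>i<p. \<Sum>j<p. adj (v i) * phi_map (X i j) * v j) = (\<Sum>r\<in>?I. (1 / ?N) * s (adj (z r) * z r))"
    by (simp add: state_sum[OF s] stateD(2)[OF s])
  also have "Re \<dots> = (\<Sum>r\<in>?I. Re (s (adj (z r) * z r)) / real CARD('g option))"
    by (simp add: Re_sum del: of_nat_Suc)
  finally show ?thesis
    using state_square[OF s] by (simp add: sum_nonneg complex_nonneg_Reals_iff)
qed

lemma W_system_simps [simp]:
  "os_space W_system = W_space" "os_zero W_system = 0" "os_add W_system = (+)"
  "os_scale W_system = scaleC" "os_adj W_system = adj" "os_unit W_system = 1"
  by (simp_all add: W_system_def cstar_system_def)

lemma os_pos_W_iff: "os_pos W_system p X \<longleftrightarrow> (\<forall>i<p. \<forall>j<p. X i j \<in> W_space) \<and>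
    (\<exists>Y. \<forall>i<p. \<forall>j<p. X i j = (\<Sum>k<p. adj (Y k i) * Y k j))"
  by (simp add: W_system_def cstar_system_def)

text \<open>\<open>phi_map\<close> kills K and sends the unit to 1, so in each state the form of the
  image of H is at least -\<epsilon> times a number independent of \<epsilon>. The limit is taken in
  the state, and \<open>matrix_sqrt\<close> leads back to a Gram factor.\<close>

lemma phi_map_pos_of_approx:
  fixes H :: "nat \<Rightarrow> nat \<Rightarrow> complex^('g::finite option)^('g option)"
  assumes herm: "\<And>i j. i < p \<Longrightarrow> j < p \<Longrightarrow> H i j = mat_adj (H j i)"
    and approx: "\<And>\<epsilon>. 0 < \<epsilon> \<Longrightarrow> \<exists>K. (\<forall>i<p. \<forall>j<p. K i j \<in> diag_trace_zero) \<and>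
      os_pos matrix_system p (\<lambda>i j. mat_scale (of_real \<epsilon>) (unit_mat i j) + H i j + K i j)"
  shows "os_pos W_system p (\<lambda>i j. phi_map (H i j))"
proof -
  have pos: "0 \<le> Re (s (\<Sum>i<p. \<Sum>j<p. adj (v i) * phi_map (H i j) * v j))" if s: "state s" for s v
  proof -
    let ?q = "s (\<Sum>i<p. adj (v i) * v i)" and ?h = "s (\<Sum>i<p. \<Sum>j<p. adj (v i) * phi_map (H i j) * v j)"
    have le: "0 \<le> \<epsilon> * Re ?q + Re ?h" if e: "0 < \<epsilon>" for \<epsilon>
    proof -
      obtain K where K: "\<And>i j. i < p \<Longrightarrow> j < p \<Longrightarrow> K i j \<in> diag_trace_zero"
        and K': "os_pos matrix_system p (\<lambda>i j. mat_scale (of_real \<epsilon>) (unit_mat i j) + H i j + K i j)"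
        using approx[OF e] by blast
      have "(\<Sum>i<p. \<Sum>j<p. adj (v i) * phi_map (mat_scale (of_real \<epsilon>) (unit_mat i j) + H i j + K i j) * v j)
        = (\<Sum>i<p. \<Sum>j<p. (if i = j then \<epsilon> *\<^sub>R (adj (v i) * v i) else 0) + adj (v i) * phi_map (H i j) * v j)"
        by (intro sum.cong refl)
          (simp add: phi_map_add phi_map_scale phi_map_diag_trace_zero K unit_mat_def phi_map_one
            distrib_left distrib_right scaleC_mult_left scaleC_mult_right scaleR_scaleC)
      also have "\<dots> = \<epsilon> *\<^sub>R (\<Sum>i<p. adj (v i) * v i) + (\<Sum>i<p. \<Sum>j<p. adj (v i) * phi_map (H i j) * v j)"
        by (simp add: sum.distrib scaleR_sum_right)
      finally show ?thesis
        using phi_map_state_nonneg[OF K' s, of v] by (simp add: stateD(1)[OF s] state_scaleR[OF s])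
    qed
    show ?thesis
    proof (rule ccontr)
      assume neg: "\<not> 0 \<le> Re ?h"
      have "0 \<le> Re ?q" using state_square[OF s] by (simp add: state_sum[OF s] Re_sum sum_nonneg complex_nonneg_Reals_iff)
      \<comment> \<open>Makes \<epsilon> (q + 1) half of -Re h; the summand 1 is there because q may
        vanish.\<close>
      moreover define \<epsilon> where "\<epsilon> = - Re ?h / (2 * (Re ?q + 1))"
      moreover from calculation have "0 < \<epsilon>" using neg by (auto simp: \<epsilon>_def intro!: divide_neg_pos)
      ultimately have "0 < \<epsilon>" "\<epsilon> * Re ?q \<le> \<epsilon> * (Re ?q + 1)" "\<epsilon> * (Re ?q + 1) = - Re ?h / 2"
        by (simp_all add: field_simps)
      then show False using le[of \<epsilon>] neg by linarith
    qed
  qed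
  have "\<exists>Y. \<forall>i<p. \<forall>j<p. phi_map (H i j) = (\<Sum>k<p. adj (Y k i) * Y k j)"
  proof (rule matrix_sqrt[where h = "\<lambda>i j. phi_map (H i j)" and p = p])
    show "adj (phi_map (H i j)) = phi_map (H j i)" if "i < p" "j < p" for i j
      using herm[OF that] by (metis phi_map_adj mat_adj_simps(2))
  qed (auto intro: pos)
  then show ?thesis by (auto simp: os_pos_W_iff W_space_eq)
qed

section \<open>Lifting positive elements along the quotient map\<close>

lemma vector_space_matrices:
  "vector_space (\<lambda>c (X :: nat \<Rightarrow> nat \<Rightarrow> complex^'n^'n) i j. mat_scale c (X i j))"
  by unfold_locales (simp_all add: fun_eq_iff mat_scale_simps)

lemma diag_trace_zero_add: "A \<in> diag_trace_zero \<Longrightarrow> B \<in> diag_trace_zero \<Longrightarrow> A + B \<in> diag_trace_zero"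
  by (simp add: diag_trace_zero_def trace_add)

lemma trace_mat_scale: "trace (mat_scale c A) = c * trace A"
  by (simp add: trace_def sum_distrib_left)

lemma diag_trace_zero_scale: "A \<in> diag_trace_zero \<Longrightarrow> mat_scale c A \<in> diag_trace_zero"
  by (simp add: diag_trace_zero_def trace_mat_scale)

lemma diag_trace_zero_adj: "A \<in> diag_trace_zero \<Longrightarrow> mat_adj A \<in> diag_trace_zero"
proof -
  have "trace (mat_adj A) = cnj (trace A)" by (simp add: trace_def)
  then show "A \<in> diag_trace_zero \<Longrightarrow> mat_adj A \<in> diag_trace_zero"
    by (simp add: diag_trace_zero_def)
qed

lemma diag_trace_zero_zero: "0 \<in> diag_trace_zero"
  by (simp add: diag_trace_zero_def trace_def)

lemma mform_bound:
  fixes X :: "nat \<Rightarrow> nat \<Rightarrow> complex^'n^'n"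
  shows "cmod (mform p X v) \<le> (\<Sum>i<p. \<Sum>j<p. \<Sum>a\<in>UNIV. \<Sum>b\<in>UNIV. cmod (X i j $ a $ b)) * Re (mform p unit_mat v)"
proof -
  let ?q = "Re (mform p (unit_mat :: nat \<Rightarrow> nat \<Rightarrow> complex^'n^'n) v)"
  have q: "?q = (\<Sum>i<p. \<Sum>a\<in>UNIV. (cmod (v i a))\<^sup>2)" by (simp add: mform_unit)
  have le: "(cmod (v i a))\<^sup>2 \<le> ?q" if "i < p" for i a
  proof -
    have "(cmod (v i a))\<^sup>2 \<le> (\<Sum>a\<in>UNIV. (cmod (v i a))\<^sup>2)" by (rule member_le_sum) auto
    also have "\<dots> \<le> ?q"
      unfolding q using that by (intro member_le_sum[of i "{..<p}" "\<lambda>i. \<Sum>a\<in>UNIV. (cmod (v i a))\<^sup>2"]) (auto intro: sum_nonneg)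
    finally show ?thesis .
  qed
  have q0: "0 \<le> ?q" unfolding q by (intro sum_nonneg) simp
  have "cmod (v i a) \<le> sqrt ?q" if "i < p" for i a using le[OF that] by (rule real_le_rsqrt)
  then have prod: "cmod (v i a) * cmod (v j b) \<le> ?q" if "i < p" "j < p" for i j a b
    using mult_mono[of "cmod (v i a)" "sqrt ?q" "cmod (v j b)" "sqrt ?q"] that q0 by simp
  have term_le: "cmod (cnj (v i a) * X i j $ a $ b * v j b) \<le> cmod (X i j $ a $ b) * ?q"
    if ij: "i < p" "j < p" for i j a b
  proof -
    have "cmod (cnj (v i a) * X i j $ a $ b * v j b) = cmod (X i j $ a $ b) * (cmod (v i a) * cmod (v j b))"
      by (simp add: norm_mult)
    also have "\<dots> \<le> cmod (X i j $ a $ b) * ?q" using ij by (intro mult_left_mono prod) auto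
    finally show ?thesis .
  qed
  have "cmod (mform p X v) \<le> (\<Sum>i<p. \<Sum>j<p. \<Sum>a\<in>UNIV. \<Sum>b\<in>UNIV. cmod (X i j $ a $ b) * ?q)"
    unfolding mform_def[of p X] by (intro sum_norm_le term_le) auto
  then show ?thesis by (simp add: sum_distrib_right)
qed

lemma Im_mform_hermitian:
  assumes "\<And>i j. i < p \<Longrightarrow> j < p \<Longrightarrow> mat_adj (X i j) = X j i"
  shows "Im (mform p X v) = 0"
proof -
  have nth: "cnj (X i j $ a $ b) = X j i $ b $ a" if "i < p" "j < p" for i j a b
    using assms[OF that] by (metis mat_nth(2))
  have "cnj (mform p X v) = (\<Sum>i<p. \<Sum>j<p. \<Sum>a\<in>UNIV. \<Sum>b\<in>UNIV. cnj (v j b) * X j i $ b $ a * v i a)"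
    unfolding mform_def cnj_sum by (intro sum.cong refl) (simp add: nth)
  also have "\<dots> = (\<Sum>i<p. \<Sum>j<p. \<Sum>b\<in>UNIV. \<Sum>a\<in>UNIV. cnj (v j b) * X j i $ b $ a * v i a)"
    by (rule sum.cong[OF refl], rule sum.cong[OF refl], rule sum.swap)
  also have "\<dots> = mform p X v" unfolding mform_def by (rule sum.swap)
  finally show ?thesis by (simp add: Reals_cnj_iff flip: complex_is_Real_iff)
qed

lemma os_pos_unit_dominates:
  fixes X :: "nat \<Rightarrow> nat \<Rightarrow> complex^'n^'n"
  assumes "\<And>i j. i < p \<Longrightarrow> j < p \<Longrightarrow> mat_adj (X i j) = X j i"
  shows "\<exists>t. os_pos matrix_system p (\<lambda>i j. mat_scale (of_real t) (unit_mat i j) + X i j)"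
proof
  let ?t = "\<Sum>i<p. \<Sum>j<p. \<Sum>a\<in>UNIV. \<Sum>b\<in>UNIV. cmod (X i j $ a $ b)"
  show "os_pos matrix_system p (\<lambda>i j. mat_scale (of_real ?t) (unit_mat i j) + X i j)"
    unfolding os_pos_matrix_iff mform_add mform_scale complex_nonneg_Reals_iff
  proof (intro allI conjI)
    fix v
    have "- Re (mform p X v) \<le> cmod (mform p X v)" using abs_Re_le_cmod[of "mform p X v"] by linarith
    also have "\<dots> \<le> ?t * Re (mform p unit_mat v)" by (rule mform_bound)
    finally show "0 \<le> Re (of_real ?t * mform p unit_mat v + mform p X v)" by simp
    have "Im (mform p unit_mat v) = 0" by (simp add: mform_unit)
    then show "Im (of_real ?t * mform p unit_mat v + mform p X v) = 0"
      using Im_mform_hermitian[OF assms] by simp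
  qed
qed

lemma sum_diag_mform:
  fixes X :: "nat \<Rightarrow> nat \<Rightarrow> complex^'n^'n"
  assumes "k < p"
  shows "mform p X (\<lambda>i a. if i = k \<and> a = c then 1 else 0) = X k k $ c $ c"
proof -
  have "mform p X (\<lambda>i a. if i = k \<and> a = c then 1 else 0)
      = (\<Sum>i<p. \<Sum>j<p. \<Sum>a\<in>UNIV. \<Sum>b\<in>UNIV. if b = c then (if a = c then (if j = k then if i = k then X k k $ c $ c else 0 else 0) else 0) else 0)"
    unfolding mform_def by (intro sum.cong refl) auto
  also have "\<dots> = X k k $ c $ c" using assms by simp
  finally show ?thesis .
qed

text \<open>The form at e_a + u e_b in block k, where the unimodular u turns the contribution of the
  off-diagonal entries into minus twice their modulus. The trace thus bounds every off-diagonal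
  entry.\<close>

lemma os_pos_matrix_entry_bound:
  fixes X :: "nat \<Rightarrow> nat \<Rightarrow> complex^'n^'n"
  assumes X: "os_pos matrix_system p X" and k: "k < p" and ab: "a \<noteq> b"
  shows "2 * cmod (X k k $ a $ b) \<le> Re (X k k $ a $ a) + Re (X k k $ b $ b)"
proof -
  let ?z = "X k k $ a $ b"
  have herm: "X k k $ b $ a = cnj ?z" using os_pos_matrix_hermitian[OF X k k] by (metis mat_nth(2))
  define u where "u = (if ?z = 0 then 1 else - cnj ?z / of_real (cmod ?z))"
  have zz: "cnj ?z * ?z = of_real (cmod ?z) * of_real (cmod ?z)"
    using complex_norm_square[of ?z] by (simp add: power2_eq_square mult.commute)
  have u: "cnj u * u = 1" "u * ?z = - of_real (cmod ?z)"
    using zz by (auto simp: u_def mult.commute)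
  let ?v = "\<lambda>i c. if i = k then (if c = a then 1 else 0) + (if c = b then u else 0) else 0"
  define S where "S c = (\<Sum>d\<in>UNIV. X k k $ c $ d * ((if d = a then 1 else 0) + (if d = b then u else 0)))" for c
  have S: "S c = X k k $ c $ a + X k k $ c $ b * u" for c
    by (simp add: S_def distrib_left sum.distrib if_distrib[of "\<lambda>x. _ * x"] cong: if_cong)
  have "mform p X ?v = (\<Sum>i<p. \<Sum>j<p. if j = k then if i = k then (\<Sum>c\<in>UNIV. cnj (?v k c) * S c) else 0 else 0)"
    unfolding mform_def S_def by (intro sum.cong refl) (auto simp: sum_distrib_left mult.assoc)
  also have "\<dots> = (\<Sum>c\<in>UNIV. cnj (?v k c) * S c)" using k by simp
  also have "\<dots> = (\<Sum>c\<in>UNIV. (if c = a then S c else 0) + (if c = b then cnj u * S c else 0))"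
    by (intro sum.cong refl) (use ab in auto)
  also have "\<dots> = S a + cnj u * S b" by (simp add: sum.distrib)
  also have "\<dots> = X k k $ a $ a + u * ?z + cnj (u * ?z) + (cnj u * u) * X k k $ b $ b"
    by (simp add: S herm algebra_simps)
  finally have "mform p X ?v = X k k $ a $ a + X k k $ b $ b - of_real (2 * cmod ?z)"
    by (simp add: u)
  moreover have "0 \<le> Re (mform p X ?v)" using X by (simp add: os_pos_matrix_iff complex_nonneg_Reals_iff)
  ultimately show ?thesis by simp
qed

lemma sum_fun_apply: "(\<Sum>i\<in>A. f i) x = (\<Sum>i\<in>A. f i x)"
  for f :: "'i \<Rightarrow> 'x \<Rightarrow> 'a::comm_monoid_add"
  by (induction A rule: infinite_finite_induct) simp_all

lemma (in semi_inner) ip_null_cong: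
  assumes "nrm (u - u') = 0" "nrm (w - w') = 0"
  shows "ip u w = ip u' w'"
proof -
  have "ip u w = ip u' w" using ip_null[OF assms(1), of w] by (simp add: ip_diff_left)
  also have "\<dots> = ip u' w'"
    using ip_null[OF assms(2), of u'] ip_cnj[of "w - w'" u'] by (simp add: ip_diff_right)
  finally show ?thesis .
qed

lemma mform_zero: "mform p (\<lambda>i j. 0) v = 0"
  by (simp add: mform_def)

text \<open>
  If no lift exists, separation yields a positive functional \<open>F\<close> on the matrices over the matrices
  that vanishes on \<open>diag_trace_zero\<close> and is negative at \<open>H\<close>. In the semi-inner product of \<open>F\<close>, the
  families \<open>E k a\<close> of basis vectors, for different \<open>a\<close>, have the same Gram matrix, so there are
  unitaries \<open>U\<close> that move them into each other. They define a representation of the free group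
  through which \<open>F\<close> factors.
\<close>

theorem phi_map_lift:
  fixes H :: "nat \<Rightarrow> nat \<Rightarrow> complex^('g::finite option)^('g option)"
  assumes herm: "\<And>i j. i < p \<Longrightarrow> j < p \<Longrightarrow> H i j = mat_adj (H j i)"
    and pos: "os_pos W_system p (\<lambda>i j. phi_map (H i j))" and \<epsilon>: "0 < \<epsilon>"
  shows "\<exists>K. (\<forall>i<p. \<forall>j<p. K i j \<in> diag_trace_zero \<and> K i j = mat_adj (K j i)) \<and>
    os_pos matrix_system p (\<lambda>i j. mat_scale (of_real \<epsilon>) (unit_mat i j) + H i j + K i j)"
proof (cases "p = 0")
  case True
  then show ?thesis by (simp add: os_pos_matrix_iff mform_def)
next
  case False
  then have p: "0 < p" by simp
  let ?J = "diag_trace_zero :: (complex^('g option)^('g option)) set"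
  show ?thesis
  proof (rule ccontr)
    assume no: "\<not> ?thesis"
    define star where "star X = (\<lambda>i j. mat_adj (X j i))" for X :: "nat \<Rightarrow> nat \<Rightarrow> complex^('g option)^('g option)"
    define sc where "sc c X = (\<lambda>i j. mat_scale c (X i j))" for c and X :: "nat \<Rightarrow> nat \<Rightarrow> complex^('g option)^('g option)"
    have vs: "vector_space sc" unfolding sc_def by (rule vector_space_matrices)
    interpret M: vector_space sc by (rule vs)
    \<comment> \<open>Cut off outside the p \<times> p block, because \<open>star\<close> compares
      the entries at all indices whereas \<open>herm\<close> speaks about the block.\<close>
    define H0 where "H0 i j = (if i < p \<and> j < p then H i j else 0)" for i j
    define G where "G i j = mat_scale (of_real \<epsilon>) (unit_mat i j) + H0 i j" for i j
    define JH where "JH K \<longleftrightarrow> (\<forall>i<p. \<forall>j<p. K i j \<in> ?J \<and> K i j = mat_adj (K j i))" for K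
    have no': False if "JH K"
      "os_pos matrix_system p (\<lambda>i j. mat_scale (of_real \<epsilon>) (unit_mat i j) + H i j + K i j)" for K
      by (rule notE[OF no], rule exI[of _ K]) (use that in \<open>simp only: JH_def\<close>)
    \<comment> \<open>Built to contain the self-adjoint matrices that are positive, both signs of
      those over J, and -G, where G is \<epsilon> + H. A functional that is positive on it therefore
      vanishes on J and is at most 0 at G.\<close>
    define C where "C = {X. star X = X \<and> (\<exists>K r. 0 \<le> r \<and> JH K \<and>
      os_pos matrix_system p (\<lambda>i j. X i j + K i j + mat_scale (of_real r) (G i j)))}"
    have CI: "X \<in> C" if "star X = X" "0 \<le> r" "JH K"
      "os_pos matrix_system p (\<lambda>i j. X i j + K i j + mat_scale (of_real r) (G i j))" for X K r
      using that by (auto simp: C_def)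
    have star_unit: "star unit_mat = unit_mat"
      by (auto simp: star_def unit_mat_def fun_eq_iff mat_adj_simps)
    have JH0: "JH (\<lambda>i j. 0)" by (simp add: JH_def diag_trace_zero_zero mat_adj_simps)
    have psd0: "os_pos matrix_system p (\<lambda>i j. 0 :: complex^('g option)^('g option))"
      by (simp add: os_pos_matrix_iff mform_zero)
    have scale0: "mat_scale 0 A = 0" for A :: "complex^('g option)^('g option)" by (simp add: vec_eq_iff)
    have C: "vcone (\<lambda>r. sc (of_real r)) C"
      unfolding vcone_def
    proof (intro conjI ballI allI impI)
      show "0 \<in> C"
        by (rule CI[OF _ _ JH0, of _ 0]) (simp_all add: star_def fun_eq_iff mat_adj_simps scale0 psd0)
      fix X assume "X \<in> C"
      then obtain K r where X: "star X = X" "0 \<le> r" "JH K"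
        "os_pos matrix_system p (\<lambda>i j. X i j + K i j + mat_scale (of_real r) (G i j))" by (auto simp: C_def)
      { fix Y assume "Y \<in> C"
        then obtain L q where Y: "star Y = Y" "0 \<le> q" "JH L"
          "os_pos matrix_system p (\<lambda>i j. Y i j + L i j + mat_scale (of_real q) (G i j))" by (auto simp: C_def)
        show "X + Y \<in> C"
        proof (rule CI)
          show "star (X + Y) = X + Y"
            using X(1) Y(1) by (simp add: star_def fun_eq_iff mat_adj_simps)
          show "0 \<le> r + q" using X Y by simp
          show "JH (\<lambda>i j. K i j + L i j)"
            using X(3) Y(3) unfolding JH_def by (metis diag_trace_zero_add mat_adj_simps(1))
          show "os_pos matrix_system p (\<lambda>i j. (X + Y) i j + (K i j + L i j) + mat_scale (of_real (r + q)) (G i j))"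
            using os_pos_matrix_add[OF X(4) Y(4)] by (simp add: mat_scale_simps algebra_simps)
        qed }
      fix q :: real assume q: "0 \<le> q"
      show "sc (of_real q) X \<in> C"
      proof (rule CI)
        show "star (sc (of_real q) X) = sc (of_real q) X"
          using X(1) by (simp add: star_def sc_def fun_eq_iff mat_adj_simps)
        show "0 \<le> q * r" using X q by simp
        show "JH (\<lambda>i j. mat_scale (of_real q) (K i j))"
          using X(3) unfolding JH_def by (metis diag_trace_zero_scale mat_adj_simps(3) complex_cnj_complex_of_real)
        show "os_pos matrix_system p (\<lambda>i j. sc (of_real q) X i j + mat_scale (of_real q) (K i j) + mat_scale (of_real (q * r)) (G i j))"
          using os_pos_matrix_scale[OF X(4) q] by (simp add: sc_def mat_scale_simps)
      qed
    qed
    have notin: "- unit_mat \<notin> C"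
    proof
      assume "- unit_mat \<in> C"
      then obtain K r where r: "0 \<le> r" and K: "JH K"
        and psd: "os_pos matrix_system p (\<lambda>i j. - unit_mat i j + K i j + mat_scale (of_real r) (G i j))"
        by (auto simp: C_def)
      show False
      proof (cases "r = 0")
        case True
        \<comment> \<open>The diagonal of block (0, 0), available as 0 < p: its entries are
          nonnegative, but their sum is trace (K 0 0) - n = -n.\<close>
        have "0 \<le> (\<Sum>c\<in>UNIV. Re ((- unit_mat 0 0 + K 0 0) $ c $ c))"
        proof (rule sum_nonneg)
          fix c
          have "mform p (\<lambda>i j. - unit_mat i j + K i j + mat_scale (of_real r) (G i j)) (\<lambda>i a. if i = 0 \<and> a = c then 1 else 0) \<in> \<real>\<^sub>\<ge>\<^sub>0"
            using psd unfolding os_pos_matrix_iff by blast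
          then show "0 \<le> Re ((- unit_mat 0 0 + K 0 0) $ c $ c)"
            unfolding sum_diag_mform[OF p] True by (simp add: scale0 complex_nonneg_Reals_iff)
        qed
        also have "\<dots> = Re (trace (K 0 0)) - real CARD('g option)"
          by (simp add: unit_mat_def mat_def trace_def Re_sum sum_subtractf)
        finally have le: "0 \<le> Re (trace (K 0 0)) - real CARD('g option)" .
        have "K 0 0 \<in> ?J" using K p unfolding JH_def by blast
        then have "trace (K 0 0) = 0" by (simp add: diag_trace_zero_def)
        with le show False by simp
      next
        case False
        with r have r: "0 < r" by simp
        have u: "os_pos matrix_system p (unit_mat :: nat \<Rightarrow> nat \<Rightarrow> complex^('g option)^('g option))"
          unfolding os_pos_matrix_iff mform_unit by (simp add: complex_nonneg_Reals_iff sum_nonneg)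
        \<comment> \<open>Adding the unit and dividing by r produces exactly a lift that was assumed
          not to exist, with K/r as its correction term.\<close>
        have "os_pos matrix_system p (\<lambda>i j. mat_scale (of_real (inverse r))
            (- unit_mat i j + K i j + mat_scale (of_real r) (G i j) + unit_mat i j))"
          using r by (intro os_pos_matrix_scale os_pos_matrix_add psd u) simp
        then have "os_pos matrix_system p (\<lambda>i j. mat_scale (of_real \<epsilon>) (unit_mat i j) + H i j + mat_scale (of_real (inverse r)) (K i j))"
        proof (rule os_pos_matrix_cong[rotated])
          fix i j assume "i < p" "j < p"
          then show "mat_scale (of_real (inverse r)) (- unit_mat i j + K i j + mat_scale (of_real r) (G i j) + unit_mat i j)
            = mat_scale (of_real \<epsilon>) (unit_mat i j) + H i j + mat_scale (of_real (inverse r)) (K i j)"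
            using r by (simp add: mat_scale_simps G_def H0_def flip: mult.assoc)
        qed
        moreover have "JH (\<lambda>i j. mat_scale (of_real (inverse r)) (K i j))"
          using K unfolding JH_def by (metis diag_trace_zero_scale mat_adj_simps(3) complex_cnj_complex_of_real)
        ultimately show False
          by (intro no'[of "\<lambda>i j. mat_scale (of_real (inverse r)) (K i j)"])
      qed
    qed
    have unit: "\<exists>t. sc (of_real t) unit_mat + h \<in> C" if h: "star h = h" for h
    proof -
      have hij: "mat_adj (h i j) = h j i" for i j using h by (metis star_def)
      obtain t where t: "os_pos matrix_system p (\<lambda>i j. mat_scale (of_real t) (unit_mat i j) + h i j)"
        using os_pos_unit_dominates[of p h] hij by blast
      have "star (sc (of_real t) unit_mat + h) = sc (of_real t) unit_mat + h"
        using star_unit by (simp add: star_def sc_def fun_eq_iff mat_adj_simps hij)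
      then have "sc (of_real t) unit_mat + h \<in> C"
        by (rule CI[OF _ _ JH0, of _ 0]) (simp_all add: scale0 sc_def t)
      then show ?thesis by blast
    qed
    have star_add: "star (x + y) = star x + star y" for x y
      by (simp add: star_def fun_eq_iff mat_adj_simps)
    have star_sc: "star (sc c x) = sc (cnj c) (star x)" for c x
      by (simp add: star_def sc_def fun_eq_iff mat_adj_simps)
    have star_star: "star (star x) = x" for x by (simp add: star_def mat_adj_simps)
    have C_herm: "star x = x" if "x \<in> C" for x using that by (simp add: C_def)
    obtain F where F: "\<And>x y. F (x + y) = F x + F y" "\<And>c x. F (sc c x) = c * F x" "F unit_mat = 1"
      "\<And>x. F (star x) = cnj (F x)" "\<And>x. x \<in> C \<Longrightarrow> F x \<in> \<real>\<^sub>\<ge>\<^sub>0"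
      by (rule star_cone_functional[where scale = sc and star = star and C = C and e = unit_mat,
            OF vs star_add star_sc star_star C C_herm notin star_unit unit], assumption+) (rule that)
    have F0: "F 0 = 0" using F(1)[of 0 0] by simp
    have Fm: "F (- x) = - F x" for x using F(1)[of x "- x"] F0 by (simp add: add_eq_0_iff)
    have Fd: "F (x - y) = F x - F y" for x y using F(1)[of x "- y"] by (simp add: Fm)
    have Fsum: "F (sum f A) = (\<Sum>i\<in>A. F (f i))" for f :: "nat \<Rightarrow> _" and A
      by (induction A rule: infinite_finite_induct)
        (simp_all only: sum.infinite sum.empty sum.insert F0 F(1) not_False_eq_True)
    have Fsum': "F (sum f A) = (\<Sum>i\<in>A. F (f i))" for f :: "'g option \<Rightarrow> _" and A
      by (induction A rule: infinite_finite_induct)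
        (simp_all only: sum.infinite sum.empty sum.insert F0 F(1) not_False_eq_True)
    have F_psd: "F X \<in> \<real>\<^sub>\<ge>\<^sub>0" if "star X = X" "os_pos matrix_system p X" for X
      by (rule F(5), rule CI[OF _ _ JH0, of _ 0]) (simp_all add: that scale0)
    \<comment> \<open>For self-adjoint Y over J both Y and -Y lie in \<open>C\<close>. For general X
      the real part of F vanishes at X and at i X.\<close>
    have F_J: "F X = 0" if X: "\<And>i j. i < p \<Longrightarrow> j < p \<Longrightarrow> X i j \<in> ?J" for X
    proof -
      have hermitian: "F Y = 0" if Y: "star Y = Y" "\<And>i j. i < p \<Longrightarrow> j < p \<Longrightarrow> Y i j \<in> ?J" for Y
      proof -
        have Yij: "mat_adj (Y j i) = Y i j" for i j using Y(1) by (metis star_def)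
        have neg: "- Y i j \<in> ?J" if "i < p" "j < p" for i j
          using diag_trace_zero_scale[OF Y(2)[OF that], of "-1"] by (simp add: mat_scale_def vec_eq_iff uminus_vec_def)
        have "JH Y" using Y(2) Yij by (simp add: JH_def)
        then have "- Y \<in> C"
          by (rule CI[rotated 2, of _ _ 0]) (use Yij in \<open>simp_all add: star_def fun_eq_iff mat_adj_simps scale0 psd0\<close>)
        moreover have "JH (\<lambda>i j. - Y i j)" using neg Yij by (simp add: JH_def mat_adj_simps)
        then have "Y \<in> C"
          by (rule CI[rotated 2, of _ _ 0]) (use Yij in \<open>simp_all add: star_def fun_eq_iff mat_adj_simps scale0 psd0\<close>)
        ultimately have "F Y \<in> \<real>\<^sub>\<ge>\<^sub>0" "- F Y \<in> \<real>\<^sub>\<ge>\<^sub>0" unfolding Fm[symmetric] using F(5) by blast+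
        then show ?thesis by (auto simp: complex_nonneg_Reals_iff complex_eq_iff)
      qed
      have re: "Re (F Z) = 0" if Z: "\<And>i j. i < p \<Longrightarrow> j < p \<Longrightarrow> Z i j \<in> ?J" for Z
      proof -
        have "F (Z + star Z) = 0"
          by (rule hermitian) (simp_all add: star_def fun_eq_iff mat_adj_simps add.commute
              Z diag_trace_zero_add diag_trace_zero_adj)
        then have "F Z + cnj (F Z) = 0" by (simp only: F(1,4))
        then show ?thesis by (simp add: complex_eq_iff)
      qed
      have "Re (F (sc \<i> X)) = 0" by (rule re) (simp add: sc_def X diag_trace_zero_scale)
      then have "Re (\<i> * F X) = 0" by (simp only: F(2))
      then show ?thesis using re[OF X] by (simp add: complex_eq_iff)
    qed
    have H0_adj: "star H0 = H0"
    proof (intro ext)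
      fix i j
      show "star H0 i j = H0 i j" using herm[of i j] by (auto simp: star_def H0_def mat_adj_simps)
    qed
    have G_eq: "G = sc (of_real \<epsilon>) unit_mat + H0" by (simp add: G_def sc_def fun_eq_iff)
    \<comment> \<open>Hence F (\<epsilon> + H) \<le> 0 while F is 1 at the unit: the \<epsilon>
      makes F strictly negative at \<open>H0\<close>.\<close>
    have "- G \<in> C"
    proof (rule CI[OF _ _ JH0, of _ 1])
      have "star G = G" using star_unit H0_adj unfolding G_eq by (simp add: star_def sc_def fun_eq_iff mat_adj_simps)
      then show "star (- G) = - G" by (simp add: star_def fun_eq_iff mat_adj_simps)
    qed (simp_all add: mat_scale_simps psd0)
    from F(5)[OF this] have "- F G \<in> \<real>\<^sub>\<ge>\<^sub>0" by (simp only: Fm)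
    then have "Re (F G) \<le> 0" by (simp add: complex_nonneg_Reals_iff)
    moreover have "F G = of_real \<epsilon> + F H0" unfolding G_eq F(1-3) by simp
    ultimately have neg: "Re (F H0) < 0" using \<epsilon> by simp
    define outer where "outer w v = (\<lambda>k l. \<chi> a b. cnj (w k a) * v l b)"
      for w v :: "nat \<Rightarrow> 'g option \<Rightarrow> complex"
    have outer_adj: "star (outer w v) = outer v w" for v w
      by (simp add: star_def outer_def fun_eq_iff vec_eq_iff)
    have outer_psd: "os_pos matrix_system p (outer v v)" for v
      unfolding os_pos_matrix_iff
    proof
      fix x
      have "mform p (outer v v) x = (\<Sum>i<p. \<Sum>j<p. \<Sum>a\<in>UNIV. \<Sum>b\<in>UNIV. cnj (v i a * x i a) * (v j b * x j b))"
        by (simp add: mform_def outer_def mult_ac)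
      also have "\<dots> = cnj (\<Sum>i<p. \<Sum>a\<in>UNIV. v i a * x i a) * (\<Sum>j<p. \<Sum>b\<in>UNIV. v j b * x j b)"
        unfolding cnj_sum sum_product ..
      finally have eq: "mform p (outer v v) x
          = cnj (\<Sum>i<p. \<Sum>a\<in>UNIV. v i a * x i a) * (\<Sum>j<p. \<Sum>b\<in>UNIV. v j b * x j b)" .
      have "cnj z * z \<in> \<real>\<^sub>\<ge>\<^sub>0" for z by (simp add: complex_nonneg_Reals_iff)
      then show "mform p (outer v v) x \<in> \<real>\<^sub>\<ge>\<^sub>0" unfolding eq .
    qed
    interpret S: semi_inner "\<lambda>c (v :: nat \<Rightarrow> 'g option \<Rightarrow> complex) k a. c * v k a" "\<lambda>v w. F (outer w v)"
    proof unfold_locales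
      fix v w z :: "nat \<Rightarrow> 'g option \<Rightarrow> complex" and c d
      have "outer z (v + w) = outer z v + outer z w"
        by (simp add: outer_def fun_eq_iff vec_eq_iff distrib_left)
      then show "F (outer z (v + w)) = F (outer z v) + F (outer z w)" by (simp only: F(1))
      have "outer z (\<lambda>k a. c * v k a) = sc c (outer z v)"
        by (simp add: outer_def sc_def fun_eq_iff vec_eq_iff)
      then show "F (outer z (\<lambda>k a. c * v k a)) = c * F (outer z v)" by (simp only: F(2))
      show "cnj (F (outer w v)) = F (outer v w)" by (simp only: outer_adj F(4)[symmetric])
      show "0 \<le> Re (F (outer v v))"
        using F_psd[OF outer_adj outer_psd, of v] by (simp add: complex_nonneg_Reals_iff)
    qed (simp_all add: fun_eq_iff algebra_simps)
    define E where "E k a = (\<lambda>i c. if i = k \<and> c = a then 1 else 0 :: complex)" for k :: nat and a :: "'g option"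
    define U where "U k l a b = (\<lambda>i j. if i = k \<and> j = l then matrix_unit a b else 0)" for k l :: nat and a b :: "'g option"
    have EU: "outer (E k a) (E l b) = U k l a b" for k l a b
      by (auto simp: outer_def E_def U_def matrix_unit_def fun_eq_iff vec_eq_iff)
    \<comment> \<open>Both sides agree on the p \<times> p block, and F ignores all other entries by
      \<open>F_J\<close>, whose assumption concerns the block alone.\<close>
    have F_expand: "F X = (\<Sum>k<p. \<Sum>l<p. \<Sum>a\<in>UNIV. \<Sum>b\<in>UNIV. X k l $ a $ b * F (U k l a b))" for X
    proof -
      let ?X = "\<Sum>k<p. \<Sum>l<p. \<Sum>a\<in>UNIV. \<Sum>b\<in>UNIV. sc (X k l $ a $ b) (U k l a b)"
      have "F (X - ?X) = 0"
      proof (rule F_J)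
        fix i j assume ij: "i < p" "j < p"
        have "?X i j $ c $ d = X i j $ c $ d" for c d
        proof -
          have "?X i j $ c $ d = (\<Sum>k<p. \<Sum>l<p. \<Sum>a\<in>UNIV. \<Sum>b\<in>UNIV.
              if b = d then (if a = c then (if l = j then (if k = i then X i j $ c $ d else 0) else 0) else 0) else 0)"
            unfolding sum_fun_apply sum_component
            by (intro sum.cong refl) (auto simp: sc_def U_def matrix_unit_def)
          then show ?thesis using ij by simp
        qed
        then have "(X - ?X) i j = 0" by (simp add: vec_eq_iff)
        then show "(X - ?X) i j \<in> ?J" by (simp add: diag_trace_zero_zero)
      qed
      then have "F X = F ?X" unfolding Fd by simp
      also have "\<dots> = (\<Sum>k<p. \<Sum>l<p. \<Sum>a\<in>UNIV. \<Sum>b\<in>UNIV. X k l $ a $ b * F (U k l a b))"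
        by (simp only: Fsum Fsum' F(2))
      finally show ?thesis .
    qed
    \<comment> \<open>Here the kernel enters: the difference of two diagonal matrix units is
      diagonal of trace zero.\<close>
    have same_gram: "F (outer (E k a) (E l a)) = F (outer (E k None) (E l None))" for k l a
    proof -
      have "F (U k l a a - U k l None None) = 0"
      proof (rule F_J)
        fix i j
        have "trace (matrix_unit c c :: complex^('g option)^('g option)) = 1" for c
          by (simp add: trace_def matrix_unit_def)
        then have "matrix_unit a a - matrix_unit None None \<in> ?J"
          by (simp add: diag_trace_zero_def trace_sub) (simp add: matrix_unit_def)
        then show "(U k l a a - U k l None None) i j \<in> ?J"
          by (simp add: U_def diag_trace_zero_zero)
      qed
      then show ?thesis unfolding EU Fd by simp
    qed
    have "\<exists>U V. S.unitary_op U \<and> S.unitary_op V \<and> (\<forall>v. U (V v) = v) \<and> (\<forall>v. V (U v) = v) \<and>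
        (\<forall>k<p. S.nrm (U (E k None) - E k (Some g)) = 0)" for g
      by (rule S.unitary_extension) (rule same_gram[symmetric])
    then obtain T T' where T: "\<And>g. S.unitary_op (T g)" "\<And>g. S.unitary_op (T' g)"
      "\<And>g v. T g (T' g v) = v" "\<And>g v. T' g (T g v) = v"
      and TE: "\<And>g k. k < p \<Longrightarrow> S.nrm (T g (E k None) - E k (Some g)) = 0"
      by metis
    \<comment> \<open>Generators act by \<open>T'\<close> and their inverses by \<open>T\<close>.
      The entry at (a, b) must correspond to w_a w_b^*, so \<open>E k a\<close> has to be the image
      of \<open>E k None\<close> under the adjoint of w_a.\<close>
    interpret R: unitary_representation "\<lambda>c (v :: nat \<Rightarrow> 'g option \<Rightarrow> complex) k a. c * v k a"
      "\<lambda>v w. F (outer w v)" "free_act T' T"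
      by (rule S.unitary_representation_free_act) (simp_all add: T)
    let ?R = "free_act T' T"
    have n0: "S.nrm 0 = 0" using S.ip_zero_left[of 0] by (simp add: S.nrm_def)
    have RE: "S.nrm (?R (- gen_word a) (E k None) - E k a) = 0" if "k < p" for k a
      by (cases a) (simp_all add: gen_word_def free_act_zero[OF T(4,3)] free_act_uminus_gen[OF T(4,3)] TE that n0)
    have ip_E: "F (outer (E k a) (E l b)) = F (outer (E k None) (?R (gen_word a - gen_word b) (E l None)))"
      if "k < p" "l < p" for k l a b
    proof -
      have "F (outer (E k a) (E l b))
          = F (outer (?R (- gen_word a) (E k None)) (?R (- gen_word b) (E l None)))"
        by (rule S.ip_null_cong[symmetric]) (rule RE that)+
      also have "\<dots> = F (outer (E k None) (?R (gen_word a + - gen_word b) (E l None)))"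
        by (simp only: R.rep_adjoint[symmetric] R.rep_add)
      finally show ?thesis by simp
    qed
    let ?N = "of_nat CARD('g option) :: complex"
    \<comment> \<open>A preimage of \<open>phi_map (H k l)\<close> in the group algebra, where the
      representation lives.\<close>
    define x where "x k l = (\<Sum>a\<in>UNIV. \<Sum>b\<in>UNIV. Poly_Mapping.single (gen_word a - gen_word b) (H k l $ a $ b * (1 / ?N)))" for k l
    have x: "group_cstar_of (x k l) = phi_map (H k l)" for k l
    proof -
      have "group_cstar_of (Poly_Mapping.single (gen_word a - gen_word b) (c * d))
          = c *\<^sub>C d *\<^sub>C (univ_unitary a * adj (univ_unitary b))" for a b :: "'g option" and c d :: complex
        by (simp add: univ_unitary_mult_adj mult_single flip: group_cstar_of_scale)
      then show ?thesis unfolding x_def phi_map_def group_cstar_of_sum by (simp only:)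
    qed
    have act_sum: "R.act (sum f A) v = (\<Sum>i\<in>A. R.act (f i) v)" for f :: "'g option \<Rightarrow> _" and A v
      by (induction A rule: infinite_finite_induct) (simp_all add: R.act_add)
    obtain Y where "\<And>k l. k < p \<Longrightarrow> l < p \<Longrightarrow> phi_map (H k l) = (\<Sum>m<p. adj (Y m k) * Y m l)"
      using pos by (auto simp: os_pos_W_iff)
    then have "0 \<le> Re (\<Sum>k<p. \<Sum>l<p. F (outer (E k None) (R.act (x k l) (E l None))))"
      by (intro R.gram_nonneg[where Y = Y]) (simp add: x)
    also have "(\<Sum>k<p. \<Sum>l<p. F (outer (E k None) (R.act (x k l) (E l None))))
        = (\<Sum>k<p. \<Sum>l<p. (1 / ?N) * (\<Sum>a\<in>UNIV. \<Sum>b\<in>UNIV. H0 k l $ a $ b * F (U k l a b)))"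
    proof (intro sum.cong refl)
      fix k l assume kl: "k \<in> {..<p}" "l \<in> {..<p}"
      have "F (outer (E k None) (R.act (x k l) (E l None)))
          = (\<Sum>a\<in>UNIV. \<Sum>b\<in>UNIV. H k l $ a $ b * (1 / ?N) * F (outer (E k None) (?R (gen_word a - gen_word b) (E l None))))"
        unfolding x_def act_sum R.act_single by (simp only: S.ip_sum_left S.ip_scale_left)
      also have "\<dots> = (\<Sum>a\<in>UNIV. \<Sum>b\<in>UNIV. (1 / ?N) * (H0 k l $ a $ b * F (U k l a b)))"
        using kl by (intro sum.cong refl) (simp add: ip_E[symmetric] EU H0_def)
      finally show "F (outer (E k None) (R.act (x k l) (E l None)))
          = (1 / ?N) * (\<Sum>a\<in>UNIV. \<Sum>b\<in>UNIV. H0 k l $ a $ b * F (U k l a b))"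
        by (simp only: sum_distrib_left)
    qed
    also have "\<dots> = F H0 / ?N"
      unfolding F_expand[of H0] by (simp add: sum_divide_distrib)
    finally have "0 \<le> Re (F H0) / real CARD('g option)"
      by (simp add: Re_divide_of_nat del: of_nat_Suc)
    then show False using neg by (simp add: zero_le_divide_iff)
  qed
qed

section \<open>The quotient of the matrices by the kernel\<close>

abbreviation J_space :: "(complex^('g::finite option)^('g option)) set" where
  "J_space \<equiv> diag_trace_zero"

lemma diag_trace_zero_uminus: "A \<in> diag_trace_zero \<Longrightarrow> - A \<in> diag_trace_zero"
  using diag_trace_zero_scale[of A "-1"] by (simp add: mat_scale_def vec_eq_iff uminus_vec_def)

lemma diag_trace_zero_diff: "A \<in> diag_trace_zero \<Longrightarrow> B \<in> diag_trace_zero \<Longrightarrow> A - B \<in> diag_trace_zero"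
  using diag_trace_zero_add[of A "- B"] diag_trace_zero_uminus[of B] by simp

lemma os_pos_unit_mat: "os_pos matrix_system p (unit_mat :: nat \<Rightarrow> nat \<Rightarrow> complex^'n^'n)"
  unfolding os_pos_matrix_iff mform_unit by (simp add: complex_nonneg_Reals_iff sum_nonneg)

lemma cp_map_phi_map:
  "cp_map matrix_system W_system (phi_map :: complex^('g::finite option)^('g option) \<Rightarrow> 'g free_group group_cstar)"
  unfolding cp_map_def
proof (intro conjI ballI allI impI)
  fix p and X :: "nat \<Rightarrow> nat \<Rightarrow> complex^('g option)^('g option)"
  assume X: "os_pos matrix_system p X"
  show "os_pos W_system p (\<lambda>i j. phi_map (X i j))"
  proof (rule phi_map_pos_of_approx)
    show "X i j = mat_adj (X j i)" if "i < p" "j < p" for i j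
      using os_pos_matrix_hermitian[OF X that(2,1)] by simp
    fix \<epsilon> :: real assume \<epsilon>: "0 < \<epsilon>"
    have "os_pos matrix_system p (\<lambda>i j. mat_scale (of_real \<epsilon>) (unit_mat i j) + X i j + 0)"
      using os_pos_matrix_add[OF os_pos_matrix_scale[OF os_pos_unit_mat] X, of \<epsilon>] \<epsilon> by simp
    then show "\<exists>K. (\<forall>i<p. \<forall>j<p. K i j \<in> diag_trace_zero) \<and>
        os_pos matrix_system p (\<lambda>i j. mat_scale (of_real \<epsilon>) (unit_mat i j) + X i j + K i j)"
      by (intro exI[of _ "\<lambda>i j. 0"]) (simp add: diag_trace_zero_zero)
  qed
qed (simp_all add: W_space_eq phi_map_add phi_map_scale)

lemma phi_map_uminus: "phi_map (- A) = - phi_map (A :: complex^('g::finite option)^('g option))"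
  using phi_map_add[of A "- A"] by (simp add: add_eq_0_iff)

lemma phi_map_diff: "phi_map (A - B) = phi_map A - phi_map (B :: complex^('g::finite option)^('g option))"
  using phi_map_add[of A "- B"] by (simp add: phi_map_uminus)

text \<open>The lift of phi(A) = 0 is a positive X = \<epsilon> + A + K with the off-diagonal
  entries of A and with trace \<epsilon> n + trace A. Positivity for A and -A gives trace A = 0, and
  then the entries off the diagonal are bounded by the trace \<epsilon> n. Linear independence of
  the w_i w_j^* off the diagonal thus results from the lifting and not from a faithful
  representation.\<close>

lemma phi_map_kernel_hermitian:
  fixes A :: "complex^('g::finite option)^('g option)"
  assumes "phi_map A = 0" "mat_adj A = A"
  shows "A \<in> diag_trace_zero"
proof -
  let ?n = "real CARD('g option)"
  have approx: "\<exists>X. (\<forall>a b. a \<noteq> b \<longrightarrow> X $ a $ b = B $ a $ b) \<and> Re (trace X) = \<epsilon> * ?n + Re (trace B) \<and>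
      os_pos matrix_system 1 (\<lambda>i j. X)"
    if B: "phi_map B = 0" "mat_adj B = B" and \<epsilon>: "0 < \<epsilon>" for B :: "complex^('g option)^('g option)" and \<epsilon>
  proof -
    have "os_pos W_system 1 (\<lambda>i j. phi_map B)"
      using B(1) rangeI[of phi_map B] by (simp add: os_pos_W_iff W_space_eq) (rule exI[of _ "\<lambda>i j. 0"], simp)
    then obtain K where K: "K 0 0 \<in> diag_trace_zero"
      and X: "os_pos matrix_system 1 (\<lambda>i j. mat_scale (of_real \<epsilon>) (unit_mat i j) + B + K i j)"
      using phi_map_lift[of 1 "\<lambda>i j. B" \<epsilon>] B(2) \<epsilon> by auto
    let ?X = "mat_scale (of_real \<epsilon>) (mat 1) + B + K 0 0"
    have "os_pos matrix_system 1 (\<lambda>i j. ?X)"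
      by (rule os_pos_matrix_cong[OF _ X]) (simp add: unit_mat_def)
    moreover have "trace (mat 1 :: complex^('g option)^('g option)) = of_nat CARD('g option)"
      by (simp add: trace_def mat_def)
    then have "trace ?X = of_real (\<epsilon> * ?n) + trace B"
      using K by (simp add: trace_add trace_mat_scale diag_trace_zero_def)
    then have "Re (trace ?X) = \<epsilon> * ?n + Re (trace B)" by simp
    moreover have "?X $ a $ b = B $ a $ b" if "a \<noteq> b" for a b
      using K that by (simp add: diag_trace_zero_def mat_def)
    ultimately show ?thesis by blast
  qed
  have diag: "0 \<le> Re (X $ a $ a)" if X: "os_pos matrix_system 1 (\<lambda>i j. X)"
    for X :: "complex^('g option)^('g option)" and a
  proof -
    have "mform 1 (\<lambda>i j. X) (\<lambda>i b. if i = 0 \<and> b = a then 1 else 0) \<in> \<real>\<^sub>\<ge>\<^sub>0"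
      using X unfolding os_pos_matrix_iff by blast
    then show ?thesis
      using sum_diag_mform[of 0 1 "\<lambda>i j. X" a] by (simp add: complex_nonneg_Reals_iff)
  qed
  have tr_nonneg: "0 \<le> Re (trace B)" if B: "phi_map B = 0" "mat_adj B = B" for B :: "complex^('g option)^('g option)"
  proof (rule ccontr)
    assume neg: "\<not> 0 \<le> Re (trace B)"
    have n: "0 < ?n" by simp
    \<comment> \<open>With this \<epsilon> the lift has trace with real part half of Re (trace B),
      which is negative.\<close>
    with neg have "0 < - Re (trace B) / (2 * ?n)" by (intro divide_pos_pos) simp_all
    from approx[OF B this] obtain X where X0: "(\<forall>a b. a \<noteq> b \<longrightarrow> X $ a $ b = B $ a $ b) \<and>
      Re (trace X) = - Re (trace B) / (2 * ?n) * ?n + Re (trace B) \<and>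
      os_pos matrix_system 1 (\<lambda>i j. X)" by (rule exE)
    note X = X0[THEN conjunct2, THEN conjunct1] X0[THEN conjunct2, THEN conjunct2]
    have "0 \<le> Re (trace X)" using diag[OF X(2)] by (simp add: trace_def Re_sum sum_nonneg)
    moreover have "- Re (trace B) / (2 * ?n) * ?n = - Re (trace B) / 2" using n by (simp del: of_nat_Suc add: field_simps)
    ultimately show False using X(1) neg by simp
  qed
  have "trace (- A) = - trace A" by (simp add: trace_def sum_negf)
  then have Re0: "Re (trace A) = 0"
    using tr_nonneg[OF assms] tr_nonneg[of "- A"] assms by (simp add: phi_map_uminus mat_adj_simps)
  have "Im (A $ a $ a) = 0" for a
    using assms(2) by (metis mat_nth(2) Reals_cnj_iff complex_is_Real_iff)
  then have "trace A = 0" using Re0 by (simp add: complex_eq_iff trace_def Im_sum)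
  moreover have "A $ a $ b = 0" if ab: "a \<noteq> b" for a b
  proof (rule ccontr)
    assume nz: "A $ a $ b \<noteq> 0"
    let ?c = "cmod (A $ a $ b)"
    have n: "0 < ?n" by simp
    \<comment> \<open>With \<epsilon> = c/n the lift has trace with real part c, against the bound 2
      c \<le> X_aa + X_bb.\<close>
    with nz have "0 < ?c / ?n" by (intro divide_pos_pos) simp_all
    from approx[OF assms this] obtain X where X0: "(\<forall>a b. a \<noteq> b \<longrightarrow> X $ a $ b = A $ a $ b) \<and>
      Re (trace X) = ?c / ?n * ?n + Re (trace A) \<and> os_pos matrix_system 1 (\<lambda>i j. X)"
      by (rule exE)
    have X: "X $ a $ b = A $ a $ b" "Re (trace X) = ?c / ?n * ?n" "os_pos matrix_system 1 (\<lambda>i j. X)"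
      using X0[THEN conjunct1, rule_format, OF ab] X0[THEN conjunct2, THEN conjunct1]
        X0[THEN conjunct2, THEN conjunct2] Re0 by (simp_all only: add_0_right)
    have "2 * ?c \<le> Re (X $ a $ a) + Re (X $ b $ b)"
      using os_pos_matrix_entry_bound[OF X(3), of 0, OF _ ab] by (simp add: X(1))
    also have "\<dots> = (\<Sum>c\<in>{a, b}. Re (X $ c $ c))" using ab by simp
    also have "\<dots> \<le> (\<Sum>c\<in>UNIV. Re (X $ c $ c))" by (rule sum_mono2) (simp_all add: diag[OF X(3)])
    also have "\<dots> = Re (trace X)" by (simp add: trace_def Re_sum)
    also have "\<dots> = ?c" unfolding X(2) using n by (simp del: of_nat_Suc)
    finally show False using nz by simp
  qed
  ultimately show ?thesis by (simp add: diag_trace_zero_def)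
qed

lemma phi_map_eq_0_iff:
  "phi_map A = 0 \<longleftrightarrow> A \<in> (J_space :: (complex^('g::finite option)^('g option)) set)"
proof
  assume A: "phi_map A = 0"
  let ?B = "A + mat_adj A" and ?C = "mat_scale \<i> (A - mat_adj A)"
  have "?B \<in> diag_trace_zero"
    by (rule phi_map_kernel_hermitian) (simp_all add: phi_map_add phi_map_adj A mat_adj_simps add.commute)
  moreover have "mat_adj ?C = ?C"
    by (auto intro!: matrix_eqI simp: algebra_simps)
  then have "?C \<in> diag_trace_zero"
    by (intro phi_map_kernel_hermitian) (simp_all add: phi_map_scale phi_map_diff phi_map_adj A)
  ultimately have "mat_scale (1 / 2) ?B + mat_scale (- \<i> / 2) ?C \<in> diag_trace_zero"
    by (rule diag_trace_zero_add[OF diag_trace_zero_scale diag_trace_zero_scale])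
  also have "mat_scale (1 / 2) ?B + mat_scale (- \<i> / 2) ?C = A"
    by (intro matrix_eqI) (simp add: field_simps)
  finally show "A \<in> J_space" .
qed (rule phi_map_diag_trace_zero)

lemma os_kernel_phi_map: "os_kernel matrix_system W_system phi_map = J_space"
  by (auto simp: os_kernel_def phi_map_eq_0_iff)

abbreviation coset :: "complex^('g::finite option)^('g option) \<Rightarrow> (complex^('g option)^('g option)) set" where
  "coset \<equiv> os_coset matrix_system J_space"

abbreviation Q_system :: "(complex^('g::finite option)^('g option)) set operator_system" where
  "Q_system \<equiv> quotient_system matrix_system J_space"

abbreviation \<iota> :: "(complex^('g::finite option)^('g option)) set \<Rightarrow> 'g free_group group_cstar" where
  "\<iota> \<equiv> induced_map phi_map"

lemma mem_coset: "y \<in> coset x \<longleftrightarrow> y - x \<in> J_space"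
proof
  assume "y - x \<in> J_space"
  then show "y \<in> coset x" by (auto simp: os_coset_def intro!: image_eqI[of _ _ "y - x"])
qed (auto simp: os_coset_def)

lemma self_mem_coset: "x \<in> coset x"
  by (simp add: mem_coset diag_trace_zero_zero)

lemma coset_eqI: "x - y \<in> J_space \<Longrightarrow> coset x = coset y"
proof -
  assume xy: "x - y \<in> J_space"
  have "z - x \<in> J_space \<longleftrightarrow> z - y \<in> J_space" for z
    using diag_trace_zero_add[of "z - x" "x - y"] diag_trace_zero_diff[of "z - y" "x - y"] xy by auto
  then show ?thesis by (auto simp: mem_coset)
qed

lemma induced_phi_coset: "\<iota> (coset x) = phi_map x"
proof -
  have "phi_map ` coset x = {phi_map x}"
    using self_mem_coset[of x] by (auto simp: os_coset_def phi_map_add phi_map_diag_trace_zero)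
  then show ?thesis by (simp add: induced_map_def)
qed

lemma Q_space: "os_space Q_system = range coset"
  and Q_unit: "os_unit Q_system = coset (mat 1)"
  by (simp_all add: quotient_system_def)

lemma Q_add: "os_add Q_system (coset x) (coset y) = coset (x + y)"
proof -
  have "{a + b | a b. a \<in> coset x \<and> b \<in> coset y} = coset (x + y)"
  proof (intro set_eqI iffI)
    fix z assume "z \<in> {a + b | a b. a \<in> coset x \<and> b \<in> coset y}"
    then obtain a b where z: "z = a + b" "a \<in> coset x" "b \<in> coset y" by blast
    then have "(a - x) + (b - y) \<in> J_space" by (intro diag_trace_zero_add) (simp_all add: mem_coset)
    then show "z \<in> coset (x + y)" by (simp add: mem_coset z algebra_simps)
  next
    fix z assume "z \<in> coset (x + y)"
    then have "z - y \<in> coset x" by (simp add: mem_coset algebra_simps)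
    moreover have "z = (z - y) + y" by simp
    ultimately show "z \<in> {a + b | a b. a \<in> coset x \<and> b \<in> coset y}" using self_mem_coset by blast
  qed
  then show ?thesis by (simp add: quotient_system_def)
qed

lemma Q_scale: "os_scale Q_system c (coset x) = coset (mat_scale c x)"
proof -
  have diff: "mat_scale c a - mat_scale c x = mat_scale c (a - x)" for a
    by (intro matrix_eqI) (simp add: algebra_simps)
  have "{mat_scale c a + k | a k. a \<in> coset x \<and> k \<in> J_space} = coset (mat_scale c x)"
  proof (intro set_eqI iffI)
    fix z assume "z \<in> {mat_scale c a + k | a k. a \<in> coset x \<and> k \<in> J_space}"
    then obtain a k where z: "z = mat_scale c a + k" "a \<in> coset x" "k \<in> J_space" by blast
    then have "mat_scale c (a - x) + k \<in> J_space"
      by (intro diag_trace_zero_add diag_trace_zero_scale) (simp_all add: mem_coset)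
    then show "z \<in> coset (mat_scale c x)" by (simp add: mem_coset z flip: diff) (simp add: algebra_simps)
  next
    fix z assume "z \<in> coset (mat_scale c x)"
    then have "z - mat_scale c x \<in> J_space" by (simp add: mem_coset)
    moreover have "z = mat_scale c x + (z - mat_scale c x)" by simp
    ultimately show "z \<in> {mat_scale c a + k | a k. a \<in> coset x \<and> k \<in> J_space}"
      using self_mem_coset by blast
  qed
  then show ?thesis by (simp add: quotient_system_def)
qed

lemma os_pos_Q_iff:
  fixes X :: "nat \<Rightarrow> nat \<Rightarrow> (complex^('g::finite option)^('g option)) set"
  shows "os_pos Q_system p X \<longleftrightarrow> (\<exists>H. (\<forall>i<p. \<forall>j<p. H i j = mat_adj (H j i)) \<and>
    (\<forall>i<p. \<forall>j<p. X i j = coset (H i j)) \<and>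
    (\<forall>\<epsilon>>0. \<exists>K. (\<forall>i<p. \<forall>j<p. K i j \<in> J_space \<and> K i j = mat_adj (K j i)) \<and>
      os_pos matrix_system p (\<lambda>i j. mat_scale (of_real \<epsilon>) (unit_mat i j) + H i j + K i j)))"
proof -
  have *: "(if i = j then os_scale matrix_system (complex_of_real \<epsilon>) (os_unit matrix_system) else os_zero matrix_system)
      = mat_scale (of_real \<epsilon>) (unit_mat i j :: complex^('g option)^('g option))"
    for \<epsilon> and i j :: nat
    by (simp add: unit_mat_def mat_scale_simps)
  show ?thesis by (simp add: quotient_system_def hermitian_matrix_def *)
qed

lemma complete_order_iso_induced:
  "complete_order_iso Q_system W_system (\<iota> :: _ \<Rightarrow> 'g::finite free_group group_cstar)"
  unfolding complete_order_iso_def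
proof (intro conjI)
  have "inj_on (\<iota> :: _ \<Rightarrow> 'g free_group group_cstar) (os_space Q_system)"
    unfolding Q_space
  proof (rule inj_onI)
    fix C D assume CD: "C \<in> range coset" "D \<in> range coset" "\<iota> C = \<iota> D"
    then obtain x y where xy: "C = coset x" "D = coset y" by blast
    then have "phi_map (x - y) = 0" using CD(3) by (simp add: induced_phi_coset phi_map_diff)
    then show "C = D" unfolding xy by (intro coset_eqI) (simp add: phi_map_eq_0_iff)
  qed
  then show bij: "bij_betw (\<iota> :: _ \<Rightarrow> 'g free_group group_cstar) (os_space Q_system) (os_space W_system)"
    by (simp add: bij_betw_def Q_space image_image induced_phi_coset W_space_eq)
  show "cp_map Q_system W_system (\<iota> :: _ \<Rightarrow> 'g free_group group_cstar)"
    unfolding cp_map_def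
  proof (intro conjI ballI allI impI)
    fix p X assume "os_pos Q_system p X"
    then obtain H where H: "\<forall>i<p. \<forall>j<p. H i j = mat_adj (H j i)" "\<forall>i<p. \<forall>j<p. X i j = coset (H i j)"
      and K: "\<forall>\<epsilon>>0. \<exists>K. (\<forall>i<p. \<forall>j<p. K i j \<in> J_space \<and> K i j = mat_adj (K j i)) \<and>
        os_pos matrix_system p (\<lambda>i j. mat_scale (of_real \<epsilon>) (unit_mat i j) + H i j + K i j)"
      unfolding os_pos_Q_iff by (elim exE conjE) (rule that)
    have "os_pos W_system p (\<lambda>i j. phi_map (H i j))"
    proof (rule phi_map_pos_of_approx)
      show "H i j = mat_adj (H j i)" if "i < p" "j < p" for i j using H(1) that by blast
      fix \<epsilon> :: real assume "0 < \<epsilon>"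
      from K[rule_format, OF this] obtain K
        where K': "(\<forall>i<p. \<forall>j<p. K i j \<in> J_space \<and> K i j = mat_adj (K j i)) \<and>
          os_pos matrix_system p (\<lambda>i j. mat_scale (of_real \<epsilon>) (unit_mat i j) + H i j + K i j)"
        by (rule exE)
      note pos = K'[THEN conjunct2]
      from K'[THEN conjunct1] have "\<forall>i<p. \<forall>j<p. K i j \<in> J_space" by blast
      with pos show "\<exists>K. (\<forall>i<p. \<forall>j<p. K i j \<in> J_space) \<and>
          os_pos matrix_system p (\<lambda>i j. mat_scale (of_real \<epsilon>) (unit_mat i j) + H i j + K i j)"
        by (intro exI[of _ K] conjI)
    qed
    then show "os_pos W_system p (\<lambda>i j. \<iota> (X i j))"
      by (simp add: os_pos_W_iff H(2) induced_phi_coset)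
  qed (auto simp: Q_space Q_add Q_scale induced_phi_coset phi_map_add phi_map_scale W_space_eq)
  have inv: "inv_into (os_space Q_system) \<iota> (phi_map x) = coset x" for x :: "complex^('g option)^('g option)"
    using bij_betw_inv_into_left[OF bij, of "coset x"] by (simp add: Q_space induced_phi_coset)
  show "cp_map W_system Q_system (inv_into (os_space Q_system) (\<iota> :: _ \<Rightarrow> 'g free_group group_cstar))"
    unfolding cp_map_def
  proof (intro conjI ballI allI impI)
    fix p and X :: "nat \<Rightarrow> nat \<Rightarrow> 'g free_group group_cstar"
    assume X: "os_pos W_system p X"
    then have XW: "X i j \<in> W_space" if "i < p" "j < p" for i j using that by (simp add: os_pos_W_iff)
    from X obtain Y where "\<forall>i<p. \<forall>j<p. X i j = (\<Sum>k<p. adj (Y k i) * Y k j)"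
      unfolding os_pos_W_iff by blast
    then have Y: "X i j = (\<Sum>k<p. adj (Y k i) * Y k j)" if "i < p" "j < p" for i j using that by blast
    have X_adj: "adj (X j i) = X i j" if "i < p" "j < p" for i j
      using that by (simp add: Y adj_sum adj_mult adj_adj)
    define A :: "nat \<Rightarrow> nat \<Rightarrow> complex^('g option)^('g option)" where "A i j = (SOME A. phi_map A = X i j)" for i j
    have A: "phi_map (A i j) = X i j" if "i < p" "j < p" for i j
    proof -
      have "\<exists>A :: complex^('g option)^('g option). phi_map A = X i j"
        using XW[OF that] by (auto simp: W_space_eq)
      then show ?thesis unfolding A_def by (rule someI_ex)
    qed
    \<comment> \<open>The cone of the quotient asks for a hermitian representative, so an arbitrary
      preimage is symmetrised.\<close>
    define H where "H i j = mat_scale (1 / 2) (A i j + mat_adj (A j i))" for i j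
    have H: "phi_map (H i j) = X i j" if "i < p" "j < p" for i j
    proof -
      have "phi_map (H i j) = (1 / 2) *\<^sub>C (X i j + X i j)"
        using that by (simp add: H_def phi_map_scale phi_map_add phi_map_adj A X_adj)
      also have "\<dots> = ((1 / 2) + (1 / 2)) *\<^sub>C X i j" by (simp only: scaleC_add_left scaleC_add_right)
      finally show ?thesis by (simp add: scaleC_one)
    qed
    have herm: "H i j = mat_adj (H j i)" for i j
      by (simp add: H_def mat_adj_simps add.commute)
    have pos: "os_pos W_system p (\<lambda>i j. phi_map (H i j))"
      using X H by (simp add: os_pos_W_iff)
    show "os_pos Q_system p (\<lambda>i j. inv_into (os_space Q_system) \<iota> (X i j))"
      unfolding os_pos_Q_iff
    proof (rule exI[of _ H], intro conjI allI impI)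
      show "H i j = mat_adj (H j i)" for i j by (rule herm)
      show "inv_into (os_space Q_system) \<iota> (X i j) = coset (H i j)" if "i < p" "j < p" for i j
        using inv[of "H i j"] H[OF that] by simp
      show "\<exists>K. (\<forall>i<p. \<forall>j<p. K i j \<in> J_space \<and> K i j = mat_adj (K j i)) \<and>
          os_pos matrix_system p (\<lambda>i j. mat_scale (of_real \<epsilon>) (unit_mat i j) + H i j + K i j)"
        if "0 < \<epsilon>" for \<epsilon>
        by (rule phi_map_lift[OF herm pos that])
    qed
  qed (auto simp: W_space_eq Q_space inv[unfolded Q_space] Q_add Q_scale simp flip: phi_map_add phi_map_scale)
qed

theorem complete_quotient_map_phi_map:
  "complete_quotient_map matrix_system W_system
    (phi_map :: complex^('g::finite option)^('g option) \<Rightarrow> 'g free_group group_cstar)"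
  unfolding complete_quotient_map_def os_kernel_phi_map
  using cp_map_phi_map complete_order_iso_induced by blast

lemma image_Q_space: "(\<iota> :: _ \<Rightarrow> 'g::finite free_group group_cstar) ` os_space Q_system = W_space"
  by (simp add: Q_space image_image induced_phi_coset W_space_eq)

lemma complete_order_embedding_induced:
  "complete_order_embedding Q_system (\<iota> :: _ \<Rightarrow> 'g::finite free_group group_cstar)"
  unfolding complete_order_embedding_def image_Q_space
  using complete_order_iso_induced by (simp add: Q_unit induced_phi_coset phi_map_one W_system_def)

section \<open>Extension of completely positive maps\<close>

text \<open>The positivity hypothesis of \<open>matrix_sqrt\<close>. In this form the cone
  properties are immediate, which they are not for the existence of a Gram factor.\<close>

definition state_pos :: "nat \<Rightarrow> (nat \<Rightarrow> nat \<Rightarrow> 'a::cstar_algebra) \<Rightarrow> bool" where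
  "state_pos p X \<longleftrightarrow> (\<forall>s v. state s \<longrightarrow> 0 \<le> Re (s (\<Sum>i<p. \<Sum>j<p. adj (v i) * X i j * v j)))"

lemma state_pos_add: "state_pos p X \<Longrightarrow> state_pos p Y \<Longrightarrow> state_pos p (\<lambda>i j. X i j + Y i j)"
  by (simp add: state_pos_def distrib_left distrib_right sum.distrib stateD(1))

lemma state_pos_scale: "state_pos p X \<Longrightarrow> 0 \<le> r \<Longrightarrow> state_pos p (\<lambda>i j. r *\<^sub>R X i j)"
  by (simp add: state_pos_def state_scaleR flip: scaleR_sum_right)

lemma state_pos_cong: "state_pos p X \<Longrightarrow> (\<And>i j. i < p \<Longrightarrow> j < p \<Longrightarrow> X i j = Y i j) \<Longrightarrow> state_pos p Y"
  by (simp add: state_pos_def)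

lemma state_pos_zero: "state_pos p (\<lambda>i j. 0)"
  by (simp add: state_pos_def state_zero)

lemma state_pos_outer: "state_pos p (\<lambda>i j. adj (y i) * y j)" for y :: "nat \<Rightarrow> 'a::cstar_algebra"
  unfolding state_pos_def
proof (intro allI impI)
  fix s :: "'a \<Rightarrow> complex" and v assume s: "state s"
  have "(\<Sum>i<p. \<Sum>j<p. adj (v i) * (adj (y i) * y j) * v j) = adj (\<Sum>i<p. y i * v i) * (\<Sum>j<p. y j * v j)"
    by (simp add: adj_sum sum_product adj_mult mult.assoc)
  then show "0 \<le> Re (s (\<Sum>i<p. \<Sum>j<p. adj (v i) * (adj (y i) * y j) * v j))"
    using state_square[OF s] by (simp add: complex_nonneg_Reals_iff)
qed

lemma state_pos_unit_dominates:
  fixes h :: "nat \<Rightarrow> nat \<Rightarrow> 'a::cstar_algebra"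
  shows "state_pos p (\<lambda>i j. (\<Sum>i<p. \<Sum>j<p. norm (h i j)) *\<^sub>R (if i = j then 1 else 0) + h i j)"
  unfolding state_pos_def
proof (intro allI impI)
  fix s :: "'a \<Rightarrow> complex" and v assume s: "state s"
  interpret t: semi_inner "(*\<^sub>C)" "\<lambda>x y. s (adj y * x)" by (rule semi_inner_state[OF s])
  let ?t = "\<Sum>i<p. \<Sum>j<p. norm (h i j)" and ?q = "\<Sum>i<p. (t.nrm (v i))\<^sup>2"
  have q0: "0 \<le> ?q" by (simp add: sum_nonneg)
  have "(t.nrm (v k))\<^sup>2 \<le> ?q" if "k < p" for k using that by (intro member_le_sum) auto
  then have le: "t.nrm (v k) \<le> sqrt ?q" if "k < p" for k using that by (intro real_le_rsqrt)
  have "- (norm (h i j) * ?q) \<le> Re (s (adj (v i) * h i j * v j))" if "i < p" "j < p" for i j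
  proof -
    have "(t.nrm (h i j * v j))\<^sup>2 \<le> (norm (h i j) * t.nrm (v j))\<^sup>2"
      using state_conj_bound[OF s, of "v j" "h i j"]
      by (simp add: t.nrm_square power_mult_distrib adj_mult mult.assoc)
    then have n: "t.nrm (h i j * v j) \<le> norm (h i j) * t.nrm (v j)"
      by (rule power2_le_imp_le) simp
    have "cmod (s (adj (v i) * (h i j * v j))) \<le> t.nrm (h i j * v j) * t.nrm (v i)"
      by (rule t.Cauchy_Schwarz)
    also have "\<dots> \<le> (norm (h i j) * sqrt ?q) * sqrt ?q"
      using that le q0 by (intro mult_mono order_trans[OF n] mult_left_mono) auto
    finally have "cmod (s (adj (v i) * h i j * v j)) \<le> norm (h i j) * ?q"
      using q0 by (simp add: mult.assoc)
    then show ?thesis using abs_Re_le_cmod[of "s (adj (v i) * h i j * v j)"] by linarith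
  qed
  then have "(\<Sum>i<p. \<Sum>j<p. - (norm (h i j) * ?q)) \<le> (\<Sum>i<p. \<Sum>j<p. Re (s (adj (v i) * h i j * v j)))"
    by (intro sum_mono) auto
  then have "0 \<le> ?t * ?q + (\<Sum>i<p. \<Sum>j<p. Re (s (adj (v i) * h i j * v j)))"
    by (simp add: sum_negf sum_distrib_right)
  also have "?t * ?q = Re (s (?t *\<^sub>R (\<Sum>i<p. adj (v i) * v i)))"
    by (simp add: state_scaleR[OF s] state_sum[OF s] t.nrm_square)
  also have "\<dots> + (\<Sum>i<p. \<Sum>j<p. Re (s (adj (v i) * h i j * v j)))
      = Re (s (?t *\<^sub>R (\<Sum>i<p. adj (v i) * v i) + (\<Sum>i<p. \<Sum>j<p. adj (v i) * h i j * v j)))"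
    by (simp add: stateD(1)[OF s] state_sum[OF s])
  also have "?t *\<^sub>R (\<Sum>i<p. adj (v i) * v i)
      = (\<Sum>i<p. \<Sum>j<p. adj (v i) * (?t *\<^sub>R (if i = j then 1 else 0)) * v j)"
  proof -
    have "(\<Sum>j<p. adj (v i) * (r *\<^sub>R (if i = j then 1 else 0)) * v j) = r *\<^sub>R (adj (v i) * v i)"
      if "i < p" for i and r :: real
    proof -
      have "(\<Sum>j<p. adj (v i) * (r *\<^sub>R (if i = j then 1 else 0)) * v j)
          = (\<Sum>j<p. if i = j then r *\<^sub>R (adj (v i) * v i) else 0)"
        by (intro sum.cong refl) simp
      then show ?thesis using that by simp
    qed
    then show ?thesis by (simp add: scaleR_sum_right)
  qed
  finally show "0 \<le> Re (s (\<Sum>i<p. \<Sum>j<p. adj (v i) * (?t *\<^sub>R (if i = j then 1 else 0) + h i j) * v j))"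
    by (simp only: distrib_left distrib_right sum.distrib)
qed

text \<open>A unital completely positive map on an operator system \<open>K\<close>, with positivity
  of matrices expressed by Gram factors.\<close>

locale cp_extension =
  fixes K :: "'b::cstar_algebra set" and \<theta> :: "'b \<Rightarrow> 'a::cstar_algebra"
  assumes K_one: "1 \<in> K" and K_add: "x \<in> K \<Longrightarrow> y \<in> K \<Longrightarrow> x + y \<in> K"
    and K_scale: "x \<in> K \<Longrightarrow> c *\<^sub>C x \<in> K" and K_adj: "x \<in> K \<Longrightarrow> adj x \<in> K"
    and \<theta>_one: "\<theta> 1 = 1" and \<theta>_add: "x \<in> K \<Longrightarrow> y \<in> K \<Longrightarrow> \<theta> (x + y) = \<theta> x + \<theta> y"
    and \<theta>_scale: "x \<in> K \<Longrightarrow> \<theta> (c *\<^sub>C x) = c *\<^sub>C \<theta> x" and \<theta>_adj: "x \<in> K \<Longrightarrow> \<theta> (adj x) = adj (\<theta> x)"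
    and cp: "(\<And>i j. i < (p :: nat) \<Longrightarrow> j < p \<Longrightarrow> X i j \<in> K) \<Longrightarrow>
      (\<And>i j. i < p \<Longrightarrow> j < p \<Longrightarrow> X i j = (\<Sum>k<p. adj (Y k i) * Y k j)) \<Longrightarrow>
      \<exists>Z. \<forall>i<p. \<forall>j<p. \<theta> (X i j) = (\<Sum>k<p. adj (Z k i) * Z k j)"
begin

lemma K_zero: "0 \<in> K"
  using K_scale[OF K_one, of 0] by simp

lemma \<theta>_zero: "\<theta> 0 = 0"
  using \<theta>_scale[OF K_one, of 0] by simp

lemma K_scaleR: "x \<in> K \<Longrightarrow> r *\<^sub>R x \<in> K"
  by (simp add: scaleR_scaleC K_scale)

lemma \<theta>_scaleR: "x \<in> K \<Longrightarrow> \<theta> (r *\<^sub>R x) = r *\<^sub>R \<theta> x"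
  by (simp add: scaleR_scaleC \<theta>_scale)

text \<open>
  The values \<open>\<psi> i j x\<close> are the matrix entries, with respect to the vectors \<open>a i\<close> in the GNS space of
  \<open>s\<close>, of an extension of \<open>\<theta>\<close> to a completely positive map on \<open>'b\<close>.
\<close>

definition ext_form :: "('a \<Rightarrow> complex) \<Rightarrow> nat \<Rightarrow> (nat \<Rightarrow> 'a) \<Rightarrow> (nat \<Rightarrow> nat \<Rightarrow> 'b \<Rightarrow> complex) \<Rightarrow> bool" where
  "ext_form s p a \<psi> \<longleftrightarrow> (\<forall>i j x y. \<psi> i j (x + y) = \<psi> i j x + \<psi> i j y) \<and>
     (\<forall>i j c x. \<psi> i j (c *\<^sub>C x) = c * \<psi> i j x) \<and> (\<forall>i j x. cnj (\<psi> i j x) = \<psi> j i (adj x)) \<and>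
     (\<forall>y. 0 \<le> Re (\<Sum>i<p. \<Sum>j<p. \<psi> i j (adj (y i) * y j))) \<and>
     (\<forall>i<p. \<forall>j<p. \<forall>x\<in>K. \<psi> i j x = s (adj (a i) * \<theta> x * a j))"

text \<open>Arveson's extension theorem for matrix-valued maps. Completely positive maps into p
  \<times> p matrices correspond to positive functionals on p \<times> p matrices over the domain,
  so it suffices to extend the functional f from the matrices over \<open>K\<close> to those over
  \<open>'b\<close>. The hypothesis on a says that f is positive at the order unit.\<close>

theorem ext_form_exists:
  assumes s: "state s" and a: "0 < Re (\<Sum>i<p. s (adj (a i) * a i))"
  shows "\<exists>\<psi>. ext_form s p a \<psi>"
proof -
  define star where "star X = (\<lambda>i j. adj (X j i))" for X :: "nat \<Rightarrow> nat \<Rightarrow> 'b"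
  define sc where "sc c X = (\<lambda>i j. c *\<^sub>C X i j)" for c and X :: "nat \<Rightarrow> nat \<Rightarrow> 'b"
  have vs: "vector_space sc"
    by unfold_locales (simp_all add: sc_def fun_eq_iff scaleC_add_right scaleC_add_left scaleC_scaleC scaleC_one)
  interpret M: vector_space sc by (rule vs)
  define e where "e = (\<lambda>i j :: nat. if i = j then 1 else 0 :: 'b)"
  define f where "f w = (\<Sum>i<p. \<Sum>j<p. s (adj (a i) * \<theta> (w i j) * a j))" for w
  define inK where "inK w \<longleftrightarrow> (\<forall>i<p. \<forall>j<p. w i j \<in> K) \<and> (\<forall>i<p. \<forall>j<p. adj (w i j) = w j i)" for w
  \<comment> \<open>The matrices that dominate a matrix over \<open>K\<close> at which f is
    nonnegative. The separating functional must be nonnegative wherever f is, on self-adjoint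
    matrices over \<open>K\<close>, and is therefore proportional to f there.\<close>
  define C where "C = {X. star X = X \<and> (\<exists>w. inK w \<and> 0 \<le> Re (f w) \<and> state_pos p (\<lambda>i j. X i j + - w i j))}"
  have CI: "X \<in> C" if "star X = X" "inK w" "0 \<le> Re (f w)" "state_pos p (\<lambda>i j. X i j + - w i j)" for X w
    using that by (auto simp: C_def)
  note st = stateD(1,2)[OF s] state_scaleR[OF s] state_minus[OF s] state_zero[OF s]
  have f_add: "f (\<lambda>i j. w i j + w' i j) = f w + f w'" if "inK w" "inK w'" for w w'
  proof -
    have "f (\<lambda>i j. w i j + w' i j) = (\<Sum>i<p. \<Sum>j<p. s (adj (a i) * \<theta> (w i j) * a j) + s (adj (a i) * \<theta> (w' i j) * a j))"
      unfolding f_def using that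
      by (intro sum.cong refl) (simp add: inK_def \<theta>_add distrib_left distrib_right st)
    then show ?thesis by (simp add: f_def sum.distrib)
  qed
  have f_scale: "f (\<lambda>i j. r *\<^sub>R w i j) = of_real r * f w" if "inK w" for w and r :: real
  proof -
    have "f (\<lambda>i j. r *\<^sub>R w i j) = (\<Sum>i<p. \<Sum>j<p. of_real r * s (adj (a i) * \<theta> (w i j) * a j))"
      unfolding f_def using that by (intro sum.cong refl) (simp add: inK_def \<theta>_scaleR st)
    then show ?thesis by (simp add: f_def sum_distrib_left)
  qed
  have inK_add: "inK (\<lambda>i j. w i j + w' i j)" if "inK w" "inK w'" for w w'
    using that by (simp add: inK_def K_add adj_add)
  have inK_scale: "inK (\<lambda>i j. r *\<^sub>R w i j)" if "inK w" for w and r :: real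
    using that by (simp add: inK_def K_scaleR adj_scaleR)
  have inK0: "inK (\<lambda>i j. 0)" by (simp add: inK_def K_zero)
  have f0: "f (\<lambda>i j. 0) = 0" by (simp add: f_def \<theta>_zero st)
  have inKe: "inK e" by (auto simp: inK_def e_def K_one K_zero)
  have fe: "f e = (\<Sum>i<p. s (adj (a i) * a i))"
  proof -
    have "f e = (\<Sum>i<p. \<Sum>j<p. if i = j then s (adj (a i) * a i) else 0)"
      unfolding f_def e_def by (intro sum.cong refl) (simp add: \<theta>_one \<theta>_zero st)
    then show ?thesis by simp
  qed
  have star_e: "star e = e" by (auto simp: star_def e_def fun_eq_iff)
  have f_nonneg: "0 \<le> Re (f w)" if w: "inK w" "state_pos p w" for w
  proof -
    have "\<exists>Y. \<forall>i<p. \<forall>j<p. w i j = (\<Sum>k<p. adj (Y k i) * Y k j)"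
      by (rule matrix_sqrt[where h = w and p = p]) (use w in \<open>auto simp: inK_def state_pos_def\<close>)
    then obtain Y where "\<forall>i<p. \<forall>j<p. w i j = (\<Sum>k<p. adj (Y k i) * Y k j)" by (rule exE)
    then have "\<exists>Z. \<forall>i<p. \<forall>j<p. \<theta> (w i j) = (\<Sum>k<p. adj (Z k i) * Z k j)"
      using w by (intro cp[of p w Y]) (simp_all add: inK_def)
    then obtain Z where Z: "\<And>i j. i < p \<Longrightarrow> j < p \<Longrightarrow> \<theta> (w i j) = (\<Sum>k<p. adj (Z k i) * Z k j)" by blast
    have "f w = (\<Sum>i<p. \<Sum>j<p. \<Sum>k<p. s (adj (Z k i * a i) * (Z k j * a j)))"
      by (simp add: f_def Z sum_distrib_left sum_distrib_right state_sum[OF s] adj_mult mult.assoc)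
    also have "\<dots> = (\<Sum>i<p. \<Sum>k<p. \<Sum>j<p. s (adj (Z k i * a i) * (Z k j * a j)))"
      by (rule sum.cong[OF refl]) (rule sum.swap)
    also have "\<dots> = (\<Sum>k<p. \<Sum>i<p. \<Sum>j<p. s (adj (Z k i * a i) * (Z k j * a j)))" by (rule sum.swap)
    also have "\<dots> = (\<Sum>k<p. s (adj (\<Sum>i<p. Z k i * a i) * (\<Sum>j<p. Z k j * a j)))"
      by (simp add: adj_sum sum_product state_sum[OF s])
    finally show ?thesis
      using state_square[OF s] by (simp add: sum_nonneg complex_nonneg_Reals_iff)
  qed
  have C: "vcone (\<lambda>r. sc (of_real r)) C"
    unfolding vcone_def
  proof (intro conjI ballI allI impI)
    show "0 \<in> C" by (rule CI[OF _ inK0]) (simp_all add: star_def fun_eq_iff f0 state_pos_zero)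
    fix X assume "X \<in> C"
    then obtain w where X: "star X = X" "inK w" "0 \<le> Re (f w)" "state_pos p (\<lambda>i j. X i j + - w i j)"
      by (auto simp: C_def)
    { fix Y assume "Y \<in> C"
      then obtain w' where Y: "star Y = Y" "inK w'" "0 \<le> Re (f w')" "state_pos p (\<lambda>i j. Y i j + - w' i j)"
        by (auto simp: C_def)
      show "X + Y \<in> C"
      proof (rule CI)
        show "star (X + Y) = X + Y" using X(1) Y(1) by (simp add: star_def fun_eq_iff adj_add)
        show "inK (\<lambda>i j. w i j + w' i j)" using X Y by (intro inK_add)
        show "0 \<le> Re (f (\<lambda>i j. w i j + w' i j))" using X Y by (simp add: f_add)
        show "state_pos p (\<lambda>i j. (X + Y) i j + - (w i j + w' i j))"
          using state_pos_add[OF X(4) Y(4)] by (simp add: algebra_simps)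
      qed }
    fix r :: real assume r: "0 \<le> r"
    show "sc (of_real r) X \<in> C"
    proof (rule CI)
      show "star (sc (of_real r) X) = sc (of_real r) X"
        using X(1) by (simp add: star_def sc_def fun_eq_iff adj_scaleC)
      show "inK (\<lambda>i j. r *\<^sub>R w i j)" using X by (intro inK_scale)
      show "0 \<le> Re (f (\<lambda>i j. r *\<^sub>R w i j))" using X r by (simp add: f_scale)
      show "state_pos p (\<lambda>i j. sc (of_real r) X i j + - (r *\<^sub>R w i j))"
        using state_pos_scale[OF X(4) r] by (simp add: sc_def scaleR_diff_right flip: scaleR_scaleC)
    qed
  qed
  \<comment> \<open>Otherwise -(e + w) is positive over \<open>K\<close> for some w with Re (f w)
    \<ge> 0, so f would be nonnegative there, although Re (f e) > 0.\<close>
  have notin: "- e \<notin> C"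
  proof
    assume "- e \<in> C"
    then obtain w where w: "inK w" "0 \<le> Re (f w)" "state_pos p (\<lambda>i j. (- e) i j + - w i j)"
      by (auto simp: C_def)
    let ?g = "\<lambda>i j. (-1) *\<^sub>R (e i j + w i j)"
    have "state_pos p ?g" by (rule state_pos_cong[OF w(3)]) simp
    then have "0 \<le> Re (f ?g)" by (intro f_nonneg inK_scale inK_add inKe w)
    also have "f ?g = of_real (-1) * (f e + f w)"
      unfolding f_scale[OF inK_add[OF inKe w(1)]] f_add[OF inKe w(1)] ..
    finally show False using w(2) a by (simp add: fe)
  qed
  have unit: "\<exists>t. sc (of_real t) e + h \<in> C" if h: "star h = h" for h
  proof
    let ?t = "\<Sum>i<p. \<Sum>j<p. norm (h i j)"
    have "state_pos p (\<lambda>i j. (sc (of_real ?t) e + h) i j + - 0)"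
      by (rule state_pos_cong[OF state_pos_unit_dominates[of p h]]) (simp add: sc_def e_def scaleR_scaleC)
    moreover have "star (sc (of_real ?t) e + h) = sc (of_real ?t) e + h"
    proof (intro ext)
      fix i j
      have "star h i j = h i j" "star e i j = e i j" using h star_e by simp_all
      then show "star (sc (of_real ?t) e + h) i j = (sc (of_real ?t) e + h) i j"
        by (simp add: star_def sc_def adj_add adj_scaleC)
    qed
    ultimately show "sc (of_real ?t) e + h \<in> C"
      by (intro CI[OF _ inK0]) (simp_all only: f0 zero_complex.sel order_refl)
  qed
  have star_add: "star (x + y) = star x + star y" for x y by (simp add: star_def fun_eq_iff adj_add)
  have star_sc: "star (sc c x) = sc (cnj c) (star x)" for c x
    by (simp add: star_def sc_def fun_eq_iff adj_scaleC)
  have star_star: "star (star x) = x" for x by (simp add: star_def adj_adj)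
  have C_herm: "star x = x" if "x \<in> C" for x using that by (simp add: C_def)
  obtain F where F: "\<And>x y. F (x + y) = F x + F y" "\<And>c x. F (sc c x) = c * F x" "F e = 1"
    "\<And>x. F (star x) = cnj (F x)" "\<And>x. x \<in> C \<Longrightarrow> F x \<in> \<real>\<^sub>\<ge>\<^sub>0"
    by (rule star_cone_functional[where scale = sc and star = star and C = C and e = e,
          OF vs star_add star_sc star_star C C_herm notin star_e unit], assumption+) (rule that)
  have F0: "F 0 = 0" using F(1)[of 0 0] by simp
  have Fsum: "F (sum g A) = (\<Sum>i\<in>A. F (g i))" for g :: "nat \<Rightarrow> _" and A
    by (induction A rule: infinite_finite_induct)
      (simp_all only: sum.infinite sum.empty sum.insert F0 F(1) not_False_eq_True)
  define r where "r = Re (f e)"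
  have r: "0 < r" using a by (simp add: r_def fe)
  have fe_r: "f e = of_real r"
  proof -
    have "Im (s (adj x * x)) = 0" for x using state_square[OF s, of x] by (simp add: complex_nonneg_Reals_iff)
    then show ?thesis by (simp add: r_def fe complex_eq_iff Im_sum)
  qed
  have F_herm: "f w = of_real r * F w" if w: "inK w" "star w = w" for w
  proof -
    have f_cnj: "cnj (f w) = f w"
    proof -
      have "cnj (f w) = (\<Sum>i<p. \<Sum>j<p. s (adj (a j) * \<theta> (w j i) * a i))"
        unfolding f_def cnj_sum
      proof (intro sum.cong refl)
        fix i j assume ij: "i \<in> {..<p}" "j \<in> {..<p}"
        then have "adj (adj (a i) * \<theta> (w i j) * a j) = adj (a j) * \<theta> (w j i) * a i"
          using w(1) by (simp add: adj_mult adj_adj mult.assoc inK_def flip: \<theta>_adj)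
        then show "cnj (s (adj (a i) * \<theta> (w i j) * a j)) = s (adj (a j) * \<theta> (w j i) * a i)"
          by (simp flip: stateD(4)[OF s])
      qed
      also have "\<dots> = f w" unfolding f_def by (rule sum.swap)
      finally show ?thesis .
    qed
    \<comment> \<open>Then f vanishes at w - q e, so this element and its negative are both in
      \<open>C\<close>, and F vanishes at it as well.\<close>
    define q where "q = Re (f w) / r"
    have fq: "f w = of_real (q * r)" using f_cnj r by (simp add: q_def complex_eq_iff)
    let ?w = "\<lambda>c. \<lambda>i j. c *\<^sub>R (w i j + (- q) *\<^sub>R e i j)"
    have Cw: "?w c \<in> C" for c
    proof (rule CI)
      have K: "inK (\<lambda>i j. (- q) *\<^sub>R e i j)" by (rule inK_scale[OF inKe])
      show inK: "inK (?w c)" by (intro inK_scale inK_add w K)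
      have "star w i j = w i j" "star e i j = e i j" for i j using w(2) star_e by simp_all
      then show "star (?w c) = ?w c" by (simp add: star_def fun_eq_iff adj_scaleR adj_diff)
      have "f (?w c) = of_real c * (f w + of_real (- q) * f e)"
        unfolding f_scale[OF inK_add[OF w(1) K]] f_add[OF w(1) K] f_scale[OF inKe] ..
      then show "0 \<le> Re (f (?w c))" by (simp add: fq fe_r)
    qed (simp add: state_pos_zero)
    have Fw: "F (?w c) = of_real c * (F w - of_real q)" for c
    proof -
      have "?w c = sc (of_real c) (w + sc (of_real (- q)) e)"
        by (simp add: sc_def fun_eq_iff scaleR_scaleC)
      then show ?thesis by (simp only: F(1-3)) simp
    qed
    have "F w - of_real q \<in> \<real>\<^sub>\<ge>\<^sub>0" "- (F w - of_real q) \<in> \<real>\<^sub>\<ge>\<^sub>0"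
      using F(5)[OF Cw, of 1] F(5)[OF Cw, of "-1"] unfolding Fw by simp_all
    then have "F w = of_real q" by (auto simp: complex_nonneg_Reals_iff complex_eq_iff)
    then show ?thesis by (simp add: fq mult.commute)
  qed
  define E where "E i j x = (\<lambda>k l. if k = i \<and> l = j then x else 0 :: 'b)" for i j :: nat and x :: 'b
  \<comment> \<open>The values of F at matrices with one nonzero entry, rescaled by r = f e because
    F is normalised to 1 at e.\<close>
  define \<psi> where "\<psi> i j x = of_real r * F (E i j x)" for i j x
  have E_add: "E i j (x + y) = E i j x + E i j y" for i j x y by (simp add: E_def fun_eq_iff)
  have E_sc: "E i j (c *\<^sub>C x) = sc c (E i j x)" for i j c x by (simp add: E_def sc_def fun_eq_iff)
  have E_star: "star (E i j x) = E j i (adj x)" for i j x by (auto simp: E_def star_def fun_eq_iff)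
  have add: "\<psi> i j (x + y) = \<psi> i j x + \<psi> i j y" for i j x y
    unfolding \<psi>_def E_add F(1) by (rule distrib_left)
  have scale: "\<psi> i j (c *\<^sub>C x) = c * \<psi> i j x" for i j c x
    unfolding \<psi>_def E_sc F(2) by (rule mult.left_commute)
  have cnj: "cnj (\<psi> i j x) = \<psi> j i (adj x)" for i j x
    by (simp only: \<psi>_def complex_cnj_mult complex_cnj_complex_of_real F(4)[symmetric] E_star)
  have pos: "0 \<le> Re (\<Sum>i<p. \<Sum>j<p. \<psi> i j (adj (y i) * y j))" for y
  proof -
    define P where "P i j = (if i < p \<and> j < p then adj (y i) * y j else 0)" for i j
    have "state_pos p (\<lambda>i j. P i j + - 0)"
      by (rule state_pos_cong[OF state_pos_outer[of p y]]) (simp add: P_def)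
    moreover have "star P = P" by (auto simp: star_def P_def fun_eq_iff adj_mult adj_adj)
    ultimately have "P \<in> C"
      by (intro CI[OF _ inK0]) (simp_all only: f0 zero_complex.sel order_refl)
    then have "F P \<in> \<real>\<^sub>\<ge>\<^sub>0" by (rule F(5))
    then have FP: "0 \<le> Re (F P)" by (simp add: complex_nonneg_Reals_iff)
    have "P = (\<Sum>i<p. \<Sum>j<p. E i j (adj (y i) * y j))"
    proof (intro ext)
      fix k l
      have "(\<Sum>i<p. \<Sum>j<p. E i j (adj (y i) * y j)) k l
          = (\<Sum>i<p. \<Sum>j<p. if j = l then (if i = k then adj (y k) * y l else 0) else 0)"
        unfolding sum_fun_apply by (intro sum.cong refl) (auto simp: E_def)
      then show "P k l = (\<Sum>i<p. \<Sum>j<p. E i j (adj (y i) * y j)) k l"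
        by (cases "l < p") (simp_all add: P_def)
    qed
    then have "F P = (\<Sum>i<p. \<Sum>j<p. F (E i j (adj (y i) * y j)))" by (simp only: Fsum)
    then have "(\<Sum>i<p. \<Sum>j<p. \<psi> i j (adj (y i) * y j)) = of_real r * F P"
      by (simp only: \<psi>_def sum_distrib_left)
    then show ?thesis using FP r by simp
  qed
  have val: "\<psi> i j x = s (adj (a i) * \<theta> x * a j)" if ij: "i < p" "j < p" and x: "x \<in> K" for i j x
  proof -
    let ?g = "\<lambda>x. s (adj (a i) * \<theta> x * a j)"
    have fE: "f (E k l z) = s (adj (a k) * \<theta> z * a l)" if kl: "k < p" "l < p" for k l z
    proof -
      have "f (E k l z) = (\<Sum>k'<p. \<Sum>l'<p. if l' = l then (if k' = k then s (adj (a k) * \<theta> z * a l) else 0) else 0)"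
        unfolding f_def by (intro sum.cong refl) (auto simp: E_def \<theta>_zero st)
      then show ?thesis using kl by simp
    qed
    \<comment> \<open>\<open>E i j y\<close> is not self-adjoint in general, so
      \<open>F_herm\<close> is applied to its sum with its adjoint. The cases y = x and y = i x
      recover the real and the imaginary part.\<close>
    have re: "\<psi> i j y + cnj (\<psi> i j y) = ?g y + cnj (?g y)" if y: "y \<in> K" for y
    proof -
      let ?w = "E i j y + E j i (adj y)"
      have sw: "star ?w = ?w" by (simp only: star_add E_star adj_adj add.commute)
      have "adj (?w k l) = ?w l k" for k l
        using fun_cong[OF fun_cong[OF sw, of l], of k] by (simp only: star_def)
      moreover have "?w k l \<in> K" for k l using y by (simp add: E_def K_zero K_add K_adj)
      ultimately have "inK ?w" unfolding inK_def by blast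
      with sw have "of_real r * F ?w = f ?w" by (simp only: F_herm)
      also have "f ?w = f (E i j y) + f (E j i (adj y))"
      proof -
        have "f ?w = (\<Sum>k<p. \<Sum>l<p. s (adj (a k) * \<theta> (E i j y k l) * a l) + s (adj (a k) * \<theta> (E j i (adj y) k l) * a l))"
          unfolding f_def using y
          by (intro sum.cong refl) (simp add: E_def \<theta>_add K_adj K_zero distrib_left distrib_right st)
        then show ?thesis by (simp add: f_def sum.distrib)
      qed
      also have "\<dots> = ?g y + s (adj (a j) * \<theta> (adj y) * a i)"
        by (simp only: fE[OF ij] fE[OF ij(2,1)])
      also have "s (adj (a j) * \<theta> (adj y) * a i) = cnj (?g y)"
        using y by (simp add: \<theta>_adj adj_mult adj_adj mult.assoc flip: stateD(4)[OF s])
      finally have "of_real r * (F (E i j y) + F (E j i (adj y))) = ?g y + cnj (?g y)" by (simp only: F(1))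
      then show ?thesis unfolding cnj[of i j y] unfolding \<psi>_def by (simp only: distrib_left)
    qed
    have "?g (\<i> *\<^sub>C x) = \<i> * ?g x"
      using x by (simp add: \<theta>_scale scaleC_mult_left scaleC_mult_right st)
    then show ?thesis using re[OF x] re[OF K_scale[OF x, of \<i>]]
      unfolding scale by (simp add: complex_eq_iff)
  qed
  show ?thesis unfolding ext_form_def using add scale cnj pos val by blast
qed

end

section \<open>Graphs of *-homomorphisms\<close>

text \<open>k is the inverse of 1 + \<open>adj b * b\<close>, and b k is a cut-off of b, like t / (1
  + t^2): bounded for every b, and off by t^3 / (1 + t^2) \<le> 1/2 for t \<le> 1. Being rational in
  b and its adjoint, it is carried along a graph without functional calculus.\<close>

lemma positive_resolvent:
  fixes b :: "'a::cstar_algebra"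
  assumes kh: "k * (1 + adj b * b) = 1" and hk: "(1 + adj b * b) * k = 1"
  shows "norm (b * k) \<le> 1" and "norm b \<le> 1 \<Longrightarrow> norm (b - b * k) \<le> 1 / 2"
proof -
  let ?h = "adj b * b"
  have h: "adj ?h = ?h" by (simp add: adj_mult adj_adj)
  have "adj k * (1 + ?h) = 1" using arg_cong[OF hk, of adj] h by (simp add: adj_mult adj_add adj_adj)
  then have k: "adj k = k" by (metis hk mult.assoc mult.right_neutral mult.left_neutral)
  have h1: "?h * k = 1 - k" using hk by (simp add: algebra_simps)
  have h2: "k * ?h = 1 - k" using kh by (simp add: algebra_simps)
  have khk: "adj (b * k) * (b * k) = k * (1 - k)"
    by (simp only: adj_mult k mult.assoc flip: h1)
  \<comment> \<open>The element k (1 - k) is positive as \<open>adj (b * k) * (b * k)\<close>;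
    adding the square of k, respectively of 1 - k, leaves k, respectively 1 - k.\<close>
  have "pos_elem (k * k + k * (1 - k))"
    unfolding khk[symmetric] using pos_elem_square[OF k] by (intro pos_elem_add pos_elem_adj_mult_self)
  then have pk: "pos_elem k" by (simp add: algebra_simps)
  have "adj (1 - k) = 1 - k" by (simp add: adj_diff k)
  then have "pos_elem ((1 - k) * (1 - k) + k * (1 - k))"
    unfolding khk[symmetric] by (intro pos_elem_add pos_elem_adj_mult_self pos_elem_square)
  then have pk': "pos_elem (1 - k)" by (simp add: algebra_simps)
  have n1: "norm k \<le> 1" using norm_le_of_real[OF pk, of 1] pk' by simp
  have n2: "norm (1 - k) \<le> 1" using norm_le_of_real[OF pk', of 1] pk by simp
  have "(norm (b * k))\<^sup>2 = norm (k * (1 - k))" by (simp only: khk flip: cstar_identity)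
  also have "\<dots> \<le> norm k * norm (1 - k)" by (rule norm_mult_ineq)
  also have "\<dots> \<le> 1" using mult_mono[OF n1 n2] by simp
  finally show "norm (b * k) \<le> 1" by (simp add: power2_le_iff_abs_le abs_square_le_1)
  assume b: "norm b \<le> 1"
  have "norm ?h \<le> 1" using b by (simp add: cstar_identity power_le_one)
  then have "pos_elem (1 - ?h)" using pos_elem_of_real_diff[OF h, of 1] by simp
  moreover have "(1 - ?h) * k = k * (1 - ?h)" using h1 h2 by (simp add: algebra_simps)
  ultimately have "pos_elem ((1 / 2) *\<^sub>R ((1 - ?h) * k))"
    by (intro pos_elem_scaleR pos_elem_mult pk) simp_all
  moreover have "(1 / 2) *\<^sub>R ((1 - ?h) * k) = of_real (1 / 2) - (1 - k)"
  proof -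
    have "(1 - ?h) * k = 2 *\<^sub>R k - 1" using h1 by (simp add: algebra_simps scaleR_2)
    then have "(1 / 2) *\<^sub>R ((1 - ?h) * k) = k - (1 / 2) *\<^sub>R 1"
      by (simp only: scaleR_diff_right) simp
    also have "\<dots> = (1 - (1 / 2)) *\<^sub>R 1 - (1 - k)" by (simp only: scaleR_left_diff_distrib) simp
    finally show ?thesis by (simp add: of_real_def)
  qed
  ultimately have "norm (1 - k) \<le> 1 / 2" by (intro norm_le_of_real pk') simp_all
  then have "norm b * norm (1 - k) \<le> 1 * (1 / 2)" using b by (intro mult_mono) simp_all
  moreover have "b - b * k = b * (1 - k)" by (simp add: algebra_simps)
  ultimately show "norm (b - b * k) \<le> 1 / 2" using norm_mult_ineq[of b "1 - k"] by simp
qed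

lemma neumann_series:
  fixes T :: "'a::cstar_algebra"
  assumes "norm T < 1"
  shows "summable (\<lambda>m. T ^ m)" "(1 - T) * suminf (\<lambda>m. T ^ m) = 1" "suminf (\<lambda>m. T ^ m) * (1 - T) = 1"
proof -
  show summ: "summable (\<lambda>m. T ^ m)" by (rule complete_algebra_summable_geometric[OF assms])
  have "suminf (\<lambda>m. T ^ Suc m) = suminf (\<lambda>m. T ^ m) - 1" using suminf_split_head[OF summ] by simp
  moreover have "suminf (\<lambda>m. T ^ Suc m) = T * suminf (\<lambda>m. T ^ m)"
    by (simp add: suminf_mult[OF summ])
  moreover have "suminf (\<lambda>m. T ^ Suc m) = suminf (\<lambda>m. T ^ m) * T"
    unfolding power_Suc2 by (rule suminf_mult2[OF summ, symmetric])
  ultimately show "(1 - T) * suminf (\<lambda>m. T ^ m) = 1" "suminf (\<lambda>m. T ^ m) * (1 - T) = 1"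
    by (simp_all add: algebra_simps)
qed

text \<open>A relation, because P(u) |-> P(w) need not be a function of P(u) a priori;
  single-valuedness comes from \<open>G_norm\<close>. Values are dense by \<open>G_dense\<close>,
  with no control over the norm of their preimages.\<close>

locale star_graph =
  fixes G :: "'b::cstar_algebra \<Rightarrow> 'a::cstar_algebra \<Rightarrow> bool"
  assumes G_one: "G 1 1" and G_add: "G b x \<Longrightarrow> G c y \<Longrightarrow> G (b + c) (x + y)"
    and G_mult: "G b x \<Longrightarrow> G c y \<Longrightarrow> G (b * c) (x * y)"
    and G_scale: "G b x \<Longrightarrow> G (\<alpha> *\<^sub>C b) (\<alpha> *\<^sub>C x)" and G_adj: "G b x \<Longrightarrow> G (adj b) (adj x)"
    and G_norm: "G b x \<Longrightarrow> norm x \<le> norm b"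
    and G_dense: "0 < e \<Longrightarrow> \<exists>b x. G b x \<and> norm (a - x) < e"
begin

definition clG :: "'b \<Rightarrow> 'a \<Rightarrow> bool" where
  "clG b x \<longleftrightarrow> (b, x) \<in> closure {(b, x). G b x}"

lemma clG_iff: "clG b x \<longleftrightarrow> (\<exists>B X. (\<forall>n. G (B n) (X n)) \<and> B \<longlonglongrightarrow> b \<and> X \<longlonglongrightarrow> x)"
proof
  assume "clG b x"
  then obtain Z where Z: "\<And>n. Z n \<in> {(b, x). G b x}" "Z \<longlonglongrightarrow> (b, x)"
    unfolding clG_def closure_sequential by blast
  have "(\<lambda>n. fst (Z n)) \<longlonglongrightarrow> b" "(\<lambda>n. snd (Z n)) \<longlonglongrightarrow> x"
    using tendsto_fst[OF Z(2)] tendsto_snd[OF Z(2)] by simp_all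
  moreover have "G (fst (Z n)) (snd (Z n))" for n using Z(1)[of n] by (simp add: case_prod_beta)
  ultimately show "\<exists>B X. (\<forall>n. G (B n) (X n)) \<and> B \<longlonglongrightarrow> b \<and> X \<longlonglongrightarrow> x"
    by (intro exI[of _ "\<lambda>n. fst (Z n)"] exI[of _ "\<lambda>n. snd (Z n)"]) simp
next
  assume "\<exists>B X. (\<forall>n. G (B n) (X n)) \<and> B \<longlonglongrightarrow> b \<and> X \<longlonglongrightarrow> x"
  then obtain B X where "\<And>n. G (B n) (X n)" "B \<longlonglongrightarrow> b" "X \<longlonglongrightarrow> x" by blast
  then show "clG b x" unfolding clG_def closure_sequential
    by (intro exI[of _ "\<lambda>n. (B n, X n)"]) (auto intro: tendsto_Pair)
qed

lemma clGI: "G b x \<Longrightarrow> clG b x"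
  unfolding clG_def using closure_subset[of "{(b, x). G b x}"] by blast

lemma clG_lim:
  assumes "\<And>n. clG (B n) (X n)" "B \<longlonglongrightarrow> b" "X \<longlonglongrightarrow> x"
  shows "clG b x"
proof -
  have "(\<lambda>n. (B n, X n)) \<longlonglongrightarrow> (b, x)" using assms(2,3) by (rule tendsto_Pair)
  from closed_sequentially[OF closed_closure _ this, of "{(b, x). G b x}"] show ?thesis
    using assms(1) by (simp add: clG_def)
qed

lemma clG_add: "clG b x \<Longrightarrow> clG c y \<Longrightarrow> clG (b + c) (x + y)"
  unfolding clG_iff by (elim exE conjE, intro exI conjI allI) (rule G_add, erule spec, erule spec, (rule tendsto_add, assumption+)+)

lemma clG_mult: "clG b x \<Longrightarrow> clG c y \<Longrightarrow> clG (b * c) (x * y)"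
  unfolding clG_iff by (elim exE conjE, intro exI conjI allI) (rule G_mult, erule spec, erule spec, (rule tendsto_mult, assumption+)+)

lemma tendsto_scaleC: "X \<longlonglongrightarrow> x \<Longrightarrow> (\<lambda>n. \<alpha> *\<^sub>C X n) \<longlonglongrightarrow> \<alpha> *\<^sub>C (x :: 'c::cstar_algebra)"
  using tendsto_mult[OF tendsto_const[of "\<alpha> *\<^sub>C 1"], of X x] by (simp add: scaleC_mult_left)

lemma clG_scale: "clG b x \<Longrightarrow> clG (\<alpha> *\<^sub>C b) (\<alpha> *\<^sub>C x)"
  unfolding clG_iff by (elim exE conjE, intro exI conjI allI) (rule G_scale, erule spec, (rule tendsto_scaleC, assumption+)+)

lemma clG_adj: "clG b x \<Longrightarrow> clG (adj b) (adj x)"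
  unfolding clG_iff by (elim exE conjE, intro exI conjI allI) (rule G_adj, erule spec, (rule tendsto_adj, assumption+)+)

lemma clG_norm: "clG b x \<Longrightarrow> norm x \<le> norm b"
  unfolding clG_iff by (elim exE conjE) (rule LIMSEQ_le[OF tendsto_norm tendsto_norm], auto intro: G_norm)

lemma clG_one: "clG 1 1"
  by (rule clGI) (rule G_one)

lemma clG_scaleR: "clG b x \<Longrightarrow> clG (r *\<^sub>R b) (r *\<^sub>R x)"
  unfolding scaleR_scaleC by (rule clG_scale)

lemma clG_zero: "clG 0 0"
  using clG_scaleR[OF clG_one, of 0] by simp

lemma clG_diff: "clG b x \<Longrightarrow> clG c y \<Longrightarrow> clG (b - c) (x - y)"
  using clG_add[of b x "- c" "- y"] clG_scaleR[of c y "-1"] by simp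

lemma clG_unique: "clG b x \<Longrightarrow> clG b y \<Longrightarrow> x = y"
  using clG_diff[of b x b y] clG_norm[of 0 "x - y"] by simp

lemma clG_sum: "(\<And>i. clG (B i) (X i)) \<Longrightarrow> clG (\<Sum>i\<in>A. B i) (\<Sum>i\<in>A. X i)"
  by (induction A rule: infinite_finite_induct) (simp_all add: clG_zero clG_add)

lemma clG_power: "clG b x \<Longrightarrow> clG (b ^ n) (x ^ n)"
  by (induction n) (simp_all add: clG_one clG_mult)

lemma clG_suminf:
  assumes "\<And>n. clG (B n) (X n)" "summable B" "summable X"
  shows "clG (suminf B) (suminf X)"
  by (rule clG_lim[OF clG_sum[OF assms(1)]]) (rule summable_LIMSEQ, rule assms)+

text \<open>Both inverses are sums of Neumann series with the same scalars, so the pair of them is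
  again in the closed graph.\<close>

lemma clG_resolvent:
  assumes "clG b x"
  obtains k l where "clG k l" "k * (1 + adj b * b) = 1" "(1 + adj b * b) * k = 1"
    "l * (1 + adj x * x) = 1" "(1 + adj x * x) * l = 1"
proof -
  let ?h = "adj b * b" and ?h' = "adj x * x"
  have hh: "clG ?h ?h'" by (intro clG_mult clG_adj assms)
  obtain t where t: "norm (of_real t - ?h) \<le> t"
    using pos_elem_adj_mult_self[of b] by (auto simp: pos_elem_def)
  have t0: "0 \<le> t" using t norm_ge_zero order_trans by blast
  have ht: "clG (of_real t - ?h) (of_real t - ?h')"
    unfolding of_real_def by (intro clG_diff clG_scaleR clG_one hh)
  \<comment> \<open>With h = \<open>adj b * b\<close>, the element T = r (t - h) has norm at most t
    / (1 + t) < 1, and 1 - T = r (1 + h).\<close>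
  define r where "r = inverse (1 + t)"
  have r: "0 < r" "r * (1 + t) = 1" using t0 by (simp_all add: r_def)
  let ?T = "r *\<^sub>R (of_real t - ?h)" and ?T' = "r *\<^sub>R (of_real t - ?h')"
  have T: "norm ?T < 1"
  proof -
    have "norm ?T \<le> r * t" using r t by simp
    also have "\<dots> < 1" using r by (simp add: distrib_left)
    finally show ?thesis .
  qed
  have TT: "clG ?T ?T'" by (intro clG_scaleR ht)
  then have T': "norm ?T' < 1" using clG_norm T by (meson le_less_trans)
  have inv: "(r *\<^sub>R S) * (1 + g) = 1 \<and> (1 + g) * (r *\<^sub>R S) = 1"
    if "(1 - r *\<^sub>R (of_real t - g)) * S = 1" "S * (1 - r *\<^sub>R (of_real t - g)) = 1" for S g :: "'c::cstar_algebra"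
  proof -
    have "1 - r *\<^sub>R (of_real t - g) = (1 - r * t) *\<^sub>R 1 + r *\<^sub>R g"
      by (simp add: of_real_def scaleR_diff_right scaleR_left_diff_distrib)
    also have "1 - r * t = r" using r(2) by (simp add: distrib_left)
    finally have "1 - r *\<^sub>R (of_real t - g) = r *\<^sub>R (1 + g)" by (simp add: scaleR_right_distrib)
    then show ?thesis using that by simp
  qed
  show ?thesis
  proof (rule that)
    show "clG (r *\<^sub>R suminf (\<lambda>m. ?T ^ m)) (r *\<^sub>R suminf (\<lambda>m. ?T' ^ m))"
      by (intro clG_scaleR clG_suminf clG_power TT neumann_series(1) T T')
  qed (use inv[OF neumann_series(2,3)[OF T]] inv[OF neumann_series(2,3)[OF T']] in blast)+
qed

text \<open>A preimage b of an approximation to a may be large. Cutting it off to b k makes its norm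
  at most 1 and moves its image by at most 1/2, which leaves an error below 1 for the iteration in
  \<open>clG_surj\<close>.\<close>

lemma clG_half_approx_unit:
  assumes "norm a \<le> 1"
  shows "\<exists>b x. clG b x \<and> norm b \<le> 1 \<and> norm (a - x) \<le> 3 / 4"
proof -
  \<comment> \<open>The factor 8/9 brings norm x \<le> 9/8 down to 1. The error is then 1/8 from the
    approximation, 1/9 of 9/8 from the rescaling and 1/2 from the cut-off, in total 3/4.\<close>
  obtain b x where bx: "G b x" "norm (a - x) < 1 / 8" using G_dense[of "1/8" a] by auto
  have nx: "norm x \<le> 9 / 8" using norm_triangle_ineq[of a "x - a"] bx(2) assms by (simp add: norm_minus_commute)
  let ?b = "(8 / 9) *\<^sub>R b" and ?x = "(8 / 9) *\<^sub>R x"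
  have G: "clG ?b ?x" by (intro clG_scaleR clGI bx)
  have x1: "norm ?x \<le> 1" using nx by simp
  have eq: "a - ?x = (a - x) + (1 / 9) *\<^sub>R x" by (simp add: algebra_simps flip: scaleR_left_distrib)
  have "norm (a - ?x) \<le> norm (a - x) + norm ((1 / 9) *\<^sub>R x)" unfolding eq by (rule norm_triangle_ineq)
  then have ax: "norm (a - ?x) \<le> 1 / 4" using bx nx by simp
  obtain k l where kl: "clG k l" "k * (1 + adj ?b * ?b) = 1" "(1 + adj ?b * ?b) * k = 1"
    "l * (1 + adj ?x * ?x) = 1" "(1 + adj ?x * ?x) * l = 1"
    using clG_resolvent[OF G] by blast
  have "norm (?b * k) \<le> 1" by (rule positive_resolvent(1)[OF kl(2,3)])
  moreover have "norm (?x - ?x * l) \<le> 1 / 2" by (rule positive_resolvent(2)[OF kl(4,5) x1])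
  then have "norm (a - ?x * l) \<le> 3 / 4"
    using norm_triangle_ineq[of "a - ?x" "?x - ?x * l"] ax by simp
  ultimately show ?thesis using clG_mult[OF G kl(1)] by blast
qed

lemma clG_half_approx: "\<exists>b x. clG b x \<and> norm b \<le> norm a \<and> norm (a - x) \<le> 3 / 4 * norm a"
proof (cases "a = 0")
  case True
  then show ?thesis using clG_zero by (intro exI[of _ 0]) simp
next
  case False
  then have n: "0 < norm a" by simp
  then have "norm (inverse (norm a) *\<^sub>R a) \<le> 1" by simp
  from clG_half_approx_unit[OF this] obtain b x
    where bx: "clG b x \<and> norm b \<le> 1 \<and> norm (inverse (norm a) *\<^sub>R a - x) \<le> 3 / 4" by blast
  have "a - norm a *\<^sub>R x = norm a *\<^sub>R (inverse (norm a) *\<^sub>R a - x)"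
    using n by (simp add: scaleR_diff_right)
  then have "norm (a - norm a *\<^sub>R x) = norm a * norm (inverse (norm a) *\<^sub>R a - x)"
    by (simp only: norm_scaleR abs_norm_cancel)
  also have "\<dots> \<le> norm a * (3 / 4)" using bx by (intro mult_left_mono) simp_all
  finally have "norm (a - norm a *\<^sub>R x) \<le> 3 / 4 * norm a" by simp
  moreover have "norm (norm a *\<^sub>R b) \<le> norm a" using bx by (simp add: mult_left_le)
  ultimately show ?thesis using bx clG_scaleR[of b x "norm a"] by blast
qed

text \<open>The open mapping argument: correct the error of an approximate preimage over and over.\<close>

lemma clG_surj: "\<exists>b. clG b a"
proof -
  define \<beta> where "\<beta> a = (SOME b. \<exists>x. clG b x \<and> norm b \<le> norm a \<and> norm (a - x) \<le> 3 / 4 * norm a)" for a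
  define \<eta> where "\<eta> a = (SOME x. clG (\<beta> a) x \<and> norm (\<beta> a) \<le> norm a \<and> norm (a - x) \<le> 3 / 4 * norm a)" for a
  have "\<exists>x. clG (\<beta> a) x \<and> norm (\<beta> a) \<le> norm a \<and> norm (a - x) \<le> 3 / 4 * norm a" for a
    unfolding \<beta>_def by (rule someI_ex[OF clG_half_approx])
  then have *: "clG (\<beta> a) (\<eta> a) \<and> norm (\<beta> a) \<le> norm a \<and> norm (a - \<eta> a) \<le> 3 / 4 * norm a" for a
    unfolding \<eta>_def by (rule someI_ex)
  define r where "r n = ((\<lambda>a. a - \<eta> a) ^^ n) a" for n
  have r0: "r 0 = a" and rS: "r (Suc n) = r n - \<eta> (r n)" for n by (simp_all add: r_def)
  have nr: "norm (r n) \<le> (3 / 4) ^ n * norm a" for n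
  proof (induction n)
    case (Suc n)
    have "norm (r (Suc n)) \<le> 3 / 4 * norm (r n)" unfolding rS by (rule *[THEN conjunct2, THEN conjunct2])
    with Suc show ?case by simp
  qed (simp add: r0)
  have geo: "summable (\<lambda>n. (3 / 4) ^ n * norm a)" by (intro summable_mult2 summable_geometric) simp
  have "norm (\<beta> (r n)) \<le> (3 / 4) ^ n * norm a" for n
    by (rule order_trans[OF _ nr]) (rule *[THEN conjunct2, THEN conjunct1])
  then have sb: "summable (\<lambda>n. \<beta> (r n))" by (intro summable_norm_cancel[OF summable_comparison_test'[OF geo, of 0]]) simp
  have "(\<lambda>n. (3 / 4) ^ n * norm a) \<longlonglongrightarrow> 0" using geo by (rule summable_LIMSEQ_zero)
  then have "r \<longlonglongrightarrow> 0" by (rule Lim_null_comparison[rotated]) (simp add: nr)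
  then have lim: "(\<lambda>n. a - r n) \<longlonglongrightarrow> a" using tendsto_diff[OF tendsto_const] by fastforce
  have tele: "(\<Sum>k<n. \<eta> (r k)) = a - r n" for n by (induction n) (simp_all add: r0 rS)
  have "clG (suminf (\<lambda>n. \<beta> (r n))) a"
  proof (rule clG_lim)
    show "clG (\<Sum>k<n. \<beta> (r k)) (\<Sum>k<n. \<eta> (r k))" for n
      by (rule clG_sum) (rule *[THEN conjunct1])
    show "(\<lambda>n. \<Sum>k<n. \<beta> (r k)) \<longlonglongrightarrow> suminf (\<lambda>n. \<beta> (r n))" by (rule summable_LIMSEQ[OF sb])
    show "(\<lambda>n. \<Sum>k<n. \<eta> (r k)) \<longlonglongrightarrow> a" unfolding tele by (rule lim)
  qed
  then show ?thesis by blast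
qed

definition domG :: "'b set" where
  "domG = {b. \<exists>x. clG b x}"

definition homG :: "'b \<Rightarrow> 'a" where
  "homG b = (THE x. clG b x)"

lemma homG_eq: "clG b x \<Longrightarrow> homG b = x"
  unfolding homG_def using clG_unique by blast

lemma clG_homG: "b \<in> domG \<Longrightarrow> clG b (homG b)"
  unfolding domG_def using homG_eq by auto

lemma cstar_subalgebra_domG: "cstar_subalgebra domG"
  unfolding cstar_subalgebra_def
proof (intro conjI ballI allI)
  show "1 \<in> domG" using clG_one by (auto simp: domG_def)
  fix x assume x: "x \<in> domG"
  show "adj x \<in> domG" using clG_adj[OF clG_homG[OF x]] by (auto simp: domG_def)
  show "c *\<^sub>C x \<in> domG" for c using clG_scale[OF clG_homG[OF x]] by (auto simp: domG_def)
  fix y assume y: "y \<in> domG"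
  show "x + y \<in> domG" using clG_add[OF clG_homG[OF x] clG_homG[OF y]] by (auto simp: domG_def)
  show "x * y \<in> domG" using clG_mult[OF clG_homG[OF x] clG_homG[OF y]] by (auto simp: domG_def)
next
  show "closed domG" unfolding closed_sequential_limits
  proof (intro allI impI, elim conjE)
    fix B b assume B: "\<forall>n. B n \<in> domG" "B \<longlonglongrightarrow> b"
    let ?X = "\<lambda>n. homG (B n)"
    \<comment> \<open>\<open>homG\<close> is contractive, so the images of a convergent sequence
      converge, and closedness of the graph puts the limit point into the domain.\<close>
    have le: "norm (?X m - ?X n) \<le> norm (B m - B n)" for m n
      using B(1) by (intro clG_norm clG_diff clG_homG) blast+
    have "Cauchy ?X"
    proof (rule CauchyI)
      fix e :: real assume "0 < e"
      then obtain M where "\<And>m n. M \<le> m \<Longrightarrow> M \<le> n \<Longrightarrow> norm (B m - B n) < e"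
        using CauchyD[OF LIMSEQ_imp_Cauchy[OF B(2)]] by blast
      then show "\<exists>M. \<forall>m\<ge>M. \<forall>n\<ge>M. norm (?X m - ?X n) < e"
        by (intro exI[of _ M] allI impI le_less_trans[OF le])
    qed
    then have "convergent ?X" by (rule Cauchy_convergent)
    then obtain x where "?X \<longlonglongrightarrow> x" unfolding convergent_def by (rule exE)
    then have "clG b x" by (rule clG_lim[OF clG_homG[OF B(1)[rule_format]] B(2)])
    then show "b \<in> domG" by (auto simp: domG_def)
  qed
qed

lemma star_hom_on_homG: "star_hom_on domG homG"
  unfolding star_hom_on_def
  by (intro conjI ballI allI homG_eq clG_add clG_mult clG_scale clG_adj clG_homG clG_one)

lemma homG_surj: "homG ` domG = UNIV"
proof -
  have "a \<in> homG ` domG" for a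
  proof -
    obtain b where "clG b a" using clG_surj by blast
    then show ?thesis using homG_eq by (force simp: domG_def)
  qed
  then show ?thesis by blast
qed

lemma domG_subset:
  assumes "cstar_subalgebra D" "\<And>b x. G b x \<Longrightarrow> b \<in> D"
  shows "domG \<subseteq> D"
proof
  fix b assume "b \<in> domG"
  then obtain B where "\<And>n. B n \<in> D" "B \<longlonglongrightarrow> b" using assms(2) by (auto simp: domG_def clG_iff)
  moreover have "closed D" using assms(1) by (simp add: cstar_subalgebra_def)
  ultimately show "b \<in> D" unfolding closed_sequential_limits by blast
qed

end

section \<open>Null vectors of the dilation and the norm inequality\<close>

context cp_extension
begin

text \<open>The Stinespring inner product of the sums of v i \<otimes> a i and of w i \<otimes> a i.
  The vector \<open>pt b i\<close> below is b \<otimes> a i.\<close>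

definition eform :: "nat \<Rightarrow> (nat \<Rightarrow> nat \<Rightarrow> 'b \<Rightarrow> complex) \<Rightarrow> (nat \<Rightarrow> 'b) \<Rightarrow> (nat \<Rightarrow> 'b) \<Rightarrow> complex" where
  "eform p \<psi> v w = (\<Sum>i<p. \<Sum>j<p. \<psi> i j (adj (w i) * v j))"

definition pt :: "'b \<Rightarrow> nat \<Rightarrow> nat \<Rightarrow> 'b" where
  "pt b i = (\<lambda>k. if k = i then b else 0)"

lemma ext_formD:
  assumes "ext_form s p a \<psi>"
  shows "\<psi> i j (x + y) = \<psi> i j x + \<psi> i j y" "\<psi> i j (c *\<^sub>C x) = c * \<psi> i j x"
    "cnj (\<psi> i j x) = \<psi> j i (adj x)" "0 \<le> Re (\<Sum>i<p. \<Sum>j<p. \<psi> i j (adj (y' i) * y' j))"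
    "i < p \<Longrightarrow> j < p \<Longrightarrow> x \<in> K \<Longrightarrow> \<psi> i j x = s (adj (a i) * \<theta> x * a j)"
  using assms unfolding ext_form_def by blast+

lemma semi_inner_eform:
  assumes "ext_form s p a \<psi>"
  shows "semi_inner (\<lambda>c (v :: nat \<Rightarrow> 'b) i. c *\<^sub>C v i) (eform p \<psi>)"
proof -
  note D = ext_formD[OF assms]
  interpret vector_space "\<lambda>c (v :: nat \<Rightarrow> 'b) i. c *\<^sub>C v i"
    by unfold_locales (simp_all add: fun_eq_iff scaleC_add_right scaleC_add_left scaleC_scaleC scaleC_one)
  show ?thesis
  proof unfold_locales
    fix x y z :: "nat \<Rightarrow> 'b" and c
    show "eform p \<psi> (x + y) z = eform p \<psi> x z + eform p \<psi> y z"
      by (simp add: eform_def distrib_left D(1) sum.distrib)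
    show "eform p \<psi> (\<lambda>i. c *\<^sub>C x i) z = c * eform p \<psi> x z"
      by (simp add: eform_def scaleC_mult_right D(2) sum_distrib_left)
    have "cnj (eform p \<psi> x y) = (\<Sum>i<p. \<Sum>j<p. \<psi> j i (adj (x j) * y i))"
      by (simp add: eform_def D(3) adj_mult adj_adj)
    also have "\<dots> = eform p \<psi> y x" unfolding eform_def by (rule sum.swap)
    finally show "cnj (eform p \<psi> x y) = eform p \<psi> y x" .
    show "0 \<le> Re (eform p \<psi> x x)" unfolding eform_def by (rule D(4))
  qed
qed

context
  fixes s p a \<psi>
  assumes s: "state s" and E: "ext_form s p a \<psi>"
begin

interpretation V: semi_inner "\<lambda>c (v :: nat \<Rightarrow> 'b) i. c *\<^sub>C v i" "eform p \<psi>"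
  by (rule semi_inner_eform[OF E])

lemma ext_zero: "\<psi> i j 0 = 0"
  using ext_formD(2)[OF E, of i j 0 0] by simp

lemma eform_pt: "i < p \<Longrightarrow> j < p \<Longrightarrow> eform p \<psi> (pt b i) (pt c j) = \<psi> j i (adj c * b)"
proof -
  assume ij: "i < p" "j < p"
  have "eform p \<psi> (pt b i) (pt c j)
      = (\<Sum>k<p. \<Sum>l<p. if l = i then (if k = j then \<psi> j i (adj c * b) else 0) else 0)"
    unfolding eform_def pt_def by (intro sum.cong refl) (auto simp: ext_zero)
  then show ?thesis using ij by simp
qed

lemma eform_pt_one:
  "i < p \<Longrightarrow> j < p \<Longrightarrow> eform p \<psi> (pt 1 i) (pt 1 j) = s (adj (a j) * a i)"
  by (simp add: eform_pt ext_formD(5)[OF E] K_one \<theta>_one)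

lemma null_add: "V.nrm u = 0 \<Longrightarrow> V.nrm v = 0 \<Longrightarrow> V.nrm (u + v) = 0"
  using V.nrm_triangle[of u v] V.nrm_nonneg[of "u + v"] by simp

lemma null_scale: "V.nrm u = 0 \<Longrightarrow> V.nrm (\<lambda>i. c *\<^sub>C u i) = 0"
  by (simp add: V.nrm_scale)

lemma null_iff: "V.nrm u = 0 \<longleftrightarrow> Re (eform p \<psi> u u) = 0"
  by (simp add: V.nrm_def)

text \<open>As \<theta> 1 = 1, the map c |-> 1 \<otimes> c preserves the form; linear relations
  between members of the family hold in the dilation up to null vectors.\<close>

lemma null_combination:
  assumes ij: "i < p" "j < p" "k < p" and a: "a k = \<alpha> *\<^sub>C a i + \<beta> *\<^sub>C a j"
  shows "V.nrm ((\<lambda>l. \<alpha> *\<^sub>C pt 1 i l) + (\<lambda>l. \<beta> *\<^sub>C pt 1 j l) - pt 1 k) = 0"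
proof -
  let ?y = "\<alpha> *\<^sub>C a i + \<beta> *\<^sub>C a j - a k"
  have "eform p \<psi> ((\<lambda>l. \<alpha> *\<^sub>C pt 1 i l) + (\<lambda>l. \<beta> *\<^sub>C pt 1 j l) - pt 1 k)
      ((\<lambda>l. \<alpha> *\<^sub>C pt 1 i l) + (\<lambda>l. \<beta> *\<^sub>C pt 1 j l) - pt 1 k) = s (adj ?y * ?y)"
    by (simp only: V.ip_add_left V.ip_add_right V.ip_diff_left V.ip_diff_right V.ip_scale_left V.ip_scale_right
        eform_pt_one ij adj_add adj_diff adj_scaleC distrib_left distrib_right left_diff_distrib right_diff_distrib
        scaleC_mult_left scaleC_mult_right stateD(1,2)[OF s] state_diff[OF s] scaleC_scaleC)
      (simp add: algebra_simps)
  then show ?thesis using a by (simp add: null_iff state_zero[OF s])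
qed

lemma left_mult_eform_le: "Re (eform p \<psi> (\<lambda>i. b * v i) (\<lambda>i. b * v i)) \<le> (norm b)\<^sup>2 * Re (eform p \<psi> v v)"
proof -
  have "pos_elem (of_real ((norm b)\<^sup>2) - adj b * b)"
    by (intro pos_elem_of_real_diff) (simp_all add: adj_mult adj_adj cstar_identity)
  then obtain y where y: "of_real ((norm b)\<^sup>2) - adj b * b = adj y * y"
    using pos_elem_iff by blast
  have split: "complex_of_real ((norm b)\<^sup>2) *\<^sub>C (adj x * x') = adj (b * x) * (b * x') + adj (y * x) * (y * x')" for x x'
  proof -
    have "adj (y * x) * (y * x') = adj x * (adj y * y) * x'" by (simp add: adj_mult mult.assoc)
    also have "\<dots> = adj x * of_real ((norm b)\<^sup>2) * x' - adj x * (adj b * b) * x'"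
      unfolding y[symmetric] by (simp only: right_diff_distrib left_diff_distrib)
    also have "adj x * of_real ((norm b)\<^sup>2) * x' = complex_of_real ((norm b)\<^sup>2) *\<^sub>C (adj x * x')"
      by (simp only: of_real_scaleC scaleC_mult_left scaleC_mult_right mult_1_left mult_1_right)
    finally show ?thesis by (simp add: adj_mult mult.assoc)
  qed
  have "of_real ((norm b)\<^sup>2) * eform p \<psi> v v
      = eform p \<psi> (\<lambda>i. b * v i) (\<lambda>i. b * v i) + eform p \<psi> (\<lambda>i. y * v i) (\<lambda>i. y * v i)"
    unfolding eform_def sum_distrib_left sum.distrib[symmetric]
    by (intro sum.cong refl) (simp only: split ext_formD(1,2)[OF E, symmetric])
  then have "Re (of_real ((norm b)\<^sup>2) * eform p \<psi> v v)
      = Re (eform p \<psi> (\<lambda>i. b * v i) (\<lambda>i. b * v i)) + Re (eform p \<psi> (\<lambda>i. y * v i) (\<lambda>i. y * v i))"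
    by simp
  then show ?thesis using V.ip_nonneg[of "\<lambda>i. y * v i"] by simp
qed

lemma null_left_mult: "V.nrm v = 0 \<Longrightarrow> V.nrm (\<lambda>i. b * v i) = 0"
  using left_mult_eform_le[of b v] V.ip_nonneg[of "\<lambda>i. b * v i"] by (simp add: null_iff)

text \<open>The multiplicative domain argument. The squared norm of u \<otimes> c - 1 \<otimes>
  \<theta>(u) c is \<psi> i i at \<open>adj u * u\<close> minus \<psi> i i at 1, since
  \<open>\<theta> u\<close> is isometric, and it is at most 0 since u is a contraction. The element
  \<open>adj u * u\<close> may lie outside \<open>K\<close>, which is why \<theta> had to be
  extended.\<close>

lemma null_unitary:
  assumes u: "u \<in> K" "adj (\<theta> u) * \<theta> u = 1" "1 - adj u * u = (\<Sum>k<(n::nat). adj (z k) * z k)"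
    and ij: "i < p" "j < p" "a j = \<theta> u * a i"
  shows "V.nrm (pt u i - pt 1 j) = 0"
proof -
  have K: "u \<in> K" "adj u \<in> K" using u K_adj by auto
  have jj: "adj (a j) * a j = adj (a i) * a i"
    using u(2) by (simp add: ij adj_mult mult.assoc) (metis mult.assoc mult_1_left)
  have e0: "eform p \<psi> (pt u i - pt 1 j) (pt u i - pt 1 j)
      = \<psi> i i (adj u * u) - \<psi> i j (adj u) - \<psi> j i u + \<psi> j j 1"
    unfolding V.ip_diff_left V.ip_diff_right by (simp add: eform_pt ij)
  have e1: "\<psi> i j (adj u) = s (adj (a j) * a j)"
    using K by (simp add: ext_formD(5)[OF E] ij(1,2) \<theta>_adj) (simp add: ij(3) adj_mult mult.assoc)
  have e2: "\<psi> j i u = s (adj (a j) * a j)"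
    using K by (simp add: ext_formD(5)[OF E] ij(1,2)) (simp add: ij(3) mult.assoc)
  have e3: "\<psi> j j 1 = s (adj (a j) * a j)"
    by (simp add: ext_formD(5)[OF E] ij(1,2) K_one \<theta>_one)
  have e4: "s (adj (a j) * a j) = \<psi> i i 1"
    by (simp add: ext_formD(5)[OF E] ij(1,2) K_one \<theta>_one jj)
  have eq: "eform p \<psi> (pt u i - pt 1 j) (pt u i - pt 1 j) = \<psi> i i (adj u * u) - \<psi> i i 1"
    unfolding e0 e1 e2 e3 e4 by simp
  have \<psi>_sum: "\<psi> i i (\<Sum>k\<in>A. f k) = (\<Sum>k\<in>A. \<psi> i i (f k))" for f and A :: "nat set"
    by (induction A rule: infinite_finite_induct) (simp_all add: ext_zero ext_formD(1)[OF E])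
  have "\<psi> i i 1 = \<psi> i i (adj u * u) + \<psi> i i (1 - adj u * u)"
    by (simp flip: ext_formD(1)[OF E])
  moreover have "0 \<le> Re (\<psi> i i (1 - adj u * u))"
    unfolding u(3) \<psi>_sum Re_sum using V.ip_nonneg[of "pt (z _) i"] ij
    by (intro sum_nonneg) (simp add: eform_pt)
  ultimately have "Re (eform p \<psi> (pt u i - pt 1 j) (pt u i - pt 1 j)) \<le> 0" unfolding eq by simp
  then show ?thesis using V.ip_nonneg[of "pt u i - pt 1 j"] by (simp add: null_iff)
qed

end

text \<open>
  \<open>factors s b x\<close>: in the dilation of \<open>\<theta>\<close>, the operator \<open>b\<close> acts on the vectors \<open>1 \<otimes> c\<close> like \<open>x\<close>
  acts on \<open>c\<close>, as soon as the finitely many vectors in \<open>F\<close> are taken into account.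
\<close>

definition factors :: "('a \<Rightarrow> complex) \<Rightarrow> 'b \<Rightarrow> 'a \<Rightarrow> bool" where
  "factors s b x \<longleftrightarrow> (\<forall>c. \<exists>F. finite F \<and> (\<forall>p a \<psi> i j. ext_form s p a \<psi> \<longrightarrow> F \<subseteq> a ` {..<p} \<longrightarrow>
     i < p \<longrightarrow> j < p \<longrightarrow> a i = c \<longrightarrow> a j = x * c \<longrightarrow>
     semi_inner.nrm (eform p \<psi>) (pt b i - pt 1 j) = 0))"

lemma factorsI:
  assumes "\<And>c. finite (F c)" and "\<And>c p a \<psi> i j. ext_form s p a \<psi> \<Longrightarrow> F c \<subseteq> a ` {..<p} \<Longrightarrow>
     i < p \<Longrightarrow> j < p \<Longrightarrow> a i = c \<Longrightarrow> a j = x * c \<Longrightarrow> semi_inner.nrm (eform p \<psi>) (pt b i - pt 1 j) = 0"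
  shows "factors s b x"
  unfolding factors_def
proof
  fix c
  show "\<exists>F. finite F \<and> (\<forall>p a \<psi> i j. ext_form s p a \<psi> \<longrightarrow> F \<subseteq> a ` {..<p} \<longrightarrow>
     i < p \<longrightarrow> j < p \<longrightarrow> a i = c \<longrightarrow> a j = x * c \<longrightarrow>
     semi_inner.nrm (eform p \<psi>) (pt b i - pt 1 j) = 0)"
    by (rule exI[of _ "F c"], intro conjI allI impI assms(1)) (rule assms(2))
qed

text \<open>Supplies the finite sets as a function of c: products use them at c and at y c.\<close>

lemma factorsE:
  assumes "factors s b x"
  obtains F where "\<And>c. finite (F c)" and "\<And>c p a \<psi> i j. ext_form s p a \<psi> \<Longrightarrow> F c \<subseteq> a ` {..<p} \<Longrightarrow>
     i < p \<Longrightarrow> j < p \<Longrightarrow> a i = c \<Longrightarrow> a j = x * c \<Longrightarrow> semi_inner.nrm (eform p \<psi>) (pt b i - pt 1 j) = 0"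
proof -
  from choice[OF assms[unfolded factors_def]] obtain F where
    F: "\<forall>c. finite (F c) \<and> (\<forall>p a \<psi> i j. ext_form s p a \<psi> \<longrightarrow> F c \<subseteq> a ` {..<p} \<longrightarrow>
     i < p \<longrightarrow> j < p \<longrightarrow> a i = c \<longrightarrow> a j = x * c \<longrightarrow>
     semi_inner.nrm (eform p \<psi>) (pt b i - pt 1 j) = 0)" by (rule exE)
  show ?thesis
  proof (rule that)
    show "finite (F c)" for c using F[rule_format, of c] by (rule conjunct1)
    show "semi_inner.nrm (eform p \<psi>) (pt b i - pt 1 j) = 0"
      if "ext_form s p a \<psi>" "F c \<subseteq> a ` {..<p}" "i < p" "j < p" "a i = c" "a j = x * c" for c p a \<psi> i j
      using F[rule_format, of c, THEN conjunct2, rule_format, OF that] .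
  qed
qed

lemma factors_one:
  assumes s: "state s" shows "factors s 1 1"
proof (rule factorsI[of "\<lambda>_. {}"])
  fix c p a \<psi> i j assume E: "ext_form s p a \<psi>" and ij: "i < p" "j < p" "a i = c" "a j = 1 * c"
  have "(\<lambda>l. 1 *\<^sub>C pt 1 i l) + (\<lambda>l. 0 *\<^sub>C pt 1 i l) - pt 1 j = pt 1 i - pt (1 :: 'b) j"
    by (simp add: fun_eq_iff scaleC_one)
  then show "semi_inner.nrm (eform p \<psi>) (pt 1 i - pt 1 j) = 0"
    using null_combination[OF s E ij(1,1,2), of 1 0] ij by (simp add: scaleC_one)
qed simp

lemma factors_add:
  assumes s: "state s" and bx: "factors s b x" and dy: "factors s d y"
  shows "factors s (b + d) (x + y)"
proof -
  obtain F where F: "\<And>c. finite (F c)" "\<And>c p a \<psi> i j. ext_form s p a \<psi> \<Longrightarrow> F c \<subseteq> a ` {..<p} \<Longrightarrow>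
     i < p \<Longrightarrow> j < p \<Longrightarrow> a i = c \<Longrightarrow> a j = x * c \<Longrightarrow> semi_inner.nrm (eform p \<psi>) (pt b i - pt 1 j) = 0"
    using factorsE[OF bx] by blast
  obtain H where H: "\<And>c. finite (H c)" "\<And>c p a \<psi> i j. ext_form s p a \<psi> \<Longrightarrow> H c \<subseteq> a ` {..<p} \<Longrightarrow>
     i < p \<Longrightarrow> j < p \<Longrightarrow> a i = c \<Longrightarrow> a j = y * c \<Longrightarrow> semi_inner.nrm (eform p \<psi>) (pt d i - pt 1 j) = 0"
    using factorsE[OF dy] by blast
  show ?thesis
  \<comment> \<open>The intermediate vectors x c and y c must belong to the family for 1 \<otimes> x
    c and 1 \<otimes> y c to be available.\<close>
  proof (rule factorsI[of "\<lambda>c. F c \<union> H c \<union> {x * c, y * c}"])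
    fix c p a \<psi> i j
    assume E: "ext_form s p a \<psi>" and sub: "F c \<union> H c \<union> {x * c, y * c} \<subseteq> a ` {..<p}"
      and ij: "i < p" "j < p" "a i = c" "a j = (x + y) * c"
    from sub obtain k l where kl: "k < p" "a k = x * c" "l < p" "a l = y * c" by auto
    have "a j = 1 *\<^sub>C a k + 1 *\<^sub>C a l" by (simp add: ij kl distrib_right scaleC_one)
    note null = null_combination[OF s E kl(1,3) ij(2) this]
    have "(pt b i - pt 1 k) + (pt d i - pt 1 l) + ((\<lambda>m. 1 *\<^sub>C pt 1 k m) + (\<lambda>m. 1 *\<^sub>C pt 1 l m) - pt 1 j)
        = pt (b + d) i - pt 1 j"
      by (simp add: fun_eq_iff scaleC_one pt_def)
    moreover have "semi_inner.nrm (eform p \<psi>) ((pt b i - pt 1 k) + (pt d i - pt 1 l)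
        + ((\<lambda>m. 1 *\<^sub>C pt 1 k m) + (\<lambda>m. 1 *\<^sub>C pt 1 l m) - pt 1 j)) = 0"
      using sub by (intro null_add[OF s E] null F(2)[OF E _ ij(1) kl(1) ij(3) kl(2)] H(2)[OF E _ ij(1) kl(3) ij(3) kl(4)]) auto
    ultimately show "semi_inner.nrm (eform p \<psi>) (pt (b + d) i - pt 1 j) = 0" by (simp only:)
  qed (use F H in simp)
qed

lemma factors_scale:
  assumes s: "state s" and bx: "factors s b x"
  shows "factors s (\<alpha> *\<^sub>C b) (\<alpha> *\<^sub>C x)"
proof -
  obtain F where F: "\<And>c. finite (F c)" "\<And>c p a \<psi> i j. ext_form s p a \<psi> \<Longrightarrow> F c \<subseteq> a ` {..<p} \<Longrightarrow>
     i < p \<Longrightarrow> j < p \<Longrightarrow> a i = c \<Longrightarrow> a j = x * c \<Longrightarrow> semi_inner.nrm (eform p \<psi>) (pt b i - pt 1 j) = 0"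
    using factorsE[OF bx] by blast
  show ?thesis
  proof (rule factorsI[of "\<lambda>c. F c \<union> {x * c}"])
    fix c p a \<psi> i j
    assume E: "ext_form s p a \<psi>" and sub: "F c \<union> {x * c} \<subseteq> a ` {..<p}"
      and ij: "i < p" "j < p" "a i = c" "a j = (\<alpha> *\<^sub>C x) * c"
    from sub obtain k where k: "k < p" "a k = x * c" by auto
    have "a j = \<alpha> *\<^sub>C a k + 0 *\<^sub>C a k" by (simp add: ij k scaleC_mult_left)
    note null = null_combination[OF s E k(1,1) ij(2) this]
    have "(\<lambda>m. \<alpha> *\<^sub>C (pt b i - pt 1 k) m) + ((\<lambda>m. \<alpha> *\<^sub>C pt 1 k m) + (\<lambda>m. 0 *\<^sub>C pt 1 k m) - pt 1 j)
        = pt (\<alpha> *\<^sub>C b) i - pt 1 j"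
      by (simp add: fun_eq_iff pt_def complex_vector.scale_right_diff_distrib)
    moreover have "semi_inner.nrm (eform p \<psi>) ((\<lambda>m. \<alpha> *\<^sub>C (pt b i - pt 1 k) m)
        + ((\<lambda>m. \<alpha> *\<^sub>C pt 1 k m) + (\<lambda>m. 0 *\<^sub>C pt 1 k m) - pt 1 j)) = 0"
      using sub by (intro null_add[OF s E] null_scale[OF s E] null F(2)[OF E _ ij(1) k(1) ij(3) k(2)]) auto
    ultimately show "semi_inner.nrm (eform p \<psi>) (pt (\<alpha> *\<^sub>C b) i - pt 1 j) = 0" by (simp only:)
  qed (use F in simp)
qed

text \<open>Up to null vectors b d \<otimes> c is b \<otimes> y c, because left multiplication
  preserves null vectors, and this is 1 \<otimes> x y c.\<close>

lemma factors_mult: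
  assumes s: "state s" and bx: "factors s b x" and dy: "factors s d y"
  shows "factors s (b * d) (x * y)"
proof -
  obtain F where F: "\<And>c. finite (F c)" "\<And>c p a \<psi> i j. ext_form s p a \<psi> \<Longrightarrow> F c \<subseteq> a ` {..<p} \<Longrightarrow>
     i < p \<Longrightarrow> j < p \<Longrightarrow> a i = c \<Longrightarrow> a j = x * c \<Longrightarrow> semi_inner.nrm (eform p \<psi>) (pt b i - pt 1 j) = 0"
    using factorsE[OF bx] by blast
  obtain H where H: "\<And>c. finite (H c)" "\<And>c p a \<psi> i j. ext_form s p a \<psi> \<Longrightarrow> H c \<subseteq> a ` {..<p} \<Longrightarrow>
     i < p \<Longrightarrow> j < p \<Longrightarrow> a i = c \<Longrightarrow> a j = y * c \<Longrightarrow> semi_inner.nrm (eform p \<psi>) (pt d i - pt 1 j) = 0"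
    using factorsE[OF dy] by blast
  show ?thesis
  proof (rule factorsI[of "\<lambda>c. F (y * c) \<union> H c \<union> {y * c}"])
    fix c p a \<psi> i j
    assume E: "ext_form s p a \<psi>" and sub: "F (y * c) \<union> H c \<union> {y * c} \<subseteq> a ` {..<p}"
      and ij: "i < p" "j < p" "a i = c" "a j = (x * y) * c"
    from sub obtain k where k: "k < p" "a k = y * c" by auto
    have aj: "a j = x * (y * c)" by (simp add: ij mult.assoc)
    have "(\<lambda>m. b * (pt d i - pt 1 k) m) + (pt b k - pt 1 j) = pt (b * d) i - pt 1 j"
      by (simp add: fun_eq_iff pt_def right_diff_distrib)
    moreover have "semi_inner.nrm (eform p \<psi>) ((\<lambda>m. b * (pt d i - pt 1 k) m) + (pt b k - pt 1 j)) = 0"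
      using sub by (intro null_add[OF s E] null_left_mult[OF s E] F(2)[OF E _ k(1) ij(2) k(2) aj] H(2)[OF E _ ij(1) k(1) ij(3) k(2)]) auto
    ultimately show "semi_inner.nrm (eform p \<psi>) (pt (b * d) i - pt 1 j) = 0" by (simp only:)
  qed (use F H in simp)
qed

lemma factors_unitary:
  assumes "state s" "u \<in> K" "adj (\<theta> u) * \<theta> u = 1" "1 - adj u * u = (\<Sum>k<(n::nat). adj (z k) * z k)"
  shows "factors s u (\<theta> u)"
proof (rule factorsI[of "\<lambda>_. {}"])
  fix c p a \<psi> i j
  assume E: "ext_form s p a \<psi>" and ij: "i < p" "j < p" "a i = c" "a j = \<theta> u * c"
  have "a j = \<theta> u * a i" unfolding ij(3,4) ..
  then show "semi_inner.nrm (eform p \<psi>) (pt u i - pt 1 j) = 0"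
    by (rule null_unitary[OF assms(1) E assms(2-4) ij(1,2)])
qed simp

text \<open>Take a state that attains the norm of x and a finite family containing 1, x and the set
  demanded at c = 1. The squared norm of x is that of the vector 1 \<otimes> x, hence that of b
  \<otimes> 1, and left multiplication by b is bounded by norm b.\<close>

theorem factors_norm_le:
  assumes "\<And>s. state s \<Longrightarrow> factors s b x"
  shows "norm x \<le> norm b"
proof -
  obtain s where s: "state s" "s (adj x * x) = of_real ((norm x)\<^sup>2)" using state_attaining_norm by blast
  obtain F where F: "\<And>c. finite (F c)" "\<And>c p a \<psi> i j. ext_form s p a \<psi> \<Longrightarrow> F c \<subseteq> a ` {..<p} \<Longrightarrow>
     i < p \<Longrightarrow> j < p \<Longrightarrow> a i = c \<Longrightarrow> a j = x * c \<Longrightarrow> semi_inner.nrm (eform p \<psi>) (pt b i - pt 1 j) = 0"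
    using factorsE[OF assms[OF s(1)]] by blast
  let ?F = "F 1 \<union> {1, x}"
  have "finite ?F" using F(1) by simp
  from ex_bij_betw_nat_finite[OF this] obtain a where a: "bij_betw a {0..<card ?F} ?F" by (rule exE)
  define p where "p = card ?F"
  have im: "a ` {..<p} = ?F" using a unfolding p_def by (simp add: bij_betw_def atLeast0LessThan)
  have "1 \<in> a ` {..<p}" "x \<in> a ` {..<p}" unfolding im by simp_all
  then obtain i j where ij: "i < p" "a i = 1" "j < p" "a j = x" by auto
  have nn: "0 \<le> Re (s (adj y * y))" for y using state_square[OF s(1)] by (simp add: complex_nonneg_Reals_iff)
  have "1 = Re (s (adj (a i) * a i))" by (simp add: ij stateD(3)[OF s(1)])
  also have "\<dots> \<le> (\<Sum>k<p. Re (s (adj (a k) * a k)))"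
    using ij nn by (intro member_le_sum[of i _ "\<lambda>k. Re (s (adj (a k) * a k))"]) auto
  finally have "0 < Re (\<Sum>k<p. s (adj (a k) * a k))" by (simp add: Re_sum)
  from ext_form_exists[OF s(1) this] obtain \<psi> where E: "ext_form s p a \<psi>" by blast
  interpret V: semi_inner "\<lambda>c (v :: nat \<Rightarrow> 'b) i. c *\<^sub>C v i" "eform p \<psi>"
    by (rule semi_inner_eform[OF E])
  have null: "V.nrm (pt b i - pt 1 j) = 0"
    using im ij by (intro F(2)[OF E]) auto
  have "(norm x)\<^sup>2 = Re (eform p \<psi> (pt 1 j) (pt 1 j))"
    by (simp add: eform_pt_one[OF s(1) E] ij s)
  also have "eform p \<psi> (pt 1 j) (pt 1 j) = eform p \<psi> (pt b i) (pt b i)"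
    by (rule V.ip_null_cong[symmetric]) (rule null)+
  also have "pt b i = (\<lambda>k. b * pt 1 i k)" by (simp add: pt_def fun_eq_iff)
  also have "Re (eform p \<psi> \<dots> \<dots>) \<le> (norm b)\<^sup>2 * Re (eform p \<psi> (pt 1 i) (pt 1 i))"
    by (rule left_mult_eform_le[OF s(1) E])
  also have "\<dots> = (norm b)\<^sup>2" by (simp add: eform_pt_one[OF s(1) E] ij stateD(3)[OF s(1)])
  finally show ?thesis by (rule power2_le_imp_le) simp
qed

end

section \<open>The C*-envelope\<close>

text \<open>The index \<open>None\<close> stands for the unitary 1, so the products w_i w_j^*
  include all generators and their inverses. The algebraic form of the assumptions serves both the
  generated C*-algebra and the range of \<open>star_gen\<close>.\<close>

lemma group_cstar_of_mem:
  fixes R :: "'g free_group group_cstar set"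
  assumes add: "\<And>x y. x \<in> R \<Longrightarrow> y \<in> R \<Longrightarrow> x + y \<in> R" and mult: "\<And>x y. x \<in> R \<Longrightarrow> y \<in> R \<Longrightarrow> x * y \<in> R"
    and scale: "\<And>c x. x \<in> R \<Longrightarrow> c *\<^sub>C x \<in> R"
    and base: "\<And>i j. univ_unitary i * adj (univ_unitary j) \<in> R"
  shows "group_cstar_of x \<in> R"
proof (induction x rule: ga_induct)
  have one: "1 \<in> R" using base[of None None] by simp
  {
    case zero
    show ?case using scale[OF one, of 0] by simp
  next
    case (single g c)
    have word: "group_cstar_of (Poly_Mapping.single (abs_free_group w) 1) \<in> R" for w :: "('g \<times> bool) list"
    proof (induction w)
      case Nil
      show ?case using one by (simp add: group_cstar_of_one flip: zero_free_group.abs_eq)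
    next
      case (Cons l w)
      obtain a b where l: "l = (a, b)" by (cases l)
      have "group_cstar_of (Poly_Mapping.single (abs_free_group [(a, b)]) 1) \<in> R"
      proof (cases b)
        case True
        then show ?thesis
          using base[of "Some a" None] by (simp add: univ_unitary_mult_adj gen_word_def free_gen.abs_eq)
      next
        case False
        then show ?thesis
          using base[of None "Some a"]
          by (simp add: univ_unitary_mult_adj gen_word_def free_gen.abs_eq uminus_free_group.abs_eq word_inverse_def)
      qed
      from mult[OF this Cons.IH] show ?case
        by (simp add: l mult_single plus_free_group.abs_eq flip: group_cstar_of_mult)
    qed
    have "Poly_Mapping.single g c = Poly_Mapping.single 0 c * Poly_Mapping.single g 1" by (simp add: mult_single)
    then have "group_cstar_of (Poly_Mapping.single g c) = c *\<^sub>C group_cstar_of (Poly_Mapping.single g 1)"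
      by (simp only: group_cstar_of_scale)
    moreover have "g = abs_free_group (rep_free_group g)"
      by (simp add: Quotient3_abs_rep[OF Quotient3_free_group])
    ultimately show ?case using scale[OF word[of "rep_free_group g"]] by metis
  next
    case (add x y)
    then show ?case by (simp add: group_cstar_of_add assms(1))
  }
qed

lemma cstar_subalgebra_generated: "cstar_subalgebra (generated_cstar V)"
proof -
  have "cstar_subalgebra (\<Inter>\<B>)" if sub: "\<And>B. B \<in> \<B> \<Longrightarrow> cstar_subalgebra B" for \<B> :: "'a set set"
    unfolding cstar_subalgebra_def
  proof (intro conjI ballI allI)
    show "closed (\<Inter>\<B>)" by (rule closed_Inter) (use sub in \<open>simp add: cstar_subalgebra_def\<close>)
  qed (rule InterI, insert sub, simp add: cstar_subalgebra_def Inter_iff)+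
  then show ?thesis unfolding generated_cstar_def by (rule hull_in) blast
qed

lemma subset_generated: "V \<subseteq> generated_cstar V"
  unfolding generated_cstar_def by (rule hull_subset)

lemma generated_subset: "cstar_subalgebra B \<Longrightarrow> V \<subseteq> B \<Longrightarrow> generated_cstar V \<subseteq> B"
  unfolding generated_cstar_def by (rule hull_minimal)

lemma univ_unitary_mult_adj_mem_W: "univ_unitary i * adj (univ_unitary j) \<in> W_space"
  unfolding W_space_def by (intro complex_vector.span_base) blast

lemma generated_W_space: "generated_cstar (W_space :: 'g free_group group_cstar set) = UNIV"
proof -
  let ?A = "generated_cstar (W_space :: 'g free_group group_cstar set)"
  have sub: "cstar_subalgebra ?A" by (rule cstar_subalgebra_generated)
  have base: "univ_unitary i * adj (univ_unitary j) \<in> ?A" for i j :: "'g option"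
    using subset_generated univ_unitary_mult_adj_mem_W by blast
  have mem: "group_cstar_of x \<in> ?A" for x :: "'g free_group \<Rightarrow>\<^sub>0 complex"
    by (rule group_cstar_of_mem) (use sub base in \<open>simp_all add: cstar_subalgebra_def\<close>)
  have "y \<in> ?A" for y :: "'g free_group group_cstar"
  proof -
    obtain X where lim: "(\<lambda>n. group_cstar_of (X n)) \<longlonglongrightarrow> y" using group_cstar_of_approx by blast
    have cl: "closed ?A" using sub by (simp add: cstar_subalgebra_def)
    from closed_sequentially[OF cl _ lim] show ?thesis using mem by simp
  qed
  then show ?thesis by blast
qed

lemma os_pos_Q_of_W:
  fixes H :: "nat \<Rightarrow> nat \<Rightarrow> complex^('g::finite option)^('g option)"
  assumes herm: "\<And>i j. i < p \<Longrightarrow> j < p \<Longrightarrow> H i j = mat_adj (H j i)"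
    and pos: "os_pos W_system p (\<lambda>i j. phi_map (H i j))"
  shows "os_pos Q_system p (\<lambda>i j. coset (H i j))"
  unfolding os_pos_Q_iff
proof (rule exI[of _ H], intro conjI allI impI)
  show "H i j = mat_adj (H j i)" if "i < p" "j < p" for i j by (rule herm[OF that])
  show "\<exists>K. (\<forall>i<p. \<forall>j<p. K i j \<in> J_space \<and> K i j = mat_adj (K j i)) \<and>
      os_pos matrix_system p (\<lambda>i j. mat_scale (of_real \<epsilon>) (unit_mat i j) + H i j + K i j)" if "0 < \<epsilon>" for \<epsilon>
    by (rule phi_map_lift[OF herm pos that])
qed (rule refl)

text \<open>The pairs (P(u), P(w)) for polynomials P. Adjoints come for free when u and w are
  families closed under adjoints in the same way, see \<open>star_gen_adj\<close>.\<close>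

inductive star_gen :: "('i \<Rightarrow> 'b::cstar_algebra) \<Rightarrow> ('i \<Rightarrow> 'a::cstar_algebra) \<Rightarrow> 'b \<Rightarrow> 'a \<Rightarrow> bool" for u w where
  star_gen_one: "star_gen u w 1 1"
| star_gen_base: "star_gen u w (u i) (w i)"
| star_gen_add: "star_gen u w b x \<Longrightarrow> star_gen u w c y \<Longrightarrow> star_gen u w (b + c) (x + y)"
| star_gen_mult: "star_gen u w b x \<Longrightarrow> star_gen u w c y \<Longrightarrow> star_gen u w (b * c) (x * y)"
| star_gen_scale: "star_gen u w b x \<Longrightarrow> star_gen u w (\<alpha> *\<^sub>C b) (\<alpha> *\<^sub>C x)"

lemma star_gen_adj:
  assumes "\<And>i. adj (u i) = u (\<sigma> i)" "\<And>i. adj (w i) = w (\<sigma> i)" "star_gen u w b x"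
  shows "star_gen u w (adj b) (adj x)"
  using assms(3)
  by induction (simp_all add: assms(1,2) adj_add adj_mult adj_scaleC star_gen.intros)

lemma star_gen_zero: "star_gen u w 0 0"
  using star_gen_scale[OF star_gen_one, of u w 0] by simp

lemma star_gen_sum: "(\<And>i. star_gen u w (f i) (g i)) \<Longrightarrow> star_gen u w (\<Sum>i\<in>A. f i) (\<Sum>i\<in>A. g i)"
  by (induction A rule: infinite_finite_induct) (simp_all add: star_gen_zero star_gen_add)

lemma star_gen_mem:
  assumes "cstar_subalgebra D" "\<And>i. u i \<in> D" "star_gen u w b x"
  shows "b \<in> D"
  using assms(3) by induction (use assms(1,2) in \<open>simp_all add: cstar_subalgebra_def\<close>)

lemma mat_adj_matrix_unit: "mat_adj (matrix_unit i j) = matrix_unit j i"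
  by (auto intro!: matrix_eqI simp: matrix_unit_def)

lemma matrix_expand: "x = (\<Sum>i\<in>UNIV. \<Sum>j\<in>UNIV. mat_scale (x $ i $ j) (matrix_unit i j))"
  for x :: "complex^'n^'n"
proof (rule matrix_eqI)
  fix a b
  have e: "mat_scale (x $ i $ j) (matrix_unit i j) $ a $ b = (if j = b then (if i = a then x $ a $ b else 0) else 0)" for i j
    by (auto simp: matrix_unit_def mat_scale_def)
  have "(\<Sum>i\<in>UNIV. \<Sum>j\<in>UNIV. mat_scale (x $ i $ j) (matrix_unit i j)) $ a $ b
      = (\<Sum>i\<in>UNIV. \<Sum>j\<in>UNIV. if j = b then (if i = a then x $ a $ b else 0) else 0)"
    unfolding sum_component e by (rule refl)
  also have "\<dots> = x $ a $ b"
    by (simp add: sum.delta)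
  finally show "x $ a $ b = (\<Sum>i\<in>UNIV. \<Sum>j\<in>UNIV. mat_scale (x $ i $ j) (matrix_unit i j)) $ a $ b" by (rule sym)
qed

section \<open>An arbitrary copy of the quotient inside a C*-algebra\<close>

locale embedded_quotient =
  fixes \<kappa> :: "(complex^('g::finite option)^('g option)) set \<Rightarrow> 'b::cstar_algebra"
  assumes emb: "complete_order_embedding Q_system \<kappa>"
begin

definition k :: "complex^('g option)^('g option) \<Rightarrow> 'b" where
  "k x = \<kappa> (coset x)"

definition \<theta> :: "'b \<Rightarrow> 'g free_group group_cstar" where
  "\<theta> y = \<iota> (inv_into (os_space Q_system) \<kappa> y)"

lemma image_\<kappa>: "\<kappa> ` os_space Q_system = range k"
  by (auto simp: Q_space k_def)

lemma inj_\<kappa>: "inj_on \<kappa> (os_space Q_system)"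
  using emb by (simp add: complete_order_embedding_def complete_order_iso_def bij_betw_def)

lemma cp_\<kappa>: "cp_map Q_system (cstar_system (range k)) \<kappa>"
  and cp_inv: "cp_map (cstar_system (range k)) Q_system (inv_into (os_space Q_system) \<kappa>)"
  using emb by (simp_all add: complete_order_embedding_def complete_order_iso_def image_\<kappa>)

lemma \<theta>_k: "\<theta> (k x) = phi_map x"
  using inv_into_f_f[OF inj_\<kappa>, of "coset x"] by (simp add: \<theta>_def k_def Q_space induced_phi_coset)

lemma k_one: "k (mat 1) = 1"
  using emb by (simp add: complete_order_embedding_def Q_unit k_def)

lemma cstar_system_simps: "os_space (cstar_system V) = V" "os_add (cstar_system V) = (+)"
  "os_scale (cstar_system V) = scaleC"
  "os_pos (cstar_system V) p X \<longleftrightarrow> (\<forall>i<p. \<forall>j<p. X i j \<in> V) \<and>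
    (\<exists>Y. \<forall>i<p. \<forall>j<p. X i j = (\<Sum>k<p. adj (Y k i) * Y k j))"
  by (simp_all add: cstar_system_def)

lemma k_add: "k (x + y) = k x + k y"
  using cp_\<kappa> by (simp add: cp_map_def Q_space cstar_system_simps Q_add k_def)

lemma k_scale: "k (mat_scale c x) = c *\<^sub>C k x"
  using cp_\<kappa> by (simp add: cp_map_def Q_space cstar_system_simps Q_scale k_def)

lemma k_gram:
  assumes "\<And>i j. i < p \<Longrightarrow> j < p \<Longrightarrow> H i j = mat_adj (H j i)" "os_pos W_system p (\<lambda>i j. phi_map (H i j))"
  shows "\<exists>Y. \<forall>i<p. \<forall>j<p. k (H i j) = (\<Sum>m<(p::nat). adj (Y (m::nat) i) * Y m j)"
proof -
  have "os_pos (cstar_system (range k)) p (\<lambda>i j. \<kappa> (coset (H i j)))"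
    using cp_\<kappa> os_pos_Q_of_W[OF assms] unfolding cp_map_def by blast
  then show ?thesis unfolding cstar_system_simps k_def by (rule conjunct2)
qed

text \<open>\<open>cp_map\<close> does not mention adjoints, so this is extracted from positivity:
  the 2 \<times> 2 matrix with t on the diagonal and x and its adjoint off it is positive for some
  t. Its image is a Gram matrix, whose off-diagonal entries are adjoint to each other.\<close>

lemma k_adj: "k (mat_adj x) = adj (k x)"
proof -
  define X where "X i j = (if i = (0::nat) \<and> j = (1::nat) then x else if i = 1 \<and> j = 0 then mat_adj x else 0)" for i j
  have X: "mat_adj (X i j) = X j i" for i j by (auto simp: X_def mat_adj_simps)
  obtain t where t: "os_pos matrix_system 2 (\<lambda>i j. mat_scale (of_real t) (unit_mat i j) + X i j)"
    using os_pos_unit_dominates[of 2 X] X by blast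
  let ?H = "\<lambda>i j. mat_scale (of_real t) (unit_mat i j) + X i j"
  have pos: "os_pos W_system 2 (\<lambda>i j. phi_map (?H i j))"
    using cp_map_phi_map t unfolding cp_map_def by blast
  have herm: "?H i j = mat_adj (?H j i)" if "i < 2" "j < 2" for i j
    by (rule os_pos_matrix_hermitian[OF t that(2,1), symmetric])
  from k_gram[OF herm pos] obtain Y where "\<forall>i<2. \<forall>j<2. k (?H i j) = (\<Sum>m<(2::nat). adj (Y m i) * Y m j)" by (rule exE)
  then have Y: "k (?H i j) = (\<Sum>m<(2::nat). adj (Y m i) * Y m j)" if "i < 2" "j < 2" for i j using that by blast
  have "k (?H 1 0) = adj (k (?H 0 1))"
    by (simp only: Y) (simp add: Y adj_sum adj_mult adj_adj adj_add)
  moreover have "?H 1 0 = mat_adj x" "?H 0 1 = x" by (simp_all add: X_def unit_mat_def mat_scale_simps)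
  ultimately show ?thesis by (simp only:)
qed

sublocale cp_extension "range k" \<theta>
proof
  show "1 \<in> range k" using k_one by (metis rangeI)
  show "\<theta> 1 = 1" using \<theta>_k[of "mat 1"] by (simp add: k_one phi_map_one)
  fix x y c assume x: "x \<in> range k"
  show "adj x \<in> range k" "\<theta> (adj x) = adj (\<theta> x)" "c *\<^sub>C x \<in> range k" "\<theta> (c *\<^sub>C x) = c *\<^sub>C \<theta> x"
    using x by (auto simp: \<theta>_k phi_map_adj phi_map_scale simp flip: k_adj k_scale)
  assume "y \<in> range k"
  with x show "x + y \<in> range k" "\<theta> (x + y) = \<theta> x + \<theta> y"
    by (auto simp: \<theta>_k phi_map_add simp flip: k_add)
next
  fix p :: nat and X Y
  assume "\<And>i j. i < p \<Longrightarrow> j < p \<Longrightarrow> X i j \<in> range k"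
    and "\<And>i j. i < p \<Longrightarrow> j < p \<Longrightarrow> X i j = (\<Sum>k<p. adj (Y k i) * Y k j)"
  then have "os_pos (cstar_system (range k)) p X" unfolding cstar_system_simps by blast
  then have "os_pos Q_system p (\<lambda>i j. inv_into (os_space Q_system) \<kappa> (X i j))"
    using cp_inv unfolding cp_map_def by blast
  then have "os_pos W_system p (\<lambda>i j. \<theta> (X i j))"
    using complete_order_iso_induced unfolding complete_order_iso_def cp_map_def \<theta>_def by blast
  then show "\<exists>Z. \<forall>i<p. \<forall>j<p. \<theta> (X i j) = (\<Sum>k<p. adj (Z k i) * Z k j)"
    by (simp add: os_pos_W_iff)
qed

definition scaled_unit :: "'g option \<times> 'g option \<Rightarrow> complex^('g option)^('g option)" where
  "scaled_unit z = mat_scale (of_nat CARD('g option)) (matrix_unit (fst z) (snd z))"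

definition u :: "'g option \<times> 'g option \<Rightarrow> 'b" where
  "u z = k (scaled_unit z)"

definition w :: "'g option \<times> 'g option \<Rightarrow> 'g free_group group_cstar" where
  "w z = univ_unitary (fst z) * adj (univ_unitary (snd z))"

lemma phi_scaled_unit: "phi_map (scaled_unit z) = w z"
  unfolding scaled_unit_def phi_map_scale phi_map_matrix_unit w_def by (simp add: scaleC_scaleC scaleC_one)

lemma u_adj: "adj (u z) = u (prod.swap z)"
  by (simp add: u_def scaled_unit_def mat_adj_simps mat_adj_matrix_unit flip: k_adj)

lemma w_adj: "adj (w z) = w (prod.swap z)"
  by (simp add: w_def adj_mult adj_adj)

lemma w_unitary: "adj (w z) * w z = 1"
proof -
  have "adj (w z) * w z = univ_unitary (snd z) * (adj (univ_unitary (fst z)) * univ_unitary (fst z)) * adj (univ_unitary (snd z))"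
    by (simp only: w_def adj_mult adj_adj mult.assoc)
  then show ?thesis by simp
qed

text \<open>
  The matrix with rows \<open>(1, u)\<close> and \<open>(u\<^sup>*, 1)\<close> is positive in the copy of the quotient, because \<open>w\<close>
  is unitary. Hence \<open>u\<close> is a contraction.
\<close>

lemma u_contraction: "\<exists>v. 1 - adj (u z) * u z = (\<Sum>m<(2::nat). adj (v m) * v m)"
proof -
  define H where "H i j = (if i = j then mat 1 else if i < j then scaled_unit z else mat_adj (scaled_unit z))" for i j :: nat
  define Y where "Y m j = (if m = (0::nat) then if j = (0::nat) then 1 else w z else 0)" for m j
  have phi_adj: "phi_map (mat_adj (scaled_unit z)) = adj (w z)" by (simp only: phi_map_adj phi_scaled_unit)
  have two: "i < 2 \<longleftrightarrow> i = 0 \<or> i = Suc 0" for i by auto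
  have "phi_map (H i j) = (\<Sum>m<(2::nat). adj (Y m i) * Y m j)" if "i < 2" "j < 2" for i j
    using that unfolding two
    by (auto simp: H_def Y_def numeral_2_eq_2 phi_map_one phi_adj phi_scaled_unit w_unitary simp del: mat_adj_simps)
  then have pos: "os_pos W_system 2 (\<lambda>i j. phi_map (H i j))"
    unfolding os_pos_W_iff W_space_eq by blast
  have herm: "H i j = mat_adj (H j i)" for i j by (auto simp: H_def mat_adj_simps)
  from k_gram[OF herm pos] obtain V where "\<forall>i<2. \<forall>j<2. k (H i j) = (\<Sum>m<(2::nat). adj (V m i) * V m j)" by (rule exE)
  then have V: "(\<Sum>m<(2::nat). adj (V m i) * V m j) = k (H i j)" if "i < 2" "j < 2" for i j using that by simp
  have kH: "k (H 0 0) = 1" "k (H 1 1) = 1" "k (H 0 1) = u z" "k (H 1 0) = adj (u z)"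
    by (simp_all add: H_def k_one u_def k_adj)
  \<comment> \<open>Subtracting from the second column of the Gram factor the first one times u
    leaves the Schur complement 1 - \<open>adj u * u\<close>.\<close>
  have "(\<Sum>m<(2::nat). adj (V m 1 - V m 0 * u z) * (V m 1 - V m 0 * u z))
      = (\<Sum>m<2. adj (V m 1) * V m 1) - (\<Sum>m<2. adj (V m 1) * V m 0) * u z
        - adj (u z) * (\<Sum>m<2. adj (V m 0) * V m 1) + adj (u z) * (\<Sum>m<2. adj (V m 0) * V m 0) * u z"
    by (simp add: numeral_2_eq_2 adj_diff adj_mult algebra_simps)
  also have "\<dots> = 1 - adj (u z) * u z"
    by (simp add: V kH kH[simplified])
  finally show ?thesis by (intro exI[of _ "\<lambda>m. V m 1 - V m 0 * u z"]) simp
qed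

lemma factors_star_gen: "star_gen u w b x \<Longrightarrow> state s \<Longrightarrow> factors s b x"
proof (induction rule: star_gen.induct)
  case (star_gen_base z)
  obtain v where v: "1 - adj (u z) * u z = (\<Sum>m<(2::nat). adj (v m) * v m)" using u_contraction by blast
  have \<theta>u: "\<theta> (u z) = w z" unfolding u_def \<theta>_k by (rule phi_scaled_unit)
  have "factors s (u z) (\<theta> (u z))"
    by (rule factors_unitary[OF star_gen_base _ _ v]) (simp_all add: \<theta>u w_unitary, simp add: u_def)
  then show ?case by (simp add: \<theta>u)
qed (simp_all add: factors_one factors_add factors_mult factors_scale)

lemma star_gen_k: "star_gen u w (k x) (phi_map x)"
proof -
  let ?N = "of_nat CARD('g option) :: complex"
  have k_zero: "k 0 = 0" using k_scale[of 0 0] by (simp add: mat_scale_simps)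
  have k_sum: "k (sum f A) = (\<Sum>i\<in>A. k (f i))" for f :: "'g option \<Rightarrow> _" and A
    by (induction A rule: infinite_finite_induct) (simp_all add: k_zero k_add)
  have kE: "k (matrix_unit i j) = (1 / ?N) *\<^sub>C u (i, j)" for i j
    unfolding u_def scaled_unit_def k_scale by (simp add: scaleC_scaleC scaleC_one)
  have "k x = (\<Sum>i\<in>UNIV. \<Sum>j\<in>UNIV. x $ i $ j *\<^sub>C (1 / ?N) *\<^sub>C u (i, j))"
    by (subst matrix_expand[of x]) (simp only: k_sum k_scale kE)
  moreover have "phi_map x = (\<Sum>i\<in>UNIV. \<Sum>j\<in>UNIV. x $ i $ j *\<^sub>C (1 / ?N) *\<^sub>C w (i, j))"
    by (simp add: phi_map_def w_def)
  ultimately show ?thesis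
    by (simp only:) (intro star_gen_sum star_gen_scale star_gen_base)
qed

sublocale graph: star_graph "star_gen u w"
proof
  fix b x assume G: "star_gen u w b x"
  show "star_gen u w (adj b) (adj x)" by (rule star_gen_adj[OF u_adj w_adj G])
  show "norm x \<le> norm b" by (rule factors_norm_le) (rule factors_star_gen[OF G])
next
  fix e :: real and a :: "'g free_group group_cstar" assume "0 < e"
  then obtain y where y: "norm (a - group_cstar_of y) < e" using group_cstar_of_dense by blast
  have "group_cstar_of y \<in> {x. \<exists>b. star_gen u w b x}"
  proof (rule group_cstar_of_mem)
    fix i j :: "'g option"
    have "star_gen u w (u (i, j)) (w (i, j))" by (rule star_gen_base)
    then show "univ_unitary i * adj (univ_unitary j) \<in> {x. \<exists>b. star_gen u w b x}" by (auto simp: w_def)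
  qed (auto intro: star_gen.intros)
  with y show "\<exists>b x. star_gen u w b x \<and> norm (a - x) < e" by blast
qed (rule star_gen.intros; assumption)+

text \<open>The domain of the closed graph is a C*-algebra that contains the copy, and it is
  contained in any C*-algebra that contains the elements u. So \<open>homG\<close> has exactly the
  domain that the C*-envelope prescribes.\<close>

lemma generated_eq_domG: "generated_cstar (range k) = graph.domG"
proof
  have "k x \<in> graph.domG" for x
    using graph.clGI[OF star_gen_k] by (auto simp: graph.domG_def)
  then show "generated_cstar (range k) \<subseteq> graph.domG"
    by (intro generated_subset graph.cstar_subalgebra_domG) blast
  have "u z \<in> generated_cstar (range k)" for z unfolding u_def using subset_generated[of "range k"] by blast
  then have mem: "b \<in> generated_cstar (range k)" if "star_gen u w b x" for b x
    by (rule star_gen_mem[OF cstar_subalgebra_generated _ that])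
  show "graph.domG \<subseteq> generated_cstar (range k)"
    by (rule graph.domG_subset[OF cstar_subalgebra_generated]) (rule mem)
qed

lemma exists_star_hom:
  "\<exists>\<pi> :: 'b \<Rightarrow> 'g free_group group_cstar. star_hom_on (generated_cstar (\<kappa> ` os_space Q_system)) \<pi> \<and>
    \<pi> ` generated_cstar (\<kappa> ` os_space Q_system) = UNIV \<and> (\<forall>x\<in>os_space Q_system. \<pi> (\<kappa> x) = \<iota> x)"
proof (intro exI[of _ graph.homG] conjI ballI)
  fix C :: "(complex^('g option)^('g option)) set" assume "C \<in> os_space Q_system"
  then obtain x where "C = coset x" by (auto simp: Q_space)
  then show "graph.homG (\<kappa> C) = \<iota> C"
    using graph.homG_eq[OF graph.clGI[OF star_gen_k[of x]]] by (simp add: k_def induced_phi_coset)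
qed (simp_all add: image_\<kappa> generated_eq_domG graph.star_hom_on_homG graph.homG_surj)

end

theorem is_cstar_envelope_quotient:
  "is_cstar_envelope TYPE('b::cstar_algebra) Q_system (\<iota> :: _ \<Rightarrow> 'g::finite free_group group_cstar)"
  unfolding is_cstar_envelope_def
proof (intro conjI allI impI)
  show "complete_order_embedding Q_system (\<iota> :: _ \<Rightarrow> 'g free_group group_cstar)"
    by (rule complete_order_embedding_induced)
  show "generated_cstar ((\<iota> :: _ \<Rightarrow> 'g free_group group_cstar) ` os_space Q_system) = UNIV"
    unfolding image_Q_space by (rule generated_W_space)
  fix \<kappa> :: "(complex^('g option)^('g option)) set \<Rightarrow> 'b"
  assume "complete_order_embedding Q_system \<kappa>"
  then interpret embedded_quotient \<kappa> by unfold_locales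
  show "\<exists>\<pi> :: 'b \<Rightarrow> 'g free_group group_cstar. star_hom_on (generated_cstar (\<kappa> ` os_space Q_system)) \<pi> \<and>
      \<pi> ` generated_cstar (\<kappa> ` os_space Q_system) = UNIV \<and> (\<forall>x\<in>os_space Q_system. \<pi> (\<kappa> x) = \<iota> x)"
    by (rule exists_star_hom)
qed

theorem theorem2p4:
  shows "ucp_map matrix_system W_system
      (phi_map :: complex^('g::finite option)^('g option) \<Rightarrow> 'g free_group group_cstar)
    \<and> range (phi_map :: complex^('g option)^('g option) \<Rightarrow> 'g free_group group_cstar) = W_space
    \<and> complete_quotient_map matrix_system W_system
      (phi_map :: complex^('g option)^('g option) \<Rightarrow> 'g free_group group_cstar)
    \<and> is_cstar_envelope TYPE('b::cstar_algebra)
      (quotient_system matrix_system (diag_trace_zero :: (complex^('g option)^('g option)) set))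
      (induced_map (phi_map :: complex^('g option)^('g option) \<Rightarrow> 'g free_group group_cstar))"
proof (intro conjI)
  show "ucp_map matrix_system W_system
      (phi_map :: complex^('g option)^('g option) \<Rightarrow> 'g free_group group_cstar)"
    using cp_map_phi_map by (simp add: ucp_map_def phi_map_one)
qed (rule W_space_eq[symmetric] complete_quotient_map_phi_map is_cstar_envelope_quotient)+

end
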